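(* Let $L/K$ be a finite Galois extension of number fields and let $G=\mathrm{Gal}(L/K)$. Suppose that $G$ has a generalised useful idempotent relation with respect to a set of subgroups $\mathcal{H}$. Let $\mathcal{I}\subseteq\mathcal{H}$ be such that $1\notin\mathcal{I}$ and for every $H\in\mathcal{H}$ there exist $g\in G$ and $I\in\mathcal{I}$ with $gIg^{-1}\le H$. Let $p$ be a prime number. Then $\mathrm{Leo}(L,p)$ holds if and only if $\mathrm{Leo}(L^I,p)$ holds for every $I\in\mathcal{I}$.
   Context: For a subgroup $H\le G$, $e_H=|H|^{-1}\sum_{h\in H}h\in\mathbb{Q}[G]$ and $L^H$ is the subfield of $L$ fixed by $H$. A generalised useful idempotent relation with respect to $\mathcal{H}$ is an equality in $\mathbb{Q}[G]$ of the form $1=\sum_{1\ne H\in\mathcal{H}}a_He_H$ with $a_H\in\mathbb{Q}[G]$. For a number field $F$ and prime $p$, with $S_p(F)$ the places above $p$ and $U^1_{F_w}$ the principal units of $F_w$, the diagonal embedding of units induces $\lambda_{F,p}:\mathbb{Z}_p\otimes_{\mathbb{Z}}\mathcal{O}_F^\times\to\prod_{w\in S_p(F)}U^1_{F_w}$; $\mathrm{Leo}(F,p)$ holds if $\lambda_{F,p}$ is injective. *)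

theory Defs
  imports Complex_Main "HOL-Algebra.Bij" "HOL-Algebra.Generated_Fields" "HOL-Algebra.Finite_Extensions"
    "HOL-Algebra.Free_Abelian_Groups" "HOL-Algebra.Product_Groups"
    "HOL-Algebra.Algebraic_Closure_Type"
begin

section \<open>Group algebras and generalised useful idempotent relations\<close>

text \<open>The group algebra over the rationals. As for \<^const>\<open>free_Abelian_group\<close>, elements are
  finitely supported functions, here with rational values, whose support lies in the group.\<close>

definition group_algebra :: "('g, 'm) monoid_scheme \<Rightarrow> ('g \<Rightarrow>\<^sub>0 rat) ring" where
  "group_algebra G =
    \<lparr>carrier = {f. Poly_Mapping.keys f \<subseteq> carrier G},
     monoid.mult = (\<lambda>f g. \<Sum>x\<in>Poly_Mapping.keys f. \<Sum>y\<in>Poly_Mapping.keys g.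
       Poly_Mapping.single (x \<otimes>\<^bsub>G\<^esub> y) (Poly_Mapping.lookup f x * Poly_Mapping.lookup g y)),
     one = Poly_Mapping.single \<one>\<^bsub>G\<^esub> 1,
     ring.zero = 0,
     ring.add = (+)\<rparr>"

definition subgroup_idempotent :: "'g set \<Rightarrow> ('g \<Rightarrow>\<^sub>0 rat)" where
  "subgroup_idempotent H = (\<Sum>h\<in>H. Poly_Mapping.single h (1 / of_nat (card H)))"

definition has_gen_useful_idempotent_relation ::
    "('g, 'm) monoid_scheme \<Rightarrow> 'g set set \<Rightarrow> bool" where
  "has_gen_useful_idempotent_relation G \<H> \<longleftrightarrow>
    (\<exists>a. (\<forall>H \<in> \<H> - {{\<one>\<^bsub>G\<^esub>}}. a H \<in> carrier (group_algebra G)) \<and>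
      \<one>\<^bsub>group_algebra G\<^esub> =
        (\<Oplus>\<^bsub>group_algebra G\<^esub> H \<in> \<H> - {{\<one>\<^bsub>G\<^esub>}}.
          a H \<otimes>\<^bsub>group_algebra G\<^esub> subgroup_idempotent H))"


section \<open>Number fields and Galois extensions\<close>

text \<open>The set \<open>generate_field F {}\<close> is the prime subfield, that is, the copy of the rationals
  in \<open>F\<close> when the characteristic is zero.\<close>

definition number_field :: "('a, 'b) ring_scheme \<Rightarrow> bool" where
  "number_field F \<longleftrightarrow>
    field F \<and>
    (\<forall>n::nat. n > 0 \<longrightarrow> [n] \<cdot>\<^bsub>F\<^esub> \<one>\<^bsub>F\<^esub> \<noteq> \<zero>\<^bsub>F\<^esub>) \<and>
    ring.finite_dimension F (generate_field F {}) (carrier F)"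

definition Gal :: "('a, 'b) ring_scheme \<Rightarrow> 'a set \<Rightarrow> ('a \<Rightarrow> 'a) monoid" where
  "Gal L K = BijGroup (carrier L)
     \<lparr>carrier := {\<sigma> \<in> ring_hom L L \<inter> Bij (carrier L). \<forall>x\<in>K. \<sigma> x = x}\<rparr>"

definition fixed_field :: "('a, 'b) ring_scheme \<Rightarrow> ('a \<Rightarrow> 'a) set \<Rightarrow> 'a set" where
  "fixed_field L H = {x \<in> carrier L. \<forall>\<sigma>\<in>H. \<sigma> x = x}"

definition finite_galois :: "('a, 'b) ring_scheme \<Rightarrow> 'a set \<Rightarrow> bool" where
  "finite_galois L K \<longleftrightarrow>
    subfield K L \<and> ring.finite_dimension L K (carrier L) \<and>
    fixed_field L (carrier (Gal L K)) = K"

definition integral_over :: "('a, 'b) ring_scheme \<Rightarrow> 'a set \<Rightarrow> 'a \<Rightarrow> bool" where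
  "integral_over R S x \<longleftrightarrow>
    (\<exists>f \<in> carrier (S[X]\<^bsub>R\<^esub>). f \<noteq> [] \<and> hd f = \<one>\<^bsub>R\<^esub> \<and> ring.eval R f x = \<zero>\<^bsub>R\<^esub>)"

definition ring_of_integers :: "('a, 'b) ring_scheme \<Rightarrow> ('a, 'b) ring_scheme" where
  "ring_of_integers F =
    F\<lparr>carrier := {x \<in> carrier F. integral_over F (range (\<lambda>k::int. [k] \<cdot>\<^bsub>F\<^esub> \<one>\<^bsub>F\<^esub>)) x}\<rparr>"


section \<open>Absolute values and completions\<close>

definition absolute_value :: "('a, 'b) ring_scheme \<Rightarrow> ('a \<Rightarrow> real) \<Rightarrow> bool" where
  "absolute_value F v \<longleftrightarrow>
    (\<forall>x\<in>carrier F. v x \<ge> 0 \<and> (v x = 0 \<longleftrightarrow> x = \<zero>\<^bsub>F\<^esub>)) \<and>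
    (\<forall>x\<in>carrier F. \<forall>y\<in>carrier F. v (x \<otimes>\<^bsub>F\<^esub> y) = v x * v y) \<and>
    (\<forall>x\<in>carrier F. \<forall>y\<in>carrier F. v (x \<oplus>\<^bsub>F\<^esub> y) \<le> v x + v y)"

definition padic_abs :: "nat \<Rightarrow> rat \<Rightarrow> real" where
  "padic_abs p x =
    (if x = 0 then 0
     else real p powi (int (multiplicity (int p) (snd (quotient_of x)))
                     - int (multiplicity (int p) (fst (quotient_of x)))))"

text \<open>A place above \<open>p\<close> is an equivalence class of absolute values whose restriction to the
  rationals is equivalent to the \<open>p\<close>-adic one. It is represented by its unique member that restricts
  to the normalised \<open>p\<close>-adic absolute value; by multiplicativity the restriction is determined
  by the integers. Extensionality makes the representing function unique outside the carrier too.\<close>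

definition places_above :: "('a, 'b) ring_scheme \<Rightarrow> nat \<Rightarrow> ('a \<Rightarrow> real) set" where
  "places_above F p =
    {v \<in> extensional (carrier F). absolute_value F v \<and>
      (\<forall>k::int. v ([k] \<cdot>\<^bsub>F\<^esub> \<one>\<^bsub>F\<^esub>) = padic_abs p (of_int k))}"

definition cauchy_ring :: "('a, 'b) ring_scheme \<Rightarrow> ('a \<Rightarrow> real) \<Rightarrow> (nat \<Rightarrow> 'a) ring" where
  "cauchy_ring F v =
    \<lparr>carrier = {x. (\<forall>n. x n \<in> carrier F) \<and>
       (\<forall>\<epsilon>>0. \<exists>N. \<forall>m\<ge>N. \<forall>n\<ge>N. v (x m \<ominus>\<^bsub>F\<^esub> x n) < \<epsilon>)},
     monoid.mult = (\<lambda>x y n. x n \<otimes>\<^bsub>F\<^esub> y n),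
     one = (\<lambda>n. \<one>\<^bsub>F\<^esub>),
     ring.zero = (\<lambda>n. \<zero>\<^bsub>F\<^esub>),
     ring.add = (\<lambda>x y n. x n \<oplus>\<^bsub>F\<^esub> y n)\<rparr>"

definition null_sequences :: "('a, 'b) ring_scheme \<Rightarrow> ('a \<Rightarrow> real) \<Rightarrow> (nat \<Rightarrow> 'a) set" where
  "null_sequences F v = {x \<in> carrier (cauchy_ring F v). (\<lambda>n. v (x n)) \<longlonglongrightarrow> 0}"

definition completion :: "('a, 'b) ring_scheme \<Rightarrow> ('a \<Rightarrow> real) \<Rightarrow> (nat \<Rightarrow> 'a) set ring" where
  "completion F v = cauchy_ring F v Quot null_sequences F v"

definition completion_embed ::
    "('a, 'b) ring_scheme \<Rightarrow> ('a \<Rightarrow> real) \<Rightarrow> 'a \<Rightarrow> (nat \<Rightarrow> 'a) set" where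
  "completion_embed F v a = null_sequences F v +>\<^bsub>cauchy_ring F v\<^esub> (\<lambda>n. a)"

text \<open>The extension of \<open>v\<close> to the completion; \<^const>\<open>the_elem\<close> is applied to a singleton since
  the limit does not depend on the representing Cauchy sequence.\<close>

definition completion_abs ::
    "('a, 'b) ring_scheme \<Rightarrow> ('a \<Rightarrow> real) \<Rightarrow> (nat \<Rightarrow> 'a) set \<Rightarrow> real" where
  "completion_abs F v \<xi> = the_elem ((\<lambda>x. lim (\<lambda>n. v (x n))) ` \<xi>)"

definition completion_tendsto ::
    "('a, 'b) ring_scheme \<Rightarrow> ('a \<Rightarrow> real) \<Rightarrow> (nat \<Rightarrow> (nat \<Rightarrow> 'a) set) \<Rightarrow> (nat \<Rightarrow> 'a) set \<Rightarrow> bool"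
  where
  "completion_tendsto F v S \<xi> \<longleftrightarrow>
    (\<lambda>n. completion_abs F v (S n \<ominus>\<^bsub>completion F v\<^esub> \<xi>)) \<longlonglongrightarrow> 0"

definition principal_units ::
    "('a, 'b) ring_scheme \<Rightarrow> ('a \<Rightarrow> real) \<Rightarrow> (nat \<Rightarrow> 'a) set monoid" where
  "principal_units F v =
    \<lparr>carrier = {\<xi> \<in> carrier (completion F v).
       completion_abs F v (\<xi> \<ominus>\<^bsub>completion F v\<^esub> \<one>\<^bsub>completion F v\<^esub>) < 1},
     monoid.mult = monoid.mult (completion F v),
     one = \<one>\<^bsub>completion F v\<^esub>\<rparr>"

abbreviation rat_field :: "rat ring" where
  "rat_field \<equiv> ring_of_type_algebra"

definition padic_integers :: "nat \<Rightarrow> (nat \<Rightarrow> rat) set ring" where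
  "padic_integers p = (completion rat_field (padic_abs p))
    \<lparr>carrier := {\<xi> \<in> carrier (completion rat_field (padic_abs p)).
       completion_abs rat_field (padic_abs p) \<xi> \<le> 1}\<rparr>"


section \<open>The \<open>p\<close>-adic integers acting on principal units\<close>

text \<open>The power \<open>\<xi>\<^sup>a\<close> of a principal unit \<open>\<xi>\<close> is the limit of \<open>\<xi>\<^sup>k\<close> for integers \<open>k\<close>
  tending \<open>p\<close>-adically to \<open>a\<close>.\<close>

definition padic_pow ::
    "nat \<Rightarrow> ('a, 'b) ring_scheme \<Rightarrow> ('a \<Rightarrow> real) \<Rightarrow> (nat \<Rightarrow> 'a) set \<Rightarrow> (nat \<Rightarrow> rat) set
      \<Rightarrow> (nat \<Rightarrow> 'a) set" where
  "padic_pow p F v \<xi> a =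
    (THE \<eta>. \<eta> \<in> carrier (principal_units F v) \<and>
      (\<forall>k::nat \<Rightarrow> int.
        completion_tendsto rat_field (padic_abs p)
          (\<lambda>n. completion_embed rat_field (padic_abs p) (of_int (k n))) a \<longrightarrow>
        completion_tendsto F v (\<lambda>n. \<xi> [^]\<^bsub>principal_units F v\<^esub> k n) \<eta>))"

text \<open>The unit group of the valuation ring of a completion \<open>F\<^sub>v\<close> is the direct product of the
  roots of unity of order prime to \<open>p\<close> and the principal units; this is the projection to the
  second factor.\<close>

definition principal_part ::
    "nat \<Rightarrow> ('a, 'b) ring_scheme \<Rightarrow> ('a \<Rightarrow> real) \<Rightarrow> (nat \<Rightarrow> 'a) set \<Rightarrow> (nat \<Rightarrow> 'a) set" where
  "principal_part p F v \<xi> =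
    (THE \<eta>. \<eta> \<in> carrier (principal_units F v) \<and>
      (\<exists>\<zeta> \<in> carrier (completion F v). \<exists>m::nat. coprime m p \<and>
        \<zeta> [^]\<^bsub>completion F v\<^esub> m = \<one>\<^bsub>completion F v\<^esub> \<and>
        \<xi> = \<zeta> \<otimes>\<^bsub>completion F v\<^esub> \<eta>))"


section \<open>Tensor products of abelian groups\<close>

definition tensor_relations ::
    "('a, 'm) monoid_scheme \<Rightarrow> ('b, 'n) monoid_scheme \<Rightarrow> (('a \<times> 'b) \<Rightarrow>\<^sub>0 int) set" where
  "tensor_relations A B =
    {frag_of (a \<otimes>\<^bsub>A\<^esub> a', b) - frag_of (a, b) - frag_of (a', b) | a a' b.
       a \<in> carrier A \<and> a' \<in> carrier A \<and> b \<in> carrier B} \<union>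
    {frag_of (a, b \<otimes>\<^bsub>B\<^esub> b') - frag_of (a, b) - frag_of (a, b') | a b b'.
       a \<in> carrier A \<and> b \<in> carrier B \<and> b' \<in> carrier B}"

definition tensor_group ::
    "('a, 'm) monoid_scheme \<Rightarrow> ('b, 'n) monoid_scheme \<Rightarrow> (('a \<times> 'b) \<Rightarrow>\<^sub>0 int) set monoid" where
  "tensor_group A B =
    free_Abelian_group (carrier A \<times> carrier B) Mod
      generate (free_Abelian_group (carrier A \<times> carrier B)) (tensor_relations A B)"


section \<open>The Leopoldt map\<close>

definition tensored_units ::
    "('a, 'b) ring_scheme \<Rightarrow> nat \<Rightarrow> (((nat \<Rightarrow> rat) set \<times> 'a) \<Rightarrow>\<^sub>0 int) set monoid" where
  "tensored_units F p =
    tensor_group (add_monoid (padic_integers p)) (units_of (ring_of_integers F))"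

definition local_principal_units ::
    "('a, 'b) ring_scheme \<Rightarrow> nat \<Rightarrow> (('a \<Rightarrow> real) \<Rightarrow> (nat \<Rightarrow> 'a) set) monoid" where
  "local_principal_units F p = product_group (places_above F p) (principal_units F)"

text \<open>The image of a pure tensor \<open>a \<otimes> u\<close>.\<close>

definition leopoldt_pure ::
    "('a, 'b) ring_scheme \<Rightarrow> nat \<Rightarrow> (nat \<Rightarrow> rat) set \<times> 'a \<Rightarrow> (('a \<Rightarrow> real) \<Rightarrow> (nat \<Rightarrow> 'a) set)"
  where
  "leopoldt_pure F p = (\<lambda>(a, u). \<lambda>v\<in>places_above F p.
     padic_pow p F v (principal_part p F v (completion_embed F v u)) a)"

text \<open>An element of the tensor product is a coset of formal integral combinations of pairs; the
  linear extension of \<^const>\<open>leopoldt_pure\<close> is constant on each such coset.\<close>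

definition leopoldt_map ::
    "('a, 'b) ring_scheme \<Rightarrow> nat \<Rightarrow> (((nat \<Rightarrow> rat) set \<times> 'a) \<Rightarrow>\<^sub>0 int) set
      \<Rightarrow> (('a \<Rightarrow> real) \<Rightarrow> (nat \<Rightarrow> 'a) set)" where
  "leopoldt_map F p T =
    the_elem ((\<lambda>z. \<Otimes>\<^bsub>local_principal_units F p\<^esub> t \<in> Poly_Mapping.keys z.
      leopoldt_pure F p t [^]\<^bsub>local_principal_units F p\<^esub> Poly_Mapping.lookup z t) ` T)"

definition Leo :: "('a, 'b) ring_scheme \<Rightarrow> nat \<Rightarrow> bool" where
  "Leo F p \<longleftrightarrow> inj_on (leopoldt_map F p) (carrier (tensored_units F p))"

end

theory Submission
  imports Defs
begin

text \<open>An element of \<open>\<int>\<^sub>p \<otimes> O\<^sub>F\<^sup>\<times>\<close> is represented by a formal combination \<open>z\<close> of pairs. Replacing each \<open>p\<close>-adic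
  exponent by integers converging to it turns \<open>z\<close> into a sequence of units of \<open>F\<close>, and \<open>z\<close> lies in the
  kernel of the Leopoldt map iff this sequence tends to \<open>1\<close> at every place above \<open>p\<close>. In this form the
  Galois group acts on the kernel, the inclusion of a subfield preserves it, and so does the norm to a
  subfield, since every place above \<open>p\<close> of the subfield extends. Extensions of absolute values come from a
  minimal seminorm on the larger field. Moreover the kernel has no torsion: roots of unity embed injectively
  in every completion.

  If \<open>Leo(L, p)\<close> holds, then a kernel element of \<open>L\<^sup>I\<close> becomes null over \<open>L\<close>, and its norm, which is its
  \<open>|I|\<close>-th multiple, is null over \<open>L\<^sup>I\<close>; so the element itself is null. Conversely, if \<open>Leo(L\<^sup>I, p)\<close> holds,
  the norm element of \<open>I\<close> annihilates the kernel for \<open>L\<close>, hence so does that of every \<open>H\<close> containing a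
  conjugate of \<open>I\<close>. Clearing denominators in the idempotent relation writes a positive integer as a
  combination of such norm elements, so the kernel is torsion and therefore zero.\<close>

section \<open>Maps out of free abelian groups\<close>

text \<open>Sequences of global units keep every comparison between fields inside \<open>L\<close>:
  automorphisms, inclusions and norms act on them term by term. The price is one sequence of
  exponents that serves all units and all places. Modulo a place a unit has finite order prime to
  \<open>p\<close>, but this order depends on both, so \<open>tame_exp p n\<close> is made divisible
  by all numbers up to \<open>n\<close> that are prime to \<open>p\<close>, while staying congruent
  to 1 modulo \<open>p ^ n\<close>. The identities between norms and group elements hold only up to
  an integer factor, the order of \<open>I\<close> or a common denominator. So the absence of
  torsion in the kernel carries the argument, and it needs care because the tensor product itself
  can have torsion. The way out is to divide the p-adic factor. Division by a number prime to
  \<open>p\<close> is unique there; division by \<open>p ^ s\<close> leaves an ordinary integer as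
  error, which moves across the tensor sign to the unit. Torsion of order \<open>p ^ s\<close>
  therefore consists of pure tensors of 1 with a unit, and such a tensor in the kernel comes from a
  unit of finite order prime to \<open>p\<close>.\<close>

definition frag_eval :: "('g, 'm) monoid_scheme \<Rightarrow> ('s \<Rightarrow> 'g) \<Rightarrow> ('s \<Rightarrow>\<^sub>0 int) \<Rightarrow> 'g" where
  "frag_eval G f z =
    (\<Otimes>\<^bsub>G\<^esub> t \<in> Poly_Mapping.keys z. f t [^]\<^bsub>G\<^esub> Poly_Mapping.lookup z t)"

context comm_group
begin

lemma frag_eval_superset:
  assumes "finite A" "Poly_Mapping.keys z \<subseteq> A" "f \<in> A \<rightarrow> carrier G"
  shows "frag_eval G f z = (\<Otimes>t\<in>A. f t [^] Poly_Mapping.lookup z t)"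
  unfolding frag_eval_def
  by (rule finprod_mono_neutral_cong_left) (use assms in \<open>auto simp: in_keys_iff Pi_iff\<close>)

lemma frag_eval_hom:
  assumes f: "f \<in> S \<rightarrow> carrier G"
  shows "frag_eval G f \<in> hom (free_Abelian_group S) G"
proof (rule homI)
  fix x assume "x \<in> carrier (free_Abelian_group S)"
  then have "\<And>t. t \<in> Poly_Mapping.keys x \<Longrightarrow> f t \<in> carrier G"
    using f by (auto simp: Pi_iff)
  then show "frag_eval G f x \<in> carrier G"
    unfolding frag_eval_def by (intro finprod_closed) auto
next
  fix x y assume xy: "x \<in> carrier (free_Abelian_group S)" "y \<in> carrier (free_Abelian_group S)"
  let ?A = "Poly_Mapping.keys x \<union> Poly_Mapping.keys y"
  have f': "f \<in> ?A \<rightarrow> carrier G" using f xy by (auto simp: Pi_iff)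
  have "frag_eval G f (x + y) = (\<Otimes>t\<in>?A. f t [^] Poly_Mapping.lookup (x + y) t)"
    by (rule frag_eval_superset) (use f' in \<open>auto dest: subsetD [OF keys_add]\<close>)
  also have "\<dots> = (\<Otimes>t\<in>?A. f t [^] Poly_Mapping.lookup x t \<otimes> f t [^] Poly_Mapping.lookup y t)"
    by (rule finprod_cong') (use f' in \<open>auto simp: Poly_Mapping.lookup_add int_pow_mult Pi_iff\<close>)
  also have "\<dots> = (\<Otimes>t\<in>?A. f t [^] Poly_Mapping.lookup x t) \<otimes> (\<Otimes>t\<in>?A. f t [^] Poly_Mapping.lookup y t)"
    by (rule finprod_multf) (use f' in \<open>auto simp: Pi_iff\<close>)
  also have "\<dots> = frag_eval G f x \<otimes> frag_eval G f y"
    using frag_eval_superset [of ?A x f] frag_eval_superset [of ?A y f] f' by simp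
  finally show "frag_eval G f (x \<otimes>\<^bsub>free_Abelian_group S\<^esub> y) = frag_eval G f x \<otimes> frag_eval G f y"
    by simp
qed

lemma frag_eval_frag_of [simp]:
  assumes "f t \<in> carrier G" shows "frag_eval G f (frag_of t) = f t"
  using assms by (simp add: frag_eval_def finprod_singleton)

end

lemma free_Abelian_group_hom_eqI:
  assumes "h \<in> hom (free_Abelian_group S) G" "k \<in> hom (free_Abelian_group S) G" "group G"
    and "\<And>t. t \<in> S \<Longrightarrow> h (frag_of t) = k (frag_of t)"
    and z: "z \<in> carrier (free_Abelian_group S)"
  shows "h z = k z"
proof -
  interpret h: group_hom "free_Abelian_group S" G h
    using assms by (simp add: group_hom_def group_hom_axioms_def)
  interpret k: group_hom "free_Abelian_group S" G k
    using assms by (simp add: group_hom_def group_hom_axioms_def)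
  have "Poly_Mapping.keys z \<subseteq> S" using z by simp
  then show ?thesis
  proof (rule free_Abelian_group_induct)
    show "h 0 = k 0" using h.hom_one k.hom_one by simp
    show "h (frag_of a) = k (frag_of a)" if "a \<in> S" for a using that assms by simp
    fix x y assume *: "Poly_Mapping.keys x \<subseteq> S" "Poly_Mapping.keys y \<subseteq> S" "h x = k x" "h y = k y"
    have "h (x \<otimes>\<^bsub>free_Abelian_group S\<^esub> inv\<^bsub>free_Abelian_group S\<^esub> y) =
        h x \<otimes>\<^bsub>G\<^esub> inv\<^bsub>G\<^esub> h y"
      by (metis * carrier_free_Abelian_group_iff group.inv_closed group_free_Abelian_group h.hom_inv h.hom_mult)
    moreover have "k (x \<otimes>\<^bsub>free_Abelian_group S\<^esub> inv\<^bsub>free_Abelian_group S\<^esub> y) =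
        k x \<otimes>\<^bsub>G\<^esub> inv\<^bsub>G\<^esub> k y"
      by (metis * carrier_free_Abelian_group_iff group.inv_closed group_free_Abelian_group k.hom_inv k.hom_mult)
    ultimately show "h (x - y) = k (x - y)" using * by simp
  qed
qed

lemma hom_frag_eval:
  assumes "comm_group G" "comm_group H" "\<phi> \<in> hom G H" "f \<in> S \<rightarrow> carrier G"
    and "z \<in> carrier (free_Abelian_group S)"
  shows "\<phi> (frag_eval G f z) = frag_eval H (\<phi> \<circ> f) z"
proof -
  have \<phi>: "\<phi> x \<in> carrier H" if "x \<in> carrier G" for x
    using assms(3) that by (auto simp: hom_def)
  have 1: "\<phi> \<circ> frag_eval G f \<in> hom (free_Abelian_group S) H"
    by (rule hom_compose [OF comm_group.frag_eval_hom [OF assms(1,4)] assms(3)])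
  have f': "\<phi> \<circ> f \<in> S \<rightarrow> carrier H" using assms \<phi> by (auto simp: Pi_iff)
  have "(\<phi> \<circ> frag_eval G f) z = frag_eval H (\<phi> \<circ> f) z"
  proof (rule free_Abelian_group_hom_eqI [OF 1 comm_group.frag_eval_hom [OF assms(2) f']])
    show "group H" using assms(2) by (simp add: comm_group_def)
    fix t assume "t \<in> S"
    then show "(\<phi> \<circ> frag_eval G f) (frag_of t) = frag_eval H (\<phi> \<circ> f) (frag_of t)"
      using assms f' by (simp add: comm_group.frag_eval_frag_of Pi_iff)
  qed (use assms in auto)
  then show ?thesis by simp
qed

lemma frag_eval_cong:
  assumes "comm_group G" "f \<in> S \<rightarrow> carrier G" "\<And>t. t \<in> S \<Longrightarrow> f t = g t"
    and "z \<in> carrier (free_Abelian_group S)"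
  shows "frag_eval G f z = frag_eval G g z"
proof -
  interpret comm_group G by fact
  show ?thesis unfolding frag_eval_def
    by (rule finprod_cong') (use assms in \<open>auto simp: Pi_iff\<close>)
qed

lemma keys_frag_extend_subset:
  assumes "z \<in> carrier (free_Abelian_group S)" "\<And>t. t \<in> S \<Longrightarrow> f t \<in> carrier (free_Abelian_group T)"
  shows "frag_extend f z \<in> carrier (free_Abelian_group T)"
  using assms keys_frag_extend [of f z] by fastforce

lemma frag_eval_extend:
  assumes "comm_group G" "z \<in> carrier (free_Abelian_group S)"
    and "\<And>t. t \<in> S \<Longrightarrow> h t \<in> carrier (free_Abelian_group T)" "f \<in> T \<rightarrow> carrier G"
  shows "frag_eval G f (frag_extend h z) = frag_eval G (\<lambda>t. frag_eval G f (h t)) z"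
proof -
  have 1: "frag_eval G f \<in> hom (free_Abelian_group T) G"
    using assms by (simp add: comm_group.frag_eval_hom)
  have 2: "frag_extend h \<in> hom (free_Abelian_group S) (free_Abelian_group T)"
    using keys_frag_extend_subset [of _ S h T] assms(3) by (auto simp: hom_def frag_extend_add)
  have 3: "(\<lambda>t. frag_eval G f (h t)) \<in> S \<rightarrow> carrier G"
    using 1 assms(3) by (auto simp: hom_def Pi_iff)
  have "(frag_eval G f \<circ> frag_extend h) z = frag_eval G (\<lambda>t. frag_eval G f (h t)) z"
  proof (rule free_Abelian_group_hom_eqI [OF _ comm_group.frag_eval_hom [OF assms(1) 3] _ _ assms(2)])
    show "frag_eval G f \<circ> frag_extend h \<in> hom (free_Abelian_group S) G"
      using 1 2 by (rule hom_compose [rotated])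
    show "group G" using assms(1) by (simp add: comm_group_def)
    fix t assume "t \<in> S"
    then show "(frag_eval G f \<circ> frag_extend h) (frag_of t) = frag_eval G (\<lambda>t. frag_eval G f (h t)) (frag_of t)"
      using 3 assms(1) by (simp add: comm_group.frag_eval_frag_of Pi_iff)
  qed
  then show ?thesis by simp
qed

section \<open>Finitely generated abelian groups\<close>

context comm_group
begin

lemma generate_insert_decomp:
  assumes "S \<subseteq> carrier G" "m \<in> carrier G" "x \<in> generate G (insert m S)"
  shows "\<exists>c::int. \<exists>r\<in>generate G S. x = m [^] c \<otimes> r"
  using assms(3)
proof induction
  case one
  then show ?case using generate.one [of G S] by (intro exI[of _ 0] bexI[of _ \<one>]) auto
next
  case (incl h)
  show ?case
  proof (cases "h = m")
    case True
    then show ?thesis using assms generate.one [of G S] by (intro exI[of _ 1] bexI[of _ \<one>]) auto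
  next
    case False
    then show ?thesis using incl assms generate.incl [of h S G]
      by (intro exI[of _ 0] bexI[of _ h]) (auto)
  qed
next
  case (inv h)
  show ?case
  proof (cases "h = m")
    case True
    then show ?thesis using assms generate.one [of G S]
      by (intro exI[of _ "-1"] bexI[of _ \<one>]) (auto simp: int_pow_neg)
  next
    case False
    then show ?thesis using inv assms generate.inv [of h S G]
      by (intro exI[of _ 0] bexI[of _ "inv h"]) (auto)
  qed
next
  case (eng x y)
  then obtain c r d s where *: "r \<in> generate G S" "s \<in> generate G S" "x = m [^] (c::int) \<otimes> r" "y = m [^] (d::int) \<otimes> s"
    by blast
  have "r \<in> carrier G" "s \<in> carrier G" using * assms generate_in_carrier by blast+
  then have "x \<otimes> y = m [^] (c+d) \<otimes> (r \<otimes> s)"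
    using * assms by (simp add: int_pow_mult m_ac)
  then show ?case using * generate.eng by metis
qed

lemma generate_int_pow:
  assumes "S \<subseteq> carrier G" "x \<in> generate G S" shows "x [^] (c::int) \<in> generate G S"
  using generate_is_subgroup [OF assms(1)] assms(2)
  by (metis (no_types, lifting) subgroup_int_pow_closed)

text \<open>A sequence in a finitely generated abelian group eventually depends on its predecessors: reduce
  the exponents of one generator modulo their greatest common divisor.\<close>

lemma finitely_generated_imp_dependent:
  assumes "finite S" "S \<subseteq> carrier G" "\<And>n::nat. s n \<in> generate G S"
  shows "\<exists>n. s n \<in> generate G (s ` {..<n})"
  using assms
proof (induction S arbitrary: s rule: finite_induct)
  case empty
  then have "s 0 = \<one>" by (simp add: generate_empty)
  then show ?case using generate.one by (metis)
next
  case (insert m S)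
  have S: "S \<subseteq> carrier G" "m \<in> carrier G" using insert by auto
  have "\<exists>c::int. \<exists>r\<in>generate G S. s n = m [^] c \<otimes> r" for n
    using generate_insert_decomp [OF S] insert.prems by blast
  then obtain c :: "nat \<Rightarrow> int" and r where cr: "\<And>n. r n \<in> generate G S" "\<And>n. s n = m [^] c n \<otimes> r n"
    by metis
  have rc: "r n \<in> carrier G" for n using cr generate_in_carrier S by blast
  have sc: "s n \<in> carrier G" for n using cr rc S by simp
  have ss: "s ` A \<subseteq> carrier G" for A using sc by auto
  \<comment> \<open>Gcds of initial segments form a divisibility chain, so one of them already
    equals the gcd \<open>g\<close> of all exponents. The index \<open>n0\<close> with
    \<open>c n0 \<noteq> 0\<close> keeps the minimum away from 0, which is the top element for
    divisibility but the least natural number.\<close>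
  define g where "g = Gcd (range c)"
  have "\<exists>N. Gcd (c ` {..<N}) = g"
  proof -
    have "\<exists>N. \<forall>M. Gcd (c ` {..<N}) dvd Gcd (c ` {..<M})"
    proof (cases "\<forall>n. c n = 0")
      case True
      then show ?thesis by (intro exI[of _ 0]) (auto intro!: Gcd_greatest)
    next
      case False
      then obtain n0 where n0: "c n0 \<noteq> 0" by blast
      define d where "d N = nat (Gcd (c ` {..<N}))" for N
      obtain N where N: "N > n0" "\<And>M. M > n0 \<Longrightarrow> d N \<le> d M"
        using ex_has_least_nat [of "\<lambda>N. N > n0" "Suc n0" d] by auto
      have "Gcd (c ` {..<N}) dvd Gcd (c ` {..<M})" for M
      proof -
        define K where "K = max N M"
        have K: "K > n0" "N \<le> K" "M \<le> K" using N(1) by (auto simp: K_def)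
        have mono: "Gcd (c ` {..<K}) dvd Gcd (c ` {..<M})" if "M \<le> K" for M
          using that by (intro Gcd_greatest) (auto intro: Gcd_dvd)
        have "Gcd (c ` {..<N}) \<noteq> 0" using n0 N(1) by (auto simp: Gcd_0_iff)
        then have pos: "Gcd (c ` {..<N}) > 0" using Gcd_int_greater_eq_0 [of "c ` {..<N}"] by linarith
        have "Gcd (c ` {..<K}) \<le> Gcd (c ` {..<N})"
          using mono [OF K(2)] pos by (rule zdvd_imp_le)
        moreover have "d N \<le> d K" using N(2) K(1) by blast
        ultimately have "Gcd (c ` {..<K}) = Gcd (c ` {..<N})"
          unfolding d_def using pos by linarith
        then show ?thesis using mono [OF K(3)] by simp
      qed
      then show ?thesis by blast
    qed
    then obtain N where N: "\<And>M. Gcd (c ` {..<N}) dvd Gcd (c ` {..<M})" by blast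
    have "Gcd (c ` {..<N}) dvd g"
      unfolding g_def
    proof (rule Gcd_greatest, clarify)
      fix n
      have "Gcd (c ` {..<N}) dvd Gcd (c ` {..<Suc n})" by (rule N)
      also have "\<dots> dvd c n" by (intro Gcd_dvd) auto
      finally show "Gcd (c ` {..<N}) dvd c n" .
    qed
    moreover have "g dvd Gcd (c ` {..<N})" unfolding g_def by (intro Gcd_greatest) (auto intro: Gcd_dvd)
    ultimately show ?thesis
      using Gcd_int_greater_eq_0 [of "c ` {..<N}"] Gcd_int_greater_eq_0 [of "range c"]
      unfolding g_def by (intro exI[of _ N]) (simp add: zdvd_antisym_nonneg)
  qed
  then obtain N where N: "Gcd (c ` {..<N}) = g" by blast
  \<comment> \<open>By Bezout, products of powers of the first \<open>M\<close> terms reach an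
    element whose exponent of \<open>m\<close> is the gcd of theirs.\<close>
  have comb: "\<exists>t\<in>generate G (s ` {..<M}). \<exists>r'\<in>generate G S. t = m [^] Gcd (c ` {..<M}) \<otimes> r'" for M
  proof (induction M)
    case 0
    then show ?case using generate.one by (intro bexI[of _ \<one>]) (auto)
  next
    case (Suc M)
    then obtain t r' where t: "t \<in> generate G (s ` {..<M})" "r' \<in> generate G S" "t = m [^] Gcd (c ` {..<M}) \<otimes> r'"
      by blast
    obtain a b where ab: "a * Gcd (c ` {..<M}) + b * c M = gcd (Gcd (c ` {..<M})) (c M)"
      using bezout_int by blast
    have G: "Gcd (c ` {..<Suc M}) = gcd (Gcd (c ` {..<M})) (c M)"
      by (simp add: lessThan_Suc gcd.commute)
    have r'c: "r' \<in> carrier G" using t(2) generate_in_carrier S by blast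
    have t1: "t \<in> generate G (s ` {..<Suc M})"
      using t(1) mono_generate [of "s ` {..<M}" "s ` {..<Suc M}"] by fastforce
    have s1: "s M \<in> generate G (s ` {..<Suc M})" by (rule generate.incl) auto
    have "t [^] a \<otimes> s M [^] b \<in> generate G (s ` {..<Suc M})"
      by (rule generate.eng) (use t1 s1 generate_int_pow ss in auto)
    moreover have "r' [^] a \<otimes> r M [^] b \<in> generate G S"
      by (rule generate.eng) (use t(2) cr(1) generate_int_pow S in auto)
    moreover have "t [^] a \<otimes> s M [^] b = m [^] Gcd (c ` {..<Suc M}) \<otimes> (r' [^] a \<otimes> r M [^] b)"
    proof -
      have "t [^] a \<otimes> s M [^] b = (m [^] (Gcd (c ` {..<M}) * a) \<otimes> r' [^] a) \<otimes> (m [^] (c M * b) \<otimes> r M [^] b)"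
        unfolding t(3) cr(2) [of M] using S r'c rc by (simp add: int_pow_distrib int_pow_pow)
      also have "\<dots> = (m [^] (Gcd (c ` {..<M}) * a) \<otimes> m [^] (c M * b)) \<otimes> (r' [^] a \<otimes> r M [^] b)"
        using S r'c rc by (simp add: m_ac)
      also have "m [^] (Gcd (c ` {..<M}) * a) \<otimes> m [^] (c M * b) = m [^] Gcd (c ` {..<Suc M})"
        using S G ab by (simp add: int_pow_mult [symmetric] mult.commute)
      finally show ?thesis .
    qed
    ultimately show ?case by blast
  qed
  obtain t r' where t: "t \<in> generate G (s ` {..<N})" "r' \<in> generate G S" "t = m [^] g \<otimes> r'"
    using comb [of N] N by blast
  have r'c: "r' \<in> carrier G" using t(2) generate_in_carrier S by blast
  have tc: "t \<in> carrier G" using t r'c S by simp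
  have "g dvd c n" for n unfolding g_def by (intro Gcd_dvd) auto
  then obtain q where q: "\<And>n. c n = g * q n" unfolding dvd_def by metis
  \<comment> \<open>Dividing by a power of \<open>t\<close> removes \<open>m\<close>, so the
    induction hypothesis applies to \<open>s'\<close>. The shift by \<open>N\<close> makes all terms
    that \<open>t\<close> involves precede \<open>s (n + N)\<close>.\<close>
  define s' where "s' n = s (n + N) \<otimes> inv (t [^] q (n + N))" for n
  have s': "s' n \<in> generate G S" for n
  proof -
    have "s' n = r (n + N) \<otimes> inv (r' [^] q (n + N))"
    proof -
      have "t [^] q (n+N) = m [^] c (n+N) \<otimes> r' [^] q (n+N)"
        unfolding t(3) q using S r'c by (simp add: int_pow_distrib int_pow_pow)
      then show ?thesis unfolding s'_def cr(2)
        using S r'c rc by (simp add: inv_mult) (smt (verit, ccfv_SIG) int_pow_closed inv_closed m_assoc m_closed m_lcomm r_inv r_one)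
    qed
    moreover have "inv (r' [^] q (n + N)) \<in> generate G S"
      using generate_m_inv_closed [OF S(1)] generate_int_pow [OF S(1) t(2)] by blast
    ultimately show ?thesis using cr(1) generate.eng by metis
  qed
  obtain n where n: "s' n \<in> generate G (s' ` {..<n})"
    using insert.IH [OF S(1), of s'] s' by blast
  have s'c: "s' n \<in> carrier G" for n using s' generate_in_carrier S by blast
  let ?Q = "generate G (s ` {..<n + N})"
  have Q: "subgroup ?Q G" using generate_is_subgroup [OF ss] .
  have tQ: "t [^] k \<in> ?Q" for k :: int
  proof -
    have "t \<in> ?Q" using t(1) mono_generate [of "s ` {..<N}" "s ` {..<n+N}"] by fastforce
    then show ?thesis using generate_int_pow ss by blast
  qed
  have "s' i \<in> ?Q" if "i < n" for i
    unfolding s'_def using that tQ generate.incl [of "s (i+N)" "s ` {..<n+N}" G]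
    by (intro subgroup.m_closed [OF Q] subgroup.m_inv_closed [OF Q]) auto
  then have "generate G (s' ` {..<n}) \<subseteq> ?Q"
    by (intro generate_subgroup_incl [OF _ Q]) auto
  with n have "s' n \<in> ?Q" by blast
  then have "s' n \<otimes> t [^] q (n + N) \<in> ?Q" using tQ subgroup.m_closed [OF Q] by blast
  moreover have "s' n \<otimes> t [^] q (n + N) = s (n + N)"
    unfolding s'_def using sc tc by (simp add: m_assoc)
  ultimately show ?case by auto
qed

text \<open>Modulo \<open>p\<close>-th powers a finitely generated abelian group is finite, so
  infinitely many terms share a class. Applied to the additive group generated by the powers of a
  unit, this yields two powers congruent modulo \<open>p\<close>.\<close>

lemma finitely_generated_pigeonhole:
  assumes "finite S" "S \<subseteq> carrier G" "\<And>n::nat. n \<in> J \<Longrightarrow> s n \<in> generate G S" "infinite J" "p > (0::int)"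
  shows "\<exists>J'\<subseteq>J. infinite J' \<and> (\<forall>i\<in>J'. \<forall>j\<in>J'. \<exists>x\<in>generate G S. s i = s j \<otimes> x [^] p)"
  using assms(1-4)
proof (induction S arbitrary: s J rule: finite_induct)
  case empty
  then have "s i = \<one>" if "i \<in> J" for i using that by (simp add: generate_empty)
  then show ?case using empty by (intro exI[of _ J]) (auto simp: generate_empty)
next
  case (insert m S)
  have S: "S \<subseteq> carrier G" "m \<in> carrier G" using insert by auto
  have "\<exists>c::int. \<exists>r. n \<in> J \<longrightarrow> r\<in>generate G S \<and> s n = m [^] c \<otimes> r" for n
    using generate_insert_decomp [OF S] insert.prems by blast
  then obtain c :: "nat \<Rightarrow> int" and r where cr: "\<And>n. n \<in> J \<Longrightarrow> r n \<in> generate G S"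
      "\<And>n. n \<in> J \<Longrightarrow> s n = m [^] c n \<otimes> r n"
    by metis
  \<comment> \<open>First \<open>J\<close> is thinned out so that the exponents of \<open>m\<close>
    agree modulo \<open>p\<close>; their differences then contribute a \<open>p\<close>-th power of
    \<open>m\<close>.\<close>
  have "(\<lambda>n. c n mod p) ` J \<subseteq> {0..<p}" using \<open>p > 0\<close> by auto
  then have "finite ((\<lambda>n. c n mod p) ` J)" using finite_subset by blast
  then obtain n0 where n0: "n0 \<in> J" "infinite {n\<in>J. c n mod p = c n0 mod p}"
    using pigeonhole_infinite insert.prems(3) by blast
  obtain J' where J': "J' \<subseteq> {n\<in>J. c n mod p = c n0 mod p}" "infinite J'"
      "\<And>i j. i\<in>J' \<Longrightarrow> j\<in>J' \<Longrightarrow> \<exists>x\<in>generate G S. r i = r j \<otimes> x [^] p"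
    using insert.IH [OF S(1) _ n0(2), of r] cr(1) by (metis (no_types, lifting) mem_Collect_eq)
  show ?case
  proof (intro exI[of _ J'] conjI ballI)
    show "J' \<subseteq> J" using J' by auto
    show "infinite J'" by fact
    fix i j assume ij: "i \<in> J'" "j \<in> J'"
    then obtain x where x: "x \<in> generate G S" "r i = r j \<otimes> x [^] p" using J' by blast
    have "c i mod p = c n0 mod p" "c j mod p = c n0 mod p" using ij J'(1) by blast+
    then have "c i mod p = c j mod p" by simp
    then obtain k where k: "c i = c j + p * k" by (metis mod_eqE)
    have ijJ: "i \<in> J" "j \<in> J" using ij J' by auto
    have xc: "x \<in> carrier G" "r j \<in> carrier G" using x cr(1) [OF ijJ(2)] generate_in_carrier S by blast+
    have "s i = m [^] (c j + p * k) \<otimes> (r j \<otimes> x [^] p)" using cr(2) ijJ k x by simp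
    also have "\<dots> = (m [^] c j \<otimes> r j) \<otimes> (m [^] k \<otimes> x) [^] p"
      using S xc by (simp add: int_pow_mult int_pow_distrib int_pow_pow mult.commute m_ac)
    finally have "s i = s j \<otimes> (m [^] k \<otimes> x) [^] p" using cr(2) ijJ by simp
    moreover have "m [^] k \<otimes> x \<in> generate G (insert m S)"
    proof (rule generate.eng)
      show "m [^] k \<in> generate G (insert m S)"
        by (rule generate_int_pow) (use S in \<open>auto intro: generate.incl\<close>)
      show "x \<in> generate G (insert m S)" using x mono_generate [of S "insert m S"] by blast
    qed
    ultimately show "\<exists>x\<in>generate G (insert m S). s i = s j \<otimes> x [^] p" by blast
  qed
qed

end

section \<open>Nonarchimedean valued fields and their completions\<close>

locale nonarch_field = field F for F :: "('a, 'b) ring_scheme" (structure) +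
  fixes v :: "'a \<Rightarrow> real"
  assumes absolute_value: "absolute_value F v"
    and ultrametric: "\<lbrakk>x \<in> carrier F; y \<in> carrier F\<rbrakk> \<Longrightarrow> v (x \<oplus> y) \<le> max (v x) (v y)"
begin

lemma v_nonneg [simp]: "x \<in> carrier F \<Longrightarrow> 0 \<le> v x"
  and v_eq_0 [simp]: "x \<in> carrier F \<Longrightarrow> v x = 0 \<longleftrightarrow> x = \<zero>"
  and v_mult [simp]: "\<lbrakk>x \<in> carrier F; y \<in> carrier F\<rbrakk> \<Longrightarrow> v (x \<otimes> y) = v x * v y"
  using absolute_value by (auto simp: absolute_value_def)

lemma v_zero [simp]: "v \<zero> = 0" by simp

lemma v_one [simp]: "v \<one> = 1"
proof -
  have "v \<one> * v \<one> = v \<one>" using v_mult [of \<one> \<one>] by simp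
  moreover have "v \<one> \<noteq> 0" by simp
  ultimately show ?thesis by simp
qed

lemma v_minus [simp]: "x \<in> carrier F \<Longrightarrow> v (\<ominus> x) = v x"
proof -
  assume x: "x \<in> carrier F"
  have "v (\<ominus> \<one>) * v (\<ominus> \<one>) = 1" using v_mult [of "\<ominus> \<one>" "\<ominus> \<one>"] by (simp add: l_minus r_minus)
  then have "v (\<ominus> \<one>) = 1"
    using v_nonneg [of "\<ominus> \<one>"] square_eq_1_iff [of "v (\<ominus> \<one>)"] by (smt (verit) a_inv_closed one_closed)
  then have "v (\<ominus> \<one> \<otimes> x) = v x" using x by (simp del: l_minus)
  then show ?thesis using x by (simp add: l_minus)
qed

lemma v_diff: "\<lbrakk>x \<in> carrier F; y \<in> carrier F\<rbrakk> \<Longrightarrow> v (x \<ominus> y) \<le> max (v x) (v y)"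
  using ultrametric [of x "\<ominus> y"] by (simp add: a_minus_def)

lemma minus_self [simp]: "x \<in> carrier F \<Longrightarrow> x \<ominus> x = \<zero>"
  by (simp add: a_minus_def r_neg)

lemma v_diff_commute: "\<lbrakk>x \<in> carrier F; y \<in> carrier F\<rbrakk> \<Longrightarrow> v (x \<ominus> y) = v (y \<ominus> x)"
  using v_minus [of "x \<ominus> y"] by (simp add: a_minus_def minus_add a_comm)

lemma v_diff_trans:
  assumes "x \<in> carrier F" "y \<in> carrier F" "z \<in> carrier F"
  shows "v (x \<ominus> z) \<le> max (v (x \<ominus> y)) (v (y \<ominus> z))"
proof -
  have "x \<ominus> z = (x \<ominus> y) \<oplus> (y \<ominus> z)" using assms by algebra
  then show ?thesis using ultrametric [of "x \<ominus> y" "y \<ominus> z"] assms by simp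
qed

lemma v_abs_diff:
  assumes "x \<in> carrier F" "y \<in> carrier F" shows "\<bar>v x - v y\<bar> \<le> v (x \<ominus> y)"
proof -
  have *: "v a - v b \<le> v (a \<ominus> b)" if "a \<in> carrier F" "b \<in> carrier F" for a b
  proof -
    have "v ((a \<ominus> b) \<oplus> b) \<le> v (a \<ominus> b) + v b"
      using absolute_value that by (simp add: absolute_value_def)
    moreover have "(a \<ominus> b) \<oplus> b = a" using that by algebra
    ultimately show ?thesis by simp
  qed
  show ?thesis using *[OF assms] *[OF assms(2,1)] v_diff_commute [OF assms] by linarith
qed

lemma v_pow [simp]: "x \<in> carrier F \<Longrightarrow> v (x [^] (n::nat)) = v x ^ n"
  by (induction n) (auto simp: mult.commute)

lemma v_near_one: "\<lbrakk>x \<in> carrier F; v (x \<ominus> \<one>) < 1\<rbrakk> \<Longrightarrow> v x = 1"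
proof -
  assume x: "x \<in> carrier F" "v (x \<ominus> \<one>) < 1"
  have e: "x = (x \<ominus> \<one>) \<oplus> \<one>" "\<one> = x \<ominus> (x \<ominus> \<one>)" using x(1) by algebra+
  have "v x \<le> 1" using ultrametric [of "x \<ominus> \<one>" \<one>] x e(1) by auto
  moreover have "1 \<le> max (v x) (v (x \<ominus> \<one>))" using v_diff [of x "x \<ominus> \<one>"] x e(2) by auto
  ultimately show ?thesis using x by linarith
qed

lemma v_mult_diff:
  assumes "x \<in> carrier F" "y \<in> carrier F" "x' \<in> carrier F" "y' \<in> carrier F"
  shows "v (x \<otimes> y \<ominus> x' \<otimes> y') \<le> max (v x * v (y \<ominus> y')) (v (x \<ominus> x') * v y')"
proof -
  have "x \<otimes> y \<ominus> x' \<otimes> y' = x \<otimes> (y \<ominus> y') \<oplus> (x \<ominus> x') \<otimes> y'"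
    using assms by algebra
  then show ?thesis using ultrametric [of "x \<otimes> (y \<ominus> y')" "(x \<ominus> x') \<otimes> y'"] assms by simp
qed

section \<open>The ring of Cauchy sequences and its ideal of null sequences\<close>

definition Cau :: "(nat \<Rightarrow> 'a) set" where "Cau = carrier (cauchy_ring F v)"

lemma Cau_iff: "x \<in> Cau \<longleftrightarrow>
    (\<forall>n. x n \<in> carrier F) \<and> (\<forall>\<epsilon>>0. \<exists>N. \<forall>m\<ge>N. \<forall>n\<ge>N. v (x m \<ominus> x n) < \<epsilon>)"
  by (simp add: Cau_def cauchy_ring_def)

lemma Cau_carrier [simp]: "x \<in> Cau \<Longrightarrow> x n \<in> carrier F"
  by (simp add: Cau_iff)

lemma CauI:
  assumes "\<And>n. x n \<in> carrier F"
    and "\<And>\<epsilon>. \<epsilon> > 0 \<Longrightarrow> \<exists>N. \<forall>n\<ge>N. v (x n \<ominus> x N) < \<epsilon>"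
  shows "x \<in> Cau"
  unfolding Cau_iff
proof (intro conjI allI impI)
  fix \<epsilon> :: real assume "\<epsilon> > 0"
  then obtain N where N: "\<And>n. n \<ge> N \<Longrightarrow> v (x n \<ominus> x N) < \<epsilon>" using assms(2) by blast
  have "v (x m \<ominus> x n) < \<epsilon>" if "m \<ge> N" "n \<ge> N" for m n
    using v_diff_trans [of "x m" "x N" "x n"] N [OF that(1)] N [OF that(2)]
      v_diff_commute [of "x N" "x n"] assms(1) by auto
  then show "\<exists>N. \<forall>m\<ge>N. \<forall>n\<ge>N. v (x m \<ominus> x n) < \<epsilon>" by blast
qed (use assms in auto)

lemma Cau_const [simp]: "a \<in> carrier F \<Longrightarrow> (\<lambda>n. a) \<in> Cau"
  by (rule CauI) (auto simp: minus_self)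

lemma Cau_bounded:
  assumes "x \<in> Cau" shows "\<exists>B>0. \<forall>n. v (x n) \<le> B"
proof -
  obtain N where N: "\<forall>m\<ge>N. \<forall>n\<ge>N. v (x m \<ominus> x n) < 1"
    using assms unfolding Cau_iff by (meson zero_less_one)
  define B where "B = Max ((\<lambda>n. v (x n)) ` {..N}) + 1"
  have B: "v (x n) \<le> B - 1" if "n \<le> N" for n
    unfolding B_def using that by auto
  have "v (x n) \<le> B" for n
  proof (cases "n \<le> N")
    case False
    then have "v (x n \<ominus> x N) < 1" using N by simp
    then show ?thesis using v_abs_diff [of "x n" "x N"] B [of N] assms by auto
  qed (use B in fastforce)
  moreover have "B > 0" using B [of 0] v_nonneg [of "x 0"] assms by (smt (verit) Cau_carrier le0)
  ultimately show ?thesis by blast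
qed

lemma Cau_add: assumes "x \<in> Cau" "y \<in> Cau" shows "(\<lambda>n. x n \<oplus> y n) \<in> Cau"
proof (rule CauI)
  fix \<epsilon> :: real assume e: "\<epsilon> > 0"
  obtain N where N: "\<forall>m\<ge>N. \<forall>n\<ge>N. v (x m \<ominus> x n) < \<epsilon>" using assms e unfolding Cau_iff by meson
  obtain M where M: "\<forall>m\<ge>M. \<forall>n\<ge>M. v (y m \<ominus> y n) < \<epsilon>" using assms e unfolding Cau_iff by meson
  have "v ((x n \<oplus> y n) \<ominus> (x (max M N) \<oplus> y (max M N))) < \<epsilon>" if "n \<ge> max M N" for n
  proof -
    have "(x n \<oplus> y n) \<ominus> (x (max M N) \<oplus> y (max M N)) = (x n \<ominus> x (max M N)) \<oplus> (y n \<ominus> y (max M N))"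
      using assms Cau_carrier by algebra
    moreover have "v (x n \<ominus> x (max M N)) < \<epsilon>" "v (y n \<ominus> y (max M N)) < \<epsilon>" using N M that by auto
    ultimately show ?thesis
      using ultrametric [of "x n \<ominus> x (max M N)" "y n \<ominus> y (max M N)"] assms by simp
  qed
  then show "\<exists>N. \<forall>n\<ge>N. v ((x n \<oplus> y n) \<ominus> (x N \<oplus> y N)) < \<epsilon>" by blast
qed (use assms in auto)

lemma Cau_minus: assumes "x \<in> Cau" shows "(\<lambda>n. \<ominus> x n) \<in> Cau"
proof -
  have "\<ominus> x m \<ominus> \<ominus> x n = \<ominus> (x m \<ominus> x n)" for m n using assms Cau_carrier by algebra
  then have "v (\<ominus> x m \<ominus> \<ominus> x n) = v (x m \<ominus> x n)" for m n using assms by simp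
  then show ?thesis using assms by (simp add: Cau_iff)
qed

lemma Cau_diff: assumes "x \<in> Cau" "y \<in> Cau" shows "(\<lambda>n. x n \<ominus> y n) \<in> Cau"
  using Cau_add [OF assms(1) Cau_minus [OF assms(2)]] by (simp add: a_minus_def)

lemma Cau_mult: assumes "x \<in> Cau" "y \<in> Cau" shows "(\<lambda>n. x n \<otimes> y n) \<in> Cau"
proof (rule CauI)
  obtain B C where B: "B > 0" "\<And>n. v (x n) \<le> B" and C: "C > 0" "\<And>n. v (y n) \<le> C"
    using Cau_bounded assms by meson
  fix \<epsilon> :: real assume e: "\<epsilon> > 0"
  have e': "\<epsilon> / B > 0" "\<epsilon> / C > 0" using e B C by auto
  obtain N where N: "\<forall>m\<ge>N. \<forall>n\<ge>N. v (x m \<ominus> x n) < \<epsilon> / C" using assms e' unfolding Cau_iff by meson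
  obtain M where M: "\<forall>m\<ge>M. \<forall>n\<ge>M. v (y m \<ominus> y n) < \<epsilon> / B" using assms e' unfolding Cau_iff by meson
  let ?K = "max M N"
  have "v (x n \<otimes> y n \<ominus> x ?K \<otimes> y ?K) < \<epsilon>" if "n \<ge> ?K" for n
  proof -
    have xy: "v (x n \<ominus> x ?K) < \<epsilon> / C" "v (y n \<ominus> y ?K) < \<epsilon> / B" using N M that by auto
    have "v (x n) * v (y n \<ominus> y ?K) \<le> B * v (y n \<ominus> y ?K)"
      using B assms by (intro mult_right_mono) auto
    also have "\<dots> < B * (\<epsilon> / B)" using B xy by (intro mult_strict_left_mono) auto
    finally have "v (x n) * v (y n \<ominus> y ?K) < \<epsilon>" using B by simp
    moreover have "v (x n \<ominus> x ?K) * v (y ?K) \<le> v (x n \<ominus> x ?K) * C"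
      using C assms by (intro mult_left_mono) auto
    then have "v (x n \<ominus> x ?K) * v (y ?K) < \<epsilon>"
      using mult_strict_right_mono [OF xy(1) C(1)] C by simp
    ultimately show ?thesis
      using v_mult_diff [OF Cau_carrier [OF assms(1)] Cau_carrier [OF assms(2)]
        Cau_carrier [OF assms(1)] Cau_carrier [OF assms(2)], of n n ?K ?K] by linarith
  qed
  then show "\<exists>N. \<forall>n\<ge>N. v (x n \<otimes> y n \<ominus> x N \<otimes> y N) < \<epsilon>" by blast
qed (use assms in auto)

lemma cauchy_ring_simps [simp]:
  "carrier (cauchy_ring F v) = Cau"
  "x \<otimes>\<^bsub>cauchy_ring F v\<^esub> y = (\<lambda>n. x n \<otimes> y n)"
  "x \<oplus>\<^bsub>cauchy_ring F v\<^esub> y = (\<lambda>n. x n \<oplus> y n)"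
  "\<one>\<^bsub>cauchy_ring F v\<^esub> = (\<lambda>n. \<one>)"
  "\<zero>\<^bsub>cauchy_ring F v\<^esub> = (\<lambda>n. \<zero>)"
  unfolding Cau_def by (simp_all add: cauchy_ring_def)

lemma cauchy_ring_cring: "cring (cauchy_ring F v)"
proof (rule cringI)
  show "abelian_group (cauchy_ring F v)"
  proof (rule abelian_groupI, unfold cauchy_ring_simps)
    fix x assume "x \<in> Cau"
    then show "\<exists>y\<in>Cau. (\<lambda>n. y n \<oplus> x n) = (\<lambda>n. \<zero>)"
      by (intro bexI[of _ "\<lambda>n. \<ominus> x n"]) (simp_all add: Cau_minus l_neg)
  qed (simp_all add: Cau_add a_ac)
  show "comm_monoid (cauchy_ring F v)"
    by (rule comm_monoidI, unfold cauchy_ring_simps) (simp_all add: Cau_mult m_ac)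
qed (unfold cauchy_ring_simps, simp add: l_distr)

sublocale CR: cring "cauchy_ring F v" by (rule cauchy_ring_cring)

lemma CR_a_inv: "x \<in> Cau \<Longrightarrow> \<ominus>\<^bsub>cauchy_ring F v\<^esub> x = (\<lambda>n. \<ominus> x n)"
  by (rule CR.minus_equality) (auto simp: Cau_minus l_neg)

lemma CR_minus: "\<lbrakk>x \<in> Cau; y \<in> Cau\<rbrakk> \<Longrightarrow> x \<ominus>\<^bsub>cauchy_ring F v\<^esub> y = (\<lambda>n. x n \<ominus> y n)"
  by (simp add: a_minus_def CR_a_inv)

lemma null_sequences_iff: "x \<in> null_sequences F v \<longleftrightarrow> x \<in> Cau \<and> (\<lambda>n. v (x n)) \<longlonglongrightarrow> 0"
  by (simp add: null_sequences_def)

lemma tendsto_0_v_le: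
  assumes "(\<lambda>n. f n) \<longlonglongrightarrow> (0::real)" "\<And>n. v (x n) \<le> f n" "\<And>n. x n \<in> carrier F"
  shows "(\<lambda>n. v (x n)) \<longlonglongrightarrow> 0"
  by (rule tendsto_sandwich [of "\<lambda>_. 0" _ _ f]) (use assms in auto)

lemma tendsto_max_0: "\<lbrakk>f \<longlonglongrightarrow> (0::real); g \<longlonglongrightarrow> 0\<rbrakk> \<Longrightarrow> (\<lambda>n. max (f n) (g n)) \<longlonglongrightarrow> 0"
  using tendsto_max [of f 0 sequentially g 0] by simp

lemma null_ideal: "ideal (null_sequences F v) (cauchy_ring F v)"
proof (rule idealI)
  have mult: "(\<lambda>n. x n \<otimes> a n) \<in> null_sequences F v" if a: "a \<in> null_sequences F v" and x: "x \<in> Cau" for a x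
  proof -
    obtain B where B: "B > 0" "\<And>n. v (x n) \<le> B" using Cau_bounded x by meson
    have a': "a \<in> Cau" "(\<lambda>n. v (a n)) \<longlonglongrightarrow> 0" using a by (auto simp: null_sequences_iff)
    have "(\<lambda>n. v (x n \<otimes> a n)) \<longlonglongrightarrow> 0"
    proof (rule tendsto_0_v_le)
      show "(\<lambda>n. B * v (a n)) \<longlonglongrightarrow> 0" using tendsto_mult_left [OF a'(2), of B] by simp
      show "v (x n \<otimes> a n) \<le> B * v (a n)" for n
        using B a' x by (simp add: mult_right_mono)
    qed (use a' x in auto)
    then show ?thesis using a' x by (simp add: null_sequences_iff Cau_mult)
  qed
  show "a \<in> null_sequences F v \<Longrightarrow> x \<in> carrier (cauchy_ring F v) \<Longrightarrow> x \<otimes>\<^bsub>cauchy_ring F v\<^esub> a \<in> null_sequences F v" for a x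
    using mult by simp
  show "a \<in> null_sequences F v \<Longrightarrow> x \<in> carrier (cauchy_ring F v) \<Longrightarrow> a \<otimes>\<^bsub>cauchy_ring F v\<^esub> x \<in> null_sequences F v" for a x
    using mult [of a x] CR.m_comm [of a x] by (auto simp: null_sequences_iff)
  have inv: "inv\<^bsub>add_monoid (cauchy_ring F v)\<^esub> x = (\<lambda>n. \<ominus> x n)" if "x \<in> Cau" for x
    using CR_a_inv [OF that] by (simp add: a_inv_def)
  show "subgroup (null_sequences F v) (add_monoid (cauchy_ring F v))"
  proof (rule group.subgroupI [OF CR.a_group])
    show "null_sequences F v \<subseteq> carrier (add_monoid (cauchy_ring F v))" by (auto simp: null_sequences_iff)
    have "(\<lambda>n. \<zero>) \<in> null_sequences F v" by (auto simp: null_sequences_iff)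
    then show "null_sequences F v \<noteq> {}" by blast
    show "inv\<^bsub>add_monoid (cauchy_ring F v)\<^esub> a \<in> null_sequences F v" if "a \<in> null_sequences F v" for a
    proof -
      have a: "a \<in> Cau" using that by (simp add: null_sequences_iff)
      show ?thesis unfolding inv [OF a] using that a by (simp add: null_sequences_iff Cau_minus)
    qed
    fix a b assume ab: "a \<in> null_sequences F v" "b \<in> null_sequences F v"
    have "(\<lambda>n. v (a n \<oplus> b n)) \<longlonglongrightarrow> 0"
      by (rule tendsto_0_v_le [of "\<lambda>n. max (v (a n)) (v (b n))"])
         (use ab tendsto_max_0 ultrametric in \<open>auto simp: null_sequences_iff\<close>)
    then show "a \<otimes>\<^bsub>add_monoid (cauchy_ring F v)\<^esub> b \<in> null_sequences F v"
      using ab by (auto simp: null_sequences_iff Cau_add)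
  qed
qed (rule CR.ring_axioms)

sublocale NI: ideal "null_sequences F v" "cauchy_ring F v" by (rule null_ideal)

section \<open>Points of the completion and their absolute values\<close>

definition cls :: "(nat \<Rightarrow> 'a) \<Rightarrow> (nat \<Rightarrow> 'a) set" where
  "cls x = null_sequences F v +>\<^bsub>cauchy_ring F v\<^esub> x"

abbreviation CF where "CF \<equiv> completion F v"

sublocale CF: cring CF
  unfolding completion_def by (rule NI.quotient_is_cring [OF cauchy_ring_cring])

lemma cls_hom: "cls \<in> ring_hom (cauchy_ring F v) CF"
  unfolding completion_def cls_def using NI.rcos_ring_hom by blast

lemma cls_closed [simp]: "x \<in> Cau \<Longrightarrow> cls x \<in> carrier CF"
  using ring_hom_closed [OF cls_hom] by simp

lemma carrier_CF: "carrier CF = cls ` Cau"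
  by (auto simp: completion_def FactRing_def A_RCOSETS_def' cls_def)

lemma CF_cases: "\<xi> \<in> carrier CF \<Longrightarrow> (\<And>x. x \<in> Cau \<Longrightarrow> \<xi> = cls x \<Longrightarrow> P) \<Longrightarrow> P"
  by (auto simp: carrier_CF)

lemma CF_ex: "\<xi> \<in> carrier CF \<Longrightarrow> \<exists>x. x \<in> Cau \<and> \<xi> = cls x"
  by (auto simp: carrier_CF)

lemma cls_mult: "\<lbrakk>x \<in> Cau; y \<in> Cau\<rbrakk> \<Longrightarrow> cls x \<otimes>\<^bsub>CF\<^esub> cls y = cls (\<lambda>n. x n \<otimes> y n)"
  using ring_hom_mult [OF cls_hom, of x y] by simp

lemma cls_add: "\<lbrakk>x \<in> Cau; y \<in> Cau\<rbrakk> \<Longrightarrow> cls x \<oplus>\<^bsub>CF\<^esub> cls y = cls (\<lambda>n. x n \<oplus> y n)"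
  using ring_hom_add [OF cls_hom, of x y] by simp

lemma cls_one: "\<one>\<^bsub>CF\<^esub> = cls (\<lambda>n. \<one>)"
  using ring_hom_one [OF cls_hom] by simp

lemma cls_zero: "\<zero>\<^bsub>CF\<^esub> = cls (\<lambda>n. \<zero>)"
  using ring_hom_zero [OF cls_hom CR.ring_axioms CF.ring_axioms] by simp

lemma cls_a_inv: "x \<in> Cau \<Longrightarrow> \<ominus>\<^bsub>CF\<^esub> cls x = cls (\<lambda>n. \<ominus> x n)"
  by (rule CF.minus_equality) (auto simp: cls_add cls_zero Cau_minus l_neg)

lemma cls_minus: "\<lbrakk>x \<in> Cau; y \<in> Cau\<rbrakk> \<Longrightarrow> cls x \<ominus>\<^bsub>CF\<^esub> cls y = cls (\<lambda>n. x n \<ominus> y n)"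
  by (simp add: a_minus_def cls_a_inv cls_add Cau_minus)

lemma cls_eq_iff:
  "\<lbrakk>x \<in> Cau; y \<in> Cau\<rbrakk> \<Longrightarrow> cls x = cls y \<longleftrightarrow> (\<lambda>n. v (x n \<ominus> y n)) \<longlonglongrightarrow> 0"
  using CR.quotient_eq_iff_same_a_r_cos [OF null_ideal, of x y]
  by (simp add: cls_def CR_minus null_sequences_iff Cau_diff)

lemma cls_nat_pow: "x \<in> Cau \<Longrightarrow> cls x [^]\<^bsub>CF\<^esub> (m::nat) = cls (\<lambda>n. x n [^] m) \<and> (\<lambda>n. x n [^] m) \<in> Cau"
  by (induction m) (auto simp: cls_one cls_mult Cau_mult)

lemma convergent_v: assumes "x \<in> Cau" shows "convergent (\<lambda>n. v (x n))"
proof -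
  have "Cauchy (\<lambda>n. v (x n))"
    unfolding Cauchy_def dist_real_def
  proof (intro allI impI)
    fix e :: real assume "e > 0"
    then obtain N where "\<forall>m\<ge>N. \<forall>n\<ge>N. v (x m \<ominus> x n) < e" using assms unfolding Cau_iff by meson
    then show "\<exists>M. \<forall>m\<ge>M. \<forall>n\<ge>M. \<bar>v (x m) - v (x n)\<bar> < e"
      using le_less_trans [OF v_abs_diff [OF Cau_carrier [OF assms] Cau_carrier [OF assms]]] by blast
  qed
  then show ?thesis by (rule Cauchy_convergent)
qed

lemma completion_abs_cls: assumes "x \<in> Cau" shows "completion_abs F v (cls x) = lim (\<lambda>n. v (x n))"
proof -
  have eq: "lim (\<lambda>n. v (y n)) = lim (\<lambda>n. v (x n))" if "y \<in> cls x" for y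
  proof -
    obtain h where h: "h \<in> null_sequences F v" "y = (\<lambda>n. h n \<oplus> x n)"
      using \<open>y \<in> cls x\<close> unfolding cls_def a_r_coset_def' by auto
    have hc: "h n \<in> carrier F" for n using h by (auto simp: null_sequences_iff)
    have "(\<lambda>n. v (y n) - v (x n)) \<longlonglongrightarrow> 0"
    proof (rule tendsto_rabs_zero_cancel, rule tendsto_sandwich)
      show "(\<lambda>_. 0) \<longlonglongrightarrow> (0::real)" "(\<lambda>n. v (h n)) \<longlonglongrightarrow> 0" using h by (auto simp: null_sequences_iff)
      have "h n \<oplus> x n \<ominus> x n = h n" for n using hc Cau_carrier [OF assms] by algebra
      then show "\<forall>\<^sub>F n in sequentially. \<bar>v (y n) - v (x n)\<bar> \<le> v (h n)"
        using v_abs_diff [OF a_closed [OF hc Cau_carrier [OF assms]] Cau_carrier [OF assms]] h(2)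
        by (intro always_eventually) (simp, metis)
    qed auto
    moreover have "(\<lambda>n. v (x n)) \<longlonglongrightarrow> lim (\<lambda>n. v (x n))"
      using convergent_v [OF assms] by (simp add: convergent_LIMSEQ_iff)
    ultimately have "(\<lambda>n. (v (y n) - v (x n)) + v (x n)) \<longlonglongrightarrow> 0 + lim (\<lambda>n. v (x n))"
      by (rule tendsto_add)
    then show ?thesis by (simp add: limI)
  qed
  have "x \<in> cls x" unfolding cls_def using NI.a_rcos_self assms by simp
  have "(\<lambda>y. lim (\<lambda>n. v (y n))) ` cls x = (\<lambda>_. lim (\<lambda>n. v (x n))) ` cls x"
  proof (rule image_cong [OF refl])
    fix y assume "y \<in> cls x" then show "lim (\<lambda>n. v (y n)) = lim (\<lambda>n. v (x n))" by (rule eq)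
  qed
  also have "\<dots> = {lim (\<lambda>n. v (x n))}" using \<open>x \<in> cls x\<close> by (rule image_constant)
  finally show ?thesis by (simp only: completion_abs_def the_elem_eq)
qed

lemma lim_v_tendsto: "x \<in> Cau \<Longrightarrow> (\<lambda>n. v (x n)) \<longlonglongrightarrow> completion_abs F v (cls x)"
  using convergent_v by (simp add: convergent_LIMSEQ_iff completion_abs_cls)

lemma completion_abs_le:
  assumes "x \<in> Cau" "\<And>n. n \<ge> N \<Longrightarrow> v (x n) \<le> B" shows "completion_abs F v (cls x) \<le> B"
  using LIMSEQ_le_const2 [OF lim_v_tendsto [OF assms(1)]] assms(2) by blast

lemma completion_abs_nonneg: "\<xi> \<in> carrier CF \<Longrightarrow> 0 \<le> completion_abs F v \<xi>"
  by (erule CF_cases) (auto intro!: LIMSEQ_le_const [OF lim_v_tendsto])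

lemma completion_abs_less_ev:
  assumes "x \<in> Cau" "completion_abs F v (cls x) < B" shows "\<exists>N. \<forall>n\<ge>N. v (x n) < B"
  using order_tendstoD(2) [OF lim_v_tendsto [OF assms(1)] assms(2)] by (simp add: eventually_sequentially)

section \<open>Convergence in the completion\<close>

lemma completion_embed_eq: "completion_embed F v a = cls (\<lambda>n. a)"
  by (simp add: completion_embed_def cls_def)

lemma completion_tendsto_cls:
  assumes "\<And>n. Xs n \<in> Cau" "x \<in> Cau"
  shows "completion_tendsto F v (\<lambda>n. cls (Xs n)) (cls x) \<longleftrightarrow>
    (\<lambda>n. completion_abs F v (cls (\<lambda>m. Xs n m \<ominus> x m))) \<longlonglongrightarrow> 0"
  using assms by (simp add: completion_tendsto_def cls_minus)

text \<open>Uniqueness of limits is what makes the description by \<open>THE\<close> in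
  \<open>padic_pow\<close> meaningful.\<close>

lemma completion_tendsto_unique:
  assumes "\<And>n. S n \<in> carrier CF" "\<xi> \<in> carrier CF" "\<eta> \<in> carrier CF"
    and "completion_tendsto F v S \<xi>" "completion_tendsto F v S \<eta>"
  shows "\<xi> = \<eta>"
proof -
  obtain x y where xy: "x \<in> Cau" "y \<in> Cau" "\<xi> = cls x" "\<eta> = cls y" using assms(2,3) CF_ex by meson
  have "\<forall>n. \<exists>x. x \<in> Cau \<and> S n = cls x" using assms(1) CF_ex by blast
  from choice [OF this] obtain Xs where Xs: "\<And>n. Xs n \<in> Cau" "\<And>n. S n = cls (Xs n)" by blast
  have S: "S = (\<lambda>n. cls (Xs n))" using Xs by auto
  have 1: "(\<lambda>n. completion_abs F v (cls (\<lambda>m. Xs n m \<ominus> x m))) \<longlonglongrightarrow> 0"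
     and 2: "(\<lambda>n. completion_abs F v (cls (\<lambda>m. Xs n m \<ominus> y m))) \<longlonglongrightarrow> 0"
    using assms(4,5) xy Xs completion_tendsto_cls unfolding S by auto
  have "completion_abs F v (cls (\<lambda>m. x m \<ominus> y m)) \<le> 0 + 0"
  proof (rule LIMSEQ_le_const [OF tendsto_add [OF 1 2]], intro exI allI impI)
    fix n :: nat
    show "completion_abs F v (cls (\<lambda>m. x m \<ominus> y m))
      \<le> completion_abs F v (cls (\<lambda>m. Xs n m \<ominus> x m)) + completion_abs F v (cls (\<lambda>m. Xs n m \<ominus> y m))"
    proof (rule LIMSEQ_le)
      show "(\<lambda>m. v (x m \<ominus> y m)) \<longlonglongrightarrow> completion_abs F v (cls (\<lambda>m. x m \<ominus> y m))"
        using xy by (intro lim_v_tendsto Cau_diff) auto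
      show "(\<lambda>m. v (Xs n m \<ominus> x m) + v (Xs n m \<ominus> y m)) \<longlonglongrightarrow>
        completion_abs F v (cls (\<lambda>m. Xs n m \<ominus> x m)) + completion_abs F v (cls (\<lambda>m. Xs n m \<ominus> y m))"
        using xy Xs by (intro tendsto_add lim_v_tendsto Cau_diff) auto
      have "v (x m \<ominus> y m) \<le> v (Xs n m \<ominus> x m) + v (Xs n m \<ominus> y m)" for m
      proof -
        have "v (x m \<ominus> y m) \<le> max (v (x m \<ominus> Xs n m)) (v (Xs n m \<ominus> y m))"
          using xy Xs by (intro v_diff_trans) auto
        also have "\<dots> \<le> v (Xs n m \<ominus> x m) + v (Xs n m \<ominus> y m)"
          using xy Xs v_diff_commute [of "x m" "Xs n m"] by auto
        finally show ?thesis .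
      qed
      then show "\<exists>N. \<forall>m\<ge>N. v (x m \<ominus> y m) \<le> v (Xs n m \<ominus> x m) + v (Xs n m \<ominus> y m)" by blast
    qed
  qed
  then have "completion_abs F v (cls (\<lambda>m. x m \<ominus> y m)) = 0"
    using completion_abs_nonneg [of "cls (\<lambda>m. x m \<ominus> y m)"] xy Cau_diff by simp
  then have "(\<lambda>n. v (x n \<ominus> y n)) \<longlonglongrightarrow> 0"
    using lim_v_tendsto [of "\<lambda>m. x m \<ominus> y m"] xy Cau_diff by simp
  then show ?thesis using xy cls_eq_iff by simp
qed

text \<open>A sequence from the field, embedded term by term, can only converge to the class that it
  represents. Hence the limits over integers in \<open>padic_pow\<close> become statements about
  integer sequences alone.\<close>

lemma completion_tendsto_embed_iff:
  assumes "\<And>n. a n \<in> carrier F" "\<xi> \<in> carrier CF"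
  shows "completion_tendsto F v (\<lambda>n. completion_embed F v (a n)) \<xi> \<longleftrightarrow> a \<in> Cau \<and> cls a = \<xi>"
proof -
  obtain x where x: "x \<in> Cau" "\<xi> = cls x" by (rule CF_cases [OF assms(2)])
  have T: "completion_tendsto F v (\<lambda>n. completion_embed F v (a n)) \<xi> \<longleftrightarrow>
      (\<lambda>n. completion_abs F v (cls (\<lambda>m. a n \<ominus> x m))) \<longlonglongrightarrow> 0"
    unfolding completion_embed_eq x(2)
    by (rule completion_tendsto_cls) (use x assms in auto)
  have C: "(\<lambda>m. a n \<ominus> x m) \<in> Cau" for n using Cau_diff [OF Cau_const x(1)] assms by auto
  show ?thesis
  proof
    assume "completion_tendsto F v (\<lambda>n. completion_embed F v (a n)) \<xi>"
    then have L: "(\<lambda>n. completion_abs F v (cls (\<lambda>m. a n \<ominus> x m))) \<longlonglongrightarrow> 0" using T by blast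
    have ev: "\<exists>N. \<forall>n\<ge>N. \<exists>M. \<forall>m\<ge>M. v (a n \<ominus> x m) < \<epsilon>" if "\<epsilon> > 0" for \<epsilon>
      using order_tendstoD(2) [OF L that] completion_abs_less_ev [OF C]
      unfolding eventually_sequentially by blast
    have "a \<in> Cau"
    proof (rule CauI)
      fix \<epsilon> :: real assume "\<epsilon> > 0"
      then obtain N where N: "\<forall>n\<ge>N. \<exists>M. \<forall>m\<ge>M. v (a n \<ominus> x m) < \<epsilon>" using ev by blast
      have "v (a n \<ominus> a N) < \<epsilon>" if n: "n \<ge> N" for n
      proof -
        obtain M M' where M: "\<forall>m\<ge>M. v (a n \<ominus> x m) < \<epsilon>" "\<forall>m\<ge>M'. v (a N \<ominus> x m) < \<epsilon>" using N n by blast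
        have "v (a n \<ominus> x (max M M')) < \<epsilon>" "v (a N \<ominus> x (max M M')) < \<epsilon>" using M by auto
        then show ?thesis
          using v_diff_trans [of "a n" "x (max M M')" "a N"] v_diff_commute [of "a N" "x (max M M')"] assms x
          by auto
      qed
      then show "\<exists>N. \<forall>n\<ge>N. v (a n \<ominus> a N) < \<epsilon>" by blast
    qed (use assms in auto)
    moreover have "(\<lambda>n. v (a n \<ominus> x n)) \<longlonglongrightarrow> 0"
    proof (rule LIMSEQ_I)
      fix \<epsilon> :: real assume e: "\<epsilon> > 0"
      obtain N where N: "\<forall>n\<ge>N. \<exists>M. \<forall>m\<ge>M. v (a n \<ominus> x m) < \<epsilon>" using ev e by blast
      obtain N' where N': "\<forall>m\<ge>N'. \<forall>n\<ge>N'. v (x m \<ominus> x n) < \<epsilon>" using x e unfolding Cau_iff by meson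
      have "v (a n \<ominus> x n) < \<epsilon>" if n: "n \<ge> max N N'" for n
      proof -
        obtain M where M: "\<forall>m\<ge>M. v (a n \<ominus> x m) < \<epsilon>" using N n by auto
        have "v (a n \<ominus> x (max M N')) < \<epsilon>" "v (x (max M N') \<ominus> x n) < \<epsilon>" using M N' n by auto
        then show ?thesis
          using v_diff_trans [of "a n" "x (max M N')" "x n"] assms x by auto
      qed
      then show "\<exists>no. \<forall>n\<ge>no. norm (v (a n \<ominus> x n) - 0) < \<epsilon>" using assms x by (intro exI[of _ "max N N'"]) auto
    qed
    ultimately show "a \<in> Cau \<and> cls a = \<xi>" using x cls_eq_iff by auto
  next
    assume a: "a \<in> Cau \<and> cls a = \<xi>"
    have "(\<lambda>n. completion_abs F v (cls (\<lambda>m. a n \<ominus> a m))) \<longlonglongrightarrow> 0"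
    proof (rule LIMSEQ_I)
      fix \<epsilon> :: real assume e: "\<epsilon> > 0"
      then have "\<epsilon>/2 > 0" by simp
      then obtain N where N: "\<forall>m\<ge>N. \<forall>n\<ge>N. v (a m \<ominus> a n) < \<epsilon>/2" using a unfolding Cau_iff by meson
      have C': "(\<lambda>m. a n \<ominus> a m) \<in> Cau" for n using Cau_diff [OF Cau_const] a assms by auto
      have "completion_abs F v (cls (\<lambda>m. a n \<ominus> a m)) \<le> \<epsilon>/2" if "n \<ge> N" for n
        by (rule completion_abs_le [OF C', of N]) (use N that in force)
      then show "\<exists>no. \<forall>n\<ge>no. norm (completion_abs F v (cls (\<lambda>m. a n \<ominus> a m)) - 0) < \<epsilon>"
        using e completion_abs_nonneg [OF cls_closed [OF C']] by (intro exI[of _ N]) fastforce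
    qed
    then show "completion_tendsto F v (\<lambda>n. completion_embed F v (a n)) \<xi>"
      using a assms completion_tendsto_cls [of "\<lambda>n m. a n" a] unfolding completion_embed_eq by auto
  qed
qed

end

section \<open>The \<open>p\<close>-adic absolute value\<close>

lemma padic_abs_0 [simp]: "padic_abs p 0 = 0" by (simp add: padic_abs_def)

text \<open>\<open>padic_abs\<close> is defined by the reduced fraction; cross-multiplication shows
  that every other fraction has the same difference of multiplicities.\<close>

lemma padic_abs_divide:
  assumes p: "prime p" and ab: "a \<noteq> 0" "b \<noteq> 0"
  shows "padic_abs p (of_int a / of_int b) =
    real p powi (int (multiplicity (int p) b) - int (multiplicity (int p) a))"
proof -
  have pe: "prime_elem (int p)" using p by simp
  define x :: rat where "x = of_int a / of_int b"
  obtain c d where cd: "quotient_of x = (c, d)" by fastforce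
  have d: "d > 0" using quotient_of_denom_pos [OF cd] .
  have x: "x = of_int c / of_int d" using quotient_of_div [OF cd] .
  have x0: "x \<noteq> 0" using ab by (simp add: x_def)
  then have c: "c \<noteq> 0" using x by auto
  have "of_int a * of_int d = (of_int c * of_int b :: rat)"
    using x ab d unfolding x_def by (simp add: field_simps)
  then have "a * d = c * b" by (metis of_int_eq_iff of_int_mult)
  then have "multiplicity (int p) a + multiplicity (int p) d = multiplicity (int p) c + multiplicity (int p) b"
    using ab c d pe by (metis less_irrefl prime_elem_multiplicity_mult_distrib)
  then have "int (multiplicity (int p) d) - int (multiplicity (int p) c) =
      int (multiplicity (int p) b) - int (multiplicity (int p) a)" by linarith
  then show ?thesis using x0 cd unfolding padic_abs_def x_def [symmetric] by simp
qed

lemma padic_abs_of_int: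
  "prime p \<Longrightarrow> k \<noteq> 0 \<Longrightarrow> padic_abs p (of_int k) = 1 / real p ^ multiplicity (int p) k"
  using padic_abs_divide [of p k 1] by (simp add: power_int_minus field_simps)

lemma padic_abs_divide': 
  assumes "prime p" "b \<noteq> 0"
  shows "padic_abs p (of_int a / of_int b) = padic_abs p (of_int a) / padic_abs p (of_int b)"
proof (cases "a = 0")
  case False
  have "real p \<noteq> 0" using assms by (auto simp: prime_gt_0_nat)
  then show ?thesis
    using assms False padic_abs_divide [of p a b] by (simp add: padic_abs_of_int power_int_diff)
qed simp

lemma rat_fractions:
  fixes x y :: rat obtains a b c where "c \<noteq> 0" "x = of_int a / of_int c" "y = of_int b / of_int c"
proof -
  obtain a c where 1: "quotient_of x = (a, c)" by fastforce
  obtain b d where 2: "quotient_of y = (b, d)" by fastforce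
  have "c > 0" "d > 0" using quotient_of_denom_pos 1 2 by auto
  then show thesis
    using that [of "c * d" "a * d" "b * c"] quotient_of_div [OF 1] quotient_of_div [OF 2] by auto
qed

lemma padic_abs_int_eq_0 [simp]: "prime p \<Longrightarrow> padic_abs p (of_int k) = 0 \<longleftrightarrow> k = 0"
  using prime_gt_0_nat by (cases "k = 0") (auto simp: padic_abs_of_int)

lemma padic_abs_int_pos: "prime p \<Longrightarrow> k \<noteq> 0 \<Longrightarrow> padic_abs p (of_int k) > 0"
  using prime_gt_0_nat by (auto simp: padic_abs_of_int)

lemma padic_abs_eq_0 [simp]: "prime p \<Longrightarrow> padic_abs p x = 0 \<longleftrightarrow> x = 0"
  by (rule rat_fractions [of x 0]) (auto simp: padic_abs_divide')

lemma padic_abs_int_mult: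
  assumes "prime p"
  shows "padic_abs p (of_int (a * b)) = padic_abs p (of_int a) * padic_abs p (of_int b)"
proof (cases "a = 0 \<or> b = 0")
  case False
  have "prime_elem (int p)" using assms by simp
  then show ?thesis using False assms prime_elem_multiplicity_mult_distrib [of "int p" a b]
    padic_abs_of_int [of p a] padic_abs_of_int [of p b] padic_abs_of_int [of p "a * b"]
    by (simp add: power_add del: of_int_mult)
qed auto

lemma padic_abs_int_le_iff:
  assumes "prime p"
  shows "padic_abs p (of_int k) \<le> 1 / real p ^ r \<longleftrightarrow> int p ^ r dvd k"
proof (cases "k = 0")
  case False
  have p1: "real p > 1" using assms prime_gt_1_nat by simp
  have "padic_abs p (of_int k) \<le> 1 / real p ^ r \<longleftrightarrow> real p ^ r \<le> real p ^ multiplicity (int p) k"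
    using False assms p1 by (simp add: padic_abs_of_int frac_le_eq field_simps)
  also have "\<dots> \<longleftrightarrow> r \<le> multiplicity (int p) k" using p1 by simp
  also have "\<dots> \<longleftrightarrow> int p ^ r dvd k"
    using False assms by (intro power_dvd_iff_le_multiplicity [symmetric]) auto
  finally show ?thesis .
qed (use assms in simp)

lemma padic_abs_int_le_1: "prime p \<Longrightarrow> padic_abs p (of_int k) \<le> 1"
  using padic_abs_int_le_iff [of p k 0] by simp

lemma padic_abs_int_coprime: "prime p \<Longrightarrow> coprime k (int p) \<Longrightarrow> padic_abs p (of_int k) = 1"
proof -
  assume *: "prime p" "coprime k (int p)"
  have "\<not> int p dvd k" using * coprime_common_divisor [of k "int p" "int p"] prime_gt_1_nat [of p] by auto
  moreover have "k \<noteq> 0" using calculation by auto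
  ultimately show ?thesis using * by (simp add: padic_abs_of_int not_dvd_imp_multiplicity_0)
qed

lemma padic_abs_int_add:
  assumes "prime p"
  shows "padic_abs p (of_int (a + b)) \<le> max (padic_abs p (of_int a)) (padic_abs p (of_int b))"
proof (cases "a = 0 \<or> b = 0")
  case False
  have *: "padic_abs p (of_int (a + b)) \<le> padic_abs p (of_int c)"
    if "c \<noteq> 0" "int p ^ multiplicity (int p) c dvd a" "int p ^ multiplicity (int p) c dvd b" for c
    using that assms padic_abs_int_le_iff [OF assms, of "a + b" "multiplicity (int p) c"]
    by (simp add: padic_abs_of_int)
  show ?thesis
  proof (cases "multiplicity (int p) a \<le> multiplicity (int p) b")
    case True
    then show ?thesis using * [of a] False multiplicity_dvd' multiplicity_dvd by fastforce
  next
    case False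
    then show ?thesis using * [of b] \<open>\<not> (a = 0 \<or> b = 0)\<close> multiplicity_dvd' [of "multiplicity (int p) b" "int p" a] multiplicity_dvd
      by fastforce
  qed
qed auto

lemma padic_abs_mult: assumes "prime p" shows "padic_abs p (x * y) = padic_abs p x * padic_abs p y"
proof -
  obtain a b c where c: "c \<noteq> 0" "x = of_int a / of_int c" "y = of_int b / of_int c"
    by (rule rat_fractions)
  have "x * y = of_int (a * b) / of_int (c * c)" using c by simp
  then have "padic_abs p (x * y) = padic_abs p (of_int (a * b)) / padic_abs p (of_int (c * c))"
    using assms c padic_abs_divide' [of p "c * c" "a * b"] by simp
  then show ?thesis
    using assms c padic_abs_divide' [of p c] by (simp add: padic_abs_int_mult del: of_int_mult)
qed

lemma padic_abs_add: assumes "prime p" shows "padic_abs p (x + y) \<le> max (padic_abs p x) (padic_abs p y)"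
proof -
  obtain a b c where c: "c \<noteq> 0" "x = of_int a / of_int c" "y = of_int b / of_int c"
    by (rule rat_fractions)
  have "x + y = of_int (a + b) / of_int c" using c by (simp add: add_divide_distrib)
  then have "padic_abs p (x + y) = padic_abs p (of_int (a+b)) / padic_abs p (of_int c)"
    using assms c padic_abs_divide' [of p c "a+b"] by simp
  also have "\<dots> \<le> max (padic_abs p (of_int a)) (padic_abs p (of_int b)) / padic_abs p (of_int c)"
    using assms c padic_abs_int_add padic_abs_int_pos [of p c] by (intro divide_right_mono) auto
  also have "\<dots> = max (padic_abs p x) (padic_abs p y)"
    using assms c padic_abs_divide' [of p c] padic_abs_int_pos [of p c] by (simp add: max_divide_distrib_right)
  finally show ?thesis .
qed

lemma padic_abs_nonneg [simp]: "0 \<le> padic_abs p x"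
  by (auto simp: padic_abs_def)

section \<open>Integers in a ring\<close>

context cring
begin

abbreviation ofi :: "int \<Rightarrow> 'a" where "ofi k \<equiv> [k] \<cdot> \<one>"

lemma ofi_closed [simp]: "ofi k \<in> carrier R" by simp
lemma ofi_0 [simp]: "ofi 0 = \<zero>" by (simp add: add_pow_int_ge)
lemma ofi_1 [simp]: "ofi 1 = \<one>" by (simp add: add_pow_int_ge)
lemma ofi_add: "ofi (a + b) = ofi a \<oplus> ofi b" by (simp add: add.int_pow_mult)
lemma ofi_minus: "ofi (- a) = \<ominus> ofi a" by (simp add: add.int_pow_neg)
lemma ofi_diff: "ofi (a - b) = ofi a \<ominus> ofi b" by (simp add: add.int_pow_diff a_minus_def)
lemma ofi_mult: "ofi (a * b) = ofi a \<otimes> ofi b"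
  using add.int_pow_pow [of \<one> a b] add_pow_ldistr_int [of \<one> "ofi b" a] by (simp add: mult.commute)
lemma add_pow_eq_ofi: "x \<in> carrier R \<Longrightarrow> [(k::int)] \<cdot> x = ofi k \<otimes> x"
  by (simp add: add_pow_ldistr_int)

end

section \<open>Fields with a place above \<open>p\<close>\<close>

locale padic_field = field F for F :: "('a, 'b) ring_scheme" (structure) +
  fixes v :: "'a \<Rightarrow> real" and p :: nat
  assumes prime_p: "prime p" and absolute_value: "absolute_value F v"
    and v_int: "v ([(k::int)] \<cdot> \<one>) = padic_abs p (of_int k)"
begin

text \<open>A place is only required to satisfy the triangle inequality. Since \<open>v\<close> is
  at most 1 on the integers, \<open>(\<one> \<oplus> z) [^] n\<close> is a sum of
  \<open>n + 1\<close> terms of value at most 1, and this linear bound on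
  \<open>v (\<one> \<oplus> z) ^ n\<close> excludes exponential growth.\<close>

lemma v_ultrametric_one:
  assumes z: "z \<in> carrier F" "v z \<le> 1" shows "v (\<one> \<oplus> z) \<le> 1"
proof -
  have vmult: "\<lbrakk>x \<in> carrier F; y \<in> carrier F\<rbrakk> \<Longrightarrow> v (x \<otimes> y) = v x * v y"
    and vadd: "\<lbrakk>x \<in> carrier F; y \<in> carrier F\<rbrakk> \<Longrightarrow> v (x \<oplus> y) \<le> v x + v y"
    and vnn: "x \<in> carrier F \<Longrightarrow> 0 \<le> v x" for x y
    using absolute_value by (auto simp: absolute_value_def)
  have v1: "v \<one> = 1" using v_int [of 1] padic_abs_int_coprime [OF prime_p, of 1] by simp
  have vpow: "v (x [^] n) = v x ^ n" if "x \<in> carrier F" for x and n :: nat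
    by (induction n) (use that v1 vmult in auto)
  \<comment> \<open>\<open>A n\<close> holds the polynomials in \<open>z\<close> of degree at most
    \<open>n\<close> with integer coefficients. Closure under sums and under multiplication by
    \<open>z\<close> takes the place of the binomial theorem.\<close>
  define A where "A = rec_nat (range ofi) (\<lambda>n S. {a \<oplus> ofi k \<otimes> z [^] Suc n | a k. a \<in> S})"
  have A0: "A 0 = range ofi" and AS: "A (Suc n) = {a \<oplus> ofi k \<otimes> z [^] Suc n | a k. a \<in> A n}" for n
    by (simp_all add: A_def)
  have Ac: "a \<in> carrier F \<and> v a \<le> real n + 1" if "a \<in> A n" for n a
    using that
  proof (induction n arbitrary: a)
    case 0
    then show ?case using A0 v_int padic_abs_int_le_1 [OF prime_p] by auto
  next
    case (Suc n)
    then obtain b k where b: "b \<in> A n" "a = b \<oplus> ofi k \<otimes> z [^] Suc n" using AS by blast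
    have "v (ofi k \<otimes> z [^] Suc n) = v (ofi k) * v z ^ Suc n" using z by (simp only: vmult vpow nat_pow_closed ofi_closed)
    also have "\<dots> \<le> 1 * 1"
      using z vnn v_int padic_abs_int_le_1 [OF prime_p] by (intro mult_mono power_le_one) auto
    finally have "v (ofi k \<otimes> z [^] Suc n) \<le> 1" by simp
    moreover have "b \<in> carrier F" "v b \<le> real n + 1" using Suc.IH b by auto
    ultimately show ?case using b z vadd [of b "ofi k \<otimes> z [^] Suc n"] by auto
  qed
  have Aadd: "a \<oplus> b \<in> A n" if "a \<in> A n" "b \<in> A n" for n a b
    using that
  proof (induction n arbitrary: a b)
    case 0
    then show ?case unfolding A0 by (auto simp: ofi_add [symmetric])
  next
    case (Suc n)
    then obtain a' k b' l where ab: "a' \<in> A n" "a = a' \<oplus> ofi k \<otimes> z [^] Suc n"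
       "b' \<in> A n" "b = b' \<oplus> ofi l \<otimes> z [^] Suc n" using AS by blast
    have "a' \<in> carrier F" "b' \<in> carrier F" "z [^] Suc n \<in> carrier F" using Ac ab z nat_pow_closed by blast+
    then have "a \<oplus> b = (a' \<oplus> b') \<oplus> ofi (k + l) \<otimes> z [^] Suc n"
      unfolding ab ofi_add using ofi_closed by algebra
    then show ?case using AS Suc.IH [OF ab(1,3)] by blast
  qed
  have Ainc: "a \<in> A (Suc n)" if "a \<in> A n" for n a
  proof -
    have "a = a \<oplus> ofi 0 \<otimes> z [^] Suc n" using Ac [OF that] z by simp
    then show ?thesis using AS that by blast
  qed
  have Amul: "a \<otimes> z \<in> A (Suc n)" if "a \<in> A n" for n a
    using that
  proof (induction n arbitrary: a)
    case 0
    then obtain k where k: "a = ofi k" using A0 by blast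
    have "ofi k \<otimes> z = ofi 0 \<oplus> ofi k \<otimes> z [^] Suc 0" using z by simp
    then show ?case using AS A0 k by blast
  next
    case (Suc n)
    then obtain a' k where ab: "a' \<in> A n" "a = a' \<oplus> ofi k \<otimes> z [^] Suc n" using AS by blast
    have "a' \<in> carrier F" using Ac ab by blast
    then have "a \<otimes> z = (a' \<otimes> z) \<oplus> ofi k \<otimes> z [^] Suc (Suc n)"
      unfolding ab using z by (simp add: l_distr m_assoc)
    then show ?case using AS Suc.IH [OF ab(1)] by blast
  qed
  have "(\<one> \<oplus> z) [^] n \<in> A n" for n :: nat
  proof (induction n)
    case 0
    have "\<one> = ofi 1" by simp
    then show ?case using A0 by (metis nat_pow_0 rangeI)
  next
    case (Suc n)
    have "(\<one> \<oplus> z) [^] Suc n = (\<one> \<oplus> z) [^] n \<oplus> (\<one> \<oplus> z) [^] n \<otimes> z"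
      using z by (simp add: r_distr)
    then show ?case using Aadd Ainc Amul Suc by simp
  qed
  then have le: "v (\<one> \<oplus> z) ^ n \<le> real n + 1" for n
    using Ac [of "(\<one> \<oplus> z) [^] n" n] vpow [of "\<one> \<oplus> z" n] z by simp
  show ?thesis
  proof (rule ccontr)
    assume "\<not> v (\<one> \<oplus> z) \<le> 1"
    then have gt: "sqrt (v (\<one> \<oplus> z)) > 1" by simp
    \<comment> \<open>Bernoulli's inequality for \<open>v (\<one> \<oplus> z)\<close> itself would
      give only linear growth, which need not beat \<open>n + 1\<close>. Applied to the square root
      and squared, it gives the quadratic growth \<open>(1 + n * d)\<^sup>2\<close>.\<close>
    define d where "d = sqrt (v (\<one> \<oplus> z)) - 1"
    have d: "d > 0" using gt d_def by simp
    obtain n :: nat where n: "real n > 1 / d\<^sup>2" using reals_Archimedean2 by blast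
    then have n0: "n > 0" using d by (metis gr0I less_le_not_le of_nat_0 zero_le_divide_1_iff zero_le_power2)
    have "1 + real n * d \<le> sqrt (v (\<one> \<oplus> z)) ^ n"
      using Bernoulli_inequality [of d n] d by (simp add: d_def)
    then have "(1 + real n * d)\<^sup>2 \<le> (sqrt (v (\<one> \<oplus> z)) ^ n)\<^sup>2"
      using d by (intro power_mono) auto
    also have "\<dots> = v (\<one> \<oplus> z) ^ n"
      using vnn [of "\<one> \<oplus> z"] z by (simp flip: power_mult add: mult.commute [of n]) (simp add: power_mult)
    also have "\<dots> \<le> real n + 1" by (rule le)
    finally have *: "(1 + real n * d)\<^sup>2 \<le> real n + 1" .
    have "real n * d\<^sup>2 > 1" using n d by (simp add: field_simps)
    then have "real n * (real n * d\<^sup>2) > real n" using n0 by simp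
    moreover have "real n * d > 0" using n0 d by simp
    ultimately show False using * by (simp add: power2_eq_square algebra_simps)
  qed
qed

sublocale nonarch_field F v
proof
  show "absolute_value F v" by (rule absolute_value)
  \<comment> \<open>Dividing by the element of larger value reduces the strong inequality to
    \<open>v_ultrametric_one\<close>.\<close>
  have le: "v (x \<oplus> y) \<le> v y" if "x \<in> carrier F" "y \<in> carrier F" "v x \<le> v y" for x y
  proof (cases "y = \<zero>")
    case True
    have "v \<zero> = 0" "0 \<le> v x" using that absolute_value by (auto simp: absolute_value_def)
    then have "v x = 0" using that True by simp
    then have "x = \<zero>" using that absolute_value by (auto simp: absolute_value_def)
    then show ?thesis using True by simp
  next
    case False
    then have y: "y \<in> Units F" using that field_Units by blast
    have vy: "v y > 0" using that False absolute_value by (auto simp: absolute_value_def less_le)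
    have m: "\<And>x y. \<lbrakk>x \<in> carrier F; y \<in> carrier F\<rbrakk> \<Longrightarrow> v (x \<otimes> y) = v x * v y"
      using absolute_value by (auto simp: absolute_value_def)
    have e: "x = (x \<otimes> inv y) \<otimes> y" using that y by (simp add: m_assoc)
    then have "v x = v (x \<otimes> inv y) * v y" using m [of "x \<otimes> inv y" y] that y by simp
    then have "v (x \<otimes> inv y) \<le> 1" using that vy by simp
    then have "v (\<one> \<oplus> x \<otimes> inv y) \<le> 1" using v_ultrametric_one that y by simp
    moreover have "x \<oplus> y = (\<one> \<oplus> x \<otimes> inv y) \<otimes> y"
      using that y e by (simp add: l_distr a_comm)
    ultimately show ?thesis using m that y vy by (simp add: mult_left_le_one_le)
  qed
  show "v (x \<oplus> y) \<le> max (v x) (v y)" if "x \<in> carrier F" "y \<in> carrier F" for x y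
    using le [of x y] le [of y x] that by (cases "v x \<le> v y") (auto simp: a_comm)
qed

section \<open>Powers of one-units\<close>

lemma p_gt_1: "real p > 1" using prime_p prime_gt_1_nat by simp

lemma v_int_coprime: "coprime k (int p) \<Longrightarrow> v (ofi k) = 1"
  using v_int padic_abs_int_coprime [OF prime_p] by simp

lemma v_int_p: "v (ofi (int p)) \<le> 1 / p"
  using v_int padic_abs_int_le_iff [OF prime_p, of "int p" 1] by simp

text \<open>\<open>s\<close> is the geometric sum of the powers of \<open>y\<close> below
  \<open>n\<close>. Each summand is congruent to 1 modulo \<open>y \<ominus> \<one>\<close>, so
  \<open>s\<close> is congruent to \<open>n\<close>. This decides what the \<open>n\<close>-th power
  does to the distance from 1: nothing for \<open>n\<close> prime to \<open>p\<close>, a contraction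
  for \<open>n = p\<close>.\<close>

lemma one_unit_pow_factor:
  assumes y: "y \<in> carrier F" "v (y \<ominus> \<one>) < 1"
  shows "\<exists>s\<in>carrier F. y [^] (n::nat) \<ominus> \<one> = (y \<ominus> \<one>) \<otimes> s \<and> v (s \<ominus> ofi (int n)) \<le> v (y \<ominus> \<one>) \<and> v s \<le> 1"
proof (induction n)
  case 0
  then show ?case using y by (intro bexI[of _ \<zero>]) auto
next
  case (Suc n)
  then obtain s where s: "s \<in> carrier F" "y [^] n \<ominus> \<one> = (y \<ominus> \<one>) \<otimes> s"
    "v (s \<ominus> ofi (int n)) \<le> v (y \<ominus> \<one>)" "v s \<le> 1" by blast
  have vy: "v y = 1" using v_near_one y by blast
  have yn: "y [^] n = (y \<ominus> \<one>) \<otimes> s \<oplus> \<one>"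
  proof -
    have "y [^] n = (y [^] n \<ominus> \<one>) \<oplus> \<one>" using y nat_pow_closed [of y n] by algebra
    then show ?thesis using s(2) by simp
  qed
  have yS: "y [^] Suc n \<ominus> \<one> = (y \<ominus> \<one>) \<otimes> (s \<otimes> y \<oplus> \<one>)"
    unfolding nat_pow_Suc yn using y s(1) by algebra
  have o: "ofi (int (Suc n)) = ofi (int n) \<oplus> \<one>" using ofi_add [of "int n" 1] by (simp add: add.commute)
  have "s \<otimes> y \<oplus> \<one> \<ominus> ofi (int (Suc n)) = s \<otimes> (y \<ominus> \<one>) \<oplus> (s \<ominus> ofi (int n))"
    unfolding o using y s(1) ofi_closed [of "int n"] by algebra
  moreover have "v (s \<otimes> (y \<ominus> \<one>)) \<le> v (y \<ominus> \<one>)"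
    using s y by (simp add: mult_left_le_one_le)
  ultimately have "v (s \<otimes> y \<oplus> \<one> \<ominus> ofi (int (Suc n))) \<le> v (y \<ominus> \<one>)"
    using ultrametric [of "s \<otimes> (y \<ominus> \<one>)" "s \<ominus> ofi (int n)"] s y by (simp del: v_mult)
  moreover have "v (s \<otimes> y \<oplus> \<one>) \<le> 1"
    using ultrametric [of "s \<otimes> y" \<one>] s y vy by simp
  ultimately show ?case using yS s y by (intro bexI[of _ "s \<otimes> y \<oplus> \<one>"]) auto
qed

lemma v_pow_sub_one_le:
  assumes "y \<in> carrier F" "v (y \<ominus> \<one>) < 1" shows "v (y [^] (n::nat) \<ominus> \<one>) \<le> v (y \<ominus> \<one>)"
proof -
  obtain s where "s \<in> carrier F" "y [^] n \<ominus> \<one> = (y \<ominus> \<one>) \<otimes> s" "v s \<le> 1"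
    using one_unit_pow_factor [OF assms, of n] by blast
  then show ?thesis using assms by (simp add: mult_right_le_one_le)
qed

lemma v_pow_coprime_sub_one:
  assumes "y \<in> carrier F" "v (y \<ominus> \<one>) < 1" "coprime n p"
  shows "v (y [^] (n::nat) \<ominus> \<one>) = v (y \<ominus> \<one>)"
proof -
  obtain s where s: "s \<in> carrier F" "y [^] n \<ominus> \<one> = (y \<ominus> \<one>) \<otimes> s" "v (s \<ominus> ofi (int n)) < 1"
    using one_unit_pow_factor [OF assms(1,2), of n] assms(2) by force
  have "v (ofi (int n)) = 1" using assms by (intro v_int_coprime) simp
  then have "v s = 1"
    using v_abs_diff [of s "ofi (int n)"] s ultrametric [of "s \<ominus> ofi (int n)" "ofi (int n)"]
      v_diff [of "s" "s \<ominus> ofi (int n)"]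
  proof -
    have e: "s = (s \<ominus> ofi (int n)) \<oplus> ofi (int n)" "ofi (int n) = s \<ominus> (s \<ominus> ofi (int n))"
      using s(1) ofi_closed by algebra+
    have 1: "v s \<le> 1" using ultrametric [of "s \<ominus> ofi (int n)" "ofi (int n)"] e(1) s \<open>v (ofi (int n)) = 1\<close> by auto
    have 2: "1 \<le> max (v s) (v (s \<ominus> ofi (int n)))"
      using v_diff [of "s" "s \<ominus> ofi (int n)"] e(2) s \<open>v (ofi (int n)) = 1\<close> by auto
    from 1 2 s(3) show ?thesis by linarith
  qed
  then show ?thesis using s assms by simp
qed

text \<open>The cofactor of \<open>y \<ominus> \<one>\<close> differs from \<open>p\<close> by at
  most \<open>v (y \<ominus> \<one>)\<close>, so it is bounded by any \<open>\<theta>\<close> that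
  dominates both this distance and \<open>1 / p\<close>.\<close>

lemma v_pow_p_sub_one:
  assumes "y \<in> carrier F" "v (y \<ominus> \<one>) \<le> \<theta>" "\<theta> < 1" "1 / p \<le> \<theta>"
  shows "v (y [^] p \<ominus> \<one>) \<le> \<theta> * v (y \<ominus> \<one>)"
proof -
  obtain s where s: "s \<in> carrier F" "y [^] p \<ominus> \<one> = (y \<ominus> \<one>) \<otimes> s" "v (s \<ominus> ofi (int p)) \<le> v (y \<ominus> \<one>)"
    using one_unit_pow_factor [of y p] assms by force
  have e: "s = (s \<ominus> ofi (int p)) \<oplus> ofi (int p)" using s(1) ofi_closed by algebra
  have "v s \<le> \<theta>"
    using ultrametric [of "s \<ominus> ofi (int p)" "ofi (int p)"] e s assms v_int_p by auto
  then show ?thesis using s assms v_nonneg [of "y \<ominus> \<one>"] by (simp add: mult.commute [of \<theta>] mult_left_mono)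
qed

text \<open>Each \<open>p\<close>-th power contributes one factor \<open>\<theta>\<close>, in
  addition to the one present at the start; hence the exponent \<open>Suc r\<close>.\<close>

lemma v_pow_pp_sub_one:
  assumes "y \<in> carrier F" "v (y \<ominus> \<one>) \<le> \<theta>" "\<theta> < 1" "1 / p \<le> \<theta>"
  shows "v (y [^] (p ^ r) \<ominus> \<one>) \<le> \<theta> ^ Suc r"
proof (induction r)
  case 0
  then show ?case using assms by simp
next
  case (Suc r)
  have th: "0 \<le> \<theta>" using order_trans [OF _ assms(2), of 0] assms(1) by simp
  have "\<theta> ^ Suc r \<le> \<theta>" using th assms power_decreasing [of 1 "Suc r" \<theta>] by simp
  then have le: "v (y [^] (p ^ r) \<ominus> \<one>) \<le> \<theta>" using Suc by linarith
  have "v ((y [^] (p ^ r)) [^] p \<ominus> \<one>) \<le> \<theta> * v (y [^] (p ^ r) \<ominus> \<one>)"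
    using v_pow_p_sub_one [OF _ le assms(3,4)] assms by simp
  also have "\<dots> \<le> \<theta> * \<theta> ^ Suc r" using Suc th by (intro mult_left_mono) auto
  finally show ?case using assms by (simp add: nat_pow_pow mult.commute)
qed

section \<open>Integer powers of units\<close>

sublocale UF: comm_group "units_of F" by (rule units_comm_group)

abbreviation upow :: "'a \<Rightarrow> int \<Rightarrow> 'a" where "upow u k \<equiv> u [^]\<^bsub>units_of F\<^esub> k"

lemma upow_closed [simp]: "u \<in> Units F \<Longrightarrow> upow u k \<in> Units F"
  using UF.int_pow_closed [of u k] by (simp add: units_of_carrier)

lemma upow_carrier [simp]: "u \<in> Units F \<Longrightarrow> upow u k \<in> carrier F"
  using upow_closed by blast

lemma upow_int: "u \<in> Units F \<Longrightarrow> upow u (int n) = u [^] n"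
  by (simp add: int_pow_int units_of_pow)

lemma upow_add: "u \<in> Units F \<Longrightarrow> upow u (a + b) = upow u a \<otimes> upow u b"
  using UF.int_pow_mult [of u a b] by (simp add: units_of_carrier units_of_mult)

lemma upow_neg: "u \<in> Units F \<Longrightarrow> upow u (- a) = inv (upow u a)"
  using UF.int_pow_neg [of u a] by (simp add: units_of_carrier units_of_inv)

lemma upow_upow: "u \<in> Units F \<Longrightarrow> upow (upow u a) b = upow u (a * b)"
  using UF.int_pow_pow [of u a b] by (simp add: units_of_carrier)

lemma upow_mult: "\<lbrakk>u \<in> Units F; w \<in> Units F\<rbrakk> \<Longrightarrow> upow (u \<otimes> w) a = upow u a \<otimes> upow w a"
  using UF.int_pow_distrib [of u w a] by (simp add: units_of_carrier units_of_mult)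

lemma near_one_Units: "\<lbrakk>y \<in> carrier F; v (y \<ominus> \<one>) < 1\<rbrakk> \<Longrightarrow> y \<in> Units F"
  using v_near_one [of y] v_zero unfolding field_Units by (cases "y = \<zero>") simp_all

lemma v_inv: "u \<in> Units F \<Longrightarrow> v (inv u) = 1 / v u"
proof -
  assume u: "u \<in> Units F"
  then have "v (inv u) * v u = 1" using v_mult [of "inv u" u] by (simp del: v_mult add: Units_closed)
  then show ?thesis by (metis mult_zero_right nonzero_eq_divide_eq zero_neq_one)
qed

lemma v_inv_sub_one:
  assumes "y \<in> carrier F" "v (y \<ominus> \<one>) < 1" shows "v (inv y \<ominus> \<one>) = v (y \<ominus> \<one>)"
proof -
  have u: "y \<in> Units F" using near_one_Units assms by blast
  have "y \<otimes> (inv y \<ominus> \<one>) = \<one> \<ominus> y"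
  proof -
    have "y \<otimes> (inv y \<ominus> \<one>) = y \<otimes> inv y \<ominus> y" using u Units_closed [OF u] Units_inv_closed [OF u] by algebra
    then show ?thesis using u by simp
  qed
  then have "v y * v (inv y \<ominus> \<one>) = v (\<one> \<ominus> y)"
    using v_mult [of y "inv y \<ominus> \<one>"] u assms by (simp del: v_mult)
  then show ?thesis using v_near_one [OF assms] assms(1) v_diff_commute [of \<one> y] by simp
qed

lemma v_upow_sub_one_le:
  assumes "y \<in> carrier F" "v (y \<ominus> \<one>) < 1" shows "v (upow y k \<ominus> \<one>) \<le> v (y \<ominus> \<one>)"
proof -
  have u: "y \<in> Units F" using near_one_Units assms by blast
  show ?thesis
  proof (cases k rule: int_cases)
    case (nonneg n)
    then show ?thesis using assms u upow_int v_pow_sub_one_le by simp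
  next
    case (neg n)
    have "v (y [^] Suc n \<ominus> \<one>) \<le> v (y \<ominus> \<one>)" using assms v_pow_sub_one_le by blast
    moreover have "upow y k = inv (y [^] Suc n)" using upow_neg [OF u, of "int (Suc n)"] neg upow_int [OF u, of "Suc n"] by simp
    ultimately show ?thesis using v_inv_sub_one [OF nat_pow_closed [OF assms(1)], of "Suc n"] assms(2)
      by (metis le_less_trans)
  qed
qed

text \<open>\<open>N\<close> is a multiple of the order of \<open>u\<close> in the residue field. It
  is a parameter because any such multiple prime to \<open>p\<close> serves, not just the
  order.\<close>

definition tame :: "nat \<Rightarrow> 'a \<Rightarrow> bool" where
  "tame N u \<longleftrightarrow> u \<in> Units F \<and> coprime N p \<and> v (u [^] N \<ominus> \<one>) < 1"

text \<open>The contraction rate for repeated \<open>p\<close>-th powers of \<open>u [^] N\<close>: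
  it dominates \<open>1 / p\<close> and the distance to 1, as \<open>v_pow_pp_sub_one\<close>
  demands.\<close>

definition tame_bound :: "nat \<Rightarrow> 'a \<Rightarrow> real" where
  "tame_bound N u = max (1 / p) (v (u [^] N \<ominus> \<one>))"

lemma tame_bound: "tame N u \<Longrightarrow> 0 < tame_bound N u \<and> tame_bound N u < 1"
  using p_gt_1 by (auto simp: tame_def tame_bound_def less_max_iff_disj)

lemma tame_Units: "tame N u \<Longrightarrow> u \<in> Units F" by (simp add: tame_def)

lemma tame_N_pos: "tame N u \<Longrightarrow> N > 0"
  using prime_p prime_gt_1_nat by (auto simp: tame_def intro: gr0I)

lemma tame_v: assumes "tame N u" shows "v u = 1"
proof -
  have u: "u \<in> Units F" "u \<in> carrier F" using assms tame_Units by auto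
  then have "v u ^ N = 1" using v_near_one [of "u [^] N"] assms by (simp add: tame_def)
  then show ?thesis using tame_N_pos [OF assms] u by (metis power_eq_imp_eq_base power_one v_nonneg zero_le_one)
qed

text \<open>The \<open>N\<close>-th power makes \<open>u\<close> a one-unit, the
  \<open>p ^ r\<close>-th power contracts it, and a further integer power does not move it away from
  1. As \<open>N\<close> and \<open>p\<close> are coprime, the two divisibilities combine into
  one.\<close>

lemma tame_close:
  assumes "tame N u" "int N dvd j" "int p ^ r dvd j"
  shows "v (upow u j \<ominus> \<one>) \<le> tame_bound N u ^ Suc r"
proof -
  have u: "u \<in> Units F" "u \<in> carrier F" using assms tame_Units by auto
  have "coprime (int N) (int p ^ r)" using assms(1) unfolding tame_def
    by (metis coprime_int_iff coprime_power_right_iff)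
  from semiring_gcd_class.divides_mult [OF assms(2,3) this] have "int N * int p ^ r dvd j" .
  then obtain k where k: "j = int (N * p ^ r) * k" by auto
  define y where "y = (u [^] N) [^] (p ^ r)"
  have y: "y \<in> carrier F" using u by (simp add: y_def)
  have le: "v (y \<ominus> \<one>) \<le> tame_bound N u ^ Suc r"
    unfolding y_def
    by (rule v_pow_pp_sub_one) (use u tame_bound [OF assms(1)] in \<open>auto simp: tame_bound_def\<close>)
  also have "\<dots> < 1" using tame_bound [OF assms(1)] by (intro power_Suc_less_one) auto
  finally have lt: "v (y \<ominus> \<one>) < 1" .
  have "upow u j = upow y k"
    using u upow_upow [OF u(1), of "int (N * p ^ r)" k] upow_int [OF u(1), of "N * p ^ r"]
    by (simp add: k y_def nat_pow_pow del: of_nat_mult)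
  then show ?thesis using v_upow_sub_one_le [OF y lt, of k] le by simp
qed

text \<open>Uniform continuity of the power map on exponents, where integers are close if their
  difference is divisible by \<open>N\<close> and by a high power of \<open>p\<close>. The
  convergence of the unit sequences rests on it.\<close>

lemma tame_diff:
  assumes "tame N u" "int N dvd a - b" "int p ^ r dvd a - b"
  shows "v (upow u a \<ominus> upow u b) \<le> tame_bound N u ^ Suc r"
proof -
  have u: "u \<in> Units F" using assms tame_Units by auto
  have "v (upow u b) = 1"
  proof (cases b rule: int_cases)
    case (nonneg n)
    then show ?thesis using u upow_int tame_v [OF assms(1)] by (simp add: Units_closed)
  next
    case (neg n)
    then show ?thesis using u upow_int [OF u, of "Suc n"] upow_neg [OF u, of "int (Suc n)"] tame_v [OF assms(1)]
      Units_pow_closed [OF u, of "Suc n"]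
      by (simp add: Units_closed v_inv del: nat_pow_Suc of_nat_Suc)
  qed
  moreover have "upow u a \<ominus> upow u b = (upow u (a - b) \<ominus> \<one>) \<otimes> upow u b"
  proof -
    have "upow u a = upow u (a - b) \<otimes> upow u b" using upow_add [OF u, of "a - b" b] by simp
    then show ?thesis using u upow_carrier by algebra
  qed
  ultimately show ?thesis using tame_close [OF assms] u by simp
qed

end

section \<open>The \<open>p\<close>-adic integers as classes of integer sequences\<close>

definition padic_cauchy :: "nat \<Rightarrow> (nat \<Rightarrow> int) \<Rightarrow> bool" where
  "padic_cauchy p k \<longleftrightarrow> (\<forall>r. \<exists>M. \<forall>m\<ge>M. \<forall>n\<ge>M. int p ^ r dvd k m - k n)"

definition padic_null :: "nat \<Rightarrow> (nat \<Rightarrow> int) \<Rightarrow> bool" where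
  "padic_null p k \<longleftrightarrow> (\<forall>r. \<exists>M. \<forall>n\<ge>M. int p ^ r dvd k n)"

text \<open>Points of the p-adic integers are handled through integer sequences, since these can
  serve as exponents of units; \<open>padic_integers_ex\<close> shows that all points are
  reached.\<close>

definition padic_class :: "nat \<Rightarrow> (nat \<Rightarrow> int) \<Rightarrow> (nat \<Rightarrow> rat) set" where
  "padic_class p k = null_sequences rat_field (padic_abs p)
     +>\<^bsub>cauchy_ring rat_field (padic_abs p)\<^esub> (\<lambda>n. of_int (k n))"

lemma padic_cauchy_const [simp]: "padic_cauchy p (\<lambda>_. c)"
  by (simp add: padic_cauchy_def)

lemma padic_cauchy_add: assumes "padic_cauchy p k" "padic_cauchy p l" shows "padic_cauchy p (\<lambda>n. k n + l n)"
  unfolding padic_cauchy_def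
proof
  fix r
  obtain M N where M: "\<forall>m\<ge>M. \<forall>n\<ge>M. int p ^ r dvd k m - k n" and N: "\<forall>m\<ge>N. \<forall>n\<ge>N. int p ^ r dvd l m - l n"
    using assms unfolding padic_cauchy_def by meson
  have "int p ^ r dvd (k m + l m) - (k n + l n)" if "m \<ge> max M N" "n \<ge> max M N" for m n
  proof -
    have "(k m + l m) - (k n + l n) = (k m - k n) + (l m - l n)" by simp
    then show ?thesis using M N that by (metis dvd_add max.boundedE)
  qed
  then show "\<exists>M. \<forall>m\<ge>M. \<forall>n\<ge>M. int p ^ r dvd (k m + l m) - (k n + l n)" by blast
qed

lemma padic_cauchy_mult: assumes "padic_cauchy p k" "padic_cauchy p l" shows "padic_cauchy p (\<lambda>n. k n * l n)"
  unfolding padic_cauchy_def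
proof
  fix r
  obtain M N where M: "\<forall>m\<ge>M. \<forall>n\<ge>M. int p ^ r dvd k m - k n" and N: "\<forall>m\<ge>N. \<forall>n\<ge>N. int p ^ r dvd l m - l n"
    using assms unfolding padic_cauchy_def by meson
  have "int p ^ r dvd k m * l m - k n * l n" if "m \<ge> max M N" "n \<ge> max M N" for m n
  proof -
    have "k m * l m - k n * l n = (k m - k n) * l m + k n * (l m - l n)" by (simp add: algebra_simps)
    moreover have "int p ^ r dvd (k m - k n)" "int p ^ r dvd (l m - l n)" using M N that by auto
    ultimately show ?thesis by (metis dvd_add dvd_mult dvd_mult2)
  qed
  then show "\<exists>M. \<forall>m\<ge>M. \<forall>n\<ge>M. int p ^ r dvd k m * l m - k n * l n" by blast
qed

lemma rat_field_simps [simp]: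
  "carrier rat_field = UNIV" "x \<otimes>\<^bsub>rat_field\<^esub> y = x * y" "x \<oplus>\<^bsub>rat_field\<^esub> y = x + y"
  "\<one>\<^bsub>rat_field\<^esub> = 1" "\<zero>\<^bsub>rat_field\<^esub> = 0"
  by (simp_all add: ring_of_type_algebra_def)

lemma rat_field_minus [simp]: "x \<ominus>\<^bsub>rat_field\<^esub> y = x - y"
proof -
  interpret field rat_field by (rule field_from_type_algebra)
  have "\<ominus>\<^bsub>rat_field\<^esub> y = - y" by (rule minus_equality) auto
  then show ?thesis by (simp add: a_minus_def)
qed

lemma rat_field_of_int [simp]: "[(k::int)] \<cdot>\<^bsub>rat_field\<^esub> (1::rat) = of_int k"
proof -
  interpret field rat_field by (rule field_from_type_algebra)
  show ?thesis
  proof (induction k rule: int_induct [where k=0])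
    case base
    then show ?case using ofi_0 by simp
  next
    case (step1 i)
    then show ?case using ofi_add [of i 1] ofi_1 by simp
  next
    case (step2 i)
    then show ?case using ofi_diff [of i 1] ofi_1 by simp
  qed
qed

lemma padic_field_rat: assumes "prime p" shows "padic_field rat_field (padic_abs p) p"
proof -
  interpret field rat_field by (rule field_from_type_algebra)
  show ?thesis
  proof
    have "padic_abs p (x + y) \<le> padic_abs p x + padic_abs p y" for x y
      using padic_abs_add [OF assms, of x y] padic_abs_nonneg [of p x] padic_abs_nonneg [of p y] by linarith
    then show "absolute_value rat_field (padic_abs p)"
      using assms by (simp add: absolute_value_def padic_abs_mult)
  qed (use assms in auto)
qed

text \<open>The denominator is prime to \<open>p\<close>, hence invertible modulo
  \<open>p ^ n\<close>. Nonzero values are powers of \<open>p\<close>, so the hypothesis amounts to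
  \<open>padic_abs p x \<le> 1\<close>; its strict form holds for all late terms of a sequence whose
  limit has value at most 1.\<close>

lemma padic_rat_approx:
  assumes p: "prime p" and x: "padic_abs p x < real p"
  shows "\<exists>k. padic_abs p (x - of_int k) \<le> 1 / real p ^ n"
proof -
  obtain a b where ab: "quotient_of x = (a, b)" by fastforce
  have b: "b > 0" using quotient_of_denom_pos [OF ab] .
  have cop: "coprime a b" using quotient_of_coprime [OF ab] .
  have xab: "x = of_int a / of_int b" using quotient_of_div [OF ab] .
  have p1: "real p > 1" using p prime_gt_1_nat by simp
  have "\<not> int p dvd b"
  proof
    assume pb: "int p dvd b"
    then have "\<not> int p dvd a" using cop p coprime_common_divisor [of a b "int p"] prime_gt_1_nat [of p] by auto
    then have m0: "multiplicity (int p) a = 0" and a0: "a \<noteq> 0" by (auto simp: not_dvd_imp_multiplicity_0)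
    have "multiplicity (int p) b \<ge> 1" using pb b p prime_elem_multiplicity_eq_zero_iff [of "int p" b] by (simp add: Suc_le_eq)
    then have "real p ^ 1 \<le> real p ^ multiplicity (int p) b" using p1 by (intro power_increasing) auto
    also have "\<dots> = padic_abs p x" using padic_abs_divide [OF p a0, of b] b m0 xab by simp
    finally show False using x by simp
  qed
  then have "coprime b (int p ^ n)" using p prime_imp_coprime [of "int p" b] by (simp add: coprime_commute)
  then obtain s t where st: "s * b + t * int p ^ n = 1"
    using bezout_int [of b "int p ^ n"] by (auto simp: coprime_iff_gcd_eq_1)
  have "x - of_int (a * s) = of_int (a * t * int p ^ n) / of_int b"
  proof -
    have "of_int (s * b + t * int p ^ n) = (1::rat)" using st by simp
    then have "of_int a * (of_int s * of_int b + of_int t * of_int p ^ n) = (of_int a :: rat)" by simp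
    then show ?thesis unfolding xab using b by (simp add: field_simps)
  qed
  then have "padic_abs p (x - of_int (a * s)) = padic_abs p (of_int (a * t * int p ^ n)) / padic_abs p (of_int b)"
    using padic_abs_divide' [OF p, of b "a * t * int p ^ n"] b by (metis less_irrefl)
  also have "padic_abs p (of_int b) = 1"
    using padic_abs_int_coprime [OF p, of b] \<open>\<not> int p dvd b\<close> p prime_imp_coprime [of "int p" b]
    by (simp add: coprime_commute)
  also have "padic_abs p (of_int (a * t * int p ^ n)) / 1 \<le> 1 / real p ^ n"
    using padic_abs_int_le_iff [OF p, of "a * t * int p ^ n" n] by simp
  finally show ?thesis by blast
qed

lemma padic_tendsto_0_iff:
  assumes "prime p"
  shows "(\<lambda>n. padic_abs p (of_int (k n))) \<longlonglongrightarrow> 0 \<longleftrightarrow> padic_null p k"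
proof
  have p1: "real p > 1" using assms prime_gt_1_nat by simp
  assume L: "(\<lambda>n. padic_abs p (of_int (k n))) \<longlonglongrightarrow> 0"
  show "padic_null p k" unfolding padic_null_def
  proof
    fix r
    have "1 / real p ^ r > 0" using p1 by simp
    from order_tendstoD(2) [OF L this] obtain M where "\<forall>n\<ge>M. padic_abs p (of_int (k n)) < 1 / real p ^ r"
      unfolding eventually_sequentially by blast
    then show "\<exists>M. \<forall>n\<ge>M. int p ^ r dvd k n" using padic_abs_int_le_iff [OF assms] less_imp_le by metis
  qed
next
  have p1: "real p > 1" using assms prime_gt_1_nat by simp
  assume N: "padic_null p k"
  show "(\<lambda>n. padic_abs p (of_int (k n))) \<longlonglongrightarrow> 0"
  proof (rule LIMSEQ_I)
    fix e :: real assume e: "e > 0"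
    have "1 / real p < 1" using p1 by simp
    then obtain r where r: "(1 / real p) ^ r < e" using real_arch_pow_inv [OF e] by blast
    obtain M where "\<forall>n\<ge>M. int p ^ r dvd k n" using N unfolding padic_null_def by blast
    then have "\<forall>n\<ge>M. padic_abs p (of_int (k n)) < e"
      using r padic_abs_int_le_iff [OF assms] by (metis le_less_trans power_one_over)
    then show "\<exists>M. \<forall>n\<ge>M. norm (padic_abs p (of_int (k n)) - 0) < e" by auto
  qed
qed

context
  fixes p :: nat assumes prime_p: "prime p"
begin

interpretation Q: padic_field rat_field "padic_abs p" p by (rule padic_field_rat [OF prime_p])

lemma Q_Cau_iff: "(\<lambda>n. of_int (k n)) \<in> Q.Cau \<longleftrightarrow> padic_cauchy p k"
proof
  have p1: "real p > 1" using Q.p_gt_1 .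
  assume C: "(\<lambda>n. of_int (k n)) \<in> Q.Cau"
  show "padic_cauchy p k" unfolding padic_cauchy_def
  proof
    fix r
    have "1 / real p ^ r > 0" using p1 by simp
    moreover have "\<forall>e>0. \<exists>M. \<forall>m\<ge>M. \<forall>n\<ge>M. padic_abs p (of_int (k m) - of_int (k n)) < e"
      using C unfolding Q.Cau_iff by simp
    ultimately obtain M where "\<forall>m\<ge>M. \<forall>n\<ge>M. padic_abs p (of_int (k m) - of_int (k n)) < 1 / real p ^ r"
      by blast
    then have "\<forall>m\<ge>M. \<forall>n\<ge>M. padic_abs p (of_int (k m - k n)) \<le> 1 / real p ^ r" by (simp add: less_imp_le)
    then show "\<exists>M. \<forall>m\<ge>M. \<forall>n\<ge>M. int p ^ r dvd k m - k n" using padic_abs_int_le_iff [OF prime_p] by blast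
  qed
next
  have p1: "real p > 1" using Q.p_gt_1 .
  assume N: "padic_cauchy p k"
  show "(\<lambda>n. of_int (k n)) \<in> Q.Cau"
  proof (rule Q.CauI)
    fix e :: real assume e: "e > 0"
    have "1 / real p < 1" using p1 by simp
    then obtain r where r: "(1 / real p) ^ r < e" using real_arch_pow_inv [OF e] by blast
    obtain M where M: "\<forall>m\<ge>M. \<forall>n\<ge>M. int p ^ r dvd k m - k n" using N unfolding padic_cauchy_def by blast
    have "padic_abs p (of_int (k n - k M)) < e" if "n \<ge> M" for n
    proof -
      have "padic_abs p (of_int (k n - k M)) \<le> 1 / real p ^ r"
        using M that padic_abs_int_le_iff [OF prime_p] by blast
      then show ?thesis using r by (simp add: power_one_over)
    qed
    then show "\<exists>N. \<forall>n\<ge>N. padic_abs p (of_int (k n) \<ominus>\<^bsub>rat_field\<^esub> of_int (k N)) < e" by auto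
  qed auto
qed

lemma padic_class_eq: "padic_class p k = Q.cls (\<lambda>n. of_int (k n))"
  by (simp add: padic_class_def Q.cls_def)

lemma padic_tendsto_embed_iff:
  assumes "a \<in> carrier (completion rat_field (padic_abs p))"
  shows "completion_tendsto rat_field (padic_abs p)
      (\<lambda>n. completion_embed rat_field (padic_abs p) (of_int (k n))) a \<longleftrightarrow>
    padic_cauchy p k \<and> padic_class p k = a"
  using Q.completion_tendsto_embed_iff [of "\<lambda>n. of_int (k n)" a] assms by (simp add: Q_Cau_iff padic_class_eq)

lemma padic_class_eq_iff:
  assumes "padic_cauchy p k" "padic_cauchy p l"
  shows "padic_class p k = padic_class p l \<longleftrightarrow> padic_null p (\<lambda>n. k n - l n)"
  using Q.cls_eq_iff [of "\<lambda>n. of_int (k n)" "\<lambda>n. of_int (l n)"] assms padic_tendsto_0_iff [OF prime_p, of "\<lambda>n. k n - l n"]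
  by (simp add: Q_Cau_iff padic_class_eq)

lemma padic_class_in_completion:
  "padic_cauchy p k \<Longrightarrow> padic_class p k \<in> carrier (completion rat_field (padic_abs p))"
  using Q.cls_closed [of "\<lambda>n. of_int (k n)"] by (simp add: Q_Cau_iff padic_class_eq)

lemma padic_class_closed:
  assumes "padic_cauchy p k" shows "padic_class p k \<in> carrier (padic_integers p)"
proof -
  have "completion_abs rat_field (padic_abs p) (padic_class p k) \<le> 1"
    unfolding padic_class_eq using assms padic_abs_int_le_1 [OF prime_p]
    by (intro Q.completion_abs_le [of _ 0]) (auto simp: Q_Cau_iff)
  then show ?thesis using padic_class_in_completion [OF assms] by (simp add: padic_integers_def)
qed

text \<open>Replacing the \<open>n\<close>-th rational by an integer at distance at most
  \<open>1 / p ^ n\<close> changes the sequence by a null sequence. Terms before \<open>N\<close>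
  may fail to be p-integral; there \<open>k\<close> is arbitrary.\<close>

lemma padic_integers_ex:
  assumes "a \<in> carrier (padic_integers p)" shows "\<exists>k. padic_cauchy p k \<and> padic_class p k = a"
proof -
  have a: "a \<in> carrier (completion rat_field (padic_abs p))" "completion_abs rat_field (padic_abs p) a \<le> 1"
    using assms by (auto simp: padic_integers_def)
  obtain x where x: "x \<in> Q.Cau" "a = Q.cls x" using Q.CF_ex [OF a(1)] by blast
  have "completion_abs rat_field (padic_abs p) (Q.cls x) < real p" using a(2) x(2) Q.p_gt_1 by simp
  then obtain N where N: "\<forall>n\<ge>N. padic_abs p (x n) < real p" using Q.completion_abs_less_ev [OF x(1)] by blast
  have "\<forall>n. \<exists>k. n \<ge> N \<longrightarrow> padic_abs p (x n - of_int k) \<le> 1 / real p ^ n"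
    using N padic_rat_approx [OF prime_p] by blast
  from choice [OF this] obtain k where k: "\<And>n. n \<ge> N \<Longrightarrow> padic_abs p (x n - of_int (k n)) \<le> 1 / real p ^ n"
    by blast
  have "(\<lambda>n. padic_abs p (x n - of_int (k n))) \<longlonglongrightarrow> 0"
  proof (rule tendsto_sandwich [of "\<lambda>_. 0" _ _ "\<lambda>n. (1 / real p) ^ n"])
    show "\<forall>\<^sub>F n in sequentially. padic_abs p (x n - of_int (k n)) \<le> (1 / real p) ^ n"
      using k unfolding eventually_sequentially by (auto simp: power_one_over)
    show "(\<lambda>n. (1 / real p) ^ n) \<longlonglongrightarrow> 0" using Q.p_gt_1 by (intro LIMSEQ_realpow_zero) auto
  qed auto
  note lim = this
  have kC: "(\<lambda>n. of_int (k n)) \<in> Q.Cau"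
  proof (rule Q.CauI)
    fix e :: real assume e: "e > 0"
    obtain M where M: "\<forall>n\<ge>M. padic_abs p (x n - of_int (k n)) < e"
      using order_tendstoD(2) [OF lim e]
      unfolding eventually_sequentially by blast
    obtain M' where M': "\<forall>m\<ge>M'. \<forall>n\<ge>M'. padic_abs p (x m - x n) < e" using x(1) e unfolding Q.Cau_iff by auto
    define K where "K = max M M'"
    have "padic_abs p (of_int (k n) - of_int (k K)) < e" if n: "n \<ge> K" for n
    proof -
      have 1: "padic_abs p (x n - of_int (k n)) < e" "padic_abs p (x K - of_int (k K)) < e" "padic_abs p (x n - x K) < e"
        using M M' n by (auto simp: K_def)
      have "padic_abs p (of_int (k n) - x n) < e" using 1(1) Q.v_diff_commute [of "x n" "of_int (k n)"] by simp
      then have "padic_abs p (of_int (k n) - x K) < e"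
        using Q.v_diff_trans [of "of_int (k n)" "x n" "x K"] 1 by simp
      then show ?thesis using Q.v_diff_trans [of "of_int (k n)" "x K" "of_int (k K)"] 1 by simp
    qed
    then show "\<exists>N. \<forall>n\<ge>N. padic_abs p (of_int (k n) \<ominus>\<^bsub>rat_field\<^esub> of_int (k N)) < e" by auto
  qed auto
  have "Q.cls x = Q.cls (\<lambda>n. of_int (k n))"
    using Q.cls_eq_iff [OF x(1) kC] lim by simp
  then show ?thesis using kC x by (auto simp: Q_Cau_iff padic_class_eq)
qed

lemma padic_class_add:
  assumes "padic_cauchy p k" "padic_cauchy p l"
  shows "padic_class p k \<oplus>\<^bsub>padic_integers p\<^esub> padic_class p l = padic_class p (\<lambda>n. k n + l n)"
  using Q.cls_add [of "\<lambda>n. of_int (k n)" "\<lambda>n. of_int (l n)"] assms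
  by (simp add: padic_integers_def padic_class_eq Q_Cau_iff)

lemma padic_integers_comm_group: "comm_group (add_monoid (padic_integers p))"
proof (rule comm_groupI)
  let ?Z = "padic_integers p"
  have ex: "\<exists>k. padic_cauchy p k \<and> a = padic_class p k" if "a \<in> carrier (add_monoid ?Z)" for a
    using padic_integers_ex [of a] that by auto
  have zero: "\<one>\<^bsub>add_monoid ?Z\<^esub> = padic_class p (\<lambda>_. 0)"
    using Q.cls_zero by (simp add: padic_integers_def padic_class_eq)
  show "\<one>\<^bsub>add_monoid ?Z\<^esub> \<in> carrier (add_monoid ?Z)" unfolding zero using padic_class_closed by simp
  fix x assume "x \<in> carrier (add_monoid ?Z)"
  then obtain k where k: "padic_cauchy p k" "x = padic_class p k" using ex by blast
  show "\<one>\<^bsub>add_monoid ?Z\<^esub> \<otimes>\<^bsub>add_monoid ?Z\<^esub> x = x" unfolding zero using k padic_class_add by simp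
  have k': "padic_cauchy p (\<lambda>n. (-1) * k n)" using k padic_cauchy_mult padic_cauchy_const by blast
  show "\<exists>y\<in>carrier (add_monoid ?Z). y \<otimes>\<^bsub>add_monoid ?Z\<^esub> x = \<one>\<^bsub>add_monoid ?Z\<^esub>"
    unfolding zero using k k' padic_class_add [OF k' k(1)] padic_class_closed [OF k']
    by (intro bexI[of _ "padic_class p (\<lambda>n. (-1) * k n)"]) auto
  fix y assume "y \<in> carrier (add_monoid ?Z)"
  then obtain l where l: "padic_cauchy p l" "y = padic_class p l" using ex by blast
  show "x \<otimes>\<^bsub>add_monoid ?Z\<^esub> y \<in> carrier (add_monoid ?Z)"
    using k l padic_class_add padic_class_closed padic_cauchy_add by simp
  show "x \<otimes>\<^bsub>add_monoid ?Z\<^esub> y = y \<otimes>\<^bsub>add_monoid ?Z\<^esub> x"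
    using k l padic_class_add [of k l] padic_class_add [of l k] by (simp add: add.commute)
  fix z assume "z \<in> carrier (add_monoid ?Z)"
  then obtain m where m: "padic_cauchy p m" "z = padic_class p m" using ex by blast
  show "x \<otimes>\<^bsub>add_monoid ?Z\<^esub> y \<otimes>\<^bsub>add_monoid ?Z\<^esub> z = x \<otimes>\<^bsub>add_monoid ?Z\<^esub> (y \<otimes>\<^bsub>add_monoid ?Z\<^esub> z)"
    using k l m padic_class_add padic_cauchy_add by (simp add: add.assoc)
qed

end

section \<open>Principal units\<close>

text \<open>Raising a unit to these exponents converges to its principal part: they tend to \<open>1\<close> \<open>p\<close>-adically
  and kill, in the limit, every root of unity of order prime to \<open>p\<close>.\<close>

definition tame_exp :: "nat \<Rightarrow> nat \<Rightarrow> int" where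
  "tame_exp p = (SOME e. \<forall>n. int p ^ n dvd e n - 1 \<and>
     (\<forall>N. N > 0 \<and> N \<le> n \<and> coprime N p \<longrightarrow> int N dvd e n))"

lemma tame_exp:
  "int p ^ n dvd tame_exp p n - 1"
  "\<lbrakk>N > 0; N \<le> n; coprime N p\<rbrakk> \<Longrightarrow> int N dvd tame_exp p n"
proof -
  have "\<exists>e. int p ^ n dvd e - 1 \<and> (\<forall>N. N > 0 \<and> N \<le> n \<and> coprime N p \<longrightarrow> int N dvd e)" for n
  proof -
    \<comment> \<open>\<open>m\<close> is divisible by every \<open>N\<close> in question and still
      prime to \<open>p\<close>, so by Bezout some multiple of it is congruent to 1 modulo
      \<open>p ^ n\<close>.\<close>
    define m where "m = \<Prod>{i \<in> {1..n}. coprime i p}"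
    have "coprime m (p ^ n)"
      unfolding m_def by (intro prod_coprime_left) auto
    then have "coprime (int m) (int p ^ n)" by (metis coprime_int_iff of_nat_power)
    then obtain s t where st: "s * int m + t * int p ^ n = 1"
      using bezout_int [of "int m" "int p ^ n"] by (auto simp: coprime_iff_gcd_eq_1)
    have "int p ^ n dvd s * int m - 1" using st by (metis add_diff_cancel_left' diff_add_cancel dvd_minus_iff dvd_triv_right minus_diff_eq)
    moreover have "int N dvd s * int m" if "N > 0" "N \<le> n" "coprime N p" for N
    proof -
      have "N dvd m" unfolding m_def using that by (intro dvd_prodI) auto
      then show ?thesis by simp
    qed
    ultimately show ?thesis by blast
  qed
  then have "\<exists>e. \<forall>n. int p ^ n dvd e n - 1 \<and>
     (\<forall>N. N > 0 \<and> N \<le> n \<and> coprime N p \<longrightarrow> int N dvd e n)" by metis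
  from someI_ex [OF this]
  show "int p ^ n dvd tame_exp p n - 1"
    "\<lbrakk>N > 0; N \<le> n; coprime N p\<rbrakk> \<Longrightarrow> int N dvd tame_exp p n"
    unfolding tame_exp_def by blast+
qed

text \<open>Identifies integer powers of principal units and integer multiples of p-adic integers
  from additivity alone, so that negative exponents need no formula of their own.\<close>

lemma (in group) int_pow_unique:
  assumes "\<And>i. f i \<in> carrier G" "\<And>i j. f (i + j) = f i \<otimes> f j"
  shows "f (1::int) [^] (k::int) = f k"
proof -
  have f0: "f 0 = \<one>" using assms(2) [of 0 0] assms(1) [of 0] by (metis add_0 r_cancel_one)
  show ?thesis
  proof (induction k rule: int_induct [where k=0])
    case base
    then show ?case using f0 by simp
  next
    case (step1 i)
    then show ?case using assms by (simp add: int_pow_mult)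
  next
    case (step2 i)
    have "f i = f (i - 1) \<otimes> f 1" using assms(2) [of "i - 1" 1] by simp
    then have "f (i - 1) = f i \<otimes> inv (f 1)" using assms(1) by (simp add: m_assoc)
    then show ?case using step2 assms(1) by (simp add: int_pow_diff)
  qed
qed

context padic_field
begin

abbreviation U1 where "U1 \<equiv> principal_units F v"

lemma cls_cong_ev:
  assumes "x \<in> Cau" "\<And>n. y n \<in> carrier F" "\<And>n. n \<ge> N \<Longrightarrow> y n = x n"
  shows "y \<in> Cau" "cls y = cls x"
proof -
  show y: "y \<in> Cau" unfolding Cau_iff
  proof (intro conjI allI impI)
    fix e :: real assume "e > 0"
    then obtain M where M: "\<forall>m\<ge>M. \<forall>n\<ge>M. v (x m \<ominus> x n) < e" using assms(1) unfolding Cau_iff by meson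
    then have "\<forall>m\<ge>max M N. \<forall>n\<ge>max M N. v (y m \<ominus> y n) < e" using assms(3) by simp
    then show "\<exists>N. \<forall>m\<ge>N. \<forall>n\<ge>N. v (y m \<ominus> y n) < e" by blast
  qed (use assms in auto)
  have "(\<lambda>n. v (y n \<ominus> x n)) \<longlonglongrightarrow> 0"
    by (rule tendsto_eventually) (use assms in \<open>auto simp: eventually_sequentially intro!: exI[of _ N]\<close>)
  then show "cls y = cls x" using cls_eq_iff y assms by blast
qed

lemma U1_simps [simp]: "x \<otimes>\<^bsub>U1\<^esub> y = x \<otimes>\<^bsub>CF\<^esub> y" "\<one>\<^bsub>U1\<^esub> = \<one>\<^bsub>CF\<^esub>"
  by (simp_all add: principal_units_def)

lemma U1_CF: "\<xi> \<in> carrier U1 \<Longrightarrow> \<xi> \<in> carrier CF"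
  by (simp add: principal_units_def)

lemma U1_cls_iff:
  "x \<in> Cau \<Longrightarrow> cls x \<in> carrier U1 \<longleftrightarrow> completion_abs F v (cls (\<lambda>n. x n \<ominus> \<one>)) < 1"
  by (simp add: principal_units_def cls_one cls_minus)

lemma U1_I:
  assumes "x \<in> Cau" "\<And>n. n \<ge> N \<Longrightarrow> v (x n \<ominus> \<one>) \<le> \<delta>" "\<delta> < 1" shows "cls x \<in> carrier U1"
proof -
  have "(\<lambda>n. x n \<ominus> \<one>) \<in> Cau" using Cau_diff [OF assms(1) Cau_const [of \<one>]] by simp
  from completion_abs_le [OF this assms(2)] show ?thesis using assms U1_cls_iff by fastforce
qed

lemma U1_ex:
  assumes "\<xi> \<in> carrier U1"
  shows "\<exists>x. x \<in> Cau \<and> \<xi> = cls x \<and> (\<forall>n. v (x n \<ominus> \<one>) < 1)"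
proof -
  obtain x where x: "x \<in> Cau" "\<xi> = cls x" using CF_ex [OF U1_CF [OF assms]] by blast
  have C: "(\<lambda>n. x n \<ominus> \<one>) \<in> Cau" using Cau_diff [OF x(1) Cau_const [of \<one>]] by simp
  have "completion_abs F v (cls (\<lambda>n. x n \<ominus> \<one>)) < 1" using assms x U1_cls_iff by blast
  then obtain N where N: "\<forall>n\<ge>N. v (x n \<ominus> \<one>) < 1" using completion_abs_less_ev [OF C] by blast
  \<comment> \<open>The early terms are replaced by 1, so that the bound holds for every index and
    not only eventually.\<close>
  define y where "y n = (if n \<ge> N then x n else \<one>)" for n
  have yc: "y n \<in> carrier F" for n using x by (simp add: y_def)
  have y: "y \<in> Cau" "cls y = cls x" using cls_cong_ev [of x y N, OF x(1) yc] by (simp_all add: y_def)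
  have "v (y n \<ominus> \<one>) < 1" for n using N by (simp add: y_def)
  then show ?thesis using y x by auto
qed

lemma U1_abs_tendsto:
  assumes "x \<in> Cau" shows "(\<lambda>n. v (x n \<ominus> \<one>)) \<longlonglongrightarrow> completion_abs F v (cls (\<lambda>n. x n \<ominus> \<one>))"
  by (rule lim_v_tendsto) (use Cau_diff [OF assms Cau_const [of \<one>]] in simp)

lemma U1_mult_closed:
  assumes "\<xi> \<in> carrier U1" "\<eta> \<in> carrier U1" shows "\<xi> \<otimes>\<^bsub>CF\<^esub> \<eta> \<in> carrier U1"
proof -
  obtain x where x: "x \<in> Cau" "\<xi> = cls x" "\<And>n. v (x n \<ominus> \<one>) < 1" using U1_ex assms(1) by blast
  obtain y where y: "y \<in> Cau" "\<eta> = cls y" "\<And>n. v (y n \<ominus> \<one>) < 1" using U1_ex assms(2) by blast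
  have xy: "(\<lambda>n. x n \<otimes> y n) \<in> Cau" using x y Cau_mult by blast
  have vx: "v (x n) = 1" for n using v_near_one [of "x n"] x by simp
  have le: "v (x n \<otimes> y n \<ominus> \<one>) \<le> max (v (x n \<ominus> \<one>)) (v (y n \<ominus> \<one>))" for n
    using v_mult_diff [of "x n" "y n" \<one> \<one>] x y vx by (simp add: max.commute)
  have "completion_abs F v (cls (\<lambda>n. x n \<otimes> y n \<ominus> \<one>))
     \<le> max (completion_abs F v (cls (\<lambda>n. x n \<ominus> \<one>))) (completion_abs F v (cls (\<lambda>n. y n \<ominus> \<one>)))"
    by (rule LIMSEQ_le [OF U1_abs_tendsto [OF xy] tendsto_max [OF U1_abs_tendsto [OF x(1)] U1_abs_tendsto [OF y(1)]]])
       (use le in blast)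
  then have "completion_abs F v (cls (\<lambda>n. x n \<otimes> y n \<ominus> \<one>)) < 1"
    using assms x y U1_cls_iff by fastforce
  then show ?thesis using x y xy U1_cls_iff cls_mult by simp
qed

lemma Cau_inv:
  assumes "x \<in> Cau" "\<And>n. v (x n) = 1"
  shows "(\<lambda>n. inv (x n)) \<in> Cau" "cls (\<lambda>n. inv (x n)) \<otimes>\<^bsub>CF\<^esub> cls x = \<one>\<^bsub>CF\<^esub>"
proof -
  have xU: "x n \<in> Units F" for n
    using Cau_carrier [OF assms(1), of n] assms(2) [of n] by (auto simp: field_Units)
  show C: "(\<lambda>n. inv (x n)) \<in> Cau" unfolding Cau_iff
  proof (intro conjI allI impI)
    fix e :: real assume "e > 0"
    then obtain M where M: "\<forall>m\<ge>M. \<forall>n\<ge>M. v (x m \<ominus> x n) < e" using assms(1) unfolding Cau_iff by meson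
    have "v (inv (x m) \<ominus> inv (x n)) = v (x m \<ominus> x n)" for m n
    proof -
      have "inv (x m) \<ominus> inv (x n) = inv (x m) \<otimes> inv (x n) \<otimes> (x n \<ominus> x m)"
      proof -
        have "inv (x m) \<otimes> inv (x n) \<otimes> (x n \<ominus> x m) =
          inv (x m) \<otimes> (x n \<otimes> inv (x n)) \<ominus> inv (x n) \<otimes> (x m \<otimes> inv (x m))"
          using Units_closed [OF xU] Units_inv_closed [OF xU] by algebra
        then show ?thesis using xU by simp
      qed
      then show ?thesis using xU assms v_diff_commute [of "x n" "x m"] by (simp add: v_inv)
    qed
    then show "\<exists>N. \<forall>m\<ge>N. \<forall>n\<ge>N. v (inv (x m) \<ominus> inv (x n)) < e" using M by auto
  qed (use xU in auto)
  show "cls (\<lambda>n. inv (x n)) \<otimes>\<^bsub>CF\<^esub> cls x = \<one>\<^bsub>CF\<^esub>"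
    unfolding cls_mult [OF C assms(1)] cls_one using xU by simp
qed

lemma U1_inv_ex:
  assumes "\<xi> \<in> carrier U1" shows "\<exists>\<eta>\<in>carrier U1. \<eta> \<otimes>\<^bsub>CF\<^esub> \<xi> = \<one>\<^bsub>CF\<^esub>"
proof -
  obtain x where x: "x \<in> Cau" "\<xi> = cls x" "\<And>n. v (x n \<ominus> \<one>) < 1" using U1_ex assms(1) by blast
  have vx: "v (x n) = 1" for n using v_near_one [of "x n"] x by simp
  note C = Cau_inv [OF x(1) vx]
  have "v (inv (x n) \<ominus> \<one>) = v (x n \<ominus> \<one>)" for n using v_inv_sub_one [of "x n"] x by simp
  then have "(\<lambda>n. v (inv (x n) \<ominus> \<one>)) = (\<lambda>n. v (x n \<ominus> \<one>))" by simp
  then have "completion_abs F v (cls (\<lambda>n. inv (x n) \<ominus> \<one>)) = completion_abs F v (cls (\<lambda>n. x n \<ominus> \<one>))"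
    using U1_abs_tendsto [OF C(1)] U1_abs_tendsto [OF x(1)] LIMSEQ_unique by metis
  then have "cls (\<lambda>n. inv (x n)) \<in> carrier U1" using U1_cls_iff [OF C(1)] U1_cls_iff [OF x(1)] assms x(2) by simp
  then show ?thesis using C(2) x(2) by blast
qed

lemma U1_comm_group: "comm_group U1"
proof (rule comm_groupI)
  show "\<one>\<^bsub>U1\<^esub> \<in> carrier U1" using U1_I [of "\<lambda>n. \<one>" 0 0] by (simp add: cls_one)
  fix x y z assume x: "x \<in> carrier U1" and y: "y \<in> carrier U1"
  show "x \<otimes>\<^bsub>U1\<^esub> y \<in> carrier U1" using U1_mult_closed x y by simp
  show "x \<otimes>\<^bsub>U1\<^esub> y = y \<otimes>\<^bsub>U1\<^esub> x" using x y by (simp add: U1_CF CF.m_comm)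
  show "\<one>\<^bsub>U1\<^esub> \<otimes>\<^bsub>U1\<^esub> x = x" using x by (simp add: U1_CF)
  show "\<exists>y\<in>carrier U1. y \<otimes>\<^bsub>U1\<^esub> x = \<one>\<^bsub>U1\<^esub>" using U1_inv_ex x by simp
  assume z: "z \<in> carrier U1"
  show "x \<otimes>\<^bsub>U1\<^esub> y \<otimes>\<^bsub>U1\<^esub> z = x \<otimes>\<^bsub>U1\<^esub> (y \<otimes>\<^bsub>U1\<^esub> z)" using x y z by (simp add: U1_CF CF.m_assoc)
qed

sublocale U1: comm_group U1 by (rule U1_comm_group)

text \<open>Raising to a power prime to \<open>p\<close> preserves the distance of a one-unit from
  1. This is the uniqueness behind \<open>principal_part\<close>.\<close>

lemma U1_torsion:
  assumes "\<xi> \<in> carrier U1" "\<xi> [^]\<^bsub>CF\<^esub> (n::nat) = \<one>\<^bsub>CF\<^esub>" "coprime n p" shows "\<xi> = \<one>\<^bsub>CF\<^esub>"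
proof -
  obtain x where x: "x \<in> Cau" "\<xi> = cls x" "\<And>n. v (x n \<ominus> \<one>) < 1" using U1_ex assms(1) by blast
  have "cls (\<lambda>m. x m [^] n) = cls (\<lambda>m. \<one>)" using assms(2) cls_nat_pow [OF x(1)] x(2) cls_one by simp
  then have "(\<lambda>m. v (x m [^] n \<ominus> \<one>)) \<longlonglongrightarrow> 0" using cls_nat_pow [OF x(1)] cls_eq_iff [of "\<lambda>m. x m [^] n" "\<lambda>m. \<one>"] by simp
  then have "(\<lambda>m. v (x m \<ominus> \<one>)) \<longlonglongrightarrow> 0" using v_pow_coprime_sub_one assms(3) x by simp
  then show ?thesis using cls_eq_iff [of x "\<lambda>m. \<one>"] x cls_one by simp
qed

text \<open>Its limit in the completion is the principal part of \<open>u\<close> raised to the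
  p-adic integer represented by \<open>k\<close>; see \<open>padic_pow_eq\<close>.\<close>

definition unit_seq :: "'a \<Rightarrow> (nat \<Rightarrow> int) \<Rightarrow> nat \<Rightarrow> 'a" where
  "unit_seq u k n = upow u (tame_exp p n * k n)"

lemma unit_seq_carrier [simp]: "u \<in> Units F \<Longrightarrow> unit_seq u k n \<in> carrier F"
  by (simp add: unit_seq_def)

lemma tame_bound_power_less:
  assumes "tame N u" "e > 0" shows "\<exists>r. tame_bound N u ^ Suc r < e"
proof -
  obtain r where r: "tame_bound N u ^ r < e"
    using real_arch_pow_inv [OF assms(2)] tame_bound [OF assms(1)] by blast
  have "tame_bound N u ^ Suc r \<le> tame_bound N u ^ r"
    using tame_bound [OF assms(1)] by (intro power_decreasing) auto
  then show ?thesis using r le_less_trans by blast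
qed

lemma unit_seq_near_one:
  assumes "tame N u" "n \<ge> N" shows "v (unit_seq u k n \<ominus> \<one>) \<le> tame_bound N u"
proof -
  have "int N dvd tame_exp p n" using assms tame_N_pos tame_exp(2) unfolding tame_def by blast
  then show ?thesis using tame_close [OF assms(1), of "tame_exp p n * k n" 0] by (simp add: unit_seq_def)
qed

lemma unit_seq_Cau:
  assumes "tame N u" "padic_cauchy p k" shows "unit_seq u k \<in> Cau"
proof (rule CauI)
  show "unit_seq u k n \<in> carrier F" for n using assms tame_Units by simp
  fix e :: real assume "e > 0"
  then obtain r where r: "tame_bound N u ^ Suc r < e" using tame_bound_power_less assms(1) by blast
  obtain M where M: "\<forall>m\<ge>M. \<forall>n\<ge>M. int p ^ r dvd k m - k n" using assms(2) unfolding padic_cauchy_def by blast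
  \<comment> \<open>\<open>M\<close> controls the exponents \<open>k\<close>, \<open>N\<close> makes
    \<open>tame_exp\<close> divisible by \<open>N\<close>, and \<open>r\<close> makes it congruent
    to 1 modulo \<open>p ^ r\<close>.\<close>
  define K where "K = max (max M N) r"
  have "v (unit_seq u k n \<ominus> unit_seq u k K) < e" if n: "n \<ge> K" for n
  proof -
    have "int N dvd tame_exp p n" "int N dvd tame_exp p K"
      using assms(1) n tame_N_pos tame_exp(2) unfolding tame_def K_def by auto
    then have 1: "int N dvd tame_exp p n * k n - tame_exp p K * k K" by simp
    have "int p ^ r dvd tame_exp p m - 1" if "m \<ge> r" for m
      using tame_exp(1) [of p m] that le_imp_power_dvd dvd_trans by blast
    then have "int p ^ r dvd tame_exp p n - 1" "int p ^ r dvd tame_exp p K - 1" using n by (auto simp: K_def)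
    moreover have "int p ^ r dvd k n - k K" using M n by (auto simp: K_def)
    moreover have "tame_exp p n * k n - tame_exp p K * k K =
      (tame_exp p n - 1) * k n - (tame_exp p K - 1) * k K + (k n - k K)" by (simp add: algebra_simps)
    ultimately have 2: "int p ^ r dvd tame_exp p n * k n - tame_exp p K * k K"
      by (metis dvd_add dvd_diff dvd_mult2)
    show ?thesis using tame_diff [OF assms(1) 1 2] r by (simp add: unit_seq_def)
  qed
  then show "\<exists>N. \<forall>n\<ge>N. v (unit_seq u k n \<ominus> unit_seq u k N) < e" by blast
qed

lemma unit_seq_U1:
  assumes "tame N u" "padic_cauchy p k" shows "cls (unit_seq u k) \<in> carrier U1"
  by (rule U1_I [OF unit_seq_Cau [OF assms], of N "tame_bound N u"])
     (use unit_seq_near_one [OF assms(1)] tame_bound [OF assms(1)] in auto)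

lemma unit_seq_add:
  assumes "tame N u" "padic_cauchy p k" "padic_cauchy p l"
  shows "cls (unit_seq u (\<lambda>n. k n + l n)) = cls (unit_seq u k) \<otimes>\<^bsub>CF\<^esub> cls (unit_seq u l)"
proof -
  have "unit_seq u (\<lambda>n. k n + l n) = (\<lambda>n. unit_seq u k n \<otimes> unit_seq u l n)"
    unfolding unit_seq_def using upow_add tame_Units [OF assms(1)] by (simp add: distrib_left)
  then show ?thesis using cls_mult unit_seq_Cau assms by metis
qed

lemma unit_seq_mult:
  assumes "tame N u" "tame M w" "padic_cauchy p k"
  shows "cls (unit_seq (u \<otimes> w) k) = cls (unit_seq u k) \<otimes>\<^bsub>CF\<^esub> cls (unit_seq w k)"
proof -
  have "unit_seq (u \<otimes> w) k = (\<lambda>n. unit_seq u k n \<otimes> unit_seq w k n)"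
    unfolding unit_seq_def using upow_mult tame_Units assms by simp
  then show ?thesis using cls_mult unit_seq_Cau assms by metis
qed

lemma unit_seq_cong:
  assumes "tame N u" "padic_cauchy p k" "padic_cauchy p l" "padic_null p (\<lambda>n. k n - l n)"
  shows "cls (unit_seq u k) = cls (unit_seq u l)"
proof -
  have "(\<lambda>n. v (unit_seq u k n \<ominus> unit_seq u l n)) \<longlonglongrightarrow> 0"
  proof (rule LIMSEQ_I)
    fix e :: real assume "e > 0"
    then obtain r where r: "tame_bound N u ^ Suc r < e" using tame_bound_power_less assms(1) by blast
    obtain M where M: "\<forall>n\<ge>M. int p ^ r dvd k n - l n" using assms(4) unfolding padic_null_def by blast
    have "v (unit_seq u k n \<ominus> unit_seq u l n) < e" if n: "n \<ge> max M N" for n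
    proof -
      have "int N dvd tame_exp p n" using assms(1) n tame_N_pos tame_exp(2) unfolding tame_def by auto
      then have 1: "int N dvd tame_exp p n * k n - tame_exp p n * l n" by simp
      have "int p ^ r dvd k n - l n" using M n by auto
      then have 2: "int p ^ r dvd tame_exp p n * k n - tame_exp p n * l n"
        by (metis dvd_mult right_diff_distrib)
      show ?thesis using tame_diff [OF assms(1) 1 2] r by (simp add: unit_seq_def)
    qed
    then show "\<exists>no. \<forall>n\<ge>no. norm (v (unit_seq u k n \<ominus> unit_seq u l n) - 0) < e"
      using tame_Units [OF assms(1)] by (intro exI[of _ "max M N"]) auto
  qed
  then show ?thesis using cls_eq_iff unit_seq_Cau assms by blast
qed

lemma unit_seq_int_pow:
  assumes "tame N u" "padic_cauchy p k"
  shows "cls (unit_seq u k) [^]\<^bsub>U1\<^esub> (j::int) = cls (unit_seq u (\<lambda>n. k n * j))"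
proof -
  have C: "padic_cauchy p (\<lambda>n. k n * i)" for i using padic_cauchy_mult [OF assms(2) padic_cauchy_const] by blast
  have add: "cls (unit_seq u (\<lambda>n. k n * (i + l))) =
    cls (unit_seq u (\<lambda>n. k n * i)) \<otimes>\<^bsub>U1\<^esub> cls (unit_seq u (\<lambda>n. k n * l))" for i l
    using unit_seq_add [OF assms(1) C C, of i l] by (simp add: distrib_left)
  show ?thesis
    using U1.int_pow_unique [of "\<lambda>i. cls (unit_seq u (\<lambda>n. k n * i))" j, OF unit_seq_U1 [OF assms(1) C] add]
    by simp
qed

text \<open>The exponents \<open>N\<close> and \<open>tame_exp p n * N\<close> are both divisible by
  \<open>N\<close> and agree modulo \<open>p ^ n\<close>, so the two powers of \<open>u\<close>
  approach each other. Hence \<open>u\<close> divided by the limit of its unit sequence is a root of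
  unity of order dividing \<open>N\<close>.\<close>

lemma cls_const_pow:
  assumes "tame N u"
  shows "cls (\<lambda>n. u) [^]\<^bsub>CF\<^esub> N = cls (unit_seq u (\<lambda>_. 1)) [^]\<^bsub>CF\<^esub> N"
proof -
  have u: "u \<in> Units F" "u \<in> carrier F" using assms tame_Units by auto
  have uC: "(\<lambda>n. u) \<in> Cau" using u by simp
  have etaC: "unit_seq u (\<lambda>_. 1) \<in> Cau" using unit_seq_Cau assms by simp
  have "(\<lambda>n. v (u [^] N \<ominus> unit_seq u (\<lambda>_. 1) n [^] N)) \<longlonglongrightarrow> 0"
  proof (rule LIMSEQ_I)
    fix e :: real assume "e > 0"
    then obtain r where r: "tame_bound N u ^ Suc r < e" using tame_bound_power_less assms(1) by blast
    have "v (u [^] N \<ominus> unit_seq u (\<lambda>_. 1) n [^] N) < e" if n: "n \<ge> r" for n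
    proof -
      have e: "unit_seq u (\<lambda>_. 1) n [^] N = upow u (tame_exp p n * int N)"
        using upow_upow [OF u(1), of "tame_exp p n" "int N"] upow_int [of "upow u (tame_exp p n)" N] u
        by (simp add: unit_seq_def)
      have "int p ^ r dvd tame_exp p n - 1"
        using tame_exp(1) [of p n] n le_imp_power_dvd dvd_trans by blast
      then have 2: "int p ^ r dvd int N - tame_exp p n * int N"
        by (metis dvd_diff_commute dvd_mult2 left_diff_distrib mult_1)
      have 1: "int N dvd int N - tame_exp p n * int N" by simp
      show ?thesis using tame_diff [OF assms(1) 1 2] r upow_int [OF u(1), of N] e by simp
    qed
    then show "\<exists>no. \<forall>n\<ge>no. norm (v (u [^] N \<ominus> unit_seq u (\<lambda>_. 1) n [^] N) - 0) < e"
      using u by (intro exI[of _ r]) auto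
  qed
  then show ?thesis
    using cls_nat_pow [OF uC, of N] cls_nat_pow [OF etaC, of N] cls_eq_iff [of "\<lambda>n. u [^] N" "\<lambda>n. unit_seq u (\<lambda>_. 1) n [^] N"]
    by simp
qed

lemma principal_part_eq:
  assumes "tame N u"
  shows "principal_part p F v (completion_embed F v u) = cls (unit_seq u (\<lambda>_. 1))"
  unfolding principal_part_def
proof (rule the_equality)
  let ?\<eta> = "cls (unit_seq u (\<lambda>_. 1))"
  have u: "u \<in> Units F" "u \<in> carrier F" using assms tame_Units by auto
  have etaC: "unit_seq u (\<lambda>_. 1) \<in> Cau" using unit_seq_Cau assms by simp
  have eta: "?\<eta> \<in> carrier U1" using unit_seq_U1 assms by simp
  obtain \<rho> where \<rho>: "\<rho> \<in> carrier U1" "\<rho> \<otimes>\<^bsub>CF\<^esub> ?\<eta> = \<one>\<^bsub>CF\<^esub>" using U1_inv_ex [OF eta] by blast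
  \<comment> \<open>The candidate for the root of unity: \<open>u\<close> divided by the one-unit
    \<open>?\<eta>\<close>.\<close>
  define \<zeta> where "\<zeta> = cls (\<lambda>n. u) \<otimes>\<^bsub>CF\<^esub> \<rho>"
  have uC: "(\<lambda>n. u) \<in> Cau" using u by simp
  have \<zeta>C: "\<zeta> \<in> carrier CF" unfolding \<zeta>_def using \<rho> U1_CF uC by simp
  have eq: "completion_embed F v u = \<zeta> \<otimes>\<^bsub>CF\<^esub> ?\<eta>"
    unfolding \<zeta>_def completion_embed_eq using \<rho> U1_CF uC etaC by (simp add: CF.m_assoc)
  have "cls (\<lambda>n. u) [^]\<^bsub>CF\<^esub> N = ?\<eta> [^]\<^bsub>CF\<^esub> N" by (rule cls_const_pow [OF assms])
  then have "\<zeta> [^]\<^bsub>CF\<^esub> N = (\<rho> \<otimes>\<^bsub>CF\<^esub> ?\<eta>) [^]\<^bsub>CF\<^esub> N"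
    unfolding \<zeta>_def using U1_CF [OF \<rho>(1)] cls_closed [OF uC] cls_closed [OF etaC]
    by (simp only: CF.nat_pow_distrib CF.m_comm [of "\<rho> [^]\<^bsub>CF\<^esub> N"] CF.nat_pow_closed)
  then have "\<zeta> [^]\<^bsub>CF\<^esub> N = \<one>\<^bsub>CF\<^esub>" using \<rho> by simp
  then show "?\<eta> \<in> carrier U1 \<and> (\<exists>\<zeta>\<in>carrier CF. \<exists>m::nat. coprime m p \<and> \<zeta> [^]\<^bsub>CF\<^esub> m = \<one>\<^bsub>CF\<^esub> \<and>
      completion_embed F v u = \<zeta> \<otimes>\<^bsub>CF\<^esub> ?\<eta>)"
    using eta \<zeta>C eq assms unfolding tame_def by blast
  fix \<eta>' assume "\<eta>' \<in> carrier U1 \<and> (\<exists>\<zeta>\<in>carrier CF. \<exists>m::nat. coprime m p \<and> \<zeta> [^]\<^bsub>CF\<^esub> m = \<one>\<^bsub>CF\<^esub> \<and>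
      completion_embed F v u = \<zeta> \<otimes>\<^bsub>CF\<^esub> \<eta>')"
  then obtain \<zeta>' m where m: "\<eta>' \<in> carrier U1" "\<zeta>' \<in> carrier CF" "coprime m p" "\<zeta>' [^]\<^bsub>CF\<^esub> m = \<one>\<^bsub>CF\<^esub>"
    "completion_embed F v u = \<zeta>' \<otimes>\<^bsub>CF\<^esub> \<eta>'" by blast
  \<comment> \<open>\<open>M\<close> kills both roots of unity, so the two one-units have the same
    \<open>M\<close>-th power and their quotient is torsion of order prime to
    \<open>p\<close>.\<close>
  define M where "M = N * m"
  have cM: "coprime M p" using m assms unfolding M_def tame_def by simp
  have z1: "\<zeta> [^]\<^bsub>CF\<^esub> M = \<one>\<^bsub>CF\<^esub>" unfolding M_def using \<open>\<zeta> [^]\<^bsub>CF\<^esub> N = \<one>\<^bsub>CF\<^esub>\<close> \<zeta>C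
    by (simp add: CF.nat_pow_pow [symmetric])
  have z2: "\<zeta>' [^]\<^bsub>CF\<^esub> M = \<one>\<^bsub>CF\<^esub>" unfolding M_def using m
    by (simp add: mult.commute [of N] CF.nat_pow_pow [symmetric])
  have mc: "\<eta>' \<in> carrier CF" "?\<eta> \<in> carrier CF" "\<rho> \<in> carrier CF" using m eta \<rho> U1_CF by auto
  have "(\<zeta> \<otimes>\<^bsub>CF\<^esub> ?\<eta>) [^]\<^bsub>CF\<^esub> M = (\<zeta>' \<otimes>\<^bsub>CF\<^esub> \<eta>') [^]\<^bsub>CF\<^esub> M" using eq m(5) by simp
  then have e1: "?\<eta> [^]\<^bsub>CF\<^esub> M = \<eta>' [^]\<^bsub>CF\<^esub> M"
    using z1 z2 mc \<zeta>C m(2) by (simp add: CF.nat_pow_distrib)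
  have "(\<rho> \<otimes>\<^bsub>CF\<^esub> \<eta>') [^]\<^bsub>CF\<^esub> M = (\<rho> \<otimes>\<^bsub>CF\<^esub> ?\<eta>) [^]\<^bsub>CF\<^esub> M"
    using e1 mc by (simp add: CF.nat_pow_distrib)
  then have "(\<rho> \<otimes>\<^bsub>CF\<^esub> \<eta>') [^]\<^bsub>CF\<^esub> M = \<one>\<^bsub>CF\<^esub>" using \<rho> by simp
  then have "\<rho> \<otimes>\<^bsub>CF\<^esub> \<eta>' = \<one>\<^bsub>CF\<^esub>" using U1_torsion cM U1_mult_closed m(1) \<rho>(1) by blast
  then have "?\<eta> \<otimes>\<^bsub>CF\<^esub> (\<rho> \<otimes>\<^bsub>CF\<^esub> \<eta>') = ?\<eta>" using mc by simp
  then show "\<eta>' = ?\<eta>" using \<rho>(2) mc by (metis CF.l_one CF.m_assoc CF.m_comm)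
qed

text \<open>For an integer exponent \<open>l n\<close> the power is again the class of a unit
  sequence, with constant exponent. \<open>tame_diff\<close> compares it with
  \<open>unit_seq u l\<close> uniformly in the inner index, and by \<open>unit_seq_cong\<close> all
  integer sequences with the same p-adic limit lead to the same class.\<close>

lemma padic_pow_eq:
  assumes "tame N u" "padic_cauchy p k"
  shows "padic_pow p F v (cls (unit_seq u (\<lambda>_. 1))) (padic_class p k) = cls (unit_seq u k)"
  unfolding padic_pow_def
proof (rule the_equality)
  let ?\<xi> = "cls (unit_seq u (\<lambda>_. 1))"
  let ?T = "\<lambda>l. completion_tendsto rat_field (padic_abs p)
          (\<lambda>n. completion_embed rat_field (padic_abs p) (of_int (l n))) (padic_class p k)"
  have u: "u \<in> Units F" "u \<in> carrier F" using assms tame_Units by auto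
  have T: "?T l \<longleftrightarrow> padic_cauchy p l \<and> padic_class p l = padic_class p k" for l
    using padic_tendsto_embed_iff [OF prime_p padic_class_in_completion [OF prime_p assms(2)]] .
  have lim: "completion_tendsto F v (\<lambda>n. ?\<xi> [^]\<^bsub>U1\<^esub> l n) (cls (unit_seq u l))" if l: "padic_cauchy p l" for l
  proof -
    have e: "?\<xi> [^]\<^bsub>U1\<^esub> l n = cls (unit_seq u (\<lambda>_. l n))" for n
      using unit_seq_int_pow [OF assms(1), of "\<lambda>_. 1" "l n"] by simp
    have C: "(\<lambda>m. unit_seq u (\<lambda>_. l n) m \<ominus> unit_seq u l m) \<in> Cau" for n
      using Cau_diff [OF unit_seq_Cau unit_seq_Cau] assms(1) l by auto
    have "(\<lambda>n. completion_abs F v (cls (\<lambda>m. unit_seq u (\<lambda>_. l n) m \<ominus> unit_seq u l m))) \<longlonglongrightarrow> 0"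
    proof (rule LIMSEQ_I)
      fix e :: real assume "e > 0"
      then obtain r where r: "tame_bound N u ^ Suc r < e" using tame_bound_power_less assms(1) by blast
      obtain M where M: "\<forall>m\<ge>M. \<forall>n\<ge>M. int p ^ r dvd l m - l n" using l unfolding padic_cauchy_def by blast
      have "completion_abs F v (cls (\<lambda>m. unit_seq u (\<lambda>_. l n) m \<ominus> unit_seq u l m)) \<le> tame_bound N u ^ Suc r"
        if n: "n \<ge> M" for n
      proof (rule completion_abs_le [OF C, of "max M N"])
        fix m assume m: "m \<ge> max M N"
        have "int N dvd tame_exp p m" using assms(1) m tame_N_pos tame_exp(2) unfolding tame_def by auto
        then have 1: "int N dvd tame_exp p m * l n - tame_exp p m * l m" by simp
        have "int p ^ r dvd l n - l m" using M n m by auto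
        then have 2: "int p ^ r dvd tame_exp p m * l n - tame_exp p m * l m"
          by (metis dvd_mult right_diff_distrib)
        show "v (unit_seq u (\<lambda>_. l n) m \<ominus> unit_seq u l m) \<le> tame_bound N u ^ Suc r"
          using tame_diff [OF assms(1) 1 2] by (simp add: unit_seq_def)
      qed
      then show "\<exists>no. \<forall>n\<ge>no. norm (completion_abs F v (cls (\<lambda>m. unit_seq u (\<lambda>_. l n) m \<ominus> unit_seq u l m)) - 0) < e"
        using completion_abs_nonneg [OF cls_closed [OF C]] r by (intro exI[of _ M]) fastforce
    qed
    then show ?thesis
      unfolding e using completion_tendsto_cls [of "\<lambda>n. unit_seq u (\<lambda>_. l n)" "unit_seq u l"] unit_seq_Cau assms(1) l by auto
  qed
  show "cls (unit_seq u k) \<in> carrier U1 \<and> (\<forall>l. ?T l \<longrightarrow> completion_tendsto F v (\<lambda>n. ?\<xi> [^]\<^bsub>U1\<^esub> l n) (cls (unit_seq u k)))"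
  proof (intro conjI allI impI)
    show "cls (unit_seq u k) \<in> carrier U1" using unit_seq_U1 assms by blast
    fix l assume "?T l"
    then have l: "padic_cauchy p l" "padic_class p l = padic_class p k" using T by auto
    then have "padic_null p (\<lambda>n. l n - k n)" using padic_class_eq_iff [OF prime_p l(1) assms(2)] by simp
    then have "cls (unit_seq u l) = cls (unit_seq u k)" using unit_seq_cong assms l by blast
    then show "completion_tendsto F v (\<lambda>n. ?\<xi> [^]\<^bsub>U1\<^esub> l n) (cls (unit_seq u k))" using lim [OF l(1)] by simp
  qed
  fix \<eta> assume \<eta>: "\<eta> \<in> carrier U1 \<and> (\<forall>l. ?T l \<longrightarrow> completion_tendsto F v (\<lambda>n. ?\<xi> [^]\<^bsub>U1\<^esub> l n) \<eta>)"
  then have 1: "completion_tendsto F v (\<lambda>n. ?\<xi> [^]\<^bsub>U1\<^esub> k n) \<eta>" using T assms by blast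
  have "?\<xi> \<in> carrier U1" using unit_seq_U1 assms by simp
  then have "?\<xi> [^]\<^bsub>U1\<^esub> k n \<in> carrier CF" for n using U1_CF U1.int_pow_closed by blast
  then show "\<eta> = cls (unit_seq u k)"
    using completion_tendsto_unique [OF _ _ _ 1 lim [OF assms(2)]] \<eta> U1_CF unit_seq_U1 assms by blast
qed

end

section \<open>Algebraic integers and their units\<close>

context cring
begin

section \<open>Additive groups generated by powers, and integrality\<close>

abbreviation addgen :: "'a set \<Rightarrow> 'a set" where "addgen \<equiv> generate (add_monoid R)"

lemma addgen_closed: "S \<subseteq> carrier R \<Longrightarrow> x \<in> addgen S \<Longrightarrow> x \<in> carrier R"
  using add.generate_in_carrier [of S x] by simp

lemma addgen_zero: "\<zero> \<in> addgen S"
  using generate.one [of "add_monoid R" S] by simp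

lemma addgen_add: "\<lbrakk>x \<in> addgen S; y \<in> addgen S\<rbrakk> \<Longrightarrow> x \<oplus> y \<in> addgen S"
  using generate.eng [of x "add_monoid R" S y] by simp

lemma addgen_minus: "\<lbrakk>S \<subseteq> carrier R; x \<in> addgen S\<rbrakk> \<Longrightarrow> \<ominus> x \<in> addgen S"
  using add.generate_m_inv_closed [of S x] by (simp add: a_inv_def)

lemma addgen_add_pow: "\<lbrakk>S \<subseteq> carrier R; x \<in> addgen S\<rbrakk> \<Longrightarrow> [(k::int)] \<cdot> x \<in> addgen S"
  using add.generate_int_pow [of S x k] by simp

lemma addgen_subset:
  assumes "S \<subseteq> addgen T" "T \<subseteq> carrier R" shows "addgen S \<subseteq> addgen T"
  using add.generate_subgroup_incl [OF assms(1)] add.generate_is_subgroup [of T] assms(2) by simp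

lemma addgen_induct [consumes 2, case_names zero base minus add]:
  assumes "x \<in> addgen S" "S \<subseteq> carrier R"
    and "P \<zero>" "\<And>s. s \<in> S \<Longrightarrow> P s" "\<And>s. s \<in> S \<Longrightarrow> P (\<ominus> s)"
    and "\<And>x y. \<lbrakk>x \<in> addgen S; y \<in> addgen S; P x; P y\<rbrakk> \<Longrightarrow> P (x \<oplus> y)"
  shows "P x"
  using assms(1)
  by induction (use assms in \<open>auto simp: a_inv_def\<close>)

lemma addgen_mult_right:
  assumes "x \<in> addgen S" "S \<subseteq> carrier R" "c \<in> carrier R"
  shows "x \<otimes> c \<in> addgen ((\<lambda>s. s \<otimes> c) ` S)"
  using assms(1,2)
proof (induction rule: addgen_induct)
  case zero
  then show ?case using assms addgen_zero by simp
next
  case (base s)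
  then show ?case by (intro generate.incl) auto
next
  case (minus s)
  have "\<ominus> (s \<otimes> c) \<in> addgen ((\<lambda>s. s \<otimes> c) ` S)"
    by (rule addgen_minus) (use minus assms in \<open>auto intro: generate.incl\<close>)
  then show ?case using minus assms by (simp add: l_minus subsetD)
next
  case (add x y)
  then show ?case using assms addgen_closed by (simp add: l_distr addgen_add)
qed

lemma addgen_mult:
  assumes "x \<in> addgen S" "S \<subseteq> carrier R" "y \<in> addgen T" "T \<subseteq> carrier R"
  shows "x \<otimes> y \<in> addgen ((\<lambda>(s, t). s \<otimes> t) ` (S \<times> T))" (is "_ \<in> addgen ?M")
proof -
  have M: "?M \<subseteq> carrier R" using assms by auto
  have xc: "x \<in> carrier R" using assms addgen_closed by blast
  have base: "x \<otimes> t \<in> addgen ?M" if "t \<in> T" for t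
  proof -
    have "x \<otimes> t \<in> addgen ((\<lambda>s. s \<otimes> t) ` S)" using addgen_mult_right assms that by blast
    moreover have "addgen ((\<lambda>s. s \<otimes> t) ` S) \<subseteq> addgen ?M"
      by (rule addgen_subset [OF _ M]) (use that in \<open>auto intro!: generate.incl\<close>)
    ultimately show ?thesis by blast
  qed
  show ?thesis
    using assms(3,4)
  proof (induction rule: addgen_induct)
    case (minus t)
    then show ?case using base [of t] M addgen_minus assms xc by (simp add: r_minus subsetD)
  next
    case (add y z)
    then show ?case using assms addgen_closed xc by (simp add: r_distr addgen_add)
  qed (use base addgen_zero xc in auto)
qed

lemma integral_over_iff:
  assumes "x \<in> carrier R" "\<one> \<noteq> \<zero>"
  shows "integral_over R (range ofi) x \<longleftrightarrow>
    (\<exists>cs. set cs \<subseteq> range ofi \<and> x [^] length cs \<oplus> eval cs x = \<zero>)"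
proof
  assume "integral_over R (range ofi) x"
  then obtain f where f: "f \<in> carrier ((range ofi)[X]\<^bsub>R\<^esub>)" "f \<noteq> []" "hd f = \<one>" "eval f x = \<zero>"
    unfolding integral_over_def by blast
  then obtain cs where cs: "f = \<one> # cs" by (cases f) auto
  have "set cs \<subseteq> range ofi" using f(1) unfolding cs univ_poly_carrier [symmetric] polynomial_def by auto
  then show "\<exists>cs. set cs \<subseteq> range ofi \<and> x [^] length cs \<oplus> eval cs x = \<zero>"
    using f(4) assms unfolding cs by auto
next
  assume "\<exists>cs. set cs \<subseteq> range ofi \<and> x [^] length cs \<oplus> eval cs x = \<zero>"
  then obtain cs where cs: "set cs \<subseteq> range ofi" "x [^] length cs \<oplus> eval cs x = \<zero>" by blast
  have "\<one> \<in> range ofi" by (metis ofi_1 rangeI)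
  then have "\<one> # cs \<in> carrier ((range ofi)[X]\<^bsub>R\<^esub>)"
    using cs assms unfolding univ_poly_carrier [symmetric] polynomial_def by auto
  then show "integral_over R (range ofi) x"
    unfolding integral_over_def using cs(2) assms by (intro bexI[of _ "\<one> # cs"]) auto
qed

lemma eval_in_addgen:
  assumes "x \<in> carrier R" "set cs \<subseteq> range ofi"
  shows "eval cs x \<in> addgen ((\<lambda>i::nat. x [^] i) ` {..<length cs})"
  using assms(2)
proof (induction cs)
  case Nil
  then show ?case using addgen_zero by simp
next
  case (Cons c cs)
  let ?S = "(\<lambda>i::nat. x [^] i) ` {..<length (c # cs)}"
  obtain k where k: "c = ofi k" using Cons by auto
  have S: "?S \<subseteq> carrier R" using assms by auto
  have "[k] \<cdot> (x [^] length cs) \<in> addgen ?S"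
    by (rule addgen_add_pow [OF S]) (auto intro!: generate.incl)
  then have "c \<otimes> x [^] length cs \<in> addgen ?S" using k assms add_pow_eq_ofi [of "x [^] length cs" k] by simp
  moreover have "eval cs x \<in> addgen ?S"
  proof -
    have "eval cs x \<in> addgen ((\<lambda>i::nat. x [^] i) ` {..<length cs})" using Cons by simp
    moreover have "\<dots> \<subseteq> addgen ?S" by (rule addgen_subset [OF _ S]) (auto intro!: generate.incl)
    ultimately show ?thesis by blast
  qed
  ultimately show ?case using addgen_add by simp
qed

text \<open>Zero coefficients are kept, so that the list has length exactly \<open>n\<close>: a
  monic equation of degree \<open>n\<close> then arises by putting \<open>\<one>\<close> in
  front.\<close>

lemma addgen_powers_eval:
  assumes "x \<in> carrier R" "y \<in> addgen ((\<lambda>i::nat. x [^] i) ` {..<n})"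
  shows "\<exists>cs. length cs = n \<and> set cs \<subseteq> range ofi \<and> y = eval cs x"
  using assms(2)
proof (induction n arbitrary: y)
  case 0
  then show ?case by (simp add: add.generate_empty)
next
  case (Suc n)
  let ?S = "(\<lambda>i::nat. x [^] i) ` {..<n}"
  have "y \<in> addgen (insert (x [^] n) ?S)" using Suc.prems by (simp add: lessThan_Suc)
  then obtain c r where c: "r \<in> addgen ?S" "y = [(c::int)] \<cdot> (x [^] n) \<oplus> r"
    using add.generate_insert_decomp [of ?S "x [^] n" y] assms(1) by auto
  obtain cs where "length cs = n" "set cs \<subseteq> range ofi" "r = eval cs x" using Suc.IH c by blast
  then show ?case using c assms(1) add_pow_eq_ofi [of "x [^] n" c] by (intro exI[of _ "ofi c # cs"]) auto
qed

text \<open>The monic equation rewrites the top power, so multiplication by \<open>x\<close>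
  preserves the group generated by the lower ones.\<close>

lemma integral_powers:
  assumes "x \<in> carrier R" "\<one> \<noteq> \<zero>" "integral_over R (range ofi) x"
  shows "\<exists>d. \<forall>n::nat. x [^] n \<in> addgen ((\<lambda>i::nat. x [^] i) ` {..<d})"
proof -
  obtain cs where cs: "set cs \<subseteq> range ofi" "x [^] length cs \<oplus> eval cs x = \<zero>"
    using integral_over_iff assms by blast
  let ?d = "length cs" let ?S = "(\<lambda>i::nat. x [^] i) ` {..<?d}"
  have S: "?S \<subseteq> carrier R" using assms by auto
  have ev: "eval cs x \<in> addgen ?S" using eval_in_addgen assms cs by blast
  then have "eval cs x \<in> carrier R" using addgen_closed S by blast
  then have "x [^] ?d = \<ominus> eval cs x" using cs(2) assms(1) by (intro minus_equality [symmetric]) auto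
  then have top: "x [^] ?d \<in> addgen ?S" using addgen_minus [OF S ev] by simp
  have step: "x [^] i \<in> addgen ?S" if "i \<le> ?d" for i
    using that top by (cases "i = ?d") (auto intro!: generate.incl)
  have "x [^] n \<in> addgen ?S" for n :: nat
  proof (induction n)
    case 0
    then show ?case using step [of 0] by simp
  next
    case (Suc n)
    have "x [^] n \<otimes> x \<in> addgen ((\<lambda>s. s \<otimes> x) ` ?S)" using addgen_mult_right [OF Suc S] assms by blast
    moreover have "addgen ((\<lambda>s. s \<otimes> x) ` ?S) \<subseteq> addgen ?S"
    proof (rule addgen_subset [OF _ S], clarify)
      fix i assume "i < ?d"
      then show "x [^] i \<otimes> x \<in> addgen ?S" using step [of "Suc i"] by simp
    qed
    ultimately show ?case by auto
  qed
  then show ?thesis by blast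
qed

text \<open>If all powers lie in a finitely generated group, some power is an integral combination
  of earlier ones by \<open>finitely_generated_imp_dependent\<close>, and this is a monic
  equation.\<close>

lemma powers_integral:
  assumes "x \<in> carrier R" "\<one> \<noteq> \<zero>" "finite S" "S \<subseteq> carrier R" "\<And>n::nat. x [^] n \<in> addgen S"
  shows "integral_over R (range ofi) x"
proof -
  obtain n where "x [^] n \<in> addgen ((\<lambda>i::nat. x [^] i) ` {..<n})"
    using add.finitely_generated_imp_dependent [of S "\<lambda>i. x [^] i"] assms by auto
  then have "\<ominus> (x [^] n) \<in> addgen ((\<lambda>i::nat. x [^] i) ` {..<n})"
    using assms by (intro addgen_minus) auto
  then obtain cs where "length cs = n" "set cs \<subseteq> range ofi" "\<ominus> (x [^] n) = eval cs x"
    using addgen_powers_eval assms by blast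
  then show ?thesis using assms integral_over_iff by (metis nat_pow_closed r_neg)
qed

text \<open>The products of low powers of \<open>x\<close> with low powers of \<open>y\<close>
  generate a group that contains every power of \<open>x \<otimes> y\<close>.\<close>

lemma integral_mult:
  assumes "x \<in> carrier R" "y \<in> carrier R" "\<one> \<noteq> \<zero>"
    and "integral_over R (range ofi) x" "integral_over R (range ofi) y"
  shows "integral_over R (range ofi) (x \<otimes> y)"
proof -
  obtain d where d: "\<And>n::nat. x [^] n \<in> addgen ((\<lambda>i::nat. x [^] i) ` {..<d})" using integral_powers assms by blast
  obtain e where e: "\<And>n::nat. y [^] n \<in> addgen ((\<lambda>i::nat. y [^] i) ` {..<e})" using integral_powers assms by blast
  show ?thesis
  proof (rule powers_integral)
    fix n :: nat
    show "(x \<otimes> y) [^] n \<in> addgen ((\<lambda>(s, t). s \<otimes> t) ` ((\<lambda>i::nat. x [^] i) ` {..<d} \<times> (\<lambda>i::nat. y [^] i) ` {..<e}))"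
      unfolding nat_pow_distrib [OF assms(1,2)] by (rule addgen_mult) (use d e assms in auto)
  qed (use assms in auto)
qed

lemma integral_ofi: assumes "\<one> \<noteq> \<zero>" shows "integral_over R (range ofi) (ofi k)"
proof -
  have "ofi k [^] length [ofi (-k)] \<oplus> eval [ofi (-k)] (ofi k) = \<zero>"
    by (simp add: ofi_minus r_neg)
  moreover have "set [ofi (-k)] \<subseteq> range ofi" by simp
  ultimately show ?thesis using integral_over_iff [OF ofi_closed assms, of k] by blast
qed

end

context field
begin

section \<open>The unit group of the ring of integers\<close>

abbreviation OF where "OF \<equiv> ring_of_integers R"
abbreviation UO where "UO \<equiv> units_of OF"

lemma OF_simps [simp]:
  "x \<otimes>\<^bsub>OF\<^esub> y = x \<otimes> y" "\<one>\<^bsub>OF\<^esub> = \<one>"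
  by (simp_all add: ring_of_integers_def)

lemma OF_carrier: "x \<in> carrier OF \<longleftrightarrow> x \<in> carrier R \<and> integral_over R (range ofi) x"
  by (simp add: ring_of_integers_def)

lemma OF_comm_monoid: "comm_monoid OF"
  by (rule comm_monoidI) (use integral_mult integral_ofi [of 1] in \<open>auto simp: OF_carrier m_ac\<close>)

lemma UO_comm_group: "comm_group UO"
  using comm_monoid.units_comm_group [OF OF_comm_monoid] .

lemma UO_simps [simp]: "x \<otimes>\<^bsub>UO\<^esub> y = x \<otimes> y" "\<one>\<^bsub>UO\<^esub> = \<one>"
  by (simp_all add: units_of_def)

lemma UO_carrier: "u \<in> carrier UO \<longleftrightarrow> u \<in> Units R \<and> u \<in> carrier OF \<and> inv u \<in> carrier OF"
proof
  assume "u \<in> carrier UO"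
  then obtain w where w: "u \<in> carrier OF" "w \<in> carrier OF" "w \<otimes> u = \<one>" "u \<otimes> w = \<one>"
    by (auto simp: units_of_carrier Units_def)
  then have "u \<in> Units R" by (auto simp: OF_carrier Units_def)
  moreover have "inv u = w" using w by (intro comm_inv_char) (auto simp: OF_carrier)
  ultimately show "u \<in> Units R \<and> u \<in> carrier OF \<and> inv u \<in> carrier OF" using w by simp
next
  assume "u \<in> Units R \<and> u \<in> carrier OF \<and> inv u \<in> carrier OF"
  then show "u \<in> carrier UO"
    by (auto simp: units_of_carrier Units_def [of OF] intro!: bexI[of _ "inv u"])
qed

lemma UO_hom: "id \<in> hom UO (units_of R)"
  by (auto simp: hom_def UO_carrier units_of_carrier [of R] units_of_mult)

lemma UO_int_pow: "u \<in> carrier UO \<Longrightarrow> u [^]\<^bsub>UO\<^esub> (k::int) = u [^]\<^bsub>units_of R\<^esub> k"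
  using hom_int_pow [OF UO_hom] UO_comm_group units_comm_group unfolding comm_group_def by fastforce

lemma UO_inv: "u \<in> carrier UO \<Longrightarrow> inv\<^bsub>UO\<^esub> u = inv u"
proof -
  assume u: "u \<in> carrier UO"
  have "inv\<^bsub>UO\<^esub> u \<otimes> u = \<one>" using comm_group.axioms(2) [OF UO_comm_group] group.l_inv [of UO u] u by simp
  moreover have "inv\<^bsub>UO\<^esub> u \<in> carrier UO" using group.inv_closed [OF comm_group.axioms(2) [OF UO_comm_group] u] .
  moreover have "u \<in> carrier R" "inv\<^bsub>UO\<^esub> u \<in> carrier R"
    using u calculation(2) unfolding UO_carrier by blast+
  ultimately show ?thesis using comm_inv_char [of u "inv\<^bsub>UO\<^esub> u"] m_comm [of u "inv\<^bsub>UO\<^esub> u"] by metis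
qed

end

context cring
begin

lemma binomial:
  assumes "t \<in> carrier R"
  shows "(\<one> \<oplus> t) [^] (n::nat) = (\<Oplus>i\<in>{..n}. ofi (int (n choose i)) \<otimes> t [^] i)"
proof (induction n)
  case (Suc n)
  let ?f = "\<lambda>n i. ofi (int (n choose i)) \<otimes> t [^] i"
  have fc: "?f m i \<in> carrier R" for m i using assms by simp
  have tc: "t [^] i \<in> carrier R" for i :: nat using assms by simp
  have "(\<Oplus>i\<in>{..Suc n}. ?f (Suc n) i) = (\<Oplus>i\<in>{..n}. ?f (Suc n) (Suc i)) \<oplus> ?f (Suc n) 0"
    using fc by (intro finsum_Suc2) auto
  also have "(\<Oplus>i\<in>{..n}. ?f (Suc n) (Suc i)) = (\<Oplus>i\<in>{..n}. ?f n i \<otimes> t \<oplus> ?f n (Suc i))"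
    using fc assms tc
    by (intro finsum_cong') (auto simp: ofi_add l_distr m_assoc)
  also have "\<dots> = (\<Oplus>i\<in>{..n}. ?f n i \<otimes> t) \<oplus> (\<Oplus>i\<in>{..n}. ?f n (Suc i))"
    using fc assms tc by (intro finsum_addf) auto
  also have "(\<Oplus>i\<in>{..n}. ?f n i \<otimes> t) = (\<Oplus>i\<in>{..n}. ?f n i) \<otimes> t"
    using fc assms by (intro finsum_ldistr [symmetric]) auto
  also have "(\<Oplus>i\<in>{..n}. ?f n i) \<otimes> t \<oplus> (\<Oplus>i\<in>{..n}. ?f n (Suc i)) \<oplus> ?f (Suc n) 0 =
     (\<Oplus>i\<in>{..n}. ?f n i) \<otimes> t \<oplus> ((\<Oplus>i\<in>{..n}. ?f n (Suc i)) \<oplus> ?f n 0)"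
    using fc assms tc by (simp add: a_assoc)
  also have "(\<Oplus>i\<in>{..n}. ?f n (Suc i)) \<oplus> ?f n 0 = (\<Oplus>i\<in>{..Suc n}. ?f n i)"
    using fc by (intro finsum_Suc2 [symmetric]) auto
  also have "\<dots> = ?f n (Suc n) \<oplus> (\<Oplus>i\<in>{..n}. ?f n i)"
    using fc by (intro finsum_Suc) auto
  also have "?f n (Suc n) = \<zero>" using tc [of "Suc n"] by (simp add: binomial_eq_0 del: nat_pow_Suc)
  finally have "(\<Oplus>i\<in>{..Suc n}. ?f (Suc n) i) = (\<Oplus>i\<in>{..n}. ?f n i) \<otimes> t \<oplus> (\<Oplus>i\<in>{..n}. ?f n i)"
    using fc by simp
  moreover have "(\<Oplus>i\<in>{..n}. ?f n i) \<in> carrier R" using fc by (intro finsum_closed) auto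
  ultimately show ?case using Suc assms by (simp add: r_distr a_comm)
qed simp

end

context padic_field
begin

section \<open>Units have finite order prime to \<open>p\<close> modulo a place\<close>

lemma v_finsum_le:
  assumes "finite A" "\<And>i. i \<in> A \<Longrightarrow> f i \<in> carrier F" "\<And>i. i \<in> A \<Longrightarrow> v (f i) \<le> B" "0 \<le> B"
  shows "v (\<Oplus>i\<in>A. f i) \<le> B"
  using assms(1,2,3)
proof (induction A rule: finite_induct)
  case empty
  then show ?case using assms by simp
next
  case (insert a A)
  have fA: "f \<in> A \<rightarrow> carrier F" "f a \<in> carrier F" using insert by auto
  have "v (f a \<oplus> (\<Oplus>i\<in>A. f i)) \<le> max (v (f a)) (v (\<Oplus>i\<in>A. f i))"
    using fA finsum_closed by (intro ultrametric) auto
  then show ?case using insert fA by (simp add: finsum_insert) (smt (verit) insert.IH)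
qed

text \<open>In the residue field the \<open>p\<close>-th power of \<open>z - 1\<close> is
  \<open>z ^ p - 1\<close>, because \<open>p\<close> divides the middle binomial coefficients; so
  the Frobenius map is injective there.\<close>

lemma frobenius_inj:
  assumes z: "z \<in> carrier F" "v z \<le> 1" "v (z [^] p \<ominus> \<one>) < 1" shows "v (z \<ominus> \<one>) < 1"
proof -
  define t where "t = z \<ominus> \<one>"
  have t: "t \<in> carrier F" "v t \<le> 1" using z v_diff [of z \<one>] by (auto simp: t_def)
  have zt: "z = \<one> \<oplus> t" unfolding t_def using z(1) by algebra
  let ?f = "\<lambda>i. ofi (int (p choose i)) \<otimes> t [^] i"
  have fc: "?f i \<in> carrier F" for i using t by simp
  have p2: "p \<ge> 2" using prime_p prime_ge_2_nat by blast
  \<comment> \<open>Writing \<open>p\<close> as \<open>Suc (Suc m)\<close> allows both end terms of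
    the binomial sum to be split off.\<close>
  define m where "m = p - 2"
  have pm: "p = Suc (Suc m)" using p2 m_def by simp
  have "z [^] p = (\<Oplus>i\<in>{..Suc (Suc m)}. ?f i)" unfolding zt using binomial [OF t(1), of p] by (simp flip: pm)
  also have "\<dots> = ?f (Suc (Suc m)) \<oplus> (\<Oplus>i\<in>{..Suc m}. ?f i)" using fc by (intro finsum_Suc) auto
  also have "(\<Oplus>i\<in>{..Suc m}. ?f i) = (\<Oplus>i\<in>{..m}. ?f (Suc i)) \<oplus> ?f 0" using fc by (intro finsum_Suc2) auto
  also have "?f (Suc (Suc m)) = t [^] p" using t by (simp flip: pm)
  also have "?f 0 = \<one>" by simp
  finally have e: "z [^] p = t [^] p \<oplus> ((\<Oplus>i\<in>{..m}. ?f (Suc i)) \<oplus> \<one>)" .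
  define w where "w = (\<Oplus>i\<in>{..m}. ?f (Suc i))"
  have wc: "w \<in> carrier F" unfolding w_def by (intro finsum_closed Pi_I fc)
  have "v w \<le> 1 / p" unfolding w_def
  proof (rule v_finsum_le)
    fix i assume i: "i \<in> {..m}"
    have "Suc i * (p choose Suc i) = p * ((p - 1) choose i)"
      using Suc_times_binomial_eq [of "p - 1" i] pm by (simp add: mult.commute)
    then have "p dvd Suc i * (p choose Suc i)" by simp
    moreover have "\<not> p dvd Suc i" using i pm by (auto dest: dvd_imp_le)
    ultimately have "p dvd p choose Suc i" using prime_p prime_dvd_mult_iff by blast
    then have "int p ^ 1 dvd int (p choose Suc i)" by (simp del: of_nat_dvd_iff add: int_dvd_int_iff)
    then have "v (ofi (int (p choose Suc i))) \<le> 1 / p"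
      using v_int padic_abs_int_le_iff [OF prime_p, of "int (p choose Suc i)" 1] by simp
    moreover have "v (t [^] Suc i) \<le> 1" using t by (simp add: power_le_one mult_le_one del: nat_pow_Suc)
    ultimately have "v (ofi (int (p choose Suc i))) * v (t [^] Suc i) \<le> (1 / p) * 1"
      using t p_gt_1 by (intro mult_mono) auto
    then show "v (?f (Suc i)) \<le> 1 / p" using t by (simp only: v_mult ofi_closed nat_pow_closed)
  qed (simp, rule fc, simp)
  moreover have "1 / real p < 1" using p_gt_1 by simp
  ultimately have w1: "v w < 1" by linarith
  have "t [^] p = (z [^] p \<ominus> \<one>) \<ominus> w"
    unfolding e w_def [symmetric] using wc t nat_pow_closed [OF t(1), of p] by algebra
  then have "v (t [^] p) < 1" using v_diff [of "z [^] p \<ominus> \<one>" w] wc w1 z by auto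
  then have "v t ^ p < 1" using t by simp
  then show ?thesis unfolding t_def [symmetric] using t by (metis not_less one_le_power)
qed

lemma addgen_bounded:
  assumes "x \<in> addgen S" "S \<subseteq> carrier F" "\<And>s. s \<in> S \<Longrightarrow> v s \<le> B" "0 \<le> B" shows "v x \<le> B"
  using assms(1,2)
proof (induction rule: addgen_induct)
  case (minus s)
  then show ?case using assms by (simp add: subsetD)
next
  case (add x y)
  then show ?case using ultrametric [of x y] addgen_closed assms(2) by fastforce
qed (use assms in auto)

text \<open>All powers of \<open>x\<close> lie in a finitely generated additive group, on which
  \<open>v\<close> is bounded; a value above 1 would have unbounded powers.\<close>

lemma v_integral_le_1:
  assumes x: "x \<in> carrier F" "integral_over F (range ofi) x" shows "v x \<le> 1"
proof (rule ccontr)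
  assume "\<not> v x \<le> 1"
  then have gt: "v x > 1" by simp
  obtain d where d: "\<And>n::nat. x [^] n \<in> addgen ((\<lambda>i::nat. x [^] i) ` {..<d})"
    using integral_powers [OF x(1) one_not_zero x(2)] by blast
  have "v (x [^] n) \<le> v x ^ d" for n :: nat
  proof (rule addgen_bounded [OF d])
    fix s assume "s \<in> (\<lambda>i::nat. x [^] i) ` {..<d}"
    then show "v s \<le> v x ^ d" using x gt by (auto intro: power_increasing)
  qed (use x in auto)
  from this [of "Suc d"] have "v x ^ Suc d \<le> v x ^ d" using x by (simp add: mult.commute)
  then show False using gt power_strict_increasing [of d "Suc d" "v x"] by simp
qed

lemma v_unit: assumes "u \<in> carrier UO" shows "v u = 1"
proof -
  have u: "u \<in> Units F" "v u \<le> 1" "v (inv u) \<le> 1" using assms v_integral_le_1 by (auto simp: UO_carrier OF_carrier)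
  have "v u \<noteq> 0" using u(1) by (simp add: field_Units)
  then have "v u > 0" using v_nonneg [of u] u(1) by (simp add: less_le Units_closed)
  then show ?thesis using u v_inv [of u] by (simp add: field_simps)
qed

text \<open>By \<open>finitely_generated_pigeonhole\<close> two powers of \<open>u\<close> differ by
  \<open>p\<close> times an element of value at most 1. Cancelling the lower power shows that
  \<open>u\<close> has finite order in the residue field.\<close>

lemma tame_unit: assumes u: "u \<in> carrier UO" shows "\<exists>N. tame N u"
proof -
  have uU: "u \<in> Units F" "u \<in> carrier F" "integral_over F (range ofi) u" using u by (auto simp: UO_carrier OF_carrier)
  have vu: "v u = 1" using v_unit [OF u] .
  obtain d where d: "\<And>n::nat. u [^] n \<in> addgen ((\<lambda>i::nat. u [^] i) ` {..<d})"
    using integral_powers [OF uU(2) one_not_zero uU(3)] by blast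
  let ?S = "(\<lambda>i::nat. u [^] i) ` {..<d}"
  have S: "?S \<subseteq> carrier F" using uU by auto
  obtain J :: "nat set" where J: "infinite J" "\<And>i j. \<lbrakk>i \<in> J; j \<in> J\<rbrakk> \<Longrightarrow> \<exists>x\<in>addgen ?S. u [^] i = u [^] j \<oplus> [int p] \<cdot> x"
  proof -
    have "\<exists>J'\<subseteq>(UNIV :: nat set). infinite J' \<and>
        (\<forall>i\<in>J'. \<forall>j\<in>J'. \<exists>x\<in>addgen ?S. u [^] i = u [^] j \<oplus> [int p] \<cdot> x)"
      using add.finitely_generated_pigeonhole [of ?S UNIV "\<lambda>i::nat. u [^] i" "int p"] d S
        prime_gt_0_nat [OF prime_p] by simp
    then show thesis using that by blast
  qed
  obtain i where i: "i \<in> J" using J(1) by (metis all_not_in_conv finite.emptyI)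
  obtain j where j: "j \<in> J" "j > i" using J(1) infinite_nat_iff_unbounded by blast
  obtain x where x: "x \<in> addgen ?S" "u [^] j = u [^] i \<oplus> [int p] \<cdot> x" using J(2) i j by blast
  have xc: "x \<in> carrier F" using x S addgen_closed by blast
  have "v x \<le> 1" by (rule addgen_bounded [OF x(1) S]) (use uU vu in auto)
  then have "v ([int p] \<cdot> x) \<le> 1 / p * 1"
    unfolding add_pow_eq_ofi [OF xc] using xc v_int_p p_gt_1 by (simp only: v_mult ofi_closed) (intro mult_mono, auto)
  also have "\<dots> < 1" using p_gt_1 by simp
  finally have px: "v ([int p] \<cdot> x) < 1" .
  have dif: "v (u [^] (j - i) \<ominus> \<one>) < 1"
  proof -
    have "u [^] j = u [^] i \<otimes> u [^] (j - i)" using uU j by (simp add: nat_pow_mult)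
    then have "u [^] i \<otimes> (u [^] (j - i) \<ominus> \<one>) = (u [^] i \<oplus> [int p] \<cdot> x) \<ominus> u [^] i"
      using x(2) uU(2) nat_pow_closed [OF uU(2)] by (metis minus_eq one_closed r_distr r_minus r_one a_inv_closed)
    also have "\<dots> = [int p] \<cdot> x"
      using nat_pow_closed [OF uU(2), of i] add.int_pow_closed [OF xc, of "int p"] by algebra
    finally have "v (u [^] i) * v (u [^] (j - i) \<ominus> \<one>) < 1" using px uU by (metis v_mult minus_closed nat_pow_closed one_closed)
    then show ?thesis using uU vu by simp
  qed
  define P where "P m \<longleftrightarrow> m > 0 \<and> v (u [^] m \<ominus> \<one>) < 1" for m :: nat
  have "P (j - i)" using dif j by (simp add: P_def)
  \<comment> \<open>The least exponent is the order in the residue field; if \<open>p\<close>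
    divided it, \<open>frobenius_inj\<close> would produce a smaller one.\<close>
  define N where "N = (LEAST m. P m)"
  have N: "P N" "\<And>m. P m \<Longrightarrow> N \<le> m" unfolding N_def using \<open>P (j - i)\<close> LeastI Least_le by metis+
  have "\<not> p dvd N"
  proof
    assume "p dvd N"
    then obtain m where m: "N = m * p" by (metis dvd_def mult.commute)
    have "v ((u [^] m) [^] p \<ominus> \<one>) < 1" using N(1) uU by (simp add: P_def m nat_pow_pow)
    then have "v (u [^] m \<ominus> \<one>) < 1" using frobenius_inj [of "u [^] m"] uU vu by simp
    moreover have "m > 0" using N(1) m by (auto simp: P_def)
    ultimately have "N \<le> m" using N(2) by (simp add: P_def)
    then show False using m \<open>m > 0\<close> prime_p prime_gt_1_nat [of p] by simp
  qed
  then have "coprime N p" using prime_p prime_imp_coprime coprime_commute by blast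
  then show ?thesis using N(1) uU unfolding tame_def P_def by blast
qed

end

lemma padic_field_place:
  assumes "field F" "prime p" "v \<in> places_above F p" shows "padic_field F v p"
  using assms by (auto simp: padic_field_def padic_field_axioms_def places_above_def)

section \<open>A criterion for the injectivity of the Leopoldt map\<close>

lemma free_Abelian_group_hom_diff:
  assumes "h \<in> hom (free_Abelian_group S) G" "group G"
    and "x \<in> carrier (free_Abelian_group S)" "y \<in> carrier (free_Abelian_group S)"
  shows "h (x - y) = h x \<otimes>\<^bsub>G\<^esub> inv\<^bsub>G\<^esub> h y"
proof -
  interpret h: group_hom "free_Abelian_group S" G h
    using assms by (simp add: group_hom_def group_hom_axioms_def)
  have y: "inv\<^bsub>free_Abelian_group S\<^esub> y = - y" using assms(4) by simp
  have "h (x \<otimes>\<^bsub>free_Abelian_group S\<^esub> inv\<^bsub>free_Abelian_group S\<^esub> y) = h x \<otimes>\<^bsub>G\<^esub> inv\<^bsub>G\<^esub> h y"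
    using h.hom_mult [OF assms(3) group.inv_closed [OF group_free_Abelian_group assms(4)]] h.hom_inv [OF assms(4)] by simp
  then show ?thesis unfolding y by simp
qed

lemma free_Abelian_group_hom_zero:
  "\<lbrakk>h \<in> hom (free_Abelian_group S) G; group G\<rbrakk> \<Longrightarrow> h 0 = \<one>\<^bsub>G\<^esub>"
  using hom_one [of h "free_Abelian_group S" G] by simp

text \<open>The choice is made once, independently of field and place, so that unit sequences can be
  compared across fields.\<close>

definition padic_rep :: "nat \<Rightarrow> (nat \<Rightarrow> rat) set \<Rightarrow> nat \<Rightarrow> int" where
  "padic_rep p a = (SOME k. padic_cauchy p k \<and> padic_class p k = a)"

lemma padic_rep:
  assumes "prime p" "a \<in> carrier (padic_integers p)"
  shows "padic_cauchy p (padic_rep p a)" "padic_class p (padic_rep p a) = a"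
  using someI_ex [OF padic_integers_ex [OF assms]] by (auto simp: padic_rep_def)

section \<open>Formal combinations, relations and the kernel\<close>

definition tensor_pairs :: "('a, 'b) ring_scheme \<Rightarrow> nat \<Rightarrow> ((nat \<Rightarrow> rat) set \<times> 'a) set" where
  "tensor_pairs F p = carrier (padic_integers p) \<times> carrier (units_of (ring_of_integers F))"

definition tensor_null :: "('a, 'b) ring_scheme \<Rightarrow> nat \<Rightarrow> ((nat \<Rightarrow> rat) set \<times> 'a \<Rightarrow>\<^sub>0 int) set" where
  "tensor_null F p = generate (free_Abelian_group (tensor_pairs F p))
     (tensor_relations (add_monoid (padic_integers p)) (units_of (ring_of_integers F)))"

text \<open>A sequence of global units whose image in each completion above \<open>p\<close> converges to the value
  of the Leopoldt map.\<close>

definition unit_approx :: "('a, 'b) ring_scheme \<Rightarrow> nat \<Rightarrow> ((nat \<Rightarrow> rat) set \<times> 'a \<Rightarrow>\<^sub>0 int) \<Rightarrow> nat \<Rightarrow> 'a" where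
  "unit_approx F p z n = frag_eval (units_of (ring_of_integers F))
     (\<lambda>(a, u). u [^]\<^bsub>units_of (ring_of_integers F)\<^esub> (tame_exp p n * padic_rep p a n)) z"

text \<open>By \<open>leo_eq_one_iff\<close> this is the kernel of the linear extension of
  \<open>leopoldt_pure\<close> to formal combinations, in a form that mentions only elements of the
  field and its places.\<close>

definition leo_kernel :: "('a, 'b) ring_scheme \<Rightarrow> nat \<Rightarrow> ((nat \<Rightarrow> rat) set \<times> 'a \<Rightarrow>\<^sub>0 int) set" where
  "leo_kernel F p = {z \<in> carrier (free_Abelian_group (tensor_pairs F p)).
     \<forall>v\<in>places_above F p. (\<lambda>n. v (unit_approx F p z n \<ominus>\<^bsub>F\<^esub> \<one>\<^bsub>F\<^esub>)) \<longlonglongrightarrow> 0}"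

lemma (in field) unit_approx_hom:
  "(\<lambda>z. unit_approx R p z n) \<in> hom (free_Abelian_group (tensor_pairs R p)) UO"
proof -
  interpret U: comm_group UO by (rule UO_comm_group)
  show ?thesis unfolding unit_approx_def
    by (rule U.frag_eval_hom) (auto simp: tensor_pairs_def)
qed

lemma (in field) unit_approx_closed:
  "z \<in> carrier (free_Abelian_group (tensor_pairs R p)) \<Longrightarrow> unit_approx R p z n \<in> carrier UO"
  using unit_approx_hom [of p n] by (auto simp: hom_def)

context padic_field
begin

lemma unit_approx_frag_of:
  assumes "(a, u) \<in> tensor_pairs F p"
  shows "unit_approx F p (frag_of (a, u)) = unit_seq u (padic_rep p a)"
proof
  fix n
  interpret U: comm_group UO by (rule UO_comm_group)
  have u: "u \<in> carrier UO" using assms by (simp add: tensor_pairs_def)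
  show "unit_approx F p (frag_of (a, u)) n = unit_seq u (padic_rep p a) n"
    unfolding unit_approx_def unit_seq_def using u
    by (subst U.frag_eval_frag_of, simp only: prod.case U.int_pow_closed, simp only: prod.case UO_int_pow)
qed

text \<open>Both sides are homomorphisms in \<open>z\<close>, so the generators decide. The
  subtraction step of the induction inverts a Cauchy sequence, which is possible because units have
  value 1 at \<open>v\<close>.\<close>

lemma unit_approx_cls:
  assumes z: "z \<in> carrier (free_Abelian_group (tensor_pairs F p))"
  shows "unit_approx F p z \<in> Cau \<and>
    cls (unit_approx F p z) = frag_eval U1 (\<lambda>(a, u). cls (unit_seq u (padic_rep p a))) z"
proof -
  let ?S = "tensor_pairs F p"
  let ?f = "\<lambda>(a, u). cls (unit_seq u (padic_rep p a))"
  interpret U: comm_group UO by (rule UO_comm_group)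
  have f: "?f \<in> ?S \<rightarrow> carrier U1"
    using tame_unit unit_seq_U1 padic_rep [OF prime_p] by (fastforce simp: tensor_pairs_def)
  have hom1: "frag_eval U1 ?f \<in> hom (free_Abelian_group ?S) U1" by (rule U1.frag_eval_hom [OF f])
  have "Poly_Mapping.keys z \<subseteq> ?S" using z by simp
  then show ?thesis
  proof (rule free_Abelian_group_induct)
    have "unit_approx F p 0 = (\<lambda>n. \<one>)"
      using free_Abelian_group_hom_zero [OF unit_approx_hom U.is_group] by (auto simp: fun_eq_iff)
    moreover have "frag_eval U1 ?f 0 = \<one>\<^bsub>U1\<^esub>" by (rule free_Abelian_group_hom_zero [OF hom1 U1.is_group])
    ultimately show "unit_approx F p 0 \<in> Cau \<and> cls (unit_approx F p 0) = frag_eval U1 ?f 0"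
      by (simp add: cls_one)
  next
    fix t assume t: "t \<in> ?S"
    obtain a u where au: "t = (a, u)" by fastforce
    have "u \<in> carrier UO" "a \<in> carrier (padic_integers p)" using t au by (auto simp: tensor_pairs_def)
    then have "unit_seq u (padic_rep p a) \<in> Cau" using tame_unit unit_seq_Cau padic_rep [OF prime_p] by blast
    moreover have "frag_eval U1 ?f (frag_of t) = ?f t" using f t by (intro U1.frag_eval_frag_of) auto
    ultimately show "unit_approx F p (frag_of t) \<in> Cau \<and> cls (unit_approx F p (frag_of t)) = frag_eval U1 ?f (frag_of t)"
      using unit_approx_frag_of t au by auto
  next
    fix x y assume xy: "Poly_Mapping.keys x \<subseteq> ?S" "Poly_Mapping.keys y \<subseteq> ?S"
     and X: "unit_approx F p x \<in> Cau \<and> cls (unit_approx F p x) = frag_eval U1 ?f x"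
     and Y: "unit_approx F p y \<in> Cau \<and> cls (unit_approx F p y) = frag_eval U1 ?f y"
    have xc: "x \<in> carrier (free_Abelian_group ?S)" and yc: "y \<in> carrier (free_Abelian_group ?S)" using xy by auto
    have e: "unit_approx F p (x - y) = (\<lambda>n. unit_approx F p x n \<otimes> inv (unit_approx F p y n))"
      using free_Abelian_group_hom_diff [OF unit_approx_hom U.is_group xc yc] UO_inv unit_approx_closed [OF yc]
      by (auto simp: fun_eq_iff)
    have vy: "v (unit_approx F p y n) = 1" for n using v_unit unit_approx_closed [OF yc] by blast
    note I = Cau_inv [OF conjunct1 [OF Y] vy]
    have yU: "cls (unit_approx F p y) \<in> carrier U1" "cls (unit_approx F p x) \<in> carrier U1"
      using X Y hom1 xc yc by (auto simp: hom_def Pi_iff)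
    have ic: "cls (\<lambda>n. inv (unit_approx F p y n)) = inv\<^bsub>U1\<^esub> cls (unit_approx F p y)"
    proof -
      have "cls (\<lambda>n. inv (unit_approx F p y n)) =
         cls (\<lambda>n. inv (unit_approx F p y n)) \<otimes>\<^bsub>CF\<^esub> (cls (unit_approx F p y) \<otimes>\<^bsub>CF\<^esub> inv\<^bsub>U1\<^esub> cls (unit_approx F p y))"
        using U1.r_inv [OF yU(1)] I(1) by simp
      also have "\<dots> = \<one>\<^bsub>CF\<^esub> \<otimes>\<^bsub>CF\<^esub> inv\<^bsub>U1\<^esub> cls (unit_approx F p y)"
        using I(2) cls_closed [OF I(1)] U1_CF [OF yU(1)] U1_CF [OF U1.inv_closed [OF yU(1)]]
        by (simp flip: CF.m_assoc)
      finally show ?thesis using U1_CF [OF U1.inv_closed [OF yU(1)]] by simp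
    qed
    have "cls (unit_approx F p (x - y)) = cls (unit_approx F p x) \<otimes>\<^bsub>CF\<^esub> inv\<^bsub>U1\<^esub> cls (unit_approx F p y)"
      unfolding e using cls_mult [OF conjunct1 [OF X] I(1)] ic by simp
    also have "\<dots> = frag_eval U1 ?f (x - y)"
      using free_Abelian_group_hom_diff [OF hom1 U1.is_group xc yc] X Y by simp
    finally show "unit_approx F p (x - y) \<in> Cau \<and> cls (unit_approx F p (x - y)) = frag_eval U1 ?f (x - y)"
      using Cau_mult [OF conjunct1 [OF X] I(1)] e by simp
  qed
qed

lemma leopoldt_pure_place:
  assumes "v \<in> places_above F p" "(a, u) \<in> tensor_pairs F p"
  shows "leopoldt_pure F p (a, u) v = cls (unit_seq u (padic_rep p a))"
proof -
  have u: "u \<in> carrier UO" "a \<in> carrier (padic_integers p)" using assms by (auto simp: tensor_pairs_def)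
  obtain N where N: "tame N u" using tame_unit u by blast
  show ?thesis
    using assms(1) principal_part_eq [OF N] padic_pow_eq [OF N padic_rep(1) [OF prime_p u(2)]] padic_rep(2) [OF prime_p u(2)]
    by (simp add: leopoldt_pure_def)
qed

text \<open>\<open>padic_rep\<close> is a mere choice and not additive, but the representatives of a
  sum and the sum of the representatives differ by a p-adic null sequence, which
  \<open>unit_seq_cong\<close> ignores.\<close>

lemma cls_unit_seq_add:
  assumes "a \<in> carrier (padic_integers p)" "b \<in> carrier (padic_integers p)" "u \<in> carrier UO"
  shows "cls (unit_seq u (padic_rep p (a \<oplus>\<^bsub>padic_integers p\<^esub> b))) =
    cls (unit_seq u (padic_rep p a)) \<otimes>\<^bsub>CF\<^esub> cls (unit_seq u (padic_rep p b))"
proof -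
  obtain N where N: "tame N u" using tame_unit assms by blast
  let ?k = "padic_rep p a" let ?l = "padic_rep p b"
  have k: "padic_cauchy p ?k" "padic_cauchy p ?l" "padic_class p ?k = a" "padic_class p ?l = b"
    using padic_rep [OF prime_p] assms by auto
  then have s: "a \<oplus>\<^bsub>padic_integers p\<^esub> b = padic_class p (\<lambda>n. ?k n + ?l n)"
    using padic_class_add [OF prime_p k(1,2)] by simp
  have C: "padic_cauchy p (\<lambda>n. ?k n + ?l n)" using k padic_cauchy_add by blast
  have "a \<oplus>\<^bsub>padic_integers p\<^esub> b \<in> carrier (padic_integers p)" unfolding s using padic_class_closed [OF prime_p C] .
  note m = padic_rep [OF prime_p this]
  have "padic_null p (\<lambda>n. padic_rep p (a \<oplus>\<^bsub>padic_integers p\<^esub> b) n - (?k n + ?l n))"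
    using padic_class_eq_iff [OF prime_p m(1) C] m(2) s by simp
  then show ?thesis
    using unit_seq_cong [OF N m(1) C] unit_seq_add [OF N k(1,2)] by simp
qed

end

locale leopoldt = field F for F :: "('a, 'b) ring_scheme" (structure) +
  fixes p :: nat assumes prime_p: "prime p"
begin

abbreviation Zp where "Zp \<equiv> add_monoid (padic_integers p)"
abbreviation Pairs where "Pairs \<equiv> tensor_pairs F p"
abbreviation Fr where "Fr \<equiv> free_Abelian_group Pairs"
abbreviation Null where "Null \<equiv> tensor_null F p"
abbreviation Ker where "Ker \<equiv> leo_kernel F p"
abbreviation LU where "LU \<equiv> local_principal_units F p"

definition leo :: "((nat \<Rightarrow> rat) set \<times> 'a \<Rightarrow>\<^sub>0 int) \<Rightarrow> (('a \<Rightarrow> real) \<Rightarrow> (nat \<Rightarrow> 'a) set)" where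
  "leo = frag_eval LU (leopoldt_pure F p)"

sublocale UO: comm_group UO by (rule UO_comm_group)
sublocale Zp: comm_group Zp by (rule padic_integers_comm_group [OF prime_p])

lemma place: "v \<in> places_above F p \<Longrightarrow> padic_field F v p"
  using padic_field_place field_axioms prime_p by blast

lemma U1_group: "v \<in> places_above F p \<Longrightarrow> comm_group (principal_units F v)"
  using padic_field.U1_comm_group place by blast

lemma relations_closed: "tensor_relations Zp UO \<subseteq> carrier Fr"
proof -
  have "frag_of s - frag_of t - frag_of w \<in> carrier Fr" if "s \<in> Pairs" "t \<in> Pairs" "w \<in> Pairs" for s t w
  proof -
    have "Poly_Mapping.keys (frag_of s - frag_of t - frag_of w) \<subseteq> {s, t, w}"
      using keys_diff [of "frag_of s - frag_of t" "frag_of w"] keys_diff [of "frag_of s" "frag_of t"]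
      by (auto simp: keys_frag_of)
    then show ?thesis using that by auto
  qed
  then show ?thesis
    unfolding tensor_relations_def tensor_pairs_def
    using Zp.m_closed UO.m_closed by (auto simp del: carrier_free_Abelian_group_iff UO_simps)
qed

lemma Null_subgroup: "subgroup Null Fr"
  unfolding tensor_null_def
  by (rule group.generate_is_subgroup [OF group_free_Abelian_group relations_closed])

lemma Null_closed: "z \<in> Null \<Longrightarrow> z \<in> carrier Fr"
  using subgroup.mem_carrier [OF Null_subgroup] .

lemma Null_zero [simp]: "0 \<in> Null"
  using subgroup.one_closed [OF Null_subgroup] by simp

lemma Null_add: "\<lbrakk>x \<in> Null; y \<in> Null\<rbrakk> \<Longrightarrow> x + y \<in> Null"
  using subgroup.m_closed [OF Null_subgroup] by simp

lemma Null_minus: "x \<in> Null \<Longrightarrow> - x \<in> Null"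
  using subgroup.m_inv_closed [OF Null_subgroup, of x] Null_closed [of x] by simp

lemma Null_diff: "\<lbrakk>x \<in> Null; y \<in> Null\<rbrakk> \<Longrightarrow> x - y \<in> Null"
  using Null_add [OF _ Null_minus] by fastforce

lemma Null_sum: "(\<And>i. i \<in> A \<Longrightarrow> f i \<in> Null) \<Longrightarrow> sum f A \<in> Null"
  by (induction A rule: infinite_finite_induct) (auto simp: Null_add)

lemma Null_cmul: "x \<in> Null \<Longrightarrow> frag_cmul k x \<in> Null"
  using group.subgroup_int_pow_closed [OF group_free_Abelian_group Null_subgroup, of x k] Null_closed [of x] by simp

lemma Null_add_left:
  assumes "a \<in> carrier Zp" "b \<in> carrier Zp" "u \<in> carrier UO"
  shows "frag_of (a \<otimes>\<^bsub>Zp\<^esub> b, u) - frag_of (a, u) - frag_of (b, u) \<in> Null"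
  unfolding tensor_null_def
  by (rule generate.incl) (use assms in \<open>unfold tensor_relations_def, blast\<close>)

lemma Null_add_right:
  assumes "a \<in> carrier Zp" "u \<in> carrier UO" "w \<in> carrier UO"
  shows "frag_of (a, u \<otimes>\<^bsub>UO\<^esub> w) - frag_of (a, u) - frag_of (a, w) \<in> Null"
  unfolding tensor_null_def
  by (rule generate.incl) (use assms in \<open>unfold tensor_relations_def, blast\<close>)

text \<open>The universal property of the tensor product in the form used throughout: a condition on
  formal combinations that defines a subgroup holds on \<open>Null\<close> as soon as it holds for
  the two bilinearity relations.\<close>

lemma Null_minimal:
  assumes "subgroup S Fr"
    and "\<And>a b u. \<lbrakk>a \<in> carrier Zp; b \<in> carrier Zp; u \<in> carrier UO\<rbrakk> \<Longrightarrow>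
      frag_of (a \<otimes>\<^bsub>Zp\<^esub> b, u) - frag_of (a, u) - frag_of (b, u) \<in> S"
    and "\<And>a u w. \<lbrakk>a \<in> carrier Zp; u \<in> carrier UO; w \<in> carrier UO\<rbrakk> \<Longrightarrow>
      frag_of (a, u \<otimes>\<^bsub>UO\<^esub> w) - frag_of (a, u) - frag_of (a, w) \<in> S"
  shows "Null \<subseteq> S"
  unfolding tensor_null_def
  by (rule group.generate_subgroup_incl [OF group_free_Abelian_group _ assms(1)])
     (use assms(2,3) in \<open>unfold tensor_relations_def, blast\<close>)

lemma LU_comm_group: "comm_group LU"
proof (rule group.group_comm_groupI)
  show "group LU" unfolding local_principal_units_def
    using U1_group by (simp add: comm_group_def)
  fix x y assume xy: "x \<in> carrier LU" "y \<in> carrier LU"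
  have "x v \<otimes>\<^bsub>principal_units F v\<^esub> y v = y v \<otimes>\<^bsub>principal_units F v\<^esub> x v" if "v \<in> places_above F p" for v
    using xy that U1_group [OF that]
    by (intro comm_monoid.m_comm) (auto simp: local_principal_units_def comm_group_def)
  then show "x \<otimes>\<^bsub>LU\<^esub> y = y \<otimes>\<^bsub>LU\<^esub> x" unfolding local_principal_units_def by (auto intro: restrict_ext)
qed

sublocale LU: comm_group LU by (rule LU_comm_group)

lemma leopoldt_pure_closed: "leopoldt_pure F p \<in> Pairs \<rightarrow> carrier LU"
proof
  fix t assume t: "t \<in> Pairs"
  obtain a u where au: "t = (a, u)" by fastforce
  have u: "u \<in> carrier UO" "a \<in> carrier (padic_integers p)" using t au by (auto simp: tensor_pairs_def)
  have "leopoldt_pure F p t v \<in> carrier (principal_units F v)" if v: "v \<in> places_above F p" for v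
  proof -
    interpret V: padic_field F v p using place v .
    show ?thesis using V.leopoldt_pure_place [OF v] t au V.unit_seq_U1 V.tame_unit [OF u(1)] padic_rep(1) [OF prime_p u(2)]
      by metis
  qed
  then show "leopoldt_pure F p t \<in> carrier LU"
    unfolding local_principal_units_def by (auto simp: leopoldt_pure_def split: prod.split)
qed

lemma leo_hom: "leo \<in> hom Fr LU"
  unfolding leo_def by (rule LU.frag_eval_hom [OF leopoldt_pure_closed])

text \<open>Evaluation at a place is a homomorphism and commutes with \<open>frag_eval\<close>; at
  that place the value is the class of one explicit Cauchy sequence of global units.\<close>

lemma leo_component:
  assumes v: "v \<in> places_above F p" and z: "z \<in> carrier Fr"
  shows "leo z v = \<one>\<^bsub>completion F v\<^esub> \<longleftrightarrow> (\<lambda>n. v (unit_approx F p z n \<ominus> \<one>)) \<longlonglongrightarrow> 0"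
proof -
  interpret V: padic_field F v p using place v .
  have hom: "(\<lambda>f. f v) \<in> hom LU (principal_units F v)"
    using v by (auto simp: hom_def local_principal_units_def)
  have "leo z v = frag_eval (principal_units F v) ((\<lambda>f. f v) \<circ> leopoldt_pure F p) z"
    unfolding leo_def
    using hom_frag_eval [OF LU_comm_group V.U1_comm_group hom leopoldt_pure_closed z] by simp
  also have "\<dots> = frag_eval (principal_units F v) (\<lambda>(a, u). V.cls (V.unit_seq u (padic_rep p a))) z"
  proof (rule frag_eval_cong [OF V.U1_comm_group _ _ z])
    show "(\<lambda>f. f v) \<circ> leopoldt_pure F p \<in> Pairs \<rightarrow> carrier (principal_units F v)"
      using hom leopoldt_pure_closed by (auto simp: hom_def Pi_iff)
    show "((\<lambda>f. f v) \<circ> leopoldt_pure F p) t = (case t of (a, u) \<Rightarrow> V.cls (V.unit_seq u (padic_rep p a)))"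
      if "t \<in> Pairs" for t using V.leopoldt_pure_place [OF v] that by (cases t) simp
  qed
  also have "\<dots> = V.cls (unit_approx F p z)" using V.unit_approx_cls [OF z] by simp
  finally have "leo z v = V.cls (unit_approx F p z)" .
  then show ?thesis
    using V.cls_eq_iff [of "unit_approx F p z" "\<lambda>_. \<one>"] V.unit_approx_cls [OF z] V.cls_one by simp
qed

lemma one_LU: "\<one>\<^bsub>LU\<^esub> = (\<lambda>v\<in>places_above F p. \<one>\<^bsub>completion F v\<^esub>)"
  by (auto simp: local_principal_units_def principal_units_def)

lemma leo_eq_one_iff:
  assumes z: "z \<in> carrier Fr" shows "leo z = \<one>\<^bsub>LU\<^esub> \<longleftrightarrow> z \<in> Ker"
proof -
  have "leo z \<in> carrier LU" using leo_hom z by (auto simp: hom_def)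
  then have "leo z \<in> extensional (places_above F p)" by (auto simp: local_principal_units_def PiE_def)
  then have "leo z = \<one>\<^bsub>LU\<^esub> \<longleftrightarrow> (\<forall>v\<in>places_above F p. leo z v = \<one>\<^bsub>completion F v\<^esub>)"
    unfolding one_LU by (auto intro!: extensionalityI)
  then show ?thesis using leo_component [OF _ z] z by (simp add: leo_kernel_def)
qed

lemma leo_diff: "\<lbrakk>x \<in> carrier Fr; y \<in> carrier Fr\<rbrakk> \<Longrightarrow> leo (x - y) = leo x \<otimes>\<^bsub>LU\<^esub> inv\<^bsub>LU\<^esub> leo y"
  using free_Abelian_group_hom_diff [OF leo_hom LU.is_group] .

lemma leo_closed: "x \<in> carrier Fr \<Longrightarrow> leo x \<in> carrier LU"
  using leo_hom by (auto simp: hom_def)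

lemma diff_closed: "\<lbrakk>x \<in> carrier Fr; y \<in> carrier Fr\<rbrakk> \<Longrightarrow> x - y \<in> carrier Fr"
  using keys_diff [of x y] by auto

lemma add_closed: "\<lbrakk>x \<in> carrier Fr; y \<in> carrier Fr\<rbrakk> \<Longrightarrow> x + y \<in> carrier Fr"
  using keys_add [of x y] by auto

lemma leo_diff_Ker: "\<lbrakk>x \<in> carrier Fr; y \<in> carrier Fr\<rbrakk> \<Longrightarrow> x - y \<in> Ker \<longleftrightarrow> leo x = leo y"
  using leo_eq_one_iff [OF diff_closed] leo_diff leo_closed LU.inv_solve_right' [of "\<one>\<^bsub>LU\<^esub>" "leo x" "leo y"]
  by (metis LU.inv_closed LU.l_one LU.one_closed LU.r_inv LU.inv_equality LU.inv_inv)

lemma Ker_closed: "z \<in> Ker \<Longrightarrow> z \<in> carrier Fr" by (simp add: leo_kernel_def)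

lemma Ker_subgroup: "subgroup Ker Fr"
proof -
  interpret h: group_hom Fr LU leo using leo_hom by (simp add: group_hom_def group_hom_axioms_def)
  have "Ker = kernel Fr LU leo" using leo_eq_one_iff Ker_closed by (auto simp: kernel_def)
  then show ?thesis using h.subgroup_kernel by simp
qed

text \<open>Bilinearity of \<open>leopoldt_pure\<close>. It makes \<open>leo\<close> constant on
  cosets of \<open>Null\<close>, so that \<open>the_elem\<close> in \<open>leopoldt_map\<close> is
  applied to a singleton.\<close>

lemma Null_Ker: "Null \<subseteq> Ker"
proof (rule Null_minimal [OF Ker_subgroup])
  have pure: "leo (frag_of t) = leopoldt_pure F p t" if "t \<in> Pairs" for t
    unfolding leo_def using that leopoldt_pure_closed by (intro LU.frag_eval_frag_of) auto
  have in_Ker: "frag_of s - frag_of t - frag_of w \<in> Ker"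
    if st: "s \<in> Pairs" "t \<in> Pairs" "w \<in> Pairs"
      and *: "\<And>v. v \<in> places_above F p \<Longrightarrow> leopoldt_pure F p s v = leopoldt_pure F p t v \<otimes>\<^bsub>completion F v\<^esub> leopoldt_pure F p w v"
      for s t w
  proof -
    have m: "x \<otimes>\<^bsub>LU\<^esub> y = (\<lambda>v\<in>places_above F p. x v \<otimes>\<^bsub>completion F v\<^esub> y v)" for x y
      by (auto simp: local_principal_units_def principal_units_def)
    have c: "leopoldt_pure F p t \<in> carrier LU" "leopoldt_pure F p w \<in> carrier LU" "leopoldt_pure F p s \<in> carrier LU"
      using st leopoldt_pure_closed by auto
    have "leopoldt_pure F p s = leopoldt_pure F p t \<otimes>\<^bsub>LU\<^esub> leopoldt_pure F p w"
    proof (rule extensionalityI)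
      show "leopoldt_pure F p s \<in> extensional (places_above F p)" using c(3) by (auto simp: local_principal_units_def PiE_def)
      show "leopoldt_pure F p t \<otimes>\<^bsub>LU\<^esub> leopoldt_pure F p w \<in> extensional (places_above F p)" unfolding m by simp
      show "leopoldt_pure F p s v = (leopoldt_pure F p t \<otimes>\<^bsub>LU\<^esub> leopoldt_pure F p w) v" if "v \<in> places_above F p" for v
        unfolding m using * that by simp
    qed
    moreover have fc: "frag_of s \<in> carrier Fr" "frag_of t \<in> carrier Fr" "frag_of w \<in> carrier Fr" using st by auto
    ultimately have "leo (frag_of s) = leo (frag_of t + frag_of w)"
      using leo_hom pure st unfolding hom_def by simp
    then have "frag_of s - (frag_of t + frag_of w) \<in> Ker" using leo_diff_Ker fc add_closed by blast
    then show ?thesis by (simp add: diff_diff_eq)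
  qed
  fix a u assume au: "a \<in> carrier Zp" "u \<in> carrier UO"
  have P: "(a', u') \<in> Pairs" if "a' \<in> carrier Zp" "u' \<in> carrier UO" for a' u' using that by (simp add: tensor_pairs_def)
  {
    fix b assume b: "b \<in> carrier Zp"
    show "frag_of (a \<otimes>\<^bsub>Zp\<^esub> b, u) - frag_of (a, u) - frag_of (b, u) \<in> Ker"
    proof (rule in_Ker [OF P P P])
      fix v assume v: "v \<in> places_above F p"
      interpret V: padic_field F v p using place v .
      show "leopoldt_pure F p (a \<otimes>\<^bsub>Zp\<^esub> b, u) v = leopoldt_pure F p (a, u) v \<otimes>\<^bsub>completion F v\<^esub> leopoldt_pure F p (b, u) v"
        using V.leopoldt_pure_place [OF v P] au b Zp.m_closed [OF au(1) b] V.cls_unit_seq_add [of a b u] by simp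
    qed (use au b Zp.m_closed in blast)+
  next
    fix w assume w: "w \<in> carrier UO"
    show "frag_of (a, u \<otimes>\<^bsub>UO\<^esub> w) - frag_of (a, u) - frag_of (a, w) \<in> Ker"
    proof (rule in_Ker [OF P P P])
      fix v assume v: "v \<in> places_above F p"
      interpret V: padic_field F v p using place v .
      obtain N M where "V.tame N u" "V.tame M w" using V.tame_unit au w by blast
      then show "leopoldt_pure F p (a, u \<otimes>\<^bsub>UO\<^esub> w) v = leopoldt_pure F p (a, u) v \<otimes>\<^bsub>completion F v\<^esub> leopoldt_pure F p (a, w) v"
        using V.leopoldt_pure_place [OF v P] au w UO.m_closed [OF au(2) w] V.unit_seq_mult [of N u M w "padic_rep p a"]
          padic_rep(1) [OF prime_p, of a] by simp
    qed (use au w UO.m_closed in blast)+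
  }
qed

lemma coset_eq_iff:
  assumes "x \<in> carrier Fr" "y \<in> carrier Fr"
  shows "Null #>\<^bsub>Fr\<^esub> x = Null #>\<^bsub>Fr\<^esub> y \<longleftrightarrow> x - y \<in> Null"
proof
  have c: "Null #>\<^bsub>Fr\<^esub> z = (\<lambda>r. r + z) ` Null" for z by (auto simp: r_coset_def)
  {
    assume "Null #>\<^bsub>Fr\<^esub> x = Null #>\<^bsub>Fr\<^esub> y"
    moreover have "0 + x \<in> (\<lambda>r. r + x) ` Null" using Null_zero by blast
    ultimately obtain r where "r \<in> Null" "x = r + y" unfolding c by auto
    then show "x - y \<in> Null" by simp
  next
    assume d: "x - y \<in> Null"
    have "r + x \<in> (\<lambda>r. r + y) ` Null" if "r \<in> Null" for r
      using Null_add [OF that d] by (intro image_eqI [of _ _ "r + (x - y)"]) auto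
    moreover have "r + y \<in> (\<lambda>r. r + x) ` Null" if "r \<in> Null" for r
      using Null_diff [OF that d] by (intro image_eqI [of _ _ "r - (x - y)"]) auto
    ultimately show "Null #>\<^bsub>Fr\<^esub> x = Null #>\<^bsub>Fr\<^esub> y" unfolding c by blast
  }
qed

lemma carrier_tensored_units: "carrier (tensored_units F p) = (\<lambda>z. Null #>\<^bsub>Fr\<^esub> z) ` carrier Fr"
  by (auto simp: tensored_units_def tensor_group_def FactGroup_def RCOSETS_def tensor_null_def tensor_pairs_def)

lemma leopoldt_map_coset:
  assumes z: "z \<in> carrier Fr" shows "leopoldt_map F p (Null #>\<^bsub>Fr\<^esub> z) = leo z"
proof -
  have "leo y = leo z" if "y \<in> Null #>\<^bsub>Fr\<^esub> z" for y
  proof -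
    obtain r where r: "r \<in> Null" "y = r + z" using \<open>y \<in> Null #>\<^bsub>Fr\<^esub> z\<close> by (auto simp: r_coset_def)
    then have "y - z \<in> Ker" "y \<in> carrier Fr" using Null_Ker Null_closed add_closed z by auto
    then show ?thesis using leo_diff_Ker z by blast
  qed
  moreover have "z \<in> Null #>\<^bsub>Fr\<^esub> z" using Null_zero by (force simp: r_coset_def)
  ultimately have "leo ` (Null #>\<^bsub>Fr\<^esub> z) = {leo z}" by blast
  then show ?thesis unfolding leopoldt_map_def leo_def frag_eval_def [abs_def] by simp
qed

theorem Leo_iff: "Leo F p \<longleftrightarrow> Ker \<subseteq> Null"
proof -
  have "Leo F p \<longleftrightarrow> (\<forall>x\<in>carrier Fr. \<forall>y\<in>carrier Fr. leo x = leo y \<longrightarrow> x - y \<in> Null)"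
    unfolding Leo_def inj_on_def carrier_tensored_units
    by (auto simp: leopoldt_map_coset coset_eq_iff simp del: carrier_free_Abelian_group_iff)
  also have "\<dots> \<longleftrightarrow> Ker \<subseteq> Null"
  proof
    assume *: "\<forall>x\<in>carrier Fr. \<forall>y\<in>carrier Fr. leo x = leo y \<longrightarrow> x - y \<in> Null"
    have "z \<in> Null" if "z \<in> Ker" for z
      using * Ker_closed [OF that] leo_diff_Ker [of z 0] that by force
    then show "Ker \<subseteq> Null" by blast
  qed (use leo_diff_Ker in blast)
  finally show ?thesis .
qed

end

section \<open>Torsion in the kernel of the Leopoldt map\<close>

lemma padic_class_int_pow:
  assumes "prime p" "padic_cauchy p k"
  shows "padic_class p k [^]\<^bsub>add_monoid (padic_integers p)\<^esub> (j::int) = padic_class p (\<lambda>n. k n * j)"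
proof -
  interpret Z: comm_group "add_monoid (padic_integers p)" by (rule padic_integers_comm_group [OF assms(1)])
  have C: "padic_cauchy p (\<lambda>n. k n * i)" for i using padic_cauchy_mult [OF assms(2) padic_cauchy_const] by blast
  have add: "padic_class p (\<lambda>n. k n * (i + l)) =
    padic_class p (\<lambda>n. k n * i) \<otimes>\<^bsub>add_monoid (padic_integers p)\<^esub> padic_class p (\<lambda>n. k n * l)" for i l
    using padic_class_add [OF assms(1) C C, of i l] by (simp add: distrib_left)
  have cl: "padic_class p (\<lambda>n. k n * i) \<in> carrier (add_monoid (padic_integers p))" for i
    using padic_class_closed [OF assms(1) C] by simp
  show ?thesis
    using Z.int_pow_unique [of "\<lambda>i. padic_class p (\<lambda>n. k n * i)" j, OF cl add] by simp
qed

lemma padic_null_cancel: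
  assumes "coprime (int M) (int p)" "padic_null p (\<lambda>n. k n * int M)" shows "padic_null p k"
  using assms unfolding padic_null_def
  by (metis coprime_commute coprime_dvd_mult_left_iff coprime_power_left_iff)

text \<open>The inverses of \<open>M\<close> modulo the powers \<open>p ^ n\<close> form a p-adic
  Cauchy sequence, so \<open>M\<close> is invertible in the p-adic integers. Uniqueness matters as
  much as existence: it makes the quotient additive.\<close>

lemma padic_divide_coprime:
  assumes p: "prime p" and M: "coprime M p" and a: "a \<in> carrier (padic_integers p)"
  shows "\<exists>!b. b \<in> carrier (padic_integers p) \<and> b [^]\<^bsub>add_monoid (padic_integers p)\<^esub> int M = a"
proof -
  have M': "coprime (int M) (int p)" using M by simp
  obtain k where k: "padic_cauchy p k" "padic_class p k = a" using padic_integers_ex [OF p a] by blast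
  have "\<exists>m. int p ^ n dvd int M * m - 1" for n
  proof -
    have "coprime (int M) (int p ^ n)" using M' by simp
    then obtain s t where "s * int M + t * int p ^ n = 1"
      using bezout_int [of "int M" "int p ^ n"] by (auto simp: coprime_iff_gcd_eq_1)
    then have "int M * s - 1 = int p ^ n * (- t)" by (simp add: algebra_simps)
    then show ?thesis by (metis dvd_triv_left)
  qed
  then obtain m where m: "\<And>n. int p ^ n dvd int M * m n - 1" by metis
  have m': "int p ^ r dvd int M * m n - 1" if "n \<ge> r" for r n
    using m [of n] that le_imp_power_dvd dvd_trans by blast
  have mC: "padic_cauchy p m" unfolding padic_cauchy_def
  proof
    fix r
    have "int p ^ r dvd m i - m j" if "i \<ge> r" "j \<ge> r" for i j
    proof -
      have "int p ^ r dvd (int M * m i - 1) - (int M * m j - 1)" by (rule dvd_diff [OF m' [OF that(1)] m' [OF that(2)]])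
      then have "int p ^ r dvd (m i - m j) * int M" by (simp add: algebra_simps)
      then show ?thesis using M' by (metis coprime_commute coprime_dvd_mult_left_iff coprime_power_left_iff)
    qed
    then show "\<exists>N. \<forall>i\<ge>N. \<forall>j\<ge>N. int p ^ r dvd m i - m j" by blast
  qed
  have kmC: "padic_cauchy p (\<lambda>n. k n * m n)" using padic_cauchy_mult k mC by blast
  have kmMC: "padic_cauchy p (\<lambda>n. k n * m n * int M)" using padic_cauchy_mult [OF kmC padic_cauchy_const] by blast
  have "padic_null p (\<lambda>n. k n * m n * int M - k n)" unfolding padic_null_def
  proof
    fix r
    have "int p ^ r dvd k n * m n * int M - k n" if "n \<ge> r" for n
    proof -
      have "k n * m n * int M - k n = k n * (int M * m n - 1)" by (simp add: algebra_simps)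
      then show ?thesis using m' [OF that] by simp
    qed
    then show "\<exists>M'. \<forall>n\<ge>M'. int p ^ r dvd k n * m n * int M - k n" by blast
  qed
  then have ex: "padic_class p (\<lambda>n. k n * m n) [^]\<^bsub>add_monoid (padic_integers p)\<^esub> int M = a"
    using padic_class_int_pow [OF p kmC] padic_class_eq_iff [OF p kmMC k(1)] k(2) by simp
  show ?thesis
  proof (rule ex1I)
    show "padic_class p (\<lambda>n. k n * m n) \<in> carrier (padic_integers p) \<and>
      padic_class p (\<lambda>n. k n * m n) [^]\<^bsub>add_monoid (padic_integers p)\<^esub> int M = a"
      using ex padic_class_closed [OF p kmC] by blast
    fix b assume b: "b \<in> carrier (padic_integers p) \<and> b [^]\<^bsub>add_monoid (padic_integers p)\<^esub> int M = a"
    then obtain l where l: "padic_cauchy p l" "padic_class p l = b" using padic_integers_ex [OF p] by blast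
    have lMC: "padic_cauchy p (\<lambda>n. l n * int M)" using padic_cauchy_mult [OF l(1) padic_cauchy_const] by blast
    have "padic_class p (\<lambda>n. l n * int M) = padic_class p (\<lambda>n. k n * m n * int M)"
      using b l(2) ex padic_class_int_pow [OF p l(1)] padic_class_int_pow [OF p kmC] by simp
    then have "padic_null p (\<lambda>n. (l n - k n * m n) * int M)"
      using padic_class_eq_iff [OF p lMC kmMC] by (simp add: left_diff_distrib)
    then have "padic_null p (\<lambda>n. l n - k n * m n)" by (rule padic_null_cancel [OF M'])
    then show "b = padic_class p (\<lambda>n. k n * m n)" using padic_class_eq_iff [OF p l(1) kmC] l(2) by simp
  qed
qed

text \<open>The integers are dense, so every p-adic integer is an ordinary integer modulo
  \<open>p ^ s\<close>.\<close>

lemma padic_divide_power: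
  assumes p: "prime p" and a: "a \<in> carrier (padic_integers p)"
  shows "\<exists>b\<in>carrier (padic_integers p). \<exists>j::int. a = padic_class p (\<lambda>_. j) \<oplus>\<^bsub>padic_integers p\<^esub>
     b [^]\<^bsub>add_monoid (padic_integers p)\<^esub> (int p ^ s)"
proof -
  obtain k where k: "padic_cauchy p k" "padic_class p k = a" using padic_integers_ex [OF p a] by blast
  obtain M where M: "\<forall>m\<ge>M. \<forall>n\<ge>M. int p ^ s dvd k m - k n" using k(1) unfolding padic_cauchy_def by blast
  \<comment> \<open>The division is exact from index \<open>M\<close> on; the earlier values do not
    affect the class.\<close>
  define b where "b n = (k n - k M) div int p ^ s" for n
  have bM: "b n * int p ^ s = k n - k M" if "n \<ge> M" for n
    using M that by (simp add: b_def)
  have pos: "int p ^ s > 0" using p prime_gt_0_nat by simp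
  have bC: "padic_cauchy p b" unfolding padic_cauchy_def
  proof
    fix r
    obtain N where N: "\<forall>m\<ge>N. \<forall>n\<ge>N. int p ^ (r + s) dvd k m - k n" using k(1) unfolding padic_cauchy_def by blast
    have "int p ^ r dvd b m - b n" if "m \<ge> max M N" "n \<ge> max M N" for m n
    proof -
      have "(b m - b n) * int p ^ s = k m - k n" using bM [of m] bM [of n] that by (simp add: left_diff_distrib)
      moreover have "int p ^ (r + s) dvd k m - k n" using N that by auto
      ultimately have "int p ^ r * int p ^ s dvd (b m - b n) * int p ^ s" by (simp add: power_add)
      then show ?thesis using pos by auto
    qed
    then show "\<exists>M. \<forall>m\<ge>M. \<forall>n\<ge>M. int p ^ r dvd b m - b n" by blast
  qed
  have bpC: "padic_cauchy p (\<lambda>n. b n * int p ^ s)" using padic_cauchy_mult [OF bC padic_cauchy_const] by blast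
  have sC: "padic_cauchy p (\<lambda>n. k M + b n * int p ^ s)" using padic_cauchy_add [OF padic_cauchy_const bpC] .
  have "padic_null p (\<lambda>n. k n - (k M + b n * int p ^ s))" unfolding padic_null_def
    using bM by (metis (no_types, opaque_lifting) add_diff_cancel_left' diff_add_cancel dvd_0_right diff_self add.commute)
  then have "a = padic_class p (\<lambda>n. k M + b n * int p ^ s)"
    using padic_class_eq_iff [OF p k(1) sC] k(2) by simp
  then show ?thesis
    using padic_class_add [OF p padic_cauchy_const bpC, of "k M"] padic_class_int_pow [OF p bC, of "int p ^ s"]
      padic_class_closed [OF p bC] by metis
qed

text \<open>An ordinary integer divisible by \<open>p ^ s\<close> in the p-adic integers is so among
  the integers, and multiplication by \<open>p ^ s\<close> is injective p-adically.\<close>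

lemma padic_integer_divide:
  assumes p: "prime p" and d: "d \<in> carrier (padic_integers p)"
    and e: "d [^]\<^bsub>add_monoid (padic_integers p)\<^esub> (int p ^ s) = padic_class p (\<lambda>_. j)"
  shows "\<exists>i. d = padic_class p (\<lambda>_. i)"
proof -
  obtain k where k: "padic_cauchy p k" "padic_class p k = d" using padic_integers_ex [OF p d] by blast
  have kC: "padic_cauchy p (\<lambda>n. k n * int p ^ s)" using padic_cauchy_mult [OF k(1) padic_cauchy_const] by blast
  have N: "padic_null p (\<lambda>n. k n * int p ^ s - j)"
    using e padic_class_int_pow [OF p k(1)] padic_class_eq_iff [OF p kC padic_cauchy_const, of j] k(2) by simp
  then obtain M where "int p ^ s dvd k M * int p ^ s - j" unfolding padic_null_def by blast
  then have "int p ^ s dvd j" by (metis dvd_diff_commute dvd_diff_right_iff dvd_triv_right)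
  then obtain i where i: "j = i * int p ^ s" by (metis dvd_def mult.commute)
  have pos: "int p ^ s > 0" using p prime_gt_0_nat by simp
  have "padic_null p (\<lambda>n. k n - i)" unfolding padic_null_def
  proof
    fix r
    obtain M where "\<forall>n\<ge>M. int p ^ (r + s) dvd k n * int p ^ s - j" using N unfolding padic_null_def by blast
    then have "\<forall>n\<ge>M. int p ^ r * int p ^ s dvd (k n - i) * int p ^ s" by (simp add: i power_add left_diff_distrib)
    then show "\<exists>M. \<forall>n\<ge>M. int p ^ r dvd k n - i" using pos by auto
  qed
  then show ?thesis using padic_class_eq_iff [OF p k(1) padic_cauchy_const] k(2) by metis
qed

text \<open>Measures how far a division with remainder is from being additive: here
  \<open>a\<close>, \<open>b\<close>, \<open>c\<close> are quotients by \<open>q\<close> of two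
  elements and of their product, the powers of \<open>z\<close> are the remainders, and
  \<open>d\<close> is the defect.\<close>

lemma (in comm_group) quotient_power:
  assumes "z \<in> carrier G" "a \<in> carrier G" "b \<in> carrier G" "c \<in> carrier G"
    and e: "z [^] (l::int) \<otimes> c [^] (q::int) = (z [^] j \<otimes> a [^] q) \<otimes> (z [^] i \<otimes> b [^] q)"
  shows "\<exists>d\<in>carrier G. c = d \<otimes> (a \<otimes> b) \<and> d [^] q = z [^] (j + i - l)"
proof (intro bexI conjI)
  define d where "d = c \<otimes> inv (a \<otimes> b)"
  show d: "d \<in> carrier G" and c: "c = d \<otimes> (a \<otimes> b)" using assms by (auto simp: d_def m_assoc)
  have "z [^] l \<otimes> d [^] q \<otimes> (a [^] q \<otimes> b [^] q) = z [^] (j + i) \<otimes> (a [^] q \<otimes> b [^] q)"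
    using e assms d by (subst (asm) c) (simp add: int_pow_distrib int_pow_mult m_ac)
  then have "z [^] l \<otimes> d [^] q = z [^] (j + i)" using assms d by simp
  then have "d [^] q = inv (z [^] l) \<otimes> z [^] (j + i)" using assms d by (metis int_pow_closed inv_solve_left)
  then show "d [^] q = z [^] (j + i - l)" using assms by (simp add: int_pow_diff m_comm)
qed

context leopoldt
begin

section \<open>Integer multiples and torsion in the tensor product\<close>

definition one_p where "one_p = padic_class p (\<lambda>_. 1)"

lemma one_p_closed: "one_p \<in> carrier Zp"
  using padic_class_closed [OF prime_p padic_cauchy_const] by (simp add: one_p_def)

lemma one_p_pow: "one_p [^]\<^bsub>Zp\<^esub> (j::int) = padic_class p (\<lambda>_. j)"
  using padic_class_int_pow [OF prime_p padic_cauchy_const, of 1 j] by (simp add: one_p_def)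

lemma pair_in: "\<lbrakk>a \<in> carrier Zp; u \<in> carrier UO\<rbrakk> \<Longrightarrow> frag_of (a, u) \<in> carrier Fr"
  by (simp add: tensor_pairs_def)

lemma Null_trans: "\<lbrakk>x - y \<in> Null; y - z \<in> Null\<rbrakk> \<Longrightarrow> x - z \<in> Null"
  using Null_add [of "x - y" "y - z"] by simp

lemma Null_sym: "x - y \<in> Null \<Longrightarrow> y - x \<in> Null"
  using Null_minus [of "x - y"] by simp

lemma Null_pow_left:
  assumes a: "a \<in> carrier Zp" and u: "u \<in> carrier UO"
  shows "frag_of (a [^]\<^bsub>Zp\<^esub> (k::int), u) - frag_cmul k (frag_of (a, u)) \<in> Null"
proof -
  have one: "frag_of (\<one>\<^bsub>Zp\<^esub>, u) \<in> Null"
    using Null_minus [OF Null_add_left [OF Zp.one_closed Zp.one_closed u]]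
    unfolding Zp.l_one [OF Zp.one_closed] by simp
  have step: "frag_of (a [^]\<^bsub>Zp\<^esub> (i + 1), u) - frag_of (a [^]\<^bsub>Zp\<^esub> i, u) - frag_of (a, u) \<in> Null" for i :: int
    using Null_add_left [OF Zp.int_pow_closed [OF a, of i] a u] Zp.int_pow_mult [OF a, of i 1] Zp.int_pow_1 [OF a]
    by (simp del: monoid.simps)
  let ?x = "frag_of (a, u)"
  show ?thesis
  proof (induction k rule: int_induct [where k=0])
    case base
    show ?case unfolding int_pow_0 using one by simp
  next
    case (step1 i)
    have e: "frag_of (a [^]\<^bsub>Zp\<^esub> (i + 1), u) - frag_cmul (i + 1) ?x =
      (frag_of (a [^]\<^bsub>Zp\<^esub> (i + 1), u) - frag_of (a [^]\<^bsub>Zp\<^esub> i, u) - ?x) + (frag_of (a [^]\<^bsub>Zp\<^esub> i, u) - frag_cmul i ?x)"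
      by (simp add: frag_cmul_distrib algebra_simps del: minus_frag_cmul)
    show ?case unfolding e by (rule Null_add [OF step step1(2)])
  next
    case (step2 i)
    have e: "frag_of (a [^]\<^bsub>Zp\<^esub> (i - 1), u) - frag_cmul (i - 1) ?x =
      (frag_of (a [^]\<^bsub>Zp\<^esub> i, u) - frag_cmul i ?x) - (frag_of (a [^]\<^bsub>Zp\<^esub> (i - 1 + 1), u) - frag_of (a [^]\<^bsub>Zp\<^esub> (i - 1), u) - ?x)"
      by (simp add: frag_cmul_diff_distrib algebra_simps del: minus_frag_cmul)
    show ?case unfolding e by (rule Null_diff [OF step2(2) step])
  qed
qed

lemma Null_pow_right:
  assumes a: "a \<in> carrier Zp" and u: "u \<in> carrier UO"
  shows "frag_of (a, u [^]\<^bsub>UO\<^esub> (k::int)) - frag_cmul k (frag_of (a, u)) \<in> Null"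
proof -
  have one: "frag_of (a, \<one>\<^bsub>UO\<^esub>) \<in> Null"
    using Null_minus [OF Null_add_right [OF a UO.one_closed UO.one_closed]] UO.l_one [OF UO.one_closed] by simp
  have step: "frag_of (a, u [^]\<^bsub>UO\<^esub> (i + 1)) - frag_of (a, u [^]\<^bsub>UO\<^esub> i) - frag_of (a, u) \<in> Null" for i :: int
    using Null_add_right [OF a UO.int_pow_closed [OF u, of i] u] UO.int_pow_mult [OF u, of i 1] UO.int_pow_1 [OF u]
    by simp
  let ?x = "frag_of (a, u)"
  show ?thesis
  proof (induction k rule: int_induct [where k=0])
    case base
    show ?case unfolding int_pow_0 using one by simp
  next
    case (step1 i)
    have e: "frag_of (a, u [^]\<^bsub>UO\<^esub> (i + 1)) - frag_cmul (i + 1) ?x =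
      (frag_of (a, u [^]\<^bsub>UO\<^esub> (i + 1)) - frag_of (a, u [^]\<^bsub>UO\<^esub> i) - ?x) + (frag_of (a, u [^]\<^bsub>UO\<^esub> i) - frag_cmul i ?x)"
      by (simp add: frag_cmul_distrib algebra_simps del: minus_frag_cmul)
    show ?case unfolding e by (rule Null_add [OF step step1(2)])
  next
    case (step2 i)
    have e: "frag_of (a, u [^]\<^bsub>UO\<^esub> (i - 1)) - frag_cmul (i - 1) ?x =
      (frag_of (a, u [^]\<^bsub>UO\<^esub> i) - frag_cmul i ?x) - (frag_of (a, u [^]\<^bsub>UO\<^esub> (i - 1 + 1)) - frag_of (a, u [^]\<^bsub>UO\<^esub> (i - 1)) - ?x)"
      by (simp add: frag_cmul_diff_distrib algebra_simps del: minus_frag_cmul)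
    show ?case unfolding e by (rule Null_diff [OF step2(2) step])
  qed
qed

lemma subgroup_Fr:
  assumes "subgroup S Fr"
  shows "0 \<in> S" "x \<in> S \<Longrightarrow> y \<in> S \<Longrightarrow> x + y \<in> S" "x \<in> S \<Longrightarrow> y \<in> S \<Longrightarrow> x - y \<in> S"
    "x \<in> S \<Longrightarrow> x \<in> carrier Fr" "x \<in> S \<Longrightarrow> frag_cmul k x \<in> S"
proof -
  show "0 \<in> S" using subgroup.one_closed [OF assms] by simp
  show add: "x + y \<in> S" if "x \<in> S" "y \<in> S" for x y using subgroup.m_closed [OF assms that] by simp
  show c: "x \<in> carrier Fr" if "x \<in> S" for x using subgroup.mem_carrier [OF assms that] .
  have "- y \<in> S" if "y \<in> S" for y using subgroup.m_inv_closed [OF assms that] c [OF that] by simp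
  then show "x - y \<in> S" if "x \<in> S" "y \<in> S" using add [of x "- y"] that by simp
  show "frag_cmul k x \<in> S" if "x \<in> S"
    using group.subgroup_int_pow_closed [OF group_free_Abelian_group assms that, of k] c [OF that] by simp
qed

lemma subgroup_FrI:
  assumes "S \<subseteq> carrier Fr" "0 \<in> S" "\<And>x y. x \<in> S \<Longrightarrow> y \<in> S \<Longrightarrow> x - y \<in> S"
  shows "subgroup S Fr"
proof (rule group.subgroupI [OF group_free_Abelian_group])
  have minus: "- x \<in> S" if "x \<in> S" for x using assms(3) [OF assms(2) that] by simp
  show "inv\<^bsub>Fr\<^esub> x \<in> S" if "x \<in> S" for x
  proof -
    have "Poly_Mapping.keys x \<subseteq> Pairs" using subsetD [OF assms(1) that] unfolding carrier_free_Abelian_group_iff .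
    then show ?thesis using minus [OF that] by simp
  qed
  show "x \<otimes>\<^bsub>Fr\<^esub> y \<in> S" if "x \<in> S" "y \<in> S" for x y using assms(3) [OF that(1) minus [OF that(2)]] by simp
qed (use assms in auto)

text \<open>Dividing the first tensor factor by \<open>n\<close>, up to an error in \<open>S\<close>, is well defined modulo \<open>S\<close>
  on the tensor product, hence \<open>S\<close> contains the \<open>n\<close>-torsion.\<close>

lemma torsion_subset:
  assumes S: "subgroup S Fr" "Null \<subseteq> S" and \<beta>: "\<beta> \<in> carrier Zp \<rightarrow> carrier Zp"
    and add: "\<And>a b u. \<lbrakk>a \<in> carrier Zp; b \<in> carrier Zp; u \<in> carrier UO\<rbrakk> \<Longrightarrow>
      frag_of (\<beta> (a \<otimes>\<^bsub>Zp\<^esub> b), u) - frag_of (\<beta> a, u) - frag_of (\<beta> b, u) \<in> S"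
    and div: "\<And>a u. \<lbrakk>a \<in> carrier Zp; u \<in> carrier UO\<rbrakk> \<Longrightarrow>
      frag_cmul n (frag_of (\<beta> a, u)) - frag_of (a, u) \<in> S"
    and z: "z \<in> carrier Fr" "frag_cmul n z \<in> Null"
  shows "z \<in> S"
proof -
  note SS = subgroup_Fr [OF S(1)]
  \<comment> \<open>\<open>\<beta>\<close> applied to the first tensor factor and extended linearly.
    Since \<open>\<beta>\<close> is additive only up to \<open>S\<close>, this map is meaningful on
    the tensor product only modulo \<open>S\<close>.\<close>
  let ?\<Psi> = "frag_extend (\<lambda>(a, u). frag_of (\<beta> a, u))"
  have \<Psi>c: "?\<Psi> x \<in> carrier Fr" if "x \<in> carrier Fr" for x
    using that \<beta> by (intro keys_frag_extend_subset) (auto simp: tensor_pairs_def)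
  have "Null \<subseteq> {x \<in> carrier Fr. ?\<Psi> x \<in> S}"
  proof (rule Null_minimal)
    show "subgroup {x \<in> carrier Fr. ?\<Psi> x \<in> S} Fr"
    proof (rule subgroup_FrI)
      show "0 \<in> {x \<in> carrier Fr. ?\<Psi> x \<in> S}" using SS(1) by simp
      show "x - y \<in> {x \<in> carrier Fr. ?\<Psi> x \<in> S}"
        if "x \<in> {x \<in> carrier Fr. ?\<Psi> x \<in> S}" "y \<in> {x \<in> carrier Fr. ?\<Psi> x \<in> S}" for x y
        using that diff_closed [of x y] SS(3) [of "?\<Psi> x" "?\<Psi> y"] by (auto simp: frag_extend_diff)
    qed auto
    fix a u assume au: "a \<in> carrier Zp" "u \<in> carrier UO"
    show "frag_of (a \<otimes>\<^bsub>Zp\<^esub> b, u) - frag_of (a, u) - frag_of (b, u) \<in> {x \<in> carrier Fr. ?\<Psi> x \<in> S}"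
      if b: "b \<in> carrier Zp" for b
      using add [OF au(1) b au(2)] Null_closed [OF Null_add_left [OF au(1) b au(2)]] by (simp add: frag_extend_diff)
    show "frag_of (a, u \<otimes>\<^bsub>UO\<^esub> w) - frag_of (a, u) - frag_of (a, w) \<in> {x \<in> carrier Fr. ?\<Psi> x \<in> S}"
      if w: "w \<in> carrier UO" for w
      using Null_add_right [of "\<beta> a" u w] S(2) \<beta> au w Null_closed [OF Null_add_right [OF au w]]
      by (simp add: frag_extend_diff Pi_iff subset_iff)
  qed
  then have "?\<Psi> (frag_cmul n z) \<in> S" using z by blast
  then have 1: "frag_cmul n (?\<Psi> z) \<in> S" by (simp add: frag_extend_cmul)
  have "Poly_Mapping.keys z \<subseteq> Pairs" using z by simp
  then have "frag_cmul n (?\<Psi> z) - z \<in> S"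
  proof (rule free_Abelian_group_induct)
    show "frag_cmul n (?\<Psi> 0) - 0 \<in> S" using SS(1) by simp
    show "frag_cmul n (?\<Psi> (frag_of t)) - frag_of t \<in> S" if "t \<in> Pairs" for t
      using that div by (cases t) (auto simp: tensor_pairs_def)
    fix x y assume "frag_cmul n (?\<Psi> x) - x \<in> S" "frag_cmul n (?\<Psi> y) - y \<in> S"
    then have "(frag_cmul n (?\<Psi> x) - x) - (frag_cmul n (?\<Psi> y) - y) \<in> S" using SS(3) by blast
    moreover have "frag_cmul n (?\<Psi> (x - y)) = frag_cmul n (?\<Psi> x) - frag_cmul n (?\<Psi> y)"
      using frag_cmul_distrib2 [of n "?\<Psi> x - ?\<Psi> y" "?\<Psi> y"] by (simp add: frag_extend_diff)
    moreover have "frag_cmul n (?\<Psi> x) - frag_cmul n (?\<Psi> y) - (x - y) =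
        (frag_cmul n (?\<Psi> x) - x) - (frag_cmul n (?\<Psi> y) - y)"
      by (simp add: algebra_simps del: minus_frag_cmul)
    ultimately show "frag_cmul n (?\<Psi> (x - y)) - (x - y) \<in> S" by metis
  qed
  \<comment> \<open>\<open>n\<close> times \<open>?\<Psi> z\<close> lies in \<open>S\<close> because
    \<open>n\<close> times \<open>z\<close> is a relation, and modulo \<open>S\<close> it is
    congruent to \<open>z\<close>.\<close>
  from SS(3) [OF 1 this] show ?thesis by simp
qed

text \<open>Division by \<open>M\<close> on the p-adic integers is additive because it is unique, so
  \<open>torsion_subset\<close> applies with the smallest error group \<open>Null\<close>.\<close>

lemma coprime_torsion:
  assumes M: "coprime M p" and z: "z \<in> carrier Fr" "frag_cmul (int M) z \<in> Null" shows "z \<in> Null"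
proof -
  define \<beta> where "\<beta> a = (THE b. b \<in> carrier (padic_integers p) \<and> b [^]\<^bsub>Zp\<^esub> int M = a)" for a
  have \<beta>: "\<beta> a \<in> carrier Zp" "\<beta> a [^]\<^bsub>Zp\<^esub> int M = a" if "a \<in> carrier Zp" for a
    using theI' [OF padic_divide_coprime [OF prime_p M, of a]] that unfolding \<beta>_def by auto
  have uniq: "b = \<beta> a" if "b \<in> carrier Zp" "b [^]\<^bsub>Zp\<^esub> int M = a" "a \<in> carrier Zp" for a b
    using padic_divide_coprime [OF prime_p M, of a] that \<beta> [of a] by auto
  show ?thesis
  proof (rule torsion_subset [OF Null_subgroup subset_refl _ _ _ z])
    show "\<beta> \<in> carrier Zp \<rightarrow> carrier Zp" using \<beta> by auto
    fix a u assume au: "a \<in> carrier Zp" "u \<in> carrier UO"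
    show "frag_cmul (int M) (frag_of (\<beta> a, u)) - frag_of (a, u) \<in> Null"
      using Null_sym [OF Null_pow_left [OF \<beta>(1) [OF au(1)] au(2), of "int M"]] \<beta>(2) [OF au(1)] by simp
    fix b assume b: "b \<in> carrier Zp"
    have "\<beta> a \<otimes>\<^bsub>Zp\<^esub> \<beta> b = \<beta> (a \<otimes>\<^bsub>Zp\<^esub> b)"
    proof (rule uniq)
      show "\<beta> a \<otimes>\<^bsub>Zp\<^esub> \<beta> b \<in> carrier Zp" using Zp.m_closed \<beta> au b by blast
      show "(\<beta> a \<otimes>\<^bsub>Zp\<^esub> \<beta> b) [^]\<^bsub>Zp\<^esub> int M = a \<otimes>\<^bsub>Zp\<^esub> b"
        using Zp.int_pow_distrib [OF \<beta>(1) [OF au(1)] \<beta>(1) [OF b], of "int M"] \<beta>(2) [OF au(1)] \<beta>(2) [OF b] by (simp del: monoid.simps)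
      show "a \<otimes>\<^bsub>Zp\<^esub> b \<in> carrier Zp" using Zp.m_closed au b by blast
    qed
    then show "frag_of (\<beta> (a \<otimes>\<^bsub>Zp\<^esub> b), u) - frag_of (\<beta> a, u) - frag_of (\<beta> b, u) \<in> Null"
      using Null_add_left [OF \<beta>(1) [OF au(1)] \<beta>(1) [OF b] au(2)] by (simp del: monoid.simps)
  qed
qed

text \<open>The error group is the image of the global units under tensoring with 1. Division by
  \<open>p ^ s\<close> leaves an integer \<open>j\<close> as remainder, and the tensor of
  \<open>j\<close> with \<open>u\<close> equals that of 1 with the \<open>j\<close>-th power of
  \<open>u\<close>, so all errors fall into this group.\<close>

lemma p_power_torsion:
  assumes z: "z \<in> carrier Fr" "frag_cmul (int p ^ s) z \<in> Null"
  shows "\<exists>u\<in>carrier UO. z - frag_of (one_p, u) \<in> Null"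
proof -
  define S where "S = {x \<in> carrier Fr. \<exists>u\<in>carrier UO. x - frag_of (one_p, u) \<in> Null}"
  have one: "frag_of (one_p, \<one>\<^bsub>UO\<^esub>) \<in> Null"
    using Null_pow_right [OF one_p_closed UO.one_closed, of 0] by simp
  have NS: "Null \<subseteq> S"
    unfolding S_def using Null_closed Null_diff [OF _ one] UO.one_closed by blast
  have diff: "x - y \<in> S" if xy: "x \<in> S" "y \<in> S" for x y
  proof -
    obtain u w where uw: "u \<in> carrier UO" "w \<in> carrier UO" "x - frag_of (one_p, u) \<in> Null" "y - frag_of (one_p, w) \<in> Null"
      using xy by (auto simp: S_def)
    have iw: "inv\<^bsub>UO\<^esub> w \<in> carrier UO" using uw by blast
    have 1: "frag_of (one_p, u \<otimes>\<^bsub>UO\<^esub> inv\<^bsub>UO\<^esub> w) - frag_of (one_p, u) - frag_of (one_p, inv\<^bsub>UO\<^esub> w) \<in> Null"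
      using Null_add_right one_p_closed uw iw by blast
    have 2: "frag_of (one_p, inv\<^bsub>UO\<^esub> w) + frag_of (one_p, w) \<in> Null"
      using Null_pow_right [OF one_p_closed uw(2), of "-1"] uw(2) UO.int_pow_neg [OF uw(2), of 1] by simp
    have "x - y - frag_of (one_p, u \<otimes>\<^bsub>UO\<^esub> inv\<^bsub>UO\<^esub> w) =
      (x - frag_of (one_p, u)) - (y - frag_of (one_p, w)) -
      (frag_of (one_p, u \<otimes>\<^bsub>UO\<^esub> inv\<^bsub>UO\<^esub> w) - frag_of (one_p, u) - frag_of (one_p, inv\<^bsub>UO\<^esub> w)) -
      (frag_of (one_p, inv\<^bsub>UO\<^esub> w) + frag_of (one_p, w))" by simp
    moreover have "\<dots> \<in> Null" by (intro Null_diff uw(3,4) 1 2)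
    moreover have "x - y \<in> carrier Fr" using xy diff_closed by (auto simp: S_def simp del: carrier_free_Abelian_group_iff)
    ultimately show ?thesis unfolding S_def using UO.m_closed [OF uw(1) iw] by auto
  qed
  have S: "subgroup S Fr"
    by (rule subgroup_FrI [OF _ subsetD [OF NS Null_zero] diff]) (auto simp: S_def)
  note SS = subgroup_Fr [OF S]
  have int_S: "frag_of (padic_class p (\<lambda>_. j), u) \<in> S" if u: "u \<in> carrier UO" for j u
  proof -
    have c: "padic_class p (\<lambda>_. j) \<in> carrier Zp" using padic_class_closed [OF prime_p padic_cauchy_const] by simp
    have "frag_of (padic_class p (\<lambda>_. j), u) - frag_of (one_p, u [^]\<^bsub>UO\<^esub> j) \<in> Null"
      using Null_trans [OF Null_pow_left [OF one_p_closed u, of j] Null_sym [OF Null_pow_right [OF one_p_closed u, of j]]]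
      unfolding one_p_pow .
    then show ?thesis unfolding S_def using pair_in [OF c u] UO.int_pow_closed [OF u] by blast
  qed
  have "\<forall>a. \<exists>b. a \<in> carrier Zp \<longrightarrow> b \<in> carrier Zp \<and> (\<exists>j::int. a = padic_class p (\<lambda>_. j) \<otimes>\<^bsub>Zp\<^esub> b [^]\<^bsub>Zp\<^esub> (int p ^ s))"
    using padic_divide_power [OF prime_p, of _ s] by fastforce
  from choice [OF this] obtain \<beta> where \<beta>: "\<And>a. a \<in> carrier Zp \<Longrightarrow> \<beta> a \<in> carrier Zp"
    "\<And>a. a \<in> carrier Zp \<Longrightarrow> \<exists>j::int. a = padic_class p (\<lambda>_. j) \<otimes>\<^bsub>Zp\<^esub> \<beta> a [^]\<^bsub>Zp\<^esub> (int p ^ s)"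
    by blast
  have "z \<in> S"
  proof (rule torsion_subset [OF S NS _ _ _ z])
    show "\<beta> \<in> carrier Zp \<rightarrow> carrier Zp" using \<beta> by auto
    fix a u assume a: "a \<in> carrier Zp" and u: "u \<in> carrier UO"
    obtain j :: int where j: "a = one_p [^]\<^bsub>Zp\<^esub> j \<otimes>\<^bsub>Zp\<^esub> \<beta> a [^]\<^bsub>Zp\<^esub> (int p ^ s)" using \<beta>(2) [OF a] unfolding one_p_pow by blast
    have jc: "one_p [^]\<^bsub>Zp\<^esub> j \<in> carrier Zp" "\<beta> a [^]\<^bsub>Zp\<^esub> (int p ^ s) \<in> carrier Zp"
      using Zp.int_pow_closed one_p_closed \<beta>(1) [OF a] by blast+
    have 1: "frag_of (a, u) - frag_of (one_p [^]\<^bsub>Zp\<^esub> j, u) - frag_of (\<beta> a [^]\<^bsub>Zp\<^esub> (int p ^ s), u) \<in> Null"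
      using Null_add_left [OF jc u] j by simp
    have 2: "frag_of (\<beta> a [^]\<^bsub>Zp\<^esub> (int p ^ s), u) - frag_cmul (int p ^ s) (frag_of (\<beta> a, u)) \<in> Null"
      using Null_pow_left [OF \<beta>(1) [OF a] u] .
    have 3: "frag_of (one_p [^]\<^bsub>Zp\<^esub> j, u) \<in> S" unfolding one_p_pow by (rule int_S [OF u])
    have e: "frag_cmul (int p ^ s) (frag_of (\<beta> a, u)) - frag_of (a, u) =
      0 - ((frag_of (a, u) - frag_of (one_p [^]\<^bsub>Zp\<^esub> j, u) - frag_of (\<beta> a [^]\<^bsub>Zp\<^esub> (int p ^ s), u))
        + (frag_of (\<beta> a [^]\<^bsub>Zp\<^esub> (int p ^ s), u) - frag_cmul (int p ^ s) (frag_of (\<beta> a, u)))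
        + frag_of (one_p [^]\<^bsub>Zp\<^esub> j, u))" by (simp add: algebra_simps del: minus_frag_cmul)
    show "frag_cmul (int p ^ s) (frag_of (\<beta> a, u)) - frag_of (a, u) \<in> S"
      unfolding e by (rule SS(3) [OF SS(1) SS(2) [OF SS(2) [OF subsetD [OF NS 1] subsetD [OF NS 2]] 3]])
    fix b assume b: "b \<in> carrier Zp"
    obtain i :: int where i: "b = one_p [^]\<^bsub>Zp\<^esub> i \<otimes>\<^bsub>Zp\<^esub> \<beta> b [^]\<^bsub>Zp\<^esub> (int p ^ s)" using \<beta>(2) [OF b] unfolding one_p_pow by blast
    have ab: "a \<otimes>\<^bsub>Zp\<^esub> b \<in> carrier Zp" using Zp.m_closed a b by blast
    obtain l :: int where l: "a \<otimes>\<^bsub>Zp\<^esub> b = one_p [^]\<^bsub>Zp\<^esub> l \<otimes>\<^bsub>Zp\<^esub> \<beta> (a \<otimes>\<^bsub>Zp\<^esub> b) [^]\<^bsub>Zp\<^esub> (int p ^ s)" using \<beta>(2) [OF ab] unfolding one_p_pow by blast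
    define A where "A = \<beta> a" define B where "B = \<beta> b" define C where "C = \<beta> (a \<otimes>\<^bsub>Zp\<^esub> b)"
    have ABC: "A \<in> carrier Zp" "B \<in> carrier Zp" "C \<in> carrier Zp" using \<beta>(1) a b ab by (auto simp: A_def B_def C_def simp del: monoid.simps)
    have AB: "A \<otimes>\<^bsub>Zp\<^esub> B \<in> carrier Zp" using ABC Zp.m_closed by blast
    \<comment> \<open>\<open>\<beta>\<close> is chosen pointwise and fails to be additive by some
      \<open>D\<close>. But \<open>p ^ s\<close> times \<open>D\<close> is an ordinary integer,
      hence so is \<open>D\<close>, and its contribution lies in \<open>S\<close>.\<close>
    have "\<exists>D\<in>carrier Zp. C = D \<otimes>\<^bsub>Zp\<^esub> (A \<otimes>\<^bsub>Zp\<^esub> B) \<and>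
        D [^]\<^bsub>Zp\<^esub> (int p ^ s) = one_p [^]\<^bsub>Zp\<^esub> (j + i - l)"
      by (rule Zp.quotient_power [OF one_p_closed ABC])
         (use l j i in \<open>unfold A_def B_def C_def, metis\<close>)
    then obtain D where D: "D \<in> carrier Zp" "C = D \<otimes>\<^bsub>Zp\<^esub> (A \<otimes>\<^bsub>Zp\<^esub> B)"
        "D [^]\<^bsub>Zp\<^esub> (int p ^ s) = padic_class p (\<lambda>_. j + i - l)"
      unfolding one_p_pow by blast
    then obtain m where m: "D = padic_class p (\<lambda>_. m)"
      using padic_integer_divide [OF prime_p _ D(3)] D(1) by auto
    have 1: "frag_of (C, u) - frag_of (D, u) - frag_of (A \<otimes>\<^bsub>Zp\<^esub> B, u) \<in> Null"
      using Null_add_left [OF D(1) AB u] D(2) by simp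
    have 2: "frag_of (A \<otimes>\<^bsub>Zp\<^esub> B, u) - frag_of (A, u) - frag_of (B, u) \<in> Null"
      using Null_add_left ABC u by blast
    have 3: "frag_of (D, u) \<in> S" unfolding m by (rule int_S [OF u])
    have e: "frag_of (C, u) - frag_of (A, u) - frag_of (B, u) =
        (frag_of (C, u) - frag_of (D, u) - frag_of (A \<otimes>\<^bsub>Zp\<^esub> B, u)) +
        (frag_of (A \<otimes>\<^bsub>Zp\<^esub> B, u) - frag_of (A, u) - frag_of (B, u)) + frag_of (D, u)" by simp
    show "frag_of (\<beta> (a \<otimes>\<^bsub>Zp\<^esub> b), u) - frag_of (\<beta> a, u) - frag_of (\<beta> b, u) \<in> S"
      unfolding A_def [symmetric] B_def [symmetric] C_def [symmetric] e
      by (rule SS(2) [OF SS(2) [OF subsetD [OF NS 1] subsetD [OF NS 2]] 3])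
  qed
  then show ?thesis by (simp add: S_def)
qed

text \<open>Lying in the kernel makes the principal part of \<open>u\<close> at \<open>v\<close>
  trivial. Then \<open>u [^] N\<close> becomes 1 in the completion by \<open>cls_const_pow\<close>,
  and the field embeds into its completion.\<close>

lemma Ker_one_p:
  assumes v: "v \<in> places_above F p" and u: "u \<in> carrier UO" "frag_of (one_p, u) \<in> Ker"
  shows "\<exists>N. coprime N p \<and> u [^] N = \<one>"
proof -
  interpret V: padic_field F v p using place v .
  obtain N where N: "V.tame N u" using V.tame_unit u(1) by blast
  have uU: "u \<in> Units F" "u \<in> carrier F" using N V.tame_Units by auto
  have o: "one_p \<in> carrier (padic_integers p)" using one_p_closed by simp
  note r = padic_rep [OF prime_p o]
  have P: "(one_p, u) \<in> Pairs" using u o by (simp add: tensor_pairs_def)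
  have "(\<lambda>n. v (V.unit_seq u (padic_rep p one_p) n \<ominus> \<one>)) \<longlonglongrightarrow> 0"
    using u(2) v V.unit_approx_frag_of [OF P] by (simp add: leo_kernel_def)
  then have "V.cls (V.unit_seq u (padic_rep p one_p)) = \<one>\<^bsub>completion F v\<^esub>"
    using V.cls_eq_iff [of "V.unit_seq u (padic_rep p one_p)" "\<lambda>_. \<one>"] V.unit_seq_Cau [OF N r(1)] V.cls_one by simp
  moreover have "padic_null p (\<lambda>n. padic_rep p one_p n - 1)"
    using padic_class_eq_iff [OF prime_p r(1) padic_cauchy_const, of 1] r(2) one_p_def by simp
  ultimately have "V.cls (V.unit_seq u (\<lambda>_. 1)) = \<one>\<^bsub>completion F v\<^esub>"
    using V.unit_seq_cong [OF N r(1) padic_cauchy_const, of 1] by simp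
  then have "V.cls (\<lambda>_. u) [^]\<^bsub>completion F v\<^esub> N = \<one>\<^bsub>completion F v\<^esub>" using V.cls_const_pow [OF N] by simp
  then have "V.cls (\<lambda>_. u [^] N) = V.cls (\<lambda>_. \<one>)" using V.cls_nat_pow [of "\<lambda>_. u" N] uU V.cls_one by simp
  then have "(\<lambda>n::nat. v (u [^] N \<ominus> \<one>)) \<longlonglongrightarrow> 0" using V.cls_eq_iff [of "\<lambda>_. u [^] N" "\<lambda>_. \<one>"] uU by simp
  then have "v (u [^] N \<ominus> \<one>) = 0" using LIMSEQ_const_iff by blast
  then have "u [^] N = \<one>" using uU by simp
  then show ?thesis using N unfolding V.tame_def by blast
qed

text \<open>With \<open>n = p ^ s * M\<close>, the element \<open>M\<close> times \<open>z\<close>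
  is killed by \<open>p ^ s\<close> and so is a pure tensor of 1 with a unit. Being in the kernel,
  that unit is killed by some \<open>N\<close> prime to \<open>p\<close>; then \<open>N * M\<close>
  kills \<open>z\<close>, and \<open>coprime_torsion\<close> finishes. The place is where the unit
  is recognised as a root of unity.\<close>

theorem Ker_torsion:
  assumes "places_above F p \<noteq> {}" and z: "z \<in> Ker" "frag_cmul (int n) z \<in> Null" and n: "n > 0"
  shows "z \<in> Null"
proof -
  obtain v where v: "v \<in> places_above F p" using assms by blast
  have zc: "z \<in> carrier Fr" using Ker_closed z by blast
  obtain s M where M: "n = p ^ s * M" "\<not> p dvd M"
    using n prime_p multiplicity_decompose' [of n p] by (metis neq0_conv not_prime_unit)
  have cM: "coprime M p" using M(2) prime_p prime_imp_coprime coprime_commute by blast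
  define y where "y = frag_cmul (int M) z"
  have y: "y \<in> Ker" "y \<in> carrier Fr" using subgroup_Fr(5) [OF Ker_subgroup] z Ker_closed by (auto simp: y_def simp del: carrier_free_Abelian_group_iff)
  have "frag_cmul (int p ^ s) y \<in> Null" using z(2) M by (simp add: y_def)
  then obtain u where u: "u \<in> carrier UO" "y - frag_of (one_p, u) \<in> Null" using p_power_torsion y by blast
  have "y - (y - frag_of (one_p, u)) \<in> Ker" using subgroup_Fr(3) [OF Ker_subgroup y(1)] u(2) Null_Ker by blast
  then have "frag_of (one_p, u) \<in> Ker" by simp
  then obtain N where N: "coprime N p" "u [^] N = \<one>" using Ker_one_p [OF v u(1)] by blast
  have uN: "u [^]\<^bsub>UO\<^esub> int N = \<one>\<^bsub>UO\<^esub>"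
  proof -
    have "u [^]\<^bsub>UO\<^esub> int N = u [^]\<^bsub>units_of F\<^esub> int N" using UO_int_pow [OF u(1)] .
    also have "\<dots> = u [^] N" using u(1) by (simp add: int_pow_int units_of_pow UO_carrier)
    finally show ?thesis using N by simp
  qed
  have "frag_of (one_p, \<one>\<^bsub>UO\<^esub>) \<in> Null" using Null_pow_right [OF one_p_closed UO.one_closed, of 0] by simp
  then have "frag_of (one_p, \<one>\<^bsub>UO\<^esub>) - (frag_of (one_p, u [^]\<^bsub>UO\<^esub> int N) - frag_cmul (int N) (frag_of (one_p, u))) \<in> Null"
    using Null_diff Null_pow_right [OF one_p_closed u(1), of "int N"] by blast
  then have "frag_cmul (int N) (frag_of (one_p, u)) \<in> Null" using uN by simp
  then have "frag_cmul (int N) (y - frag_of (one_p, u)) + frag_cmul (int N) (frag_of (one_p, u)) \<in> Null"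
    using Null_cmul [OF u(2)] Null_add by blast
  then have "frag_cmul (int N) y \<in> Null" by (simp flip: frag_cmul_distrib2)
  then have "frag_cmul (int (N * M)) z \<in> Null" by (simp add: y_def)
  moreover have "coprime (N * M) p" using N cM by simp
  ultimately show ?thesis using coprime_torsion zc by blast
qed

end

section \<open>Extension of nonarchimedean absolute values\<close>

lemma le_mult_of_le:
  assumes "\<And>r s. \<lbrakk>a < r; b < s\<rbrakk> \<Longrightarrow> c \<le> r * s" shows "c \<le> a * (b::real)"
proof (rule LIMSEQ_le_const)
  have "(\<lambda>n. (a + inverse (real (Suc n))) * (b + inverse (real (Suc n)))) \<longlonglongrightarrow> (a + 0) * (b + 0)"
    by (intro tendsto_intros LIMSEQ_inverse_real_of_nat)
  then show "(\<lambda>n. (a + inverse (real (Suc n))) * (b + inverse (real (Suc n)))) \<longlonglongrightarrow> a * b" by simp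
  show "\<exists>N. \<forall>n\<ge>N. c \<le> (a + inverse (real (Suc n))) * (b + inverse (real (Suc n)))"
    using assms by auto
qed

locale valued_subfield = field R for R :: "('a, 'b) ring_scheme" (structure) +
  fixes K :: "'a set" and v :: "'a \<Rightarrow> real"
  assumes K: "subfield K R"
    and vK_nonneg: "x \<in> K \<Longrightarrow> 0 \<le> v x" and vK_eq_0: "x \<in> K \<Longrightarrow> v x = 0 \<longleftrightarrow> x = \<zero>"
    and vK_mult: "\<lbrakk>x \<in> K; y \<in> K\<rbrakk> \<Longrightarrow> v (x \<otimes> y) = v x * v y"
    and vK_ultra: "\<lbrakk>x \<in> K; y \<in> K\<rbrakk> \<Longrightarrow> v (x \<oplus> y) \<le> max (v x) (v y)"
begin

lemma K_carrier [simp]: "x \<in> K \<Longrightarrow> x \<in> carrier R"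
  using subfieldE(3) [OF K] by blast

lemma K_inv: "\<lbrakk>c \<in> K; c \<noteq> \<zero>\<rbrakk> \<Longrightarrow> inv c \<in> K \<and> v (inv c) * v c = 1"
proof -
  assume c: "c \<in> K" "c \<noteq> \<zero>"
  have i: "inv c \<in> K" using subfield_m_inv(1) [OF K, of c] c by blast
  have cU: "c \<in> Units R" using c field_Units by auto
  have one: "\<one> \<in> K" using subringE(3) [OF subfieldE(1) [OF K]] .
  have "v \<one> * v \<one> = v \<one>" using vK_mult [OF one one] by simp
  moreover have "v \<one> \<noteq> 0" using vK_eq_0 [OF one] by simp
  ultimately have "v \<one> = 1" by simp
  then show ?thesis using vK_mult [OF i c(1)] i cU by simp
qed

text \<open>Seminorms on \<open>R\<close> extending \<open>v\<close>; they vanish outside the carrier so that the pointwise order is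
  antisymmetric.\<close>

definition seminorm :: "('a \<Rightarrow> real) \<Rightarrow> bool" where
  "seminorm s \<longleftrightarrow> (\<forall>x. 0 \<le> s x) \<and> (\<forall>x. x \<notin> carrier R \<longrightarrow> s x = 0) \<and> s \<one> = 1 \<and>
    (\<forall>x\<in>carrier R. \<forall>y\<in>carrier R. s (x \<oplus> y) \<le> max (s x) (s y) \<and> s (x \<otimes> y) \<le> s x * s y) \<and>
    (\<forall>c\<in>K. \<forall>x\<in>carrier R. s (c \<otimes> x) = v c * s x)"

lemma seminormD:
  assumes "seminorm s"
  shows "0 \<le> s x" "x \<notin> carrier R \<Longrightarrow> s x = 0" "s \<one> = 1"
    "\<lbrakk>x \<in> carrier R; y \<in> carrier R\<rbrakk> \<Longrightarrow> s (x \<oplus> y) \<le> max (s x) (s y)"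
    "\<lbrakk>x \<in> carrier R; y \<in> carrier R\<rbrakk> \<Longrightarrow> s (x \<otimes> y) \<le> s x * s y"
    "\<lbrakk>c \<in> K; x \<in> carrier R\<rbrakk> \<Longrightarrow> s (c \<otimes> x) = v c * s x"
  using assms by (auto simp: seminorm_def)

text \<open>The reverse inequality is the given one for the inverse of \<open>c\<close>.\<close>

lemma homogeneous_of_le:
  assumes "\<And>c x. \<lbrakk>c \<in> K; c \<noteq> \<zero>; x \<in> carrier R\<rbrakk> \<Longrightarrow> t (c \<otimes> x) \<le> v c * t x"
    and "t \<zero> = 0" "c \<in> K" "x \<in> carrier R"
  shows "t (c \<otimes> x) = v c * (t x :: real)"
proof (cases "c = \<zero>")
  case True
  then show ?thesis using assms vK_eq_0 [of c] by simp
next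
  case False
  have i: "inv c \<in> K" "v (inv c) * v c = 1" using K_inv assms False by auto
  have cU: "c \<in> Units R" using assms False field_Units by auto
  have ic: "inv c \<noteq> \<zero>" using i vK_eq_0 [of "inv c"] by auto
  have vc: "v c > 0" using vK_nonneg vK_eq_0 assms(3) False by (simp add: less_le)
  have "inv c \<otimes> (c \<otimes> x) = x" using assms cU by (simp flip: m_assoc)
  then have "t x \<le> v (inv c) * t (c \<otimes> x)" using assms(1) [OF i(1) ic, of "c \<otimes> x"] assms by simp
  then have "v c * t x \<le> v c * (v (inv c) * t (c \<otimes> x))" using vc by simp
  also have "\<dots> = t (c \<otimes> x)" using i(2) by (metis mult.assoc mult.commute mult_1)
  finally show ?thesis using assms(1) [OF assms(3) False assms(4)] by linarith
qed

text \<open>Infima do not respect sums and products in general; a common index \<open>k\<close> for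
  each pair supplies the bound. The lemma serves both the chains in Zorn's lemma and the
  localisations at an element.\<close>

lemma seminorm_Inf:
  fixes a :: "'i \<Rightarrow> 'a \<Rightarrow> real"
  assumes I: "I \<noteq> {}" and nn: "\<And>i x. \<lbrakk>i \<in> I; x \<in> carrier R\<rbrakk> \<Longrightarrow> 0 \<le> a i x"
    and one: "\<And>i. i \<in> I \<Longrightarrow> a i \<one> = 1" and zero: "\<And>i. i \<in> I \<Longrightarrow> a i \<zero> = 0"
    and hom: "\<And>i c x. \<lbrakk>i \<in> I; c \<in> K; x \<in> carrier R\<rbrakk> \<Longrightarrow> a i (c \<otimes> x) = v c * a i x"
    and add: "\<And>i j x y. \<lbrakk>i \<in> I; j \<in> I; x \<in> carrier R; y \<in> carrier R\<rbrakk> \<Longrightarrow>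
      \<exists>k\<in>I. a k (x \<oplus> y) \<le> max (a i x) (a j y)"
    and mult: "\<And>i j x y. \<lbrakk>i \<in> I; j \<in> I; x \<in> carrier R; y \<in> carrier R\<rbrakk> \<Longrightarrow>
      \<exists>k\<in>I. a k (x \<otimes> y) \<le> a i x * a j y"
  shows "seminorm (\<lambda>x. if x \<in> carrier R then INF i\<in>I. a i x else 0)" (is "seminorm ?t")
    and "\<And>i x. \<lbrakk>i \<in> I; x \<in> carrier R\<rbrakk> \<Longrightarrow> (INF i\<in>I. a i x) \<le> a i x"
proof -
  have bdd: "bdd_below ((\<lambda>i. a i x) ` I)" if "x \<in> carrier R" for x
    using nn that by (intro bdd_belowI [of _ 0]) auto
  show low: "(INF i\<in>I. a i x) \<le> a i x" if "i \<in> I" "x \<in> carrier R" for i x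
    by (rule cINF_lower [OF bdd [OF that(2)] that(1)])
  have ex: "\<exists>i\<in>I. a i x < r" if "?t x < r" "x \<in> carrier R" for x r
    using that cINF_less_iff [OF I bdd [OF that(2)]] by simp
  have t_nn: "0 \<le> ?t x" for x using I nn by (auto intro!: cINF_greatest)
  have const: "?t x = c" if "x \<in> carrier R" "\<And>i. i \<in> I \<Longrightarrow> a i x = c" for x c
    using that I by (simp cong: INF_cong)
  show "seminorm ?t" unfolding seminorm_def
  proof (intro conjI ballI)
    show "\<forall>x. 0 \<le> ?t x" using t_nn by blast
    show "?t \<one> = 1" using const one by blast
    fix x y assume xy: "x \<in> carrier R" "y \<in> carrier R"
    show "?t (x \<oplus> y) \<le> max (?t x) (?t y)"
    proof (rule dense_ge)
      fix r assume "max (?t x) (?t y) < r"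
      then obtain i j where "i \<in> I" "a i x < r" "j \<in> I" "a j y < r" using ex xy by (metis max_less_iff_conj)
      then obtain k where "k \<in> I" "a k (x \<oplus> y) < r" using add [of i j x y] xy by fastforce
      then show "?t (x \<oplus> y) \<le> r" using low [of k "x \<oplus> y"] xy by auto
    qed
    show "?t (x \<otimes> y) \<le> ?t x * ?t y"
    proof (rule le_mult_of_le)
      fix r s assume "?t x < r" "?t y < s"
      then obtain i j where ij: "i \<in> I" "a i x < r" "j \<in> I" "a j y < s" using ex xy by blast
      then obtain k where k: "k \<in> I" "a k (x \<otimes> y) \<le> a i x * a j y" using mult [of i j x y] xy by blast
      have "a i x * a j y \<le> r * s" using ij nn xy by (intro mult_mono) (auto intro: less_imp_le order_trans [of 0])
      then show "?t (x \<otimes> y) \<le> r * s" using low [OF k(1), of "x \<otimes> y"] k(2) xy by auto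
    qed
  next
    fix c x assume cx: "c \<in> K" "x \<in> carrier R"
    show "?t (c \<otimes> x) = v c * ?t x"
    proof (rule homogeneous_of_le [OF _ _ cx])
      show "?t \<zero> = 0" using const zero by blast
      fix c x assume c: "c \<in> K" "c \<noteq> \<zero>" "x \<in> carrier R"
      have vc: "v c > 0" using vK_nonneg vK_eq_0 c by (simp add: less_le)
      have "?t (c \<otimes> x) / v c \<le> ?t x"
      proof -
        have "?t (c \<otimes> x) / v c \<le> a i x" if "i \<in> I" for i
          using low [OF that, of "c \<otimes> x"] hom [OF that c(1,3)] c vc by (simp add: divide_le_eq mult.commute)
        then show ?thesis using I c by (auto intro!: cINF_greatest)
      qed
      then show "?t (c \<otimes> x) \<le> v c * ?t x" using vc by (simp only: pos_divide_le_eq mult.commute)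
    qed
  qed auto
qed

text \<open>A form of the spectral radius without roots: \<open>r\<close> bounds the growth rate of
  \<open>s (x [^] n)\<close>. For nonnegative \<open>s\<close> the infimum of these rates is the
  upper limit of the \<open>n\<close>-th roots of \<open>s (x [^] n)\<close>.\<close>

definition spectral_bound :: "('a \<Rightarrow> real) \<Rightarrow> 'a \<Rightarrow> real \<Rightarrow> bool" where
  "spectral_bound s x r \<longleftrightarrow> 0 < r \<and> (\<exists>C. \<forall>n::nat. s (x [^] n) \<le> C * r ^ n)"

definition spectral :: "('a \<Rightarrow> real) \<Rightarrow> 'a \<Rightarrow> real" where
  "spectral s x = (if x \<in> carrier R then Inf {r. spectral_bound s x r} else 0)"

context
  fixes s :: "'a \<Rightarrow> real" and M :: real
  assumes M: "0 < M" and s_nn: "\<And>x. x \<in> carrier R \<Longrightarrow> 0 \<le> s x" and s_one: "0 < s \<one>" and s_zero: "s \<zero> = 0"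
    and s_add: "\<And>x y. \<lbrakk>x \<in> carrier R; y \<in> carrier R\<rbrakk> \<Longrightarrow> s (x \<oplus> y) \<le> max (s x) (s y)"
    and s_mult: "\<And>x y. \<lbrakk>x \<in> carrier R; y \<in> carrier R\<rbrakk> \<Longrightarrow> s (x \<otimes> y) \<le> M * s x * s y"
    and s_hom: "\<And>c x. \<lbrakk>c \<in> K; x \<in> carrier R\<rbrakk> \<Longrightarrow> s (c \<otimes> x) = v c * s x"
begin

lemma spectral_bound_mono: "\<lbrakk>spectral_bound s x r; r \<le> r'\<rbrakk> \<Longrightarrow> spectral_bound s x r'"
proof -
  assume a: "spectral_bound s x r" and r: "r \<le> r'"
  obtain C where C: "\<And>n::nat. s (x [^] n) \<le> C * r ^ n" and r0: "r > 0" using a unfolding spectral_bound_def by blast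
  have C0: "C > 0" using C [of 0] s_one by simp
  have "s (x [^] n) \<le> C * r' ^ n" for n :: nat
    using C [of n] C0 r r0 power_mono [of r r' n] mult_left_mono [of "r^n" "r'^n" C] by linarith
  then show ?thesis using r r0 unfolding spectral_bound_def by (intro conjI exI[of _ C]) auto
qed

lemma spectral_bound_ex:
  assumes "x \<in> carrier R" shows "spectral_bound s x (max 1 (M * s x))"
proof -
  let ?r = "max 1 (M * s x)"
  have "s (x [^] n) \<le> s \<one> * ?r ^ n" for n :: nat
  proof (induction n)
    case (Suc n)
    have "s (x [^] Suc n) \<le> M * s (x [^] n) * s x" using s_mult [of "x [^] n" x] assms by simp
    also have "\<dots> = s (x [^] n) * (M * s x)" by simp
    also have "\<dots> \<le> (s \<one> * ?r ^ n) * ?r"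
      using Suc s_nn assms M s_one by (intro mult_mono) auto
    finally show ?case by (simp add: mult_ac)
  qed simp
  then show ?thesis unfolding spectral_bound_def by (intro conjI exI[of _ "s \<one>"]) auto
qed

lemma spectral_le:
  assumes "x \<in> carrier R" "spectral_bound s x r" shows "spectral s x \<le> r"
proof -
  have "bdd_below {r. spectral_bound s x r}" by (rule bdd_belowI [of _ 0]) (simp add: spectral_bound_def)
  then have "Inf {r. spectral_bound s x r} \<le> r" using assms(2) by (intro cInf_lower) auto
  then show ?thesis using assms(1) by (simp add: spectral_def)
qed

lemma spectral_less: "\<lbrakk>x \<in> carrier R; spectral s x < r\<rbrakk> \<Longrightarrow> spectral_bound s x r"
proof -
  assume x: "x \<in> carrier R" "spectral s x < r"
  then have "Inf {r. spectral_bound s x r} < r" by (simp add: spectral_def)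
  moreover have "{r. spectral_bound s x r} \<noteq> {}" using spectral_bound_ex [OF x(1)] by blast
  ultimately have "\<exists>q\<in>{r. spectral_bound s x r}. q < r" by (rule cInf_lessD [rotated])
  then obtain q where "spectral_bound s x q" "q < r" by blast
  then show ?thesis using spectral_bound_mono less_imp_le by blast
qed

lemma spectral_nonneg: "0 \<le> spectral s x"
proof (cases "x \<in> carrier R")
  case True
  have "0 \<le> Inf {r. spectral_bound s x r}"
  proof (rule cInf_greatest)
    show "{r. spectral_bound s x r} \<noteq> {}" using spectral_bound_ex [OF True] by blast
  qed (simp add: spectral_bound_def)
  then show ?thesis by (simp add: spectral_def)
qed (simp add: spectral_def)

text \<open>The constant \<open>M\<close> contributes only a fixed factor to each bound and so
  disappears from growth rates. In this way a norm that is submultiplicative only up to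
  \<open>M\<close>, such as a sup norm of coordinates, yields a seminorm.\<close>

lemma spectral_seminorm: "seminorm (spectral s)"
  unfolding seminorm_def
proof (intro conjI ballI)
  show "\<forall>x. 0 \<le> spectral s x" using spectral_nonneg by blast
  show "\<forall>x. x \<notin> carrier R \<longrightarrow> spectral s x = 0" by (simp add: spectral_def)
  show "spectral s \<one> = 1"
  proof (rule antisym)
    show "spectral s \<one> \<le> 1"
      by (rule spectral_le) (auto simp: spectral_bound_def intro!: exI[of _ "s \<one>"])
    show "1 \<le> spectral s \<one>"
    proof (rule ccontr)
      assume "\<not> 1 \<le> spectral s \<one>"
      then obtain r where r: "spectral s \<one> < r" "r < 1" using dense by (metis not_le)
      then obtain C where C: "\<And>n::nat. s \<one> \<le> C * r ^ n" and r0: "r > 0"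
        using spectral_less [of \<one> r] by (auto simp: spectral_bound_def)
      have "(\<lambda>n. C * r ^ n) \<longlonglongrightarrow> C * 0" using r r0 by (intro tendsto_intros LIMSEQ_realpow_zero) auto
      then have "s \<one> \<le> C * 0" by (rule LIMSEQ_le_const) (use C in blast)
      then show False using s_one by simp
    qed
  qed
  fix x y assume xy: "x \<in> carrier R" "y \<in> carrier R"
  show "spectral s (x \<otimes> y) \<le> spectral s x * spectral s y"
  proof (rule le_mult_of_le)
    fix r q assume "spectral s x < r" "spectral s y < q"
    then obtain C D where C: "\<And>n::nat. s (x [^] n) \<le> C * r ^ n" "r > 0" and D: "\<And>n::nat. s (y [^] n) \<le> D * q ^ n" "q > 0"
      using spectral_less xy unfolding spectral_bound_def by metis
    have C0: "C > 0" using C(1) [of 0] s_one by simp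
    have "s ((x \<otimes> y) [^] n) \<le> (M * C * D) * (r * q) ^ n" for n :: nat
    proof -
      have "s ((x \<otimes> y) [^] n) \<le> M * s (x [^] n) * s (y [^] n)"
        using s_mult [of "x [^] n" "y [^] n"] xy by (simp add: nat_pow_distrib)
      also have "\<dots> \<le> M * (C * r ^ n) * (D * q ^ n)"
        using C(1) [of n] D(1) [of n] C(2) D(2) C0 M s_nn xy by (intro mult_mono) auto
      finally show ?thesis by (simp add: power_mult_distrib mult_ac)
    qed
    then have "spectral_bound s (x \<otimes> y) (r * q)" using C D unfolding spectral_bound_def by auto
    then show "spectral s (x \<otimes> y) \<le> r * q" using spectral_le xy by simp
  qed
  show "spectral s (x \<oplus> y) \<le> max (spectral s x) (spectral s y)"
  proof (rule dense_ge)
    fix r assume "max (spectral s x) (spectral s y) < r"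
    then obtain C D where C: "\<And>n::nat. s (x [^] n) \<le> C * r ^ n" and D: "\<And>n::nat. s (y [^] n) \<le> D * r ^ n" and r0: "r > 0"
      using spectral_less [of x r] spectral_less [of y r] xy unfolding spectral_bound_def by auto
    have C0: "C > 0" using C [of 0] s_one by simp
    \<comment> \<open>One factor \<open>x \<oplus> y\<close> is expanded at a time. The ultrametric
      inequality makes the number of resulting terms irrelevant; only the total degree
      \<open>n + i + j\<close> matters.\<close>
    have *: "s ((x \<oplus> y) [^] n \<otimes> (x [^] i \<otimes> y [^] j)) \<le> (M * C * D) * r ^ (n + i + j)" for n i j :: nat
    proof (induction n arbitrary: i j)
      case 0
      have "s (x [^] i \<otimes> y [^] j) \<le> M * s (x [^] i) * s (y [^] j)" using s_mult xy by simp
      also have "\<dots> \<le> M * (C * r ^ i) * (D * r ^ j)"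
        using C [of i] D [of j] C0 r0 M s_nn xy by (intro mult_mono) auto
      finally show ?case using xy by (simp add: power_add mult_ac)
    next
      case (Suc n)
      have "(x \<oplus> y) [^] Suc n \<otimes> (x [^] i \<otimes> y [^] j) =
        (x \<oplus> y) [^] n \<otimes> (x [^] Suc i \<otimes> y [^] j) \<oplus> (x \<oplus> y) [^] n \<otimes> (x [^] i \<otimes> y [^] Suc j)"
        using xy nat_pow_closed [of "x \<oplus> y" n] nat_pow_closed [of x i] nat_pow_closed [of y j]
        unfolding nat_pow_Suc by algebra
      then have "s ((x \<oplus> y) [^] Suc n \<otimes> (x [^] i \<otimes> y [^] j)) \<le>
        max (s ((x \<oplus> y) [^] n \<otimes> (x [^] Suc i \<otimes> y [^] j))) (s ((x \<oplus> y) [^] n \<otimes> (x [^] i \<otimes> y [^] Suc j)))"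
        using s_add [of "(x \<oplus> y) [^] n \<otimes> (x [^] Suc i \<otimes> y [^] j)" "(x \<oplus> y) [^] n \<otimes> (x [^] i \<otimes> y [^] Suc j)"] xy
        by (simp del: nat_pow_Suc)
      then show ?case using Suc [of "Suc i" j] Suc [of i "Suc j"] by (simp del: nat_pow_Suc)
    qed
    have "spectral_bound s (x \<oplus> y) r"
      unfolding spectral_bound_def using * [of _ 0 0] r0 xy by (intro conjI exI[of _ "M * C * D"]) auto
    then show "spectral s (x \<oplus> y) \<le> r" using spectral_le xy by simp
  qed
next
  fix c x assume cx: "c \<in> K" "x \<in> carrier R"
  show "spectral s (c \<otimes> x) = v c * spectral s x"
  proof (rule homogeneous_of_le [OF _ _ cx])
    have "spectral s \<zero> \<le> r" if "r > 0" for r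
    proof (rule spectral_le)
      have "s (\<zero> [^] n) \<le> s \<one> * r ^ n" for n :: nat
        using s_zero s_one that by (cases n) auto
      then show "spectral_bound s \<zero> r" using that unfolding spectral_bound_def by blast
    qed simp
    then show "spectral s \<zero> = 0" using spectral_nonneg [of \<zero>] by (meson dense_ge antisym)
    fix c x assume c: "c \<in> K" "c \<noteq> \<zero>" "x \<in> carrier R"
    have vc: "v c > 0" using vK_nonneg vK_eq_0 c by (simp add: less_le)
    have cn: "c [^] n \<in> K \<and> v (c [^] n) = v c ^ n" for n :: nat
    proof (induction n)
      case 0
      have "\<one> \<in> K" using subringE(3) [OF subfieldE(1) [OF K]] .
      moreover have "v \<one> = 1" using K_inv [OF c(1,2)] vK_mult [of "inv c" c] c field_Units by auto
      ultimately show ?case by simp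
    next
      case (Suc n)
      then show ?case using vK_mult [of "c [^] n" c] c subringE(6) [OF subfieldE(1) [OF K], of "c [^] n" c] by simp
    qed
    have "spectral s (c \<otimes> x) / v c \<le> spectral s x"
    proof (rule dense_ge)
      fix r assume "spectral s x < r"
      then obtain C where C: "\<And>n::nat. s (x [^] n) \<le> C * r ^ n" "r > 0"
        using spectral_less c unfolding spectral_bound_def by metis
      have "s ((c \<otimes> x) [^] n) \<le> C * (v c * r) ^ n" for n :: nat
        using s_hom [of "c [^] n" "x [^] n"] cn [of n] c C(1) [of n] vc
        by (simp add: nat_pow_distrib power_mult_distrib mult_ac)
      then have "spectral_bound s (c \<otimes> x) (v c * r)" using C vc unfolding spectral_bound_def by auto
      then show "spectral s (c \<otimes> x) / v c \<le> r" using spectral_le [of "c \<otimes> x"] c vc by (simp add: divide_le_eq mult.commute)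
    qed
    then show "spectral s (c \<otimes> x) \<le> v c * spectral s x" using vc by (simp only: pos_divide_le_eq mult.commute)
  qed
qed

text \<open>Even powers of \<open>x\<close> are powers of its square, at the square root of the
  rate; an odd power costs one more factor \<open>s x\<close>, which the constant \<open>D\<close>
  absorbs. Together with submultiplicativity this makes the spectral seminorm compatible with
  squares.\<close>

lemma spectral_square: "x \<in> carrier R \<Longrightarrow> (spectral s x)\<^sup>2 \<le> spectral s (x \<otimes> x)"
proof (rule dense_ge)
  assume x: "x \<in> carrier R"
  fix r assume "spectral s (x \<otimes> x) < r"
  then obtain C where C: "\<And>n::nat. s ((x \<otimes> x) [^] n) \<le> C * r ^ n" "r > 0"
    using spectral_less [of "x \<otimes> x" r] x unfolding spectral_bound_def by auto
  have C0: "C > 0" using C(1) [of 0] s_one by simp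
  define q where "q = sqrt r"
  have q: "q > 0" "q\<^sup>2 = r" using C by (auto simp: q_def)
  define D where "D = max C (M * C * s x / q)"
  have "s (x [^] n) \<le> D * q ^ n" for n :: nat
  proof -
    obtain m where m: "n = 2 * m \<or> n = Suc (2 * m)" by (metis evenE oddE add.commute plus_1_eq_Suc)
    have e: "x [^] (2 * m) = (x \<otimes> x) [^] m" using x by (simp add: nat_pow_distrib nat_pow_mult mult_2)
    have qm: "q ^ (2 * m) = r ^ m" using q by (simp add: power_mult)
    from m show ?thesis
    proof
      assume "n = 2 * m"
      then have "s (x [^] n) \<le> C * q ^ n" using C(1) [of m] e qm by simp
      also have "\<dots> \<le> D * q ^ n" using q by (simp add: D_def)
      finally show ?thesis .
    next
      assume n: "n = Suc (2 * m)"
      have "s (x [^] n) \<le> M * s ((x \<otimes> x) [^] m) * s x" using s_mult [of "(x \<otimes> x) [^] m" x] x n e by simp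
      also have "\<dots> \<le> M * (C * r ^ m) * s x" using C(1) [of m] C(2) C0 M s_nn x by (intro mult_mono) auto
      also have "\<dots> = (M * C * s x / q) * q ^ n" using q n qm by simp
      also have "\<dots> \<le> D * q ^ n" using q by (intro mult_right_mono) (auto simp: D_def)
      finally show ?thesis .
    qed
  qed
  then have "spectral_bound s x q" using q unfolding spectral_bound_def by blast
  then have "spectral s x \<le> q" using spectral_le x by simp
  then show "(spectral s x)\<^sup>2 \<le> r" using q spectral_nonneg [of x] power_mono by fastforce
qed

end

section \<open>Minimal seminorms and multiplicativity\<close>

lemma seminorm_zero: "seminorm s \<Longrightarrow> s \<zero> = 0"
  using seminormD(6) [of s \<zero> \<one>] vK_eq_0 [of \<zero>] subringE(2) [OF subfieldE(1) [OF K]] by simp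

text \<open>Zorn's lemma for the reversed pointwise order, with infima of chains as bounds. The
  normalisation \<open>s \<one> = 1\<close> passes to the infimum and keeps it from collapsing to
  0.\<close>

lemma exists_minimal_seminorm:
  assumes "seminorm s0"
  shows "\<exists>s. seminorm s \<and> (\<forall>t. seminorm t \<longrightarrow> (\<forall>x. t x \<le> s x) \<longrightarrow> t = s)"
proof -
  let ?P = "\<lambda>s t. \<forall>x. t x \<le> (s x :: real)"
  have "\<exists>m\<in>{s. seminorm s}. \<forall>t\<in>{s. seminorm s}. ?P m t \<longrightarrow> t = m"
  proof (rule predicate_Zorn)
    show "partial_order_on {s. seminorm s} (relation_of ?P {s. seminorm s})"
      by (rule partial_order_on_relation_ofI) (auto intro: order_trans, meson antisym ext)
    fix C assume C: "C \<in> Chains (relation_of ?P {s. seminorm s})"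
    have CS: "seminorm s" if "s \<in> C" for s using C that by (auto simp: Chains_def relation_of_def)
    have dir: "?P s t \<or> ?P t s" if "s \<in> C" "t \<in> C" for s t using C that by (auto simp: Chains_def relation_of_def)
    show "\<exists>u\<in>{s. seminorm s}. \<forall>a\<in>C. ?P a u"
    proof (cases "C = {}")
      case True
      then show ?thesis using assms by blast
    next
      case False
      let ?u = "\<lambda>x. if x \<in> carrier R then INF s\<in>C. s x else 0"
      have "seminorm ?u \<and> (\<forall>s\<in>C. \<forall>x\<in>carrier R. (INF s\<in>C. s x) \<le> s x)"
      proof (intro conjI ballI)
        have add: "\<exists>k\<in>C. k (x \<oplus> y) \<le> max (i x) (j y)" and mult: "\<exists>k\<in>C. k (x \<otimes> y) \<le> i x * j y"
          if ij: "i \<in> C" "j \<in> C" and xy: "x \<in> carrier R" "y \<in> carrier R" for i j x y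
        proof -
          obtain k where k: "k \<in> C" "?P i k" "?P j k" using dir [OF ij] ij by auto
          have "k (x \<oplus> y) \<le> max (k x) (k y)" using seminormD(4) [OF CS [OF k(1)] xy] .
          then show "\<exists>k\<in>C. k (x \<oplus> y) \<le> max (i x) (j y)" using k by (meson max.mono order_trans)
          have "k (x \<otimes> y) \<le> k x * k y" using seminormD(5) [OF CS [OF k(1)] xy] .
          also have "\<dots> \<le> i x * j y" using k seminormD(1) CS ij by (intro mult_mono) auto
          finally show "\<exists>k\<in>C. k (x \<otimes> y) \<le> i x * j y" using k by blast
        qed
        note * = seminorm_Inf [of C "\<lambda>s. s", OF False]
        show "seminorm ?u"
          by (rule *(1)) (use add mult CS seminormD seminorm_zero in auto)
        show "(INF s\<in>C. s x) \<le> s x" if "s \<in> C" "x \<in> carrier R" for s x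
          by (rule *(2) [OF _ _ _ _ _ _ that]) (use add mult CS seminormD seminorm_zero in auto)
      qed
      then have "seminorm ?u" "\<forall>a\<in>C. ?P a ?u" using CS seminormD(1) by auto
      then show ?thesis by (intro bexI[of _ ?u]) simp_all
    qed
  qed
  then show ?thesis by blast
qed

text \<open>A minimal seminorm equals its spectral seminorm, hence is power multiplicative; it also equals each
  localisation \<open>x \<mapsto> inf s (x f\<^sup>n) / (s f)\<^sup>n\<close>, hence is multiplicative.\<close>

lemma minimal_seminorm_mult:
  assumes s: "seminorm s" and min: "\<And>t. \<lbrakk>seminorm t; \<And>x. t x \<le> s x\<rbrakk> \<Longrightarrow> t = s"
    and f: "f \<in> carrier R" and x: "x \<in> carrier R"
  shows "s (x \<otimes> f) = s x * s f"
proof -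
  note D = seminormD [OF s]
  note hyps = zero_less_one D(1) _ seminorm_zero [OF s] D(4) _ D(6)
  have s1: "0 < s \<one>" using D(3) by simp
  have sm: "s (x \<otimes> y) \<le> 1 * s x * s y" if "x \<in> carrier R" "y \<in> carrier R" for x y using D(5) that by simp
  have "spectral s x \<le> s x" for x
  proof (cases "x \<in> carrier R")
    case True
    have pow: "s (x [^] n) \<le> s x ^ n" for n :: nat
    proof (induction n)
      case (Suc n)
      have "s (x [^] Suc n) \<le> s (x [^] n) * s x" using D(5) True by simp
      also have "\<dots> \<le> s x ^ n * s x" using Suc D(1) by (intro mult_right_mono) auto
      finally show ?case by (simp add: mult.commute)
    qed (simp add: D)
    show ?thesis
    proof (rule dense_ge)
      fix r assume r: "s x < r"
      have "s (x [^] n) \<le> 1 * r ^ n" for n :: nat using pow [of n] power_mono [of "s x" r n] r D(1) [of x] by simp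
      then have "spectral_bound s x r" using r D(1) [of x] unfolding spectral_bound_def by (meson le_less_trans)
      then show "spectral s x \<le> r" using spectral_le [OF zero_less_one D(1) s1 seminorm_zero [OF s] D(4) sm D(6) True] by blast
    qed
  qed (simp add: spectral_def D)
  then have sp: "spectral s = s"
    using min spectral_seminorm [OF zero_less_one D(1) s1 seminorm_zero [OF s] D(4) sm D(6)] by blast
  have sq: "s (y \<otimes> y) = (s y)\<^sup>2" if "y \<in> carrier R" for y
    using spectral_square [OF zero_less_one D(1) s1 seminorm_zero [OF s] D(4) sm D(6) that] D(5) [OF that that]
    unfolding sp by (simp add: power2_eq_square)
  show ?thesis
  proof (cases "s f = 0")
    case True
    then show ?thesis using D(5) [OF x f] D(1) [of "x \<otimes> f"] by simp
  next
    case False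
    then have sf: "s f > 0" using D(1) [of f] by simp
    \<comment> \<open>Squares determine the exponents \<open>2 ^ k\<close>. A general exponent
      \<open>n\<close> follows by splitting \<open>2 ^ n\<close> into \<open>n\<close> and a
      rest.\<close>
    have p2: "s (f [^] (2 ^ k :: nat)) = s f ^ (2 ^ k)" for k :: nat
    proof (induction k)
      case (Suc k)
      have "f [^] (2 ^ Suc k :: nat) = f [^] (2 ^ k :: nat) \<otimes> f [^] (2 ^ k :: nat)" using f by (simp add: nat_pow_mult mult_2)
      then show ?case using sq [of "f [^] (2 ^ k :: nat)"] f Suc by (simp add: power_mult [symmetric] mult.commute)
    qed (use f in simp)
    have ple: "s (f [^] n) \<le> s f ^ n" for n :: nat
    proof (induction n)
      case (Suc n)
      have "s (f [^] Suc n) \<le> s (f [^] n) * s f" using D(5) f by simp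
      also have "\<dots> \<le> s f ^ n * s f" using Suc D(1) by (intro mult_right_mono) auto
      finally show ?case by (simp add: mult.commute)
    qed (simp add: D)
    have pn: "s (f [^] n) = s f ^ n" for n :: nat
    proof (rule antisym [OF ple])
      have n2: "n \<le> 2 ^ n" by (simp add: less_imp_le)
      have "s f ^ n * s f ^ (2 ^ n - n) = s (f [^] (2 ^ n :: nat))" using p2 [of n] n2 by (simp flip: power_add)
      also have "\<dots> \<le> s (f [^] n) * s (f [^] (2 ^ n - n))"
        using D(5) [of "f [^] n" "f [^] (2 ^ n - n)"] f n2 by (simp add: nat_pow_mult)
      also have "\<dots> \<le> s (f [^] n) * s f ^ (2 ^ n - n)" using ple D(1) by (intro mult_left_mono) auto
      finally show "s f ^ n \<le> s (f [^] n)" using sf by simp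
    qed
    \<comment> \<open>By submultiplicativity \<open>a n y\<close> decreases in \<open>n\<close>,
      starting from \<open>s y\<close> at \<open>n = 0\<close>, so its infimum lies below
      \<open>s\<close>. Power multiplicativity \<open>pn\<close> gives it the value 1 at
      \<open>\<one>\<close>, as a seminorm must have.\<close>
    define a where "a n y = s (y \<otimes> f [^] n) / s f ^ n" for n :: nat and y
    have amono: "a (n + m) y \<le> a n y" if "y \<in> carrier R" for n m y
    proof -
      have "s (y \<otimes> f [^] (n + m)) \<le> s (y \<otimes> f [^] n) * s (f [^] m)"
        using D(5) [of "y \<otimes> f [^] n" "f [^] m"] that f by (simp add: m_assoc nat_pow_mult)
      then show ?thesis unfolding a_def pn using sf by (simp add: field_simps power_add)
    qed
    have "\<exists>k\<in>UNIV. a k (y \<oplus> z) \<le> max (a i y) (a j z)" if yz: "y \<in> carrier R" "z \<in> carrier R" for i j y z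
    proof -
      let ?k = "i + j"
      have "s ((y \<oplus> z) \<otimes> f [^] ?k) \<le> max (s (y \<otimes> f [^] ?k)) (s (z \<otimes> f [^] ?k))"
        using D(4) [of "y \<otimes> f [^] ?k" "z \<otimes> f [^] ?k"] yz f by (simp add: l_distr)
      then have "a ?k (y \<oplus> z) \<le> max (a ?k y) (a ?k z)"
        unfolding a_def le_max_iff_disj using sf by (auto intro: divide_right_mono)
      also have "\<dots> \<le> max (a i y) (a j z)"
        using amono [OF yz(1), of i j] amono [OF yz(2), of j i] by (simp add: add.commute max.coboundedI1 max.coboundedI2)
      finally show ?thesis by blast
    qed
    note add = this
    have "\<exists>k\<in>UNIV. a k (y \<otimes> z) \<le> a i y * a j z" if yz: "y \<in> carrier R" "z \<in> carrier R" for i j y z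
    proof -
      have "y \<otimes> z \<otimes> f [^] (i + j) = (y \<otimes> f [^] i) \<otimes> (z \<otimes> f [^] j)"
        using yz f by (simp add: nat_pow_mult [symmetric] m_ac)
      then have "s (y \<otimes> z \<otimes> f [^] (i + j)) \<le> s (y \<otimes> f [^] i) * s (z \<otimes> f [^] j)"
        using D(5) [of "y \<otimes> f [^] i" "z \<otimes> f [^] j"] yz f by simp
      then have "a (i + j) (y \<otimes> z) \<le> a i y * a j z"
        unfolding a_def using sf by (simp add: power_add divide_right_mono)
      then show ?thesis by blast
    qed
    note mult = this
    have nn: "0 \<le> a i y" for i y unfolding a_def using D(1) sf by simp
    have one: "a i \<one> = 1" for i unfolding a_def using f pn sf by simp
    have zero: "a i \<zero> = 0" for i unfolding a_def using f seminorm_zero [OF s] by simp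
    have hom: "a i (c \<otimes> y) = v c * a i y" if "c \<in> K" "y \<in> carrier R" for i c y
      unfolding a_def using that f D(6) [of c "y \<otimes> f [^] i"] by (simp add: m_assoc)
    let ?t = "\<lambda>y. if y \<in> carrier R then INF i\<in>UNIV. a i y else 0"
    have SI: "seminorm ?t" "\<And>i y. y \<in> carrier R \<Longrightarrow> (INF i\<in>UNIV. a i y) \<le> a i y"
      by (rule seminorm_Inf(1) [of UNIV a], use nn one zero hom add mult in simp_all)
         (rule seminorm_Inf(2) [of UNIV a], use nn one zero hom add mult in simp_all)
    have "?t y \<le> s y" for y
      using SI(2) [of y 0] D(2) [of y] by (auto simp: a_def)
    then have ts: "?t = s" using min SI(1) by blast
    have "s x = (INF i\<in>UNIV. a i x)" using fun_cong [OF ts, of x] x by simp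
    \<comment> \<open>Minimality has forced the infimum to equal \<open>s\<close>, so already
      \<open>a 1 x\<close> is at least \<open>s x\<close>: the missing half of
      multiplicativity.\<close>
    also have "\<dots> \<le> a 1 x" using SI(2) x by blast
    finally have "s x * s f \<le> s (x \<otimes> f)" using sf f by (simp add: a_def field_simps)
    then show ?thesis using D(5) [OF x f] by simp
  qed
qed

lemma absolute_value_extension:
  assumes "seminorm s0"
  shows "\<exists>w. absolute_value R w \<and> (\<forall>x\<in>carrier R. \<forall>y\<in>carrier R. w (x \<oplus> y) \<le> max (w x) (w y)) \<and> (\<forall>c\<in>K. w c = v c)"
proof -
  obtain s where s: "seminorm s" "\<And>t. \<lbrakk>seminorm t; \<And>x. t x \<le> s x\<rbrakk> \<Longrightarrow> t = s"
    using exists_minimal_seminorm [OF assms] by blast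
  note D = seminormD [OF s(1)]
  have mult: "s (x \<otimes> y) = s x * s y" if "x \<in> carrier R" "y \<in> carrier R" for x y
    by (rule minimal_seminorm_mult) (use s that in auto)
  have "x = \<zero>" if "x \<in> carrier R" "s x = 0" for x
  proof (rule ccontr)
    assume "x \<noteq> \<zero>"
    then have "x \<in> Units R" using that field_Units by auto
    then have "s (inv x) * s x = 1" using mult [of "inv x" x] that D(3) by simp
    then show False using that by simp
  qed
  then have "absolute_value R s"
    unfolding absolute_value_def using D(1,4) mult seminorm_zero [OF s(1)] by (smt (verit))
  moreover have "s c = v c" if "c \<in> K" for c using D(6) [OF that, of \<one>] D(3) that by simp
  ultimately show ?thesis using D(4) by blast
qed

text \<open>The coordinates with respect to a basis provide a first norm.\<close>

lemma exists_seminorm: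
  assumes "finite_dimension K (carrier R)" shows "\<exists>s. seminorm s"
proof -
  obtain n where "dimension n K (carrier R)" using assms unfolding finite_dimension_def by blast
  then obtain Us where Us: "set Us \<subseteq> carrier R" "independent K Us" "Span K Us = carrier R"
    using exists_base [OF K] by blast
  \<comment> \<open>The sup norm on coordinate vectors.\<close>
  define vm where "vm Ks = foldr (\<lambda>k m. max (v k) m) Ks (0::real)" for Ks
  have vm_nn: "0 \<le> vm Ks" for Ks by (induction Ks) (auto simp: vm_def)
  have vm_Cons [simp]: "vm (k # Ks) = max (v k) (vm Ks)" "vm [] = 0" for k Ks by (simp_all add: vm_def)
  have K0: "\<zero> \<in> K" "v \<zero> = 0" using subringE(2) [OF subfieldE(1) [OF K]] vK_eq_0 by auto
  define co where "co a = (THE Ks. set Ks \<subseteq> K \<and> length Ks = length Us \<and> a = combine Ks Us)" for a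
  have co: "set (co a) \<subseteq> K" "length (co a) = length Us" "combine (co a) Us = a" if "a \<in> carrier R" for a
    using theI' [OF unique_decomposition [OF K Us(2), of a]] that Us(3) unfolding co_def by auto
  have coI: "co a = Ks" if "set Ks \<subseteq> K" "length Ks = length Us" "a = combine Ks Us" "a \<in> carrier R" for a Ks
    using unique_decomposition [OF K Us(2), of a] co [OF that(4)] that Us(3) by metis
  define N where "N a = vm (co a)" for a
  have KR: "K \<subseteq> carrier R" using K_carrier by blast
  have N_nn: "0 \<le> N a" for a using vm_nn by (simp add: N_def)
  have N_hom: "N (c \<otimes> x) = v c * N x" if "c \<in> K" "x \<in> carrier R" for c x
  proof -
    have 1: "set (map ((\<otimes>) c) (co x)) \<subseteq> K" using co [OF that(2)] that subringE(6) [OF subfieldE(1) [OF K]] by auto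
    have 2: "c \<otimes> x = combine (map ((\<otimes>) c) (co x)) Us"
      using combine_r_distr [of "co x" Us c] co [OF that(2)] that Us(1) KR by auto
    have "length (map ((\<otimes>) c) (co x)) = length Us" using co(2) [OF that(2)] by simp
    from coI [OF 1 this 2] have "co (c \<otimes> x) = map ((\<otimes>) c) (co x)" using that by simp
    moreover have "vm (map ((\<otimes>) c) Ks) = v c * vm Ks" if "set Ks \<subseteq> K" for Ks
      using that by (induction Ks) (auto simp: vK_mult \<open>c \<in> K\<close> max_mult_distrib_left vK_nonneg)
    ultimately show ?thesis using co [OF that(2)] by (simp add: N_def)
  qed
  have N_add: "N (x \<oplus> y) \<le> max (N x) (N y)" if xy: "x \<in> carrier R" "y \<in> carrier R" for x y
  proof -
    have S: "set (map2 (\<oplus>) Ks Ls) \<subseteq> K \<and> vm (map2 (\<oplus>) Ks Ls) \<le> max (vm Ks) (vm Ls)"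
      if "length Ks = length Ls" "set Ks \<subseteq> K" "set Ls \<subseteq> K" for Ks Ls
      using that
    proof (induction Ks Ls rule: list_induct2)
      case (Cons k Ks l Ls)
      then show ?case using vK_ultra [of k l] subringE(7) [OF subfieldE(1) [OF K], of k l] by auto
    qed simp
    note S' = S [of "co x" "co y"]
    have 2: "x \<oplus> y = combine (map2 (\<oplus>) (co x) (co y)) Us"
      using combine_add [of "co x" Us "co y"] co [OF xy(1)] co [OF xy(2)] Us(1) KR by auto
    have 1: "set (map2 (\<oplus>) (co x) (co y)) \<subseteq> K" "length (map2 (\<oplus>) (co x) (co y)) = length Us"
      using S' co [OF xy(1)] co [OF xy(2)] by auto
    from coI [OF 1 2] have "co (x \<oplus> y) = map2 (\<oplus>) (co x) (co y)" using xy by simp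
    then show ?thesis using S' co [OF xy(1)] co [OF xy(2)] by (simp add: N_def)
  qed
  have N_zero: "N \<zero> = 0" using N_hom [of \<zero> \<one>] K0 by simp
  have N_one: "N \<one> > 0"
  proof (rule ccontr)
    assume "\<not> N \<one> > 0"
    then have "vm (co \<one>) \<le> 0" by (simp add: N_def)
    then have "vm (co \<one>) = 0" using vm_nn [of "co \<one>"] by simp
    moreover have "combine Ks Vs = \<zero>" if "vm Ks = 0" "set Ks \<subseteq> K" "set Vs \<subseteq> carrier R" for Ks Vs
      using that
    proof (induction Ks Vs rule: combine.induct)
      case (1 k Ks u Vs)
      have "v k = 0" "vm Ks = 0" using 1 vK_nonneg [of k] vm_nn [of Ks] by auto
      then show ?case using 1 vK_eq_0 [of k] by simp
    qed simp_all
    ultimately have "\<one> = \<zero>" using co [OF one_closed] Us(1) by metis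
    then show False by simp
  qed
  have comb: "N (combine Ks Vs \<otimes> b) \<le> vm Ks * C"
    if "set Ks \<subseteq> K" "set Vs \<subseteq> carrier R" "b \<in> carrier R" "\<And>u. u \<in> set Vs \<Longrightarrow> N (u \<otimes> b) \<le> C" "0 \<le> C" for Ks Vs b C
    using that(1,2,4)
  proof (induction Ks Vs rule: combine.induct)
    case (1 k Ks u Vs)
    have c: "combine Ks Vs \<in> carrier R" using 1 KR by (intro combine_in_carrier) auto
    have "(k \<otimes> u \<oplus> combine Ks Vs) \<otimes> b = k \<otimes> (u \<otimes> b) \<oplus> combine Ks Vs \<otimes> b"
      using 1 c that(3) by (simp add: l_distr m_assoc)
    then have "N (combine (k # Ks) (u # Vs) \<otimes> b) \<le> max (N (k \<otimes> (u \<otimes> b))) (N (combine Ks Vs \<otimes> b))"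
      using N_add [of "k \<otimes> (u \<otimes> b)" "combine Ks Vs \<otimes> b"] 1 c that(3) by simp
    also have "N (k \<otimes> (u \<otimes> b)) = v k * N (u \<otimes> b)" using N_hom 1 that(3) by simp
    also have "max (v k * N (u \<otimes> b)) (N (combine Ks Vs \<otimes> b)) \<le> max (v k * C) (vm Ks * C)"
      using 1 vK_nonneg by (intro max.mono mult_left_mono) auto
    finally show ?case using that(5) by (simp add: max_mult_distrib_right)
  qed (use N_zero that vm_nn in auto)
  \<comment> \<open>\<open>M\<close> bounds the norms of products of basis vectors and thereby makes
    \<open>N\<close> submultiplicative up to a factor. The spectral seminorm removes this
    factor.\<close>
  define M where "M = Max (insert 1 ((\<lambda>(u, w). N (u \<otimes> w)) ` (set Us \<times> set Us)))"
  have M: "1 \<le> M" "\<And>u w. \<lbrakk>u \<in> set Us; w \<in> set Us\<rbrakk> \<Longrightarrow> N (u \<otimes> w) \<le> M"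
    unfolding M_def by (auto intro!: Max_ge)
  have N_mult: "N (x \<otimes> y) \<le> M * N x * N y" if xy: "x \<in> carrier R" "y \<in> carrier R" for x y
  proof -
    have 1: "N (u \<otimes> y) \<le> N y * M" if u: "u \<in> set Us" for u
    proof -
      have "N (combine (co y) Us \<otimes> u) \<le> vm (co y) * M"
        by (rule comb) (use co [OF xy(2)] Us M u in auto)
      then show ?thesis using co [OF xy(2)] m_comm [of y u] xy u Us(1) by (auto simp: N_def)
    qed
    have "N (combine (co x) Us \<otimes> y) \<le> vm (co x) * (N y * M)"
      by (rule comb) (use co [OF xy(1)] Us M 1 xy N_nn in auto)
    then show ?thesis using co [OF xy(1)] by (simp add: N_def mult_ac)
  qed
  have "M > 0" using M(1) by simp
  from spectral_seminorm [OF this N_nn N_one N_zero N_add N_mult N_hom] show ?thesis by blast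
qed

end

section \<open>Subfields and their places\<close>

context field
begin

context
  fixes F :: "'a set" assumes F: "subfield F R"
begin

abbreviation RF where "RF \<equiv> R\<lparr>carrier := F\<rparr>"

interpretation F': field RF by (rule subfield_iff(2) [OF F])

lemma F_carrier: "x \<in> F \<Longrightarrow> x \<in> carrier R"
  using subfieldE(3) [OF F] by blast

lemma sub_a_inv: "x \<in> F \<Longrightarrow> \<ominus>\<^bsub>RF\<^esub> x = \<ominus> x"
  using subringE(5) [OF subfieldE(1) [OF F], of x] F_carrier
  by (intro F'.minus_equality) (auto simp: l_neg)

lemma sub_minus: "\<lbrakk>x \<in> F; y \<in> F\<rbrakk> \<Longrightarrow> x \<ominus>\<^bsub>RF\<^esub> y = x \<ominus> y"
  by (simp add: a_minus_def sub_a_inv)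

lemma sub_ofi: "[(k::int)] \<cdot>\<^bsub>RF\<^esub> \<one> = ofi k"
proof -
  have nat: "[(n::nat)] \<cdot>\<^bsub>RF\<^esub> \<one> = [n] \<cdot> \<one>" for n
    by (simp add: add_pow_def nat_pow_def)
  have cl: "[(n::nat)] \<cdot> \<one> \<in> F" for n
    using F'.add.nat_pow_closed [of \<one> n] F'.one_closed nat [of n] by simp
  show ?thesis
  proof (cases "k \<ge> 0")
    case True
    then show ?thesis using nat by (simp add: add_pow_int_ge)
  next
    case False
    then show ?thesis using nat cl sub_a_inv by (simp add: add_pow_int_lt)
  qed
qed

lemma sub_integral: "x \<in> F \<Longrightarrow> integral_over RF (range (\<lambda>k::int. [k] \<cdot>\<^bsub>RF\<^esub> \<one>)) x \<longleftrightarrow> integral_over R (range ofi) x"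
proof -
  have "carrier (S[X]\<^bsub>RF\<^esub>) = carrier (S[X])" for S
    by (auto simp: univ_poly_carrier [symmetric] polynomial_def)
  then show ?thesis
    unfolding integral_over_def sub_ofi
    using eval_consistent [OF subfieldE(1) [OF F]] by simp
qed

lemma sub_OF: "x \<in> carrier (ring_of_integers RF) \<longleftrightarrow> x \<in> F \<and> x \<in> carrier OF"
  using F'.OF_carrier [of x] sub_integral [of x] OF_carrier [of x] F_carrier [of x] by auto

lemma sub_UO: "u \<in> carrier (units_of (ring_of_integers RF)) \<longleftrightarrow> u \<in> F \<and> u \<in> carrier UO"
proof -
  have U: "u \<in> Units RF \<longleftrightarrow> u \<in> F \<and> u \<in> Units R"
    using F'.field_Units field_Units F_carrier by auto
  have "inv\<^bsub>RF\<^esub> u = inv u" if "u \<in> F" "u \<in> Units R"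
    using subfield_m_inv [OF F, of u] that field_Units
    by (intro F'.comm_inv_char) (auto simp: F_carrier)
  moreover have "inv u \<in> F" if "u \<in> F" "u \<in> Units R"
    using subfield_m_inv(1) [OF F, of u] that field_Units by auto
  ultimately show ?thesis
    unfolding F'.UO_carrier UO_carrier U sub_OF by metis
qed

lemma sub_UO_hom: "id \<in> hom (units_of (ring_of_integers RF)) UO"
  by (rule homI) (use sub_UO F'.UO_simps in auto)

text \<open>Places are normalised on the integers, which both fields share, so restriction involves
  no rescaling.\<close>

lemma places_restrict:
  assumes "w \<in> places_above R p" shows "restrict w F \<in> places_above RF p"
proof -
  have o: "[(k::int)] \<cdot>\<^bsub>RF\<^esub> \<one> \<in> F" for k using F'.ofi_closed [of k] by simp
  have "absolute_value RF (restrict w F)"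
    using assms F_carrier subringE(6,7) [OF subfieldE(1) [OF F]]
    by (auto simp: places_above_def absolute_value_def)
  moreover have "restrict w F ([(k::int)] \<cdot>\<^bsub>RF\<^esub> \<one>) = padic_abs p (of_int k)" for k
    using assms o [of k] by (simp add: places_above_def sub_ofi)
  ultimately show ?thesis by (simp add: places_above_def)
qed

text \<open>Finite dimension supplies a seminorm over \<open>v\<close>, and a minimal one is an
  absolute value. It agrees with \<open>v\<close> on the integers, so it is again normalised at
  \<open>p\<close>.\<close>

lemma places_extend:
  assumes p: "prime p" and v: "v \<in> places_above RF p" and fin: "finite_dimension F (carrier R)"
  shows "\<exists>w\<in>places_above R p. \<forall>x\<in>F. w x = v x"
proof -
  interpret V: padic_field RF v p by (rule padic_field_place [OF F'.field_axioms p v])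
  interpret valued_subfield R F v
  proof (rule valued_subfield.intro [OF field_axioms], rule valued_subfield_axioms.intro)
    show "subfield F R" by (rule F)
    show "0 \<le> v x" if "x \<in> F" for x using V.v_nonneg [of x] that by simp
    show "v x = 0 \<longleftrightarrow> x = \<zero>" if "x \<in> F" for x using V.v_eq_0 [of x] that by simp
    show "v (x \<otimes> y) = v x * v y" if "x \<in> F" "y \<in> F" for x y using V.v_mult [of x y] that by simp
    show "v (x \<oplus> y) \<le> max (v x) (v y)" if "x \<in> F" "y \<in> F" for x y using V.ultrametric [of x y] that by simp
  qed
  obtain w where w: "absolute_value R w" "\<And>c. c \<in> F \<Longrightarrow> w c = v c"
    using exists_seminorm [OF fin] absolute_value_extension by blast
  have o: "ofi k \<in> F" for k using F'.ofi_closed [of k] sub_ofi by simp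
  have "restrict w (carrier R) \<in> places_above R p"
    using w o V.v_int by (auto simp: places_above_def absolute_value_def sub_ofi)
  moreover have "\<forall>x\<in>F. restrict w (carrier R) x = v x" using w F_carrier by simp
  ultimately show ?thesis by blast
qed

end

lemma finite_dimension_mono:
  assumes K: "subfield K R" and F: "subfield F R" and KF: "K \<subseteq> F" and fin: "finite_dimension K (carrier R)"
  shows "finite_dimension F (carrier R)"
proof -
  obtain n where "dimension n K (carrier R)" using fin unfolding finite_dimension_def by blast
  then obtain Us where Us: "set Us \<subseteq> carrier R" "Span K Us = carrier R" using exists_base [OF K] by blast
  have "Span K Us \<subseteq> Span F Us"
    unfolding Span_eq_combine_set [OF K Us(1)] Span_eq_combine_set [OF F Us(1)] using KF by blast
  moreover have "Span F Us \<subseteq> carrier R" using Span_in_carrier [OF _ Us(1)] subfieldE(3) [OF F] by blast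
  ultimately have "Span F Us = carrier R" using Us(2) by blast
  then show ?thesis using Span_finite_dimension [OF F Us(1)] by simp
qed

end

section \<open>A place above \<open>p\<close> in every number field\<close>

lemma number_field_ofi_nonzero:
  fixes R (structure)
  assumes "number_field R" "k \<noteq> 0" shows "[(k::int)] \<cdot>\<^bsub>R\<^esub> \<one>\<^bsub>R\<^esub> \<noteq> \<zero>\<^bsub>R\<^esub>"
proof -
  interpret field R using assms by (simp add: number_field_def)
  have n: "[(n::nat)] \<cdot> \<one> \<noteq> \<zero>" if "n > 0" for n using assms that by (simp add: number_field_def)
  show ?thesis
  proof (cases "k \<ge> 0")
    case True
    then show ?thesis using n [of "nat k"] assms(2) by (simp add: add_pow_int_ge)
  next
    case False
    then have "[nat (- k)] \<cdot> \<one> \<noteq> \<zero>" using n by simp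
    moreover have "[k] \<cdot> \<one> = \<ominus> ([nat (- k)] \<cdot> \<one>)" using False by (simp add: add_pow_int_lt)
    moreover have "[nat (- k)] \<cdot> \<one> \<in> carrier R" by simp
    ultimately show ?thesis by (metis minus_minus minus_zero)
  qed
qed

text \<open>The prime field consists of fractions of integers and carries the p-adic absolute value,
  which extends because the field has finite dimension over it.\<close>

lemma exists_place:
  fixes R (structure)
  assumes nf: "number_field R" and p: "prime p" shows "places_above R p \<noteq> {}"
proof -
  interpret field R using nf by (simp add: number_field_def)
  have nz: "ofi k \<noteq> \<zero>" if "k \<noteq> 0" for k using number_field_ofi_nonzero [OF nf that] .
  have U: "ofi k \<in> Units R" if "k \<noteq> 0" for k using nz [OF that] field_Units by simp
  define P where "P = generate_field R {}"
  have P: "subfield P R" unfolding P_def by (rule generate_field_is_subfield) simp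
  define fr where "fr a b = ofi a \<otimes> inv (ofi b)" for a b
  have frc: "fr a b \<in> carrier R" if "b \<noteq> 0" for a b using U [OF that] by (simp add: fr_def)
  have cross: "fr a b \<otimes> ofi b = ofi a" if "b \<noteq> 0" for a b
    using U [OF that] by (simp add: fr_def m_assoc)
  have frI: "x = fr a b" if "x \<in> carrier R" "x \<otimes> ofi b = ofi a" "b \<noteq> 0" for x a b
    using that U [OF that(3)] by (metis fr_def Units_inv_closed Units_r_inv ofi_closed m_assoc r_one)
  have fr_mult: "fr a b \<otimes> fr c d = fr (a * c) (b * d)" if "b \<noteq> 0" "d \<noteq> 0" for a b c d
  proof (rule frI)
    have "fr a b \<otimes> fr c d \<otimes> ofi (b * d) = (fr a b \<otimes> ofi b) \<otimes> (fr c d \<otimes> ofi d)"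
      unfolding ofi_mult using frc that by (simp add: m_ac)
    then show "fr a b \<otimes> fr c d \<otimes> ofi (b * d) = ofi (a * c)" using cross [OF that(1)] cross [OF that(2)] by (simp add: ofi_mult)
  qed (use that frc in auto)
  have fr_add: "fr a b \<oplus> fr c d = fr (a * d + c * b) (b * d)" if "b \<noteq> 0" "d \<noteq> 0" for a b c d
  proof (rule frI)
    have "(fr a b \<oplus> fr c d) \<otimes> ofi (b * d) = (fr a b \<otimes> ofi b) \<otimes> ofi d \<oplus> (fr c d \<otimes> ofi d) \<otimes> ofi b"
      unfolding ofi_mult using frc [OF that(1), of a] frc [OF that(2), of c] ofi_closed [of b] ofi_closed [of d] by algebra
    then show "(fr a b \<oplus> fr c d) \<otimes> ofi (b * d) = ofi (a * d + c * b)"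
      using cross that by (simp add: ofi_mult ofi_add)
  qed (use that frc in auto)
  have ex: "\<exists>a b. b \<noteq> 0 \<and> x = fr a b" if "x \<in> P" for x
    using that unfolding P_def
  proof induction
    case one
    have "\<one> = fr 1 1" by (rule frI) auto
    then show ?case by (metis zero_neq_one)
  next
    case (a_inv h)
    then obtain a b where ab: "b \<noteq> 0" "h = fr a b" by blast
    have "\<ominus> h = fr (- a) b"
      by (rule frI) (use ab frc cross [of b a] in \<open>auto simp: ofi_minus l_minus\<close>)
    then show ?case using ab by blast
  next
    case (m_inv h)
    then obtain a b where ab: "b \<noteq> 0" "h = fr a b" by blast
    have a0: "a \<noteq> 0" using m_inv(2) ab U by (auto simp: fr_def)
    have hU: "h \<in> Units R" using m_inv ab frc field_Units by auto
    have "inv h \<otimes> ofi a = inv h \<otimes> (h \<otimes> ofi b)" using cross [of b a] ab by simp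
    also have "\<dots> = ofi b" using hU by (simp add: m_assoc [symmetric] Units_closed)
    finally have "inv h = fr b a" using frI a0 hU by simp
    then show ?case using a0 by blast
  next
    case (eng_add h1 h2)
    then show ?case using fr_add by (metis mult_eq_0_iff)
  next
    case (eng_mult h1 h2)
    then show ?case using fr_mult by (metis mult_eq_0_iff)
  qed simp
  have inj: "a * d = c * b" if "fr a b = fr c d" "b \<noteq> 0" "d \<noteq> 0" for a b c d
  proof -
    have "ofi (a * d) = fr a b \<otimes> ofi b \<otimes> ofi d" by (simp only: ofi_mult cross [OF that(2)])
    also have "\<dots> = (fr c d \<otimes> ofi d) \<otimes> ofi b" using that frc [of d c] by (simp add: m_ac)
    also have "\<dots> = ofi (c * b)" using cross [of d c] that by (simp add: ofi_mult)
    finally have "ofi (a * d - c * b) = \<zero>" by (simp add: ofi_diff a_minus_def r_neg)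
    then have "a * d - c * b = 0" using nz by blast
    then show ?thesis by simp
  qed
  \<comment> \<open>This is well defined by \<open>inj\<close>: two fractions for the same element
    satisfy the cross-multiplied equation already in the integers, since the characteristic is
    zero.\<close>
  define v where "v x = (THE r. \<exists>a b. b \<noteq> 0 \<and> x = fr a b \<and> r = padic_abs p (of_int a / of_int b))" for x
  have v: "v (fr a b) = padic_abs p (of_int a / of_int b)" if "b \<noteq> 0" for a b
    unfolding v_def
  proof (rule the_equality)
    fix r assume "\<exists>a' b'. b' \<noteq> 0 \<and> fr a b = fr a' b' \<and> r = padic_abs p (of_int a' / of_int b')"
    then obtain c d where cd: "d \<noteq> 0" "fr a b = fr c d" "r = padic_abs p (of_int c / of_int d)" by blast
    have "of_int (a * d) = (of_int (c * b) :: rat)" using inj [OF cd(2) that cd(1)] by simp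
    then have "of_int c / of_int d = (of_int a / of_int b :: rat)" using that cd(1) by (simp add: field_simps)
    then show "r = padic_abs p (of_int a / of_int b)" using cd by simp
  qed (use that in blast)
  have fr0: "fr a b = \<zero> \<longleftrightarrow> a = 0" if "b \<noteq> 0" for a b
  proof
    assume "fr a b = \<zero>"
    then have "ofi a = \<zero>" using cross [OF that, of a] by simp
    then show "a = 0" using nz by blast
  next
    assume "a = 0"
    then show "fr a b = \<zero>" using U [OF that] by (simp add: fr_def)
  qed
  interpret valued_subfield R P v
  proof (rule valued_subfield.intro [OF field_axioms], rule valued_subfield_axioms.intro)
    show "subfield P R" by (rule P)
  next
    fix x assume "x \<in> P"
    then obtain a b where ab: "b \<noteq> 0" "x = fr a b" using ex by blast
    show "0 \<le> v x" using v ab by simp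
    show "v x = 0 \<longleftrightarrow> x = \<zero>" using v fr0 ab p by simp
  next
    fix x y assume "x \<in> P" "y \<in> P"
    then obtain a b where ab: "b \<noteq> 0" "x = fr a b" using ex by blast
    obtain c d where cd: "d \<noteq> 0" "y = fr c d" using ex [OF \<open>y \<in> P\<close>] by blast
    have bd: "b * d \<noteq> 0" using ab cd by simp
    show "v (x \<otimes> y) = v x * v y"
      using v [OF bd, of "a * c"] v [OF ab(1)] v [OF cd(1)] fr_mult [OF ab(1) cd(1)] ab cd
        padic_abs_mult [OF p, of "of_int a / of_int b" "of_int c / of_int d"] by simp
    have e: "of_int (a * d + c * b) / of_int (b * d) = (of_int a / of_int b + of_int c / of_int d :: rat)"
      using ab(1) cd(1) by (simp add: add_frac_eq)
    show "v (x \<oplus> y) \<le> max (v x) (v y)"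
      unfolding ab(2) cd(2) fr_add [OF ab(1) cd(1)] v [OF bd] v [OF ab(1)] v [OF cd(1)] e
      by (rule padic_abs_add [OF p])
  qed
  have fin: "finite_dimension P (carrier R)" using nf by (simp add: number_field_def P_def)
  obtain w where w: "absolute_value R w" "\<And>c. c \<in> P \<Longrightarrow> w c = v c"
    using exists_seminorm [OF fin] absolute_value_extension by blast
  have o: "ofi k = fr k 1" for k by (rule frI) auto
  interpret P': field "R\<lparr>carrier := P\<rparr>" by (rule subfield_iff(2) [OF P])
  have "ofi k \<in> P" for k using P'.ofi_closed [of k] sub_ofi [OF P] by simp
  then have "w (ofi k) = padic_abs p (of_int k)" for k using w(2) v [of 1 k] o by simp
  then have "restrict w (carrier R) \<in> places_above R p"
    using w(1) by (auto simp: places_above_def absolute_value_def)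
  then show ?thesis by blast
qed

section \<open>Functoriality in the unit group\<close>

text \<open>The map that \<open>\<phi>\<close> induces on the second tensor factor, at the level of
  formal combinations.\<close>

definition push :: "('a \<Rightarrow> 'b) \<Rightarrow> ('c \<times> 'a \<Rightarrow>\<^sub>0 int) \<Rightarrow> ('c \<times> 'b \<Rightarrow>\<^sub>0 int)" where
  "push \<phi> = frag_extend (\<lambda>(a, u). frag_of (a, \<phi> u))"

lemma push_simps [simp]:
  "push \<phi> 0 = 0" "push \<phi> (frag_of (a, u)) = frag_of (a, \<phi> u)"
  "push \<phi> (x - y) = push \<phi> x - push \<phi> y" "push \<phi> (x + y) = push \<phi> x + push \<phi> y"
  "push \<phi> (frag_cmul k x) = frag_cmul k (push \<phi> x)"
  by (simp_all add: push_def frag_extend_diff frag_extend_add frag_extend_cmul)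

lemma push_sum: "push \<phi> (sum f A) = (\<Sum>i\<in>A. push \<phi> (f i))"
  by (induction A rule: infinite_finite_induct) auto

text \<open>The map is multiplicative on units rather than a ring homomorphism, so that norms are
  covered along with automorphisms and inclusions.\<close>

locale leopoldt_hom = E: leopoldt E p + F: leopoldt F p
  for E :: "('a, 'b) ring_scheme" and F :: "('c, 'd) ring_scheme" and p +
  fixes \<phi> :: "'a \<Rightarrow> 'c"
  assumes hom: "\<phi> \<in> hom E.UO F.UO"
begin

lemma \<phi>_closed: "u \<in> carrier E.UO \<Longrightarrow> \<phi> u \<in> carrier F.UO"
  using hom by (auto simp: hom_def)

lemma push_closed: "z \<in> carrier E.Fr \<Longrightarrow> push \<phi> z \<in> carrier F.Fr"
  unfolding push_def
  by (rule keys_frag_extend_subset) (use \<phi>_closed in \<open>auto simp: tensor_pairs_def\<close>)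

lemma push_Null: "z \<in> E.Null \<Longrightarrow> push \<phi> z \<in> F.Null"
proof -
  have "E.Null \<subseteq> {z \<in> carrier E.Fr. push \<phi> z \<in> F.Null}"
  proof (rule E.Null_minimal)
    show "subgroup {z \<in> carrier E.Fr. push \<phi> z \<in> F.Null} E.Fr"
    proof (rule E.subgroup_FrI)
      show "x - y \<in> {z \<in> carrier E.Fr. push \<phi> z \<in> F.Null}"
        if "x \<in> {z \<in> carrier E.Fr. push \<phi> z \<in> F.Null}" "y \<in> {z \<in> carrier E.Fr. push \<phi> z \<in> F.Null}" for x y
        using that E.diff_closed [of x y] F.Null_diff by auto
    qed auto
    fix a u assume au: "a \<in> carrier E.Zp" "u \<in> carrier E.UO"
    show "frag_of (a \<otimes>\<^bsub>E.Zp\<^esub> b, u) - frag_of (a, u) - frag_of (b, u) \<in> {z \<in> carrier E.Fr. push \<phi> z \<in> F.Null}"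
      if b: "b \<in> carrier E.Zp" for b
      using E.Null_closed [OF E.Null_add_left [OF au(1) b au(2)]] F.Null_add_left [OF au(1) b \<phi>_closed [OF au(2)]]
      unfolding mem_Collect_eq push_simps by blast
    show "frag_of (a, u \<otimes>\<^bsub>E.UO\<^esub> w) - frag_of (a, u) - frag_of (a, w) \<in> {z \<in> carrier E.Fr. push \<phi> z \<in> F.Null}"
      if w: "w \<in> carrier E.UO" for w
      using E.Null_closed [OF E.Null_add_right [OF au w]] F.Null_add_right [OF au(1) \<phi>_closed [OF au(2)] \<phi>_closed [OF w]]
      unfolding mem_Collect_eq push_simps hom_mult [OF hom au(2) w] by blast
  qed
  then show "z \<in> E.Null \<Longrightarrow> push \<phi> z \<in> F.Null" by blast
qed

text \<open>The exponents \<open>tame_exp p n * padic_rep p a n\<close> depend only on the p-adic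
  factor, so the same ones are used in both fields, and a homomorphism commutes with integer
  powers.\<close>

lemma unit_approx_push:
  assumes z: "z \<in> carrier E.Fr" shows "unit_approx F p (push \<phi> z) n = \<phi> (unit_approx E p z n)"
proof -
  let ?f = "\<lambda>(a, u). u [^]\<^bsub>E.UO\<^esub> (tame_exp p n * padic_rep p a n)"
  let ?g = "\<lambda>(a, u). u [^]\<^bsub>F.UO\<^esub> (tame_exp p n * padic_rep p a n)"
  have f: "?f \<in> E.Pairs \<rightarrow> carrier E.UO" by (auto simp: tensor_pairs_def)
  have g: "?g \<in> F.Pairs \<rightarrow> carrier F.UO" by (auto simp: tensor_pairs_def)
  have "unit_approx F p (push \<phi> z) n = frag_eval F.UO (\<lambda>t. frag_eval F.UO ?g (case t of (a, u) \<Rightarrow> frag_of (a, \<phi> u))) z"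
    unfolding unit_approx_def push_def
    by (rule frag_eval_extend [OF F.UO_comm_group z _ g]) (use \<phi>_closed in \<open>auto simp: tensor_pairs_def\<close>)
  also have "\<dots> = frag_eval F.UO (\<phi> \<circ> ?f) z"
  proof (rule sym, rule frag_eval_cong [OF F.UO_comm_group _ _ z])
    show "\<phi> \<circ> ?f \<in> E.Pairs \<rightarrow> carrier F.UO" using f \<phi>_closed by (auto simp: Pi_iff)
    fix t assume t: "t \<in> E.Pairs"
    obtain a u where au: "t = (a, u)" by fastforce
    have u: "u \<in> carrier E.UO" using t au by (simp add: tensor_pairs_def)
    have "frag_eval F.UO ?g (frag_of (a, \<phi> u)) = ?g (a, \<phi> u)"
      by (rule F.UO.frag_eval_frag_of) (use \<phi>_closed [OF u] in simp)
    also have "\<dots> = \<phi> (?f (a, u))"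
      using hom_int_pow [OF hom u E.UO.is_group F.UO.is_group] by simp
    finally show "(\<phi> \<circ> ?f) t = frag_eval F.UO ?g (case t of (a, u) \<Rightarrow> frag_of (a, \<phi> u))" using au by simp
  qed
  also have "\<dots> = \<phi> (unit_approx E p z n)"
    unfolding unit_approx_def by (rule hom_frag_eval [OF E.UO_comm_group F.UO_comm_group hom f z, symmetric])
  finally show ?thesis .
qed

end

context leopoldt
begin

section \<open>Kernels over a subfield and over the whole field\<close>

context
  fixes K :: "'a set" assumes K: "subfield K F"
begin

abbreviation FK where "FK \<equiv> F\<lparr>carrier := K\<rparr>"

lemma sub_leopoldt: "leopoldt FK p"
  using subfield_iff(2) [OF K] prime_p by (simp add: leopoldt_def leopoldt_axioms_def)

lemma sub_hom: "leopoldt_hom FK F p id"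
  using sub_leopoldt leopoldt_axioms sub_UO_hom [OF K] by (simp add: leopoldt_hom_def leopoldt_hom_axioms_def)

lemma push_id: "push id z = z"
proof -
  have "(\<lambda>(a, u). frag_of (a, id u)) = (frag_of :: 'c \<times> 'd \<Rightarrow> _)" by auto
  then show ?thesis unfolding push_def using frag_expansion [of z] by simp
qed

lemma sub_Null: "z \<in> tensor_null FK p \<Longrightarrow> z \<in> Null"
  using leopoldt_hom.push_Null [OF sub_hom] by (simp add: push_id)

lemma sub_Fr: "z \<in> carrier (free_Abelian_group (tensor_pairs FK p)) \<Longrightarrow> z \<in> carrier Fr"
  using leopoldt_hom.push_closed [OF sub_hom] by (simp add: push_id)

lemma sub_unit_approx:
  "z \<in> carrier (free_Abelian_group (tensor_pairs FK p)) \<Longrightarrow> unit_approx F p z n = unit_approx FK p z n"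
  using leopoldt_hom.unit_approx_push [OF sub_hom] by (simp add: push_id)

lemma sub_unit_approx_in:
  assumes "z \<in> carrier (free_Abelian_group (tensor_pairs FK p))" shows "unit_approx FK p z n \<in> K"
proof -
  interpret K': leopoldt FK p by (rule sub_leopoldt)
  show ?thesis using K'.unit_approx_closed [OF assms] sub_UO [OF K] by blast
qed

lemma sub_one: "\<one> \<in> K" using subringE(3) [OF subfieldE(1) [OF K]] .

text \<open>A place of the large field restricts to one of the subfield, where the same sequence of
  units is already known to tend to 1.\<close>

lemma sub_Ker: assumes "z \<in> leo_kernel FK p" shows "z \<in> Ker"
proof -
  have z: "z \<in> carrier (free_Abelian_group (tensor_pairs FK p))" using assms by (simp add: leo_kernel_def)
  have "(\<lambda>n. w (unit_approx F p z n \<ominus> \<one>)) \<longlonglongrightarrow> 0" if w: "w \<in> places_above F p" for w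
  proof -
    have "(\<lambda>n. restrict w K (unit_approx FK p z n \<ominus>\<^bsub>FK\<^esub> \<one>\<^bsub>FK\<^esub>)) \<longlonglongrightarrow> 0"
      using assms places_restrict [OF K w] unfolding leo_kernel_def mem_Collect_eq by blast
    moreover have "restrict w K (unit_approx FK p z n \<ominus>\<^bsub>FK\<^esub> \<one>\<^bsub>FK\<^esub>) = w (unit_approx F p z n \<ominus> \<one>)" for n
    proof -
      interpret K': field FK by (rule subfield_iff(2) [OF K])
      have "unit_approx FK p z n \<ominus>\<^bsub>FK\<^esub> \<one>\<^bsub>FK\<^esub> \<in> K"
        using K'.minus_closed [of "unit_approx FK p z n" "\<one>\<^bsub>FK\<^esub>"] sub_unit_approx_in [OF z] sub_one by simp
      then show ?thesis
        using sub_minus [OF K sub_unit_approx_in [OF z] sub_one] sub_unit_approx [OF z] by simp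
    qed
    ultimately show ?thesis by (simp only:)
  qed
  then show ?thesis using sub_Fr [OF z] by (simp add: leo_kernel_def)
qed

text \<open>Every place of the subfield above \<open>p\<close> extends to the large field, so
  convergence can be tested there.\<close>

lemma Ker_sub:
  assumes z: "z \<in> Ker" "z \<in> carrier (free_Abelian_group (tensor_pairs FK p))"
    and fin: "finite_dimension K (carrier F)"
  shows "z \<in> leo_kernel FK p"
proof -
  have "(\<lambda>n. v (unit_approx FK p z n \<ominus>\<^bsub>FK\<^esub> \<one>\<^bsub>FK\<^esub>)) \<longlonglongrightarrow> 0" if v: "v \<in> places_above FK p" for v
  proof -
    obtain w where w: "w \<in> places_above F p" "\<And>x. x \<in> K \<Longrightarrow> w x = v x"
      using places_extend [OF K prime_p v fin] by blast
    have "(\<lambda>n. w (unit_approx F p z n \<ominus> \<one>)) \<longlonglongrightarrow> 0" using z(1) w(1) by (simp add: leo_kernel_def)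
    moreover have "w (unit_approx F p z n \<ominus> \<one>) = v (unit_approx FK p z n \<ominus>\<^bsub>FK\<^esub> \<one>\<^bsub>FK\<^esub>)" for n
    proof -
      interpret K': field FK by (rule subfield_iff(2) [OF K])
      have "unit_approx FK p z n \<ominus>\<^bsub>FK\<^esub> \<one>\<^bsub>FK\<^esub> \<in> K"
        using K'.minus_closed [of "unit_approx FK p z n" "\<one>\<^bsub>FK\<^esub>"] sub_unit_approx_in [OF z(2)] sub_one by simp
      then show ?thesis
        using w(2) sub_minus [OF K sub_unit_approx_in [OF z(2)] sub_one] sub_unit_approx [OF z(2)] by simp
    qed
    ultimately show ?thesis by simp
  qed
  then show ?thesis using z(2) by (simp add: leo_kernel_def)
qed

end

end

section \<open>The Galois group\<close>

context field
begin

context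
  fixes K :: "'a set" assumes KR: "K \<subseteq> carrier R"
begin

lemma Gal_carrier: "\<phi> \<in> carrier (Gal R K) \<longleftrightarrow>
    \<phi> \<in> ring_hom R R \<and> \<phi> \<in> Bij (carrier R) \<and> (\<forall>x\<in>K. \<phi> x = x)"
  by (auto simp: Gal_def)

lemma Gal_mult:
  "\<lbrakk>\<phi> \<in> carrier (Gal R K); \<psi> \<in> carrier (Gal R K); x \<in> carrier R\<rbrakk> \<Longrightarrow> (\<phi> \<otimes>\<^bsub>Gal R K\<^esub> \<psi>) x = \<phi> (\<psi> x)"
  by (auto simp: Gal_def BijGroup_def compose_def)

lemma Gal_one: "x \<in> carrier R \<Longrightarrow> \<one>\<^bsub>Gal R K\<^esub> x = x"
  by (simp add: Gal_def BijGroup_def)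

lemma Gal_group: "group (Gal R K)"
proof -
  let ?B = "BijGroup (carrier R)"
  let ?C = "{\<phi> \<in> ring_hom R R \<inter> Bij (carrier R). \<forall>x\<in>K. \<phi> x = x}"
  have "subgroup ?C ?B"
  proof (rule group.subgroupI [OF group_BijGroup])
    show "?C \<subseteq> carrier ?B" by (auto simp: BijGroup_def)
    have "(\<lambda>x\<in>carrier R. x) \<in> ?C" using id_Bij KR by (auto intro!: ring_hom_memI)
    then show "?C \<noteq> {}" by blast
    fix f assume f: "f \<in> ?C"
    then have fB: "f \<in> Bij (carrier R)" and fh: "f \<in> ring_hom R R" by auto
    then have bij: "bij_betw f (carrier R) (carrier R)" by (auto simp: Bij_def)
    let ?i = "\<lambda>x\<in>carrier R. inv_into (carrier R) f x"
    have ic: "?i x \<in> carrier R" "f (?i x) = x" if "x \<in> carrier R" for x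
      using bij that Bij_inv_into_mem [OF fB] by (auto simp: bij_betw_def f_inv_into_f)
    have iu: "?i x = y" if "y \<in> carrier R" "f y = x" for x y
      using bij that ring_hom_memE(1) [OF fh that(1)] by (auto simp: bij_betw_def inv_into_f_eq)
    have "?i \<in> ring_hom R R"
    proof (rule ring_hom_memI)
      show "?i x \<in> carrier R" if "x \<in> carrier R" for x using ic(1) [OF that] .
      show "?i (x \<otimes> y) = ?i x \<otimes> ?i y" "?i (x \<oplus> y) = ?i x \<oplus> ?i y" if "x \<in> carrier R" "y \<in> carrier R" for x y
        using ring_hom_memE(2,3) [OF fh ic(1) [OF that(1)] ic(1) [OF that(2)]] ic [OF that(1)] ic [OF that(2)]
        by (metis iu m_closed, metis iu a_closed)
      show "?i \<one> = \<one>" using iu [OF one_closed ring_hom_memE(4) [OF fh]] .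
    qed
    moreover have "?i x = x" if "x \<in> K" for x using iu [of x x] that KR f by auto
    ultimately show "inv\<^bsub>?B\<^esub> f \<in> ?C" using restrict_inv_into_Bij [OF fB] unfolding inv_BijGroup [OF fB] by auto
    fix g assume g: "g \<in> ?C"
    have m: "f \<otimes>\<^bsub>?B\<^esub> g = compose (carrier R) f g" using f g by (simp add: BijGroup_def)
    have "compose (carrier R) f g \<in> ring_hom R R"
      by (rule ring_hom_memI) (use f g in \<open>auto simp: compose_def ring_hom_memE\<close>)
    moreover have "compose (carrier R) f g x = x" if "x \<in> K" for x
      using that f g KR by (auto simp: compose_def)
    ultimately show "f \<otimes>\<^bsub>?B\<^esub> g \<in> ?C" unfolding m using compose_Bij f g by auto
  qed
  then show ?thesis unfolding Gal_def by (rule subgroup.subgroup_is_group [OF _ group_BijGroup])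
qed

lemma Gal_ring_hom: "\<phi> \<in> carrier (Gal R K) \<Longrightarrow> ring_hom_ring R R \<phi>"
  using Gal_carrier ring_hom_ringI2 ring_axioms by blast

lemma Gal_closed: "\<lbrakk>\<phi> \<in> carrier (Gal R K); x \<in> carrier R\<rbrakk> \<Longrightarrow> \<phi> x \<in> carrier R"
  by (rule ring_hom_memE(1)) (simp_all add: Gal_carrier)

lemma Gal_inj: "\<phi> \<in> carrier (Gal R K) \<Longrightarrow> inj_on \<phi> (carrier R)"
  using Gal_carrier by (auto simp: Bij_def bij_betw_def)

lemma Gal_ofi: assumes "\<phi> \<in> carrier (Gal R K)" shows "\<phi> (ofi k) = ofi k"
proof -
  interpret s: ring_hom_ring R R \<phi> by (rule Gal_ring_hom [OF assms])
  show ?thesis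
  proof (induction k rule: int_induct [where k=0])
    case base
    show ?case unfolding ofi_0 by (rule s.hom_zero)
  next
    case (step1 i)
    show ?case unfolding ofi_add ofi_1 using step1(2) s.hom_add [of "ofi i" \<one>] s.hom_one by simp
  next
    case (step2 i)
    have "\<phi> (ofi i \<oplus> \<ominus> \<one>) = \<phi> (ofi i) \<oplus> \<ominus> \<phi> \<one>" using s.hom_add [of "ofi i" "\<ominus> \<one>"] by simp
    then show ?case unfolding ofi_diff ofi_1 a_minus_def using step2(2) s.hom_one by simp
  qed
qed

lemma Gal_OF: assumes s: "\<phi> \<in> carrier (Gal R K)" and x: "x \<in> carrier OF" shows "\<phi> x \<in> carrier OF"
proof -
  interpret s: ring_hom_ring R R \<phi> by (rule Gal_ring_hom [OF s])
  have xc: "x \<in> carrier R" using x OF_carrier by blast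
  obtain cs where cs: "set cs \<subseteq> range ofi" "x [^] length cs \<oplus> eval cs x = \<zero>"
    using x integral_over_iff [OF xc one_not_zero] OF_carrier by blast
  have csc: "set cs \<subseteq> carrier R" using cs(1) ofi_closed by blast
  have "map \<phi> cs = cs" using cs(1) Gal_ofi [OF s] by (intro map_idI) blast
  then have "\<phi> (eval cs x) = eval cs (\<phi> x)" using s.eval_hom' [OF xc csc] by simp
  moreover have "\<phi> (x [^] length cs \<oplus> eval cs x) = \<phi> x [^] length cs \<oplus> \<phi> (eval cs x)"
    using xc eval_in_carrier [OF csc xc] s.hom_nat_pow by simp
  ultimately have "\<phi> x [^] length cs \<oplus> eval cs (\<phi> x) = \<zero>" using cs(2) s.hom_zero by simp
  then show ?thesis
    using integral_over_iff [OF Gal_closed [OF s xc] one_not_zero] cs(1) OF_carrier Gal_closed [OF s xc] by blast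
qed

lemma Gal_UO: assumes s: "\<phi> \<in> carrier (Gal R K)" shows "\<phi> \<in> hom UO UO"
proof (rule homI)
  note h = ring_hom_memE [of \<phi> R R]
  have sh: "\<phi> \<in> ring_hom R R" using s Gal_carrier by blast
  fix x assume "x \<in> carrier UO"
  then obtain y where y: "x \<in> carrier OF" "y \<in> carrier OF" "y \<otimes> x = \<one>" "x \<otimes> y = \<one>"
    by (auto simp: units_of_carrier Units_def)
  have c: "x \<in> carrier R" "y \<in> carrier R" using y OF_carrier by auto
  have "\<phi> y \<otimes> \<phi> x = \<one>" "\<phi> x \<otimes> \<phi> y = \<one>"
    using h(2) [OF sh c] h(2) [OF sh c(2,1)] h(4) [OF sh] y by auto
  then show "\<phi> x \<in> carrier UO" using Gal_OF [OF s] y by (auto simp: units_of_carrier Units_def)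
next
  have sh: "\<phi> \<in> ring_hom R R" using s Gal_carrier by blast
  fix x y assume "x \<in> carrier UO" "y \<in> carrier UO"
  then show "\<phi> (x \<otimes>\<^bsub>UO\<^esub> y) = \<phi> x \<otimes>\<^bsub>UO\<^esub> \<phi> y"
    using ring_hom_memE(2) [OF sh, of x y] by (simp add: UO_carrier OF_carrier)
qed

lemma fixed_subfield:
  assumes H: "H \<subseteq> carrier (Gal R K)" shows "subfield (fixed_field R H) R"
proof (rule subfieldI')
  have sh: "\<phi> \<in> ring_hom R R" if "\<phi> \<in> H" for \<phi> using that H Gal_carrier by blast
  have neg: "\<phi> (\<ominus> h) = \<ominus> \<phi> h" if "\<phi> \<in> H" "h \<in> carrier R" for \<phi> h
  proof -
    interpret s: ring_hom_ring R R \<phi> by (rule Gal_ring_hom) (use H that in blast)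
    show ?thesis using that by simp
  qed
  show "subring (fixed_field R H) R"
  proof (rule subringI)
    show "fixed_field R H \<subseteq> carrier R" by (auto simp: fixed_field_def)
    show "\<one> \<in> fixed_field R H" using ring_hom_memE(4) [OF sh] by (simp add: fixed_field_def)
    fix x y assume xy: "x \<in> fixed_field R H" "y \<in> fixed_field R H"
    then have f: "\<phi> x = x" "\<phi> y = y" if "\<phi> \<in> H" for \<phi>
      using that by (simp_all add: fixed_field_def)
    have c: "x \<in> carrier R" "y \<in> carrier R" using xy by (simp_all add: fixed_field_def)
    have "\<phi> (\<ominus> x) = \<ominus> x" "\<phi> (x \<otimes> y) = x \<otimes> y" "\<phi> (x \<oplus> y) = x \<oplus> y" if h: "\<phi> \<in> H" for \<phi>
      using neg [OF h c(1)] ring_hom_memE(2,3) [OF sh [OF h] c] f [OF h] by simp_all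
    then show "\<ominus> x \<in> fixed_field R H" "x \<otimes> y \<in> fixed_field R H" "x \<oplus> y \<in> fixed_field R H"
      using c by (simp_all add: fixed_field_def)
  qed
  fix k assume k: "k \<in> fixed_field R H - {\<zero>}"
  then have kU: "k \<in> Units R" by (auto simp: fixed_field_def field_Units)
  have kc: "k \<in> carrier R" using kU by blast
  have "\<phi> (inv k) = inv k" if s: "\<phi> \<in> H" for \<phi>
  proof -
    have "\<phi> k \<otimes> \<phi> (inv k) = \<one>"
      using ring_hom_memE(2) [OF sh [OF s] kc, of "inv k"] ring_hom_memE(4) [OF sh [OF s]] kU by simp
    moreover have "\<phi> k = k" using k s by (simp add: fixed_field_def)
    ultimately show ?thesis
      using comm_inv_char [of k "\<phi> (inv k)"] ring_hom_memE(1) [OF sh [OF s], of "inv k"] kU kc by simp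
  qed
  then show "inv k \<in> fixed_field R H" using kU by (simp add: fixed_field_def)
qed

lemma fixed_mono: "H \<subseteq> carrier (Gal R K) \<Longrightarrow> K \<subseteq> fixed_field R H"
  using KR Gal_carrier by (auto simp: fixed_field_def)

end

text \<open>An automorphism is determined by the images of a finite spanning set, and each image is
  a root of a nonzero polynomial over \<open>K\<close> that does not depend on the
  automorphism.\<close>

lemma Gal_finite:
  assumes K: "subfield K R" and fin: "finite_dimension K (carrier R)" shows "finite (carrier (Gal R K))"
proof -
  have KR: "K \<subseteq> carrier R" using subfieldE(3) [OF K] .
  obtain n where "dimension n K (carrier R)" using fin unfolding finite_dimension_def by blast
  then obtain Us where Us: "set Us \<subseteq> carrier R" "Span K Us = carrier R" using exists_base [OF K] by blast
  let ?G = "carrier (Gal R K)"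
  have "\<exists>A. finite A \<and> (\<forall>\<phi>\<in>?G. \<phi> u \<in> A)" if u: "u \<in> carrier R" for u
  proof -
    have "(algebraic over K) u" by (rule finite_dimension_imp_algebraic [OF K carrier_is_subring fin u])
    then obtain p where p: "p \<in> carrier (K[X])" "p \<noteq> []" "eval p u = \<zero>"
      by (rule algebraicE [OF subfieldE(1) [OF K] u])
    have pK: "set p \<subseteq> K" using p(1) unfolding univ_poly_carrier [symmetric] polynomial_def by auto
    have "p \<in> carrier (poly_ring R)"
      using p(1) carrier_polynomial [OF subfieldE(1) [OF K]] unfolding univ_poly_carrier [symmetric] by blast
    then have "finite {x. is_root p x}" by (rule finite_number_of_roots)
    moreover have "is_root p (\<phi> u)" if s: "\<phi> \<in> ?G" for \<phi>
    proof -
      interpret s: ring_hom_ring R R \<phi> by (rule Gal_ring_hom [OF KR s])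
      have "map \<phi> p = p" using pK s Gal_carrier [OF KR] by (intro map_idI) blast
      then have "\<phi> (eval p u) = eval p (\<phi> u)" using s.eval_hom' [OF u] pK KR by (metis subset_trans)
      then show ?thesis unfolding is_root_def using p s.hom_zero Gal_closed [OF KR s u] by simp
    qed
    ultimately show ?thesis by blast
  qed
  then obtain A where A: "\<And>u. u \<in> carrier R \<Longrightarrow> finite (A u)" "\<And>u \<phi>. u \<in> carrier R \<Longrightarrow> \<phi> \<in> ?G \<Longrightarrow> \<phi> u \<in> A u"
    by metis
  let ?B = "\<Union>u\<in>set Us. A u"
  have "finite ?B" using A(1) Us(1) by blast
  then have "finite {xs. set xs \<subseteq> ?B \<and> length xs = length Us}" by (rule finite_lists_length_eq)
  moreover have "(\<lambda>\<phi>. map \<phi> Us) ` ?G \<subseteq> {xs. set xs \<subseteq> ?B \<and> length xs = length Us}"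
  proof (rule image_subsetI)
    fix \<phi> assume "\<phi> \<in> ?G"
    then have "\<phi> u \<in> ?B" if "u \<in> set Us" for u using A(2) [of u \<phi>] Us(1) that by blast
    then show "map \<phi> Us \<in> {xs. set xs \<subseteq> ?B \<and> length xs = length Us}" by auto
  qed
  ultimately have "finite ((\<lambda>\<phi>. map \<phi> Us) ` ?G)" by (rule rev_finite_subset)
  moreover have "inj_on (\<lambda>\<phi>. map \<phi> Us) ?G"
  proof (rule inj_onI)
    fix \<phi> \<psi> assume st: "\<phi> \<in> ?G" "\<psi> \<in> ?G" "map \<phi> Us = map \<psi> Us"
    interpret s: ring_hom_ring R R \<phi> by (rule Gal_ring_hom [OF KR st(1)])
    interpret t: ring_hom_ring R R \<psi> by (rule Gal_ring_hom [OF KR st(2)])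
    show "\<phi> = \<psi>"
    proof (rule extensionalityI)
      show "\<phi> \<in> extensional (carrier R)" "\<psi> \<in> extensional (carrier R)"
        using st Gal_carrier [OF KR] Bij_imp_extensional by blast+
      fix x assume "x \<in> carrier R"
      then obtain Ks where Ks: "set Ks \<subseteq> K" "x = combine Ks Us"
        using Us Span_eq_combine_set [OF K Us(1)] by blast
      have KsR: "set Ks \<subseteq> carrier R" using Ks KR by blast
      have "map \<phi> Ks = Ks" "map \<psi> Ks = Ks" using Ks(1) st(1,2) Gal_carrier [OF KR] by (intro map_idI; blast)+
      then show "\<phi> x = \<psi> x"
        using s.combine_hom [OF KsR Us(1)] t.combine_hom [OF KsR Us(1)] Ks(2) st(3) by simp
    qed
  qed
  ultimately show ?thesis by (rule finite_imageD)
qed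

end

section \<open>Integral form of an idempotent relation\<close>

lemma common_denominator:
  assumes "finite (Q :: rat set)" shows "\<exists>d>0. \<forall>q\<in>Q. \<exists>n::int. of_nat d * q = of_int n"
  using assms
proof (induction Q rule: finite_induct)
  case (insert q Q)
  then obtain d where d: "d > 0" "\<forall>q\<in>Q. \<exists>n::int. of_nat d * q = of_int n" by blast
  obtain a b where ab: "quotient_of q = (a, b)" by fastforce
  have b: "b > 0" "q = of_int a / of_int b" using quotient_of_denom_pos quotient_of_div ab by auto
  have "of_nat (d * nat b) * q = of_int (int d * a)" using b by simp
  moreover have "\<exists>n::int. of_nat (d * nat b) * q' = of_int n" if q': "q' \<in> Q" for q'
  proof -
    obtain n :: int where n: "of_nat d * q' = of_int n" using bspec [OF d(2) q'] by (rule exE)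
    have "of_nat (d * nat b) * q' = of_nat d * q' * of_int b" using b(1) by simp
    also have "\<dots> = of_int (n * b)" unfolding n by simp
    finally show ?thesis ..
  qed
  ultimately have "\<exists>n::int. of_nat (d * nat b) * q' = of_int n" if "q' \<in> insert q Q" for q'
    using that by (elim insertE) (simp only:, rule exI, blast)
  then show ?case using d(1) b(1) by (intro exI[of _ "d * nat b"]) simp
qed (auto intro: exI[of _ 1])

context group
begin

lemma group_algebra_mult_closed:
  assumes "a \<in> carrier (group_algebra G)" "b \<in> carrier (group_algebra G)"
  shows "a \<otimes>\<^bsub>group_algebra G\<^esub> b \<in> carrier (group_algebra G)"
proof -
  have "Poly_Mapping.keys (\<Sum>x\<in>Poly_Mapping.keys a. \<Sum>y\<in>Poly_Mapping.keys b.
       Poly_Mapping.single (x \<otimes> y) (Poly_Mapping.lookup a x * Poly_Mapping.lookup b y)) \<subseteq> carrier G"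
  proof
    fix g assume "g \<in> Poly_Mapping.keys (\<Sum>x\<in>Poly_Mapping.keys a. \<Sum>y\<in>Poly_Mapping.keys b.
       Poly_Mapping.single (x \<otimes> y) (Poly_Mapping.lookup a x * Poly_Mapping.lookup b y))"
    then have "(\<Sum>x\<in>Poly_Mapping.keys a. \<Sum>y\<in>Poly_Mapping.keys b.
       Poly_Mapping.lookup (Poly_Mapping.single (x \<otimes> y) (Poly_Mapping.lookup a x * Poly_Mapping.lookup b y)) g) \<noteq> 0"
      by (simp add: in_keys_iff lookup_sum)
    then obtain x where x: "x \<in> Poly_Mapping.keys a" "(\<Sum>y\<in>Poly_Mapping.keys b.
       Poly_Mapping.lookup (Poly_Mapping.single (x \<otimes> y) (Poly_Mapping.lookup a x * Poly_Mapping.lookup b y)) g) \<noteq> 0"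
      by (metis (no_types, lifting) sum.neutral)
    then obtain y where y: "y \<in> Poly_Mapping.keys b"
       "Poly_Mapping.lookup (Poly_Mapping.single (x \<otimes> y) (Poly_Mapping.lookup a x * Poly_Mapping.lookup b y)) g \<noteq> 0"
      by (metis (no_types, lifting) sum.neutral)
    then have "x \<otimes> y = g" by (auto simp: lookup_single when_def split: if_splits)
    then show "g \<in> carrier G" using x y assms by (auto simp: group_algebra_def)
  qed
  then show ?thesis by (simp add: group_algebra_def)
qed

lemma group_algebra_finsum:
  assumes "finite A" "\<And>i. i \<in> A \<Longrightarrow> f i \<in> carrier (group_algebra G)"
  shows "(\<Oplus>\<^bsub>group_algebra G\<^esub> i\<in>A. f i) = (\<Sum>i\<in>A. f i)"
proof -
  interpret Q: comm_monoid "add_monoid (group_algebra G)"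
    by (rule comm_monoidI) (use keys_add in \<open>fastforce simp: group_algebra_def add.assoc add.commute\<close>)+
  have "finprod (add_monoid (group_algebra G)) f A = (\<Sum>i\<in>A. f i)"
    using assms
  proof (induction A rule: finite_induct)
    case empty
    show ?case using Q.finprod_empty [of f] by (simp add: group_algebra_def)
  next
    case (insert a A)
    then show ?case using Q.finprod_insert [of A a f] by (simp add: group_algebra_def Pi_iff)
  qed
  then show ?thesis by (simp add: finsum_def)
qed

lemma lookup_subgroup_idempotent:
  assumes "finite H"
  shows "Poly_Mapping.lookup (subgroup_idempotent H) h = (if h \<in> H then 1 / of_nat (card H) else 0)"
  using assms by (simp add: subgroup_idempotent_def lookup_sum lookup_single when_def)

text \<open>The sums are extended from the supports to all of \<open>G\<close> and \<open>H\<close>,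
  so that they can be interchanged freely when the relation is applied.\<close>

lemma lookup_mult_idempotent:
  assumes fin: "finite (carrier G)" and H: "H \<subseteq> carrier G" and a: "a \<in> carrier (group_algebra G)"
  shows "Poly_Mapping.lookup (a \<otimes>\<^bsub>group_algebra G\<^esub> subgroup_idempotent H) g =
    (\<Sum>x\<in>carrier G. \<Sum>h\<in>H. if x \<otimes> h = g then Poly_Mapping.lookup a x / of_nat (card H) else 0)"
proof -
  let ?e = "subgroup_idempotent H"
  have fH: "finite H" using fin H finite_subset by blast
  have kH: "Poly_Mapping.keys ?e \<subseteq> H" using lookup_subgroup_idempotent [OF fH] by (auto simp: in_keys_iff split: if_splits)
  have ka: "Poly_Mapping.keys a \<subseteq> carrier G" using a by (simp add: group_algebra_def)
  have "Poly_Mapping.lookup (a \<otimes>\<^bsub>group_algebra G\<^esub> ?e) g =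
    (\<Sum>x\<in>Poly_Mapping.keys a. \<Sum>h\<in>Poly_Mapping.keys ?e.
      if x \<otimes> h = g then Poly_Mapping.lookup a x * Poly_Mapping.lookup ?e h else 0)"
    by (simp add: group_algebra_def lookup_sum lookup_single when_def)
  also have "\<dots> = (\<Sum>x\<in>Poly_Mapping.keys a. \<Sum>h\<in>H.
      if x \<otimes> h = g then Poly_Mapping.lookup a x * Poly_Mapping.lookup ?e h else 0)"
    by (intro sum.cong refl sum.mono_neutral_left fH kH) (auto simp: in_keys_iff)
  also have "\<dots> = (\<Sum>x\<in>carrier G. \<Sum>h\<in>H.
      if x \<otimes> h = g then Poly_Mapping.lookup a x * Poly_Mapping.lookup ?e h else 0)"
    by (intro sum.mono_neutral_left fin ka) (auto simp: in_keys_iff intro!: sum.neutral)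
  also have "\<dots> = (\<Sum>x\<in>carrier G. \<Sum>h\<in>H. if x \<otimes> h = g then Poly_Mapping.lookup a x / of_nat (card H) else 0)"
    by (intro sum.cong refl) (simp add: lookup_subgroup_idempotent [OF fH])
  finally show ?thesis .
qed

text \<open>Comparing coefficients at each \<open>g\<close> turns the relation into identities
  between rationals. The factor \<open>1 / card H\<close> of each idempotent is moved into the
  coefficients before denominators are cleared, which leaves norm elements with integer
  coefficients.\<close>

lemma integral_idempotent_relation:
  assumes fin: "finite (carrier G)" and sub: "\<And>H. H \<in> \<H> \<Longrightarrow> H \<subseteq> carrier G"
    and rel: "has_gen_useful_idempotent_relation G \<H>"
  shows "\<exists>d>0. \<exists>b. \<forall>g\<in>carrier G.
    (\<Sum>H\<in>\<H> - {{\<one>}}. \<Sum>x\<in>carrier G. \<Sum>h\<in>H. if x \<otimes> h = g then b H x else 0) = (if g = \<one> then int d else 0)"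
proof -
  let ?H = "\<H> - {{\<one>}}"
  obtain a where a: "\<And>H. H \<in> ?H \<Longrightarrow> a H \<in> carrier (group_algebra G)"
    "\<one>\<^bsub>group_algebra G\<^esub> = (\<Oplus>\<^bsub>group_algebra G\<^esub> H \<in> ?H. a H \<otimes>\<^bsub>group_algebra G\<^esub> subgroup_idempotent H)"
    using rel unfolding has_gen_useful_idempotent_relation_def by blast
  have fH: "finite ?H" using fin sub by (intro finite_subset [of ?H "Pow (carrier G)"]) auto
  have fh: "finite H" if "H \<in> ?H" for H using sub [of H] that fin finite_subset by blast
  have e: "subgroup_idempotent H \<in> carrier (group_algebra G)" if "H \<in> ?H" for H
  proof -
    have "Poly_Mapping.keys (subgroup_idempotent H) \<subseteq> H"
      using lookup_subgroup_idempotent [OF fh [OF that]] by (auto simp: in_keys_iff split: if_splits)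
    then show ?thesis using sub that by (auto simp: group_algebra_def)
  qed
  define q where "q H x = Poly_Mapping.lookup (a H) x / of_nat (card H)" for H x
  have eq: "(\<Sum>H\<in>?H. \<Sum>x\<in>carrier G. \<Sum>h\<in>H. if x \<otimes> h = g then q H x else 0) = (if g = \<one> then 1 else 0)" for g
  proof -
    have "\<one>\<^bsub>group_algebra G\<^esub> = (\<Sum>H\<in>?H. a H \<otimes>\<^bsub>group_algebra G\<^esub> subgroup_idempotent H)"
      unfolding a(2) using a(1) e by (intro group_algebra_finsum fH group_algebra_mult_closed) auto
    then have "Poly_Mapping.lookup (\<one>\<^bsub>group_algebra G\<^esub>) g =
      (\<Sum>H\<in>?H. Poly_Mapping.lookup (a H \<otimes>\<^bsub>group_algebra G\<^esub> subgroup_idempotent H) g)" by (simp add: lookup_sum)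
    also have "\<dots> = (\<Sum>H\<in>?H. \<Sum>x\<in>carrier G. \<Sum>h\<in>H. if x \<otimes> h = g then q H x else 0)"
      unfolding q_def using a(1) sub by (intro sum.cong refl lookup_mult_idempotent [OF fin]) auto
    also have "Poly_Mapping.lookup (\<one>\<^bsub>group_algebra G\<^esub>) g = (if g = \<one> then 1 else 0)"
      by (simp add: group_algebra_def lookup_single when_def)
    finally show ?thesis by simp
  qed
  have "finite ((\<lambda>(H, x). q H x) ` (?H \<times> carrier G))" using fH fin by blast
  then obtain d where d: "d > 0" "\<forall>r\<in>(\<lambda>(H, x). q H x) ` (?H \<times> carrier G). \<exists>n::int. of_nat d * r = of_int n"
    using common_denominator by blast
  then have "\<forall>H x. \<exists>n::int. H \<in> ?H \<and> x \<in> carrier G \<longrightarrow> of_nat d * q H x = of_int n" by blast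
  then obtain b :: "'a set \<Rightarrow> 'a \<Rightarrow> int" where b: "\<And>H x. \<lbrakk>H \<in> ?H; x \<in> carrier G\<rbrakk> \<Longrightarrow> of_nat d * q H x = of_int (b H x)"
    by metis
  have "(\<Sum>H\<in>?H. \<Sum>x\<in>carrier G. \<Sum>h\<in>H. if x \<otimes> h = g then b H x else 0) = (if g = \<one> then int d else 0)" for g
  proof -
    have "(of_int (\<Sum>H\<in>?H. \<Sum>x\<in>carrier G. \<Sum>h\<in>H. if x \<otimes> h = g then b H x else 0) :: rat) =
      (\<Sum>H\<in>?H. \<Sum>x\<in>carrier G. \<Sum>h\<in>H. of_nat d * (if x \<otimes> h = g then q H x else 0))"
      unfolding of_int_sum by (intro sum.cong refl) (simp add: b)
    also have "\<dots> = of_nat d * (if g = \<one> then 1 else 0)"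
      unfolding sum_distrib_left [symmetric] eq ..
    finally have "(of_int (\<Sum>H\<in>?H. \<Sum>x\<in>carrier G. \<Sum>h\<in>H. if x \<otimes> h = g then b H x else 0) :: rat)
        = of_int (if g = \<one> then int d else 0)" by simp
    then show ?thesis by (simp only: of_int_eq_iff)
  qed
  then show ?thesis using d(1) by blast
qed

end

section \<open>Galois action, norms and the Leopoldt kernel\<close>

lemma frag_cmul_sum_left: "frag_cmul (\<Sum>i\<in>A. f i) x = (\<Sum>i\<in>A. frag_cmul (f i) x)"
  by (induction A rule: infinite_finite_induct) (auto simp: frag_cmul_distrib)

lemma push_cong:
  assumes "z \<in> carrier (free_Abelian_group S)" "\<And>a u. (a, u) \<in> S \<Longrightarrow> \<phi> u = \<psi> u"
  shows "push \<phi> z = push \<psi> z"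
proof -
  have "Poly_Mapping.keys z \<subseteq> S" using assms(1) by simp
  then show ?thesis
    by (rule free_Abelian_group_induct) (use assms(2) in auto)
qed

lemma push_push: "push \<phi> (push \<psi> z) = push (\<lambda>u. \<phi> (\<psi> u)) z"
  using subset_UNIV [of "Poly_Mapping.keys z"]
  by (rule free_Abelian_group_induct) auto

lemma push_ident: "push (\<lambda>u. u) z = z"
  using subset_UNIV [of "Poly_Mapping.keys z"]
  by (rule free_Abelian_group_induct) auto

locale leopoldt_galois = leopoldt L p for L :: "('a, 'b) ring_scheme" (structure) and p +
  fixes K :: "'a set"
  assumes nf: "number_field L" and K: "subfield K L" and fin_dim: "finite_dimension K (carrier L)"
begin

abbreviation G where "G \<equiv> Gal L K"

lemma KL: "K \<subseteq> carrier L" using subfieldE(3) [OF K] .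

sublocale G: group G by (rule Gal_group [OF KL])

lemma finite_G: "finite (carrier G)" by (rule Gal_finite [OF K fin_dim])

lemma Pairs_carrier: "(a, u) \<in> Pairs \<Longrightarrow> u \<in> carrier L"
  by (auto simp: tensor_pairs_def UO_carrier OF_carrier)

lemma act_hom: "g \<in> carrier G \<Longrightarrow> leopoldt_hom L L p g"
  using leopoldt_axioms Gal_UO [OF KL] by (simp add: leopoldt_hom_def leopoldt_hom_axioms_def)

lemma act_closed: "\<lbrakk>g \<in> carrier G; z \<in> carrier Fr\<rbrakk> \<Longrightarrow> push g z \<in> carrier Fr"
  using leopoldt_hom.push_closed [OF act_hom] .

lemma act_Null: "\<lbrakk>g \<in> carrier G; z \<in> Null\<rbrakk> \<Longrightarrow> push g z \<in> Null"
  using leopoldt_hom.push_Null [OF act_hom] .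

lemma act_mult:
  assumes "g \<in> carrier G" "h \<in> carrier G" "z \<in> carrier Fr" shows "push (g \<otimes>\<^bsub>G\<^esub> h) z = push g (push h z)"
  unfolding push_push
  by (rule push_cong [OF assms(3)]) (use Gal_mult [OF KL assms(1,2)] Pairs_carrier in blast)

lemma act_one: "z \<in> carrier Fr \<Longrightarrow> push \<one>\<^bsub>G\<^esub> z = z"
  using push_cong [of z Pairs "\<one>\<^bsub>G\<^esub>" "\<lambda>u. u"] Gal_one [OF KL] Pairs_carrier push_ident by metis

text \<open>The Galois group acts on the places above \<open>p\<close> by composition, since it
  fixes the integers. A condition imposed at all places is therefore invariant under it.\<close>

lemma act_place:
  assumes g: "g \<in> carrier G" and w: "w \<in> places_above L p"
  shows "restrict (\<lambda>x. w (g x)) (carrier L) \<in> places_above L p"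
proof -
  interpret s: ring_hom_ring L L g by (rule Gal_ring_hom [OF KL g])
  have "g x = \<zero> \<longleftrightarrow> x = \<zero>" if "x \<in> carrier L" for x
    using Gal_inj [OF KL g] that s.hom_zero unfolding inj_on_def by (metis zero_closed)
  then have "absolute_value L (restrict (\<lambda>x. w (g x)) (carrier L))"
    using w by (simp add: places_above_def absolute_value_def)
  moreover have "restrict (\<lambda>x. w (g x)) (carrier L) (ofi k) = padic_abs p (of_int k)" for k
    using w Gal_ofi [OF KL g, of k] by (simp add: places_above_def)
  ultimately show ?thesis by (simp add: places_above_def)
qed

lemma act_Ker: assumes g: "g \<in> carrier G" and z: "z \<in> Ker" shows "push g z \<in> Ker"
proof -
  interpret s: ring_hom_ring L L g by (rule Gal_ring_hom [OF KL g])
  have zc: "z \<in> carrier Fr" using Ker_closed [OF z] .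
  have "(\<lambda>n. w (unit_approx L p (push g z) n \<ominus> \<one>)) \<longlonglongrightarrow> 0" if w: "w \<in> places_above L p" for w
  proof -
    have "(\<lambda>n. restrict (\<lambda>x. w (g x)) (carrier L) (unit_approx L p z n \<ominus> \<one>)) \<longlonglongrightarrow> 0"
      using z act_place [OF g w] unfolding leo_kernel_def mem_Collect_eq by blast
    moreover have "restrict (\<lambda>x. w (g x)) (carrier L) (unit_approx L p z n \<ominus> \<one>) = w (unit_approx L p (push g z) n \<ominus> \<one>)" for n
    proof -
      have c: "unit_approx L p z n \<in> carrier L" using unit_approx_closed [OF zc, of n] by (auto simp: UO_carrier OF_carrier)
      have "g (unit_approx L p z n \<ominus> \<one>) = g (unit_approx L p z n) \<ominus> \<one>"
        using c s.hom_add [of "unit_approx L p z n" "\<ominus> \<one>"] by (simp add: a_minus_def)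
      then show ?thesis using leopoldt_hom.unit_approx_push [OF act_hom [OF g] zc, of n] c by simp
    qed
    ultimately show ?thesis by (simp only:)
  qed
  then show ?thesis using act_closed [OF g zc] by (simp add: leo_kernel_def)
qed

lemma Null_finprod:
  assumes "finite I" "a \<in> carrier Zp" "\<And>i. i \<in> I \<Longrightarrow> f i \<in> carrier UO"
  shows "frag_of (a, finprod UO f I) - (\<Sum>i\<in>I. frag_of (a, f i)) \<in> Null"
  using assms(1,3)
proof (induction I rule: finite_induct)
  case empty
  then show ?case using Null_pow_right [OF assms(2) UO.one_closed, of 0] by simp
next
  case (insert i I)
  have f: "f \<in> I \<rightarrow> carrier UO" "f i \<in> carrier UO" using insert by auto
  have "frag_of (a, finprod UO f (insert i I)) - (\<Sum>j\<in>insert i I. frag_of (a, f j)) =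
    (frag_of (a, f i \<otimes>\<^bsub>UO\<^esub> finprod UO f I) - frag_of (a, f i) - frag_of (a, finprod UO f I)) +
    (frag_of (a, finprod UO f I) - (\<Sum>j\<in>I. frag_of (a, f j)))"
    using insert f UO.finprod_insert [OF insert(1,2) f] by simp
  then show ?case
    using Null_add [OF Null_add_right [OF assms(2) f(2) UO.finprod_closed [OF f(1)]] insert.IH] insert.prems by simp
qed

section \<open>Norms to the fixed field of a subgroup\<close>

context
  fixes I :: "('a \<Rightarrow> 'a) set" assumes I: "subgroup I G"
begin

abbreviation LI where "LI \<equiv> L\<lparr>carrier := fixed_field L I\<rparr>"

lemma IG: "I \<subseteq> carrier G" using subgroup.subset [OF I] .

lemma finite_I: "finite I" using finite_G IG finite_subset by blast

lemma card_I: "card I > 0" using finite_I subgroup.one_closed [OF I] card_gt_0_iff by blast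

lemma LI_subfield: "subfield (fixed_field L I) L" by (rule fixed_subfield [OF KL IG])

lemma LI_finite_dimension: "finite_dimension (fixed_field L I) (carrier L)"
  by (rule finite_dimension_mono [OF K LI_subfield fixed_mono [OF KL IG] fin_dim])

definition Nm :: "'a \<Rightarrow> 'a" where "Nm u = finprod UO (\<lambda>h. h u) I"

lemma act_UO: "\<lbrakk>h \<in> I; u \<in> carrier UO\<rbrakk> \<Longrightarrow> h u \<in> carrier UO"
  using Gal_UO [OF KL, of h] IG by (auto simp: hom_def)

lemma Nm_closed: "u \<in> carrier UO \<Longrightarrow> Nm u \<in> carrier UO"
  unfolding Nm_def using act_UO by (intro UO.finprod_closed) auto

lemma hom_finprod_UO:
  assumes "\<phi> \<in> hom UO UO" "finite A" "f \<in> A \<rightarrow> carrier UO"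
  shows "\<phi> (finprod UO f A) = finprod UO (\<lambda>i. \<phi> (f i)) A"
  using assms(2,3)
proof (induction A rule: finite_induct)
  case empty
  then show ?case using hom_one [OF assms(1) UO.is_group UO.is_group] by simp
next
  case (insert a A)
  have f: "f \<in> A \<rightarrow> carrier UO" "f a \<in> carrier UO" using insert by auto
  have sc: "\<phi> x \<in> carrier UO" if "x \<in> carrier UO" for x using assms(1) that by (auto simp: hom_def)
  have sf: "(\<lambda>i. \<phi> (f i)) \<in> A \<rightarrow> carrier UO" using f sc by auto
  show ?case
    unfolding UO.finprod_insert [OF insert(1,2) f] UO.finprod_insert [OF insert(1,2) sf sc [OF f(2)]]
    using hom_mult [OF assms(1) f(2) UO.finprod_closed [OF f(1)]] insert.IH [OF f(1)] by simp
qed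

lemma Nm_fixed: assumes u: "u \<in> carrier UO" shows "Nm u \<in> fixed_field L I"
proof -
  have uc: "u \<in> carrier L" using u by (auto simp: UO_carrier OF_carrier)
  have "\<phi> (Nm u) = Nm u" if s: "\<phi> \<in> I" for \<phi>
  proof -
    have sG: "\<phi> \<in> carrier G" using s IG by blast
    have "\<phi> (Nm u) = finprod UO (\<lambda>h. \<phi> (h u)) I"
      unfolding Nm_def by (rule hom_finprod_UO [OF Gal_UO [OF KL sG] finite_I]) (use act_UO u in auto)
    also have "\<dots> = finprod UO (\<lambda>h. (\<phi> \<otimes>\<^bsub>G\<^esub> h) u) I"
      using Gal_mult [OF KL sG] IG uc act_UO [OF s] act_UO u by (intro UO.finprod_cong') auto
    also have "\<dots> = finprod UO (\<lambda>h. h u) ((\<lambda>h. \<phi> \<otimes>\<^bsub>G\<^esub> h) ` I)"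
    proof (rule UO.finprod_reindex [symmetric])
      show "(\<lambda>h. h u) \<in> (\<lambda>h. \<phi> \<otimes>\<^bsub>G\<^esub> h) ` I \<rightarrow> carrier UO"
        using act_UO u subgroup.m_closed [OF I s] by auto
      show "inj_on (\<lambda>h. \<phi> \<otimes>\<^bsub>G\<^esub> h) I" 
        using sG IG by (auto simp: inj_on_def subset_iff)
    qed
    also have "(\<lambda>h. \<phi> \<otimes>\<^bsub>G\<^esub> h) ` I = I"
    proof
      show "(\<lambda>h. \<phi> \<otimes>\<^bsub>G\<^esub> h) ` I \<subseteq> I" using subgroup.m_closed [OF I s] by blast
      show "I \<subseteq> (\<lambda>h. \<phi> \<otimes>\<^bsub>G\<^esub> h) ` I"
      proof
        fix h assume h: "h \<in> I"
        have "h = \<phi> \<otimes>\<^bsub>G\<^esub> (inv\<^bsub>G\<^esub> \<phi> \<otimes>\<^bsub>G\<^esub> h)" 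
          using sG subsetD [OF IG h] by (simp add: G.m_assoc [symmetric])
        then show "h \<in> (\<lambda>h. \<phi> \<otimes>\<^bsub>G\<^esub> h) ` I" using subgroup.m_closed [OF I subgroup.m_inv_closed [OF I s] h] by blast
      qed
    qed
    finally show ?thesis by (simp add: Nm_def)
  qed
  moreover have "Nm u \<in> carrier L" using Nm_closed [OF u] by (auto simp: UO_carrier OF_carrier)
  ultimately show ?thesis by (simp add: fixed_field_def)
qed

lemma LI_leopoldt: "leopoldt LI p" by (rule sub_leopoldt [OF LI_subfield])

lemma Nm_leopoldt_hom: "leopoldt_hom L LI p Nm"
proof -
  interpret LI: leopoldt LI p by (rule LI_leopoldt)
  have "Nm \<in> hom UO LI.UO"
  proof (rule homI)
    show "Nm u \<in> carrier LI.UO" if "u \<in> carrier UO" for u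
      using Nm_fixed [OF that] Nm_closed [OF that] sub_UO [OF LI_subfield] by blast
    fix x y assume xy: "x \<in> carrier UO" "y \<in> carrier UO"
    have "Nm (x \<otimes>\<^bsub>UO\<^esub> y) = finprod UO (\<lambda>h. h x \<otimes>\<^bsub>UO\<^esub> h y) I"
      unfolding Nm_def
    proof (rule UO.finprod_cong')
      show "h (x \<otimes>\<^bsub>UO\<^esub> y) = h x \<otimes>\<^bsub>UO\<^esub> h y" if "h \<in> I" for h
        using hom_mult [OF Gal_UO [OF KL] xy, of h] that IG by blast
      show "(\<lambda>h. h x \<otimes>\<^bsub>UO\<^esub> h y) \<in> I \<rightarrow> carrier UO" using act_UO xy UO.m_closed by blast
    qed simp
    also have "\<dots> = Nm x \<otimes>\<^bsub>UO\<^esub> Nm y"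
      unfolding Nm_def by (rule UO.finprod_multf) (use act_UO xy in auto)
    finally show "Nm (x \<otimes>\<^bsub>UO\<^esub> y) = Nm x \<otimes>\<^bsub>LI.UO\<^esub> Nm y" by (simp add: LI.UO_simps)
  qed
  then show ?thesis using leopoldt_axioms LI.leopoldt_axioms by (simp add: leopoldt_hom_def leopoldt_hom_axioms_def)
qed

text \<open>In the tensor product a product of units becomes a sum, so the norm acts as the sum of
  the automorphisms in \<open>I\<close>.\<close>

lemma push_Nm:
  assumes z: "z \<in> carrier Fr" shows "push Nm z - (\<Sum>h\<in>I. push h z) \<in> Null"
proof -
  have "Poly_Mapping.keys z \<subseteq> Pairs" using z by simp
  then show ?thesis
  proof (rule free_Abelian_group_induct)
    show "push Nm 0 - (\<Sum>h\<in>I. push h 0) \<in> Null" by simp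
    fix x y :: "(nat \<Rightarrow> rat) set \<times> 'a \<Rightarrow>\<^sub>0 int"
    assume "push Nm x - (\<Sum>h\<in>I. push h x) \<in> Null" "push Nm y - (\<Sum>h\<in>I. push h y) \<in> Null"
    then have "(push Nm x - (\<Sum>h\<in>I. push h x)) - (push Nm y - (\<Sum>h\<in>I. push h y)) \<in> Null" by (rule Null_diff)
    then show "push Nm (x - y) - (\<Sum>h\<in>I. push h (x - y)) \<in> Null" by (simp add: sum_subtractf algebra_simps)
  next
    fix t assume t: "t \<in> Pairs"
    obtain a u where au: "t = (a, u)" by fastforce
    have "a \<in> carrier Zp" "u \<in> carrier UO" using t au by (auto simp: tensor_pairs_def)
    then show "push Nm (frag_of t) - (\<Sum>h\<in>I. push h (frag_of t)) \<in> Null"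
      unfolding au push_simps Nm_def using Null_finprod [OF finite_I, of a "\<lambda>h. h u"] act_UO by blast
  qed
qed

lemma sum_act_Ker: "z \<in> Ker \<Longrightarrow> (\<Sum>h\<in>A. push h z) \<in> Ker" if "A \<subseteq> carrier G"
  using that
proof (induction A rule: infinite_finite_induct)
  case (insert h A)
  then show ?case using subgroup_Fr(2) [OF Ker_subgroup act_Ker [of h z], of "\<Sum>h\<in>A. push h z"] by simp
qed (use subgroup_Fr(1) [OF Ker_subgroup] in auto)

text \<open>Up to relations the norm of \<open>z\<close> is a sum of conjugates of \<open>z\<close>,
  so it stays in the kernel over \<open>L\<close>, and its units lie in the fixed field.
  \<open>Ker_sub\<close> moves it down to that field, where the hypothesis makes it a
  relation.\<close>

lemma norm_Null:
  assumes Leo: "Leo LI p" and z: "z \<in> Ker" shows "(\<Sum>h\<in>I. push h z) \<in> Null"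
proof -
  interpret LI: leopoldt LI p by (rule LI_leopoldt)
  interpret N: leopoldt_hom L LI p Nm by (rule Nm_leopoldt_hom)
  have zc: "z \<in> carrier Fr" using Ker_closed [OF z] .
  let ?d = "push Nm z - (\<Sum>h\<in>I. push h z)"
  have "?d + (\<Sum>h\<in>I. push h z) \<in> Ker"
    using subgroup_Fr(2) [OF Ker_subgroup _ sum_act_Ker [OF IG z]] push_Nm [OF zc] Null_Ker by blast
  then have "push Nm z \<in> Ker" by simp
  then have "push Nm z \<in> LI.Ker" using Ker_sub [OF LI_subfield _ N.push_closed [OF zc] LI_finite_dimension] by blast
  then have "push Nm z \<in> LI.Null" using LI.Leo_iff Leo by blast
  then have "push Nm z \<in> Null" using sub_Null [OF LI_subfield] by blast
  then have "push Nm z - ?d \<in> Null" using Null_diff push_Nm [OF zc] by blast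
  then show ?thesis by simp
qed

lemma Leo_subfield:
  assumes Leo: "Leo L p" shows "Leo LI p"
proof -
  interpret LI: leopoldt LI p by (rule LI_leopoldt)
  interpret N: leopoldt_hom L LI p Nm by (rule Nm_leopoldt_hom)
  have places: "places_above LI p \<noteq> {}"
    using exists_place [OF nf prime_p] places_restrict [OF LI_subfield] by blast
  have "z \<in> LI.Null" if z: "z \<in> LI.Ker" for z
  proof -
    have zc: "z \<in> carrier LI.Fr" using LI.Ker_closed [OF z] .
    have "z \<in> Null" using sub_Ker [OF LI_subfield z] Leo_iff Leo by blast
    then have 1: "push Nm z \<in> LI.Null" by (rule N.push_Null)
    \<comment> \<open>On the fixed field every factor of the norm is \<open>u\<close>
      itself.\<close>
    have pw: "Nm u = u [^]\<^bsub>LI.UO\<^esub> int (card I)" if u: "u \<in> carrier LI.UO" for u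
    proof -
      have uU: "u \<in> fixed_field L I" "u \<in> carrier UO" using u sub_UO [OF LI_subfield] by auto
      have "Nm u = finprod UO (\<lambda>h. u) I" unfolding Nm_def
        by (rule UO.finprod_cong') (use uU in \<open>auto simp: fixed_field_def\<close>)
      also have "\<dots> = u [^]\<^bsub>UO\<^esub> card I" by (rule UO.finprod_const [OF uU(2)])
      also have "\<dots> = u [^]\<^bsub>UO\<^esub> int (card I)" by (simp add: int_pow_int)
      also have "\<dots> = u [^]\<^bsub>LI.UO\<^esub> int (card I)"
        using hom_int_pow [OF sub_UO_hom [OF LI_subfield] u LI.UO.is_group UO.is_group, of "int (card I)"] by simp
      finally show ?thesis .
    qed
    have "Poly_Mapping.keys z \<subseteq> LI.Pairs" using zc by simp
    then have "push Nm z - frag_cmul (int (card I)) z \<in> LI.Null"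
    proof (rule free_Abelian_group_induct)
      show "push Nm 0 - frag_cmul (int (card I)) 0 \<in> LI.Null" by simp
      fix x y :: "(nat \<Rightarrow> rat) set \<times> 'a \<Rightarrow>\<^sub>0 int"
      assume "push Nm x - frag_cmul (int (card I)) x \<in> LI.Null" "push Nm y - frag_cmul (int (card I)) y \<in> LI.Null"
      then have "(push Nm x - frag_cmul (int (card I)) x) - (push Nm y - frag_cmul (int (card I)) y) \<in> LI.Null"
        by (rule LI.Null_diff)
      moreover have "frag_cmul (int (card I)) x = frag_cmul (int (card I)) (x - y) + frag_cmul (int (card I)) y"
        by (simp flip: frag_cmul_distrib2)
      then have "push Nm (x - y) - frag_cmul (int (card I)) (x - y) =
          (push Nm x - frag_cmul (int (card I)) x) - (push Nm y - frag_cmul (int (card I)) y)"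
        by (simp add: algebra_simps del: minus_frag_cmul)
      ultimately show "push Nm (x - y) - frag_cmul (int (card I)) (x - y) \<in> LI.Null" by (simp only:)
    next
      fix t assume t: "t \<in> LI.Pairs"
      obtain a u where au: "t = (a, u)" by fastforce
      have "a \<in> carrier LI.Zp" "u \<in> carrier LI.UO" using t au by (auto simp: tensor_pairs_def)
      then show "push Nm (frag_of t) - frag_cmul (int (card I)) (frag_of t) \<in> LI.Null"
        unfolding au push_simps using pw LI.Null_pow_right by metis
    qed
    from LI.Null_diff [OF 1 this] have "frag_cmul (int (card I)) z \<in> LI.Null" by simp
    then show ?thesis using LI.Ker_torsion [OF places z _ card_I] by blast
  qed
  then show ?thesis using LI.Leo_iff by blast
qed

end

text \<open>Averaging over the conjugate \<open>g I g\<inverse>\<close> inside \<open>H\<close> expresses \<open>|I|\<close> times the norm of \<open>H\<close>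
  through translates of the norm of \<open>I\<close>; the factor \<open>|I|\<close> is removed by \<open>Ker_torsion\<close>.\<close>

lemma conjugate_norm_Null:
  assumes H: "subgroup H G" and I: "subgroup I G" and g: "g \<in> carrier G"
    and sub: "(g <#\<^bsub>G\<^esub> I) #>\<^bsub>G\<^esub> (inv\<^bsub>G\<^esub> g) \<subseteq> H"
    and Leo: "Leo (L\<lparr>carrier := fixed_field L I\<rparr>) p" and z: "z \<in> Ker"
  shows "(\<Sum>h\<in>H. push h z) \<in> Null"
proof -
  have HG: "H \<subseteq> carrier G" and IG': "I \<subseteq> carrier G" using H I subgroup.subset by auto
  have zc: "z \<in> carrier Fr" using Ker_closed [OF z] .
  have gi: "inv\<^bsub>G\<^esub> g \<in> carrier G" using g by simp
  define c where "c i = g \<otimes>\<^bsub>G\<^esub> i \<otimes>\<^bsub>G\<^esub> inv\<^bsub>G\<^esub> g" for i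
  have cH: "c i \<in> H" if "i \<in> I" for i
    using that sub unfolding c_def l_coset_def r_coset_def by blast
  have shift: "(\<Sum>h\<in>H. push (k \<otimes>\<^bsub>G\<^esub> h) z) = (\<Sum>h\<in>H. push h z)" if k: "k \<in> H" for k
  proof (rule sum.reindex_bij_betw)
    have kG: "k \<in> carrier G" using k HG by blast
    show "bij_betw (\<lambda>h. k \<otimes>\<^bsub>G\<^esub> h) H H"
    proof (rule bij_betwI [where g = "\<lambda>h. inv\<^bsub>G\<^esub> k \<otimes>\<^bsub>G\<^esub> h"])
      show "(\<lambda>h. k \<otimes>\<^bsub>G\<^esub> h) \<in> H \<rightarrow> H" "(\<lambda>h. inv\<^bsub>G\<^esub> k \<otimes>\<^bsub>G\<^esub> h) \<in> H \<rightarrow> H"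
        using subgroup.m_closed [OF H] subgroup.m_inv_closed [OF H] k by auto
      show "inv\<^bsub>G\<^esub> k \<otimes>\<^bsub>G\<^esub> (k \<otimes>\<^bsub>G\<^esub> x) = x" "k \<otimes>\<^bsub>G\<^esub> (inv\<^bsub>G\<^esub> k \<otimes>\<^bsub>G\<^esub> x) = x" if "x \<in> H" for x
        using that HG kG by (auto simp: G.m_assoc [symmetric])
    qed
  qed
  \<comment> \<open>In the \<open>i\<close>-th of the \<open>card I\<close> copies the sum over
    \<open>H\<close> is translated by \<open>c i\<close>, which only permutes it. Moving
    \<open>g\<close> to the front then exposes the sum over \<open>I\<close>, applied to translates
    of \<open>z\<close>.\<close>
  have "frag_cmul (int (card I)) (\<Sum>h\<in>H. push h z) = (\<Sum>i\<in>I. \<Sum>h\<in>H. push h z)"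
    using frag_cmul_sum_left [of "\<lambda>_. 1" I "\<Sum>h\<in>H. push h z"] by simp
  also have "\<dots> = (\<Sum>i\<in>I. \<Sum>h\<in>H. push (c i \<otimes>\<^bsub>G\<^esub> h) z)"
    by (rule sum.cong [OF refl], rule shift [OF cH, symmetric])
  also have "\<dots> = (\<Sum>h\<in>H. \<Sum>i\<in>I. push g (push i (push (inv\<^bsub>G\<^esub> g \<otimes>\<^bsub>G\<^esub> h) z)))"
  proof (subst sum.swap, intro sum.cong refl)
    fix h i assume "h \<in> H" "i \<in> I"
    then have hi: "h \<in> carrier G" "i \<in> carrier G" using HG IG' by auto
    have "c i \<otimes>\<^bsub>G\<^esub> h = g \<otimes>\<^bsub>G\<^esub> (i \<otimes>\<^bsub>G\<^esub> (inv\<^bsub>G\<^esub> g \<otimes>\<^bsub>G\<^esub> h))"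
      unfolding c_def using hi g by (simp add: G.m_assoc)
    then show "push (c i \<otimes>\<^bsub>G\<^esub> h) z = push g (push i (push (inv\<^bsub>G\<^esub> g \<otimes>\<^bsub>G\<^esub> h) z))"
      using act_mult [OF g _ zc] act_mult [OF hi(2) _ zc] hi g by simp
  qed
  also have "\<dots> = (\<Sum>h\<in>H. push g (\<Sum>i\<in>I. push i (push (inv\<^bsub>G\<^esub> g \<otimes>\<^bsub>G\<^esub> h) z)))"
    by (simp add: push_sum)
  also have "\<dots> \<in> Null"
  proof (rule Null_sum, rule act_Null [OF g], rule norm_Null [OF I Leo], rule act_Ker [OF _ z])
    show "inv\<^bsub>G\<^esub> g \<otimes>\<^bsub>G\<^esub> h \<in> carrier G" if "h \<in> H" for h using that HG gi by blast
  qed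
  finally have "frag_cmul (int (card I)) (\<Sum>h\<in>H. push h z) \<in> Null" .
  then show ?thesis
    using Ker_torsion [OF exists_place [OF nf prime_p] sum_act_Ker [OF I HG z] _ card_I [OF I]] by blast
qed

lemma Leo_of_relation:
  assumes sub: "\<And>H. H \<in> \<H> \<Longrightarrow> subgroup H G" and rel: "has_gen_useful_idempotent_relation G \<H>"
    and norm: "\<And>H z. \<lbrakk>H \<in> \<H>; z \<in> Ker\<rbrakk> \<Longrightarrow> (\<Sum>h\<in>H. push h z) \<in> Null"
  shows "Leo L p"
proof -
  let ?H = "\<H> - {{\<one>\<^bsub>G\<^esub>}}"
  have HG: "H \<subseteq> carrier G" if "H \<in> \<H>" for H using sub [OF that] subgroup.subset by blast
  obtain d b where d: "d > 0" and b: "\<And>g. g \<in> carrier G \<Longrightarrow>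
    (\<Sum>H\<in>?H. \<Sum>x\<in>carrier G. \<Sum>h\<in>H. if x \<otimes>\<^bsub>G\<^esub> h = g then b H x else 0) = (if g = \<one>\<^bsub>G\<^esub> then int d else 0)"
    using G.integral_idempotent_relation [OF finite_G HG rel] by blast
  have "z \<in> Null" if z: "z \<in> Ker" for z
  proof -
    have zc: "z \<in> carrier Fr" using Ker_closed [OF z] .
    \<comment> \<open>The coefficient of the relation is \<open>d\<close> at the identity and 0
      elsewhere, so \<open>d\<close> times \<open>z\<close> can be written as a sum over all of
      \<open>G\<close>. Substituting the relation and carrying out the sum over \<open>g\<close>
      first leaves the norms over the subgroups \<open>H\<close>.\<close>
    have "frag_cmul (int d) z = (\<Sum>g\<in>carrier G. frag_cmul (if g = \<one>\<^bsub>G\<^esub> then int d else 0) (push g z))"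
      using finite_G act_one [OF zc] by (simp add: if_distrib [of "\<lambda>c. frag_cmul c _"] sum.delta cong: if_cong)
    also have "\<dots> = (\<Sum>g\<in>carrier G. \<Sum>H\<in>?H. \<Sum>x\<in>carrier G. \<Sum>h\<in>H.
        frag_cmul (if x \<otimes>\<^bsub>G\<^esub> h = g then b H x else 0) (push g z))"
      by (intro sum.cong refl) (simp only: b [symmetric] frag_cmul_sum_left)
    also have "\<dots> = (\<Sum>H\<in>?H. \<Sum>g\<in>carrier G. \<Sum>x\<in>carrier G. \<Sum>h\<in>H.
        frag_cmul (if x \<otimes>\<^bsub>G\<^esub> h = g then b H x else 0) (push g z))"
      by (rule sum.swap)
    also have "\<dots> = (\<Sum>H\<in>?H. \<Sum>x\<in>carrier G. \<Sum>g\<in>carrier G. \<Sum>h\<in>H.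
        frag_cmul (if x \<otimes>\<^bsub>G\<^esub> h = g then b H x else 0) (push g z))"
      by (rule sum.cong [OF refl], rule sum.swap)
    also have "\<dots> = (\<Sum>H\<in>?H. \<Sum>x\<in>carrier G. \<Sum>h\<in>H. \<Sum>g\<in>carrier G.
        frag_cmul (if x \<otimes>\<^bsub>G\<^esub> h = g then b H x else 0) (push g z))"
      by (rule sum.cong [OF refl], rule sum.cong [OF refl], rule sum.swap)
    also have "\<dots> = (\<Sum>H\<in>?H. \<Sum>x\<in>carrier G. \<Sum>h\<in>H. frag_cmul (b H x) (push x (push h z)))"
    proof (intro sum.cong refl)
      fix H x h assume *: "H \<in> ?H" "x \<in> carrier G" "h \<in> H"
      have h: "h \<in> carrier G" using * HG by blast
      have "(\<Sum>g\<in>carrier G. frag_cmul (if x \<otimes>\<^bsub>G\<^esub> h = g then b H x else 0) (push g z)) =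
        (\<Sum>g\<in>carrier G. if x \<otimes>\<^bsub>G\<^esub> h = g then frag_cmul (b H x) (push g z) else 0)"
        by (intro sum.cong refl) simp
      also have "\<dots> = frag_cmul (b H x) (push (x \<otimes>\<^bsub>G\<^esub> h) z)"
        using finite_G G.m_closed [OF *(2) h] by (simp add: sum.delta')
      finally show "(\<Sum>g\<in>carrier G. frag_cmul (if x \<otimes>\<^bsub>G\<^esub> h = g then b H x else 0) (push g z)) =
        frag_cmul (b H x) (push x (push h z))" using act_mult [OF *(2) h zc] by simp
    qed
    also have "\<dots> = (\<Sum>H\<in>?H. \<Sum>x\<in>carrier G. frag_cmul (b H x) (push x (\<Sum>h\<in>H. push h z)))"
      by (simp add: push_sum frag_cmul_sum)
    also have "\<dots> \<in> Null"
      by (intro Null_sum Null_cmul act_Null norm z) auto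
    finally have "frag_cmul (int d) z \<in> Null" .
    then show ?thesis using Ker_torsion [OF exists_place [OF nf prime_p] z _ d] by blast
  qed
  then show ?thesis using Leo_iff by blast
qed

end

theorem theorem4p22:
  fixes L :: "('a, 'b) ring_scheme" and K :: "'a set"
    and G :: "('a \<Rightarrow> 'a) monoid" and \<H> \<I> :: "('a \<Rightarrow> 'a) set set" and p :: nat
  assumes "number_field L" and "number_field (L\<lparr>carrier := K\<rparr>)"
    and "finite_galois L K"
    and "G = Gal L K"
    and "\<And>H. H \<in> \<H> \<Longrightarrow> subgroup H G"
    and "has_gen_useful_idempotent_relation G \<H>"
    and "\<I> \<subseteq> \<H>" and "{\<one>\<^bsub>G\<^esub>} \<notin> \<I>"
    and "\<And>H. H \<in> \<H> \<Longrightarrow>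
      \<exists>g \<in> carrier G. \<exists>I \<in> \<I>. (g <#\<^bsub>G\<^esub> I) #>\<^bsub>G\<^esub> (inv\<^bsub>G\<^esub> g) \<subseteq> H"
    and "prime p"
  shows "Leo L p \<longleftrightarrow> (\<forall>I \<in> \<I>. Leo (L\<lparr>carrier := fixed_field L I\<rparr>) p)"
proof -
  have "field L" using assms(1) by (simp add: number_field_def)
  then interpret leopoldt_galois L p K
    using assms(1,3,10)
    by (simp add: leopoldt_galois_def leopoldt_galois_axioms_def leopoldt_def leopoldt_axioms_def finite_galois_def)
  show ?thesis
  proof (intro iffI ballI)
    fix I assume "Leo L p" "I \<in> \<I>"
    then show "Leo (L\<lparr>carrier := fixed_field L I\<rparr>) p" using Leo_subfield assms(4,5,7) by blast
  next
    assume Leo: "\<forall>I\<in>\<I>. Leo (L\<lparr>carrier := fixed_field L I\<rparr>) p"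
    show "Leo L p"
    proof (rule Leo_of_relation)
      show "subgroup H (Gal L K)" if "H \<in> \<H>" for H using assms(4,5) that by blast
      show "has_gen_useful_idempotent_relation (Gal L K) \<H>" using assms(4,6) by simp
      fix H z assume H: "H \<in> \<H>" and z: "z \<in> leo_kernel L p"
      obtain g I where gI: "g \<in> carrier G" "I \<in> \<I>" "(g <#\<^bsub>G\<^esub> I) #>\<^bsub>G\<^esub> (inv\<^bsub>G\<^esub> g) \<subseteq> H"
        using assms(9) [OF H] by blast
      have "subgroup H (Gal L K)" "subgroup I (Gal L K)" using assms(4,5,7) H gI(2) by blast+
      then show "(\<Sum>h\<in>H. push h z) \<in> tensor_null L p"
        using conjugate_norm_Null [of H I g z] gI Leo z assms(4) by blast
    qed
  qed
qed

end
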